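(* Let $n\ge1$ and $p>1$, and let $\mathcal{N}(u)=|u|^p$ or $\mathcal{N}(u)=-|u|^p$, where $\mathcal{N}$ satisfies condition (N) of the context with exponent $p$ and integer $p_0\in[0,p]$. Let $s\ge0$ and $r\in(1,2]$ satisfy $[s]\le p_0$, $r\ge\frac{2(n-1)}{n+1}$, and $$1<p<\infty\ \text{ if } 2s\ge n,\qquad 1<p\le1+\frac{\min\{n,2\}}{n-2s}\ \text{ if } 2s<n.$$ Suppose in addition that $p<1+\frac{2r}{n}$. Let $\beta=(n-1)\left(\frac1r-\frac12\right)$ and $\omega=\frac1{p-1}-\frac{n}{2r}$. Then for any $\delta>0$ there exist initial data $$(u_0,u_1)\in\left(H^s(\mathbb{R}^n)\cap H^\beta_r(\mathbb{R}^n)\right)\times\left(H^{s-1}(\mathbb{R}^n)\cap L^r(\mathbb{R}^n)\right),$$ a constant $\varepsilon_2=\varepsilon_2(n,p,r,s,\delta)>0$, and a constant $C>0$ depending on $\delta$ but independent of $\varepsilon$, such that for any $\varepsilon\in(0,\varepsilon_2]$ $$T_2(\varepsilon)\le C\varepsilon^{-1/\omega-\delta},$$ where $T_2(\varepsilon)$ is the supremum of all $T\in(0,\infty]$ for which there exists a unique $H^s$-mild solution with $u\in C([0,T);H^s(\mathbb{R}^n))$, $\partial_tu\in C([0,T);H^{s-1}(\mathbb{R}^n))$ of $$\partial_t^2u-\Delta u+\partial_tu=\mathcal{N}(u),\qquad u(0)=\varepsilon u_0,\ \partial_tu(0)=\varepsilon u_1.$$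
   Context: $[s]$ is the integer part of $s$. $H^s_r(\mathbb{R}^n)$ is the Sobolev space with norm $\|\langle\nabla\rangle^sf\|_{L^r}$, where $\langle\nabla\rangle^s$ is the Fourier multiplier with symbol $(1+|\xi|^2)^{s/2}$; $H^s=H^s_2$. Condition (N): $\mathcal{N}\in C^{p_0}(\mathbb{R})$ for some integer $p_0\in[0,p]$, and for $l=0,1,\dots,p_0$ one has $\mathcal{N}^{(l)}(0)=0$ and $|\mathcal{N}^{(l)}(u)-\mathcal{N}^{(l)}(v)|\le C|u-v|(|u|+|v|)^{p-l-1}$ for $u,v\in\mathbb{R}$. $\mathcal{D}(t)=e^{-t/2}\mathcal{F}^{-1}L(t,\xi)\mathcal{F}$, where $L(t,\xi)=\frac{\sinh(t\sqrt{1/4-|\xi|^2})}{\sqrt{1/4-|\xi|^2}}$ for $|\xi|<1/2$ and $L(t,\xi)=\frac{\sin(t\sqrt{|\xi|^2-1/4})}{\sqrt{|\xi|^2-1/4}}$ for $|\xi|>1/2$. A function $u\in L^\infty(0,T;L^2(\mathbb{R}^n))$ is a mild solution of the Cauchy problem if $u(t)=\varepsilon\mathcal{D}(t)(u_0+u_1)+\varepsilon\partial_t\mathcal{D}(t)u_0+\int_0^t\mathcal{D}(t-\tau)\mathcal{N}(u(\tau))\,d\tau$ in $L^\infty(0,T;L^2(\mathbb{R}^n))$. It is an $H^s$-mild solution if in addition $u\in C([0,T);H^s)$. *)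

theory Defs
  imports "HOL-Analysis.Analysis"
begin

primrec iter_partial :: "'a::euclidean_space list \<Rightarrow> ('a \<Rightarrow> complex) \<Rightarrow> 'a \<Rightarrow> complex" where
  "iter_partial [] f = f"
| "iter_partial (b # bs) f = (\<lambda>x. frechet_derivative (iter_partial bs f) (at x) b)"

definition smooth :: "('a::euclidean_space \<Rightarrow> complex) \<Rightarrow> bool" where
  "smooth f \<longleftrightarrow> (\<forall>bs. set bs \<subseteq> Basis \<longrightarrow> iter_partial bs f differentiable_on UNIV)"

definition schwartz :: "('a::euclidean_space \<Rightarrow> complex) set" where
  "schwartz = {f. smooth f \<and>
     (\<forall>bs k. set bs \<subseteq> Basis \<longrightarrow>
        bounded (range (\<lambda>x. (1 + norm x) ^ k *\<^sub>R iter_partial bs f x)))}"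

text \<open>The real supremum below is meaningful because it is only used for Schwartz functions,
  where the set is bounded (and it is never empty).\<close>
definition schwartz_seminorm :: "nat \<Rightarrow> ('a::euclidean_space \<Rightarrow> complex) \<Rightarrow> real" where
  "schwartz_seminorm m f =
     (SUP (bs, x) \<in> {bs. set bs \<subseteq> Basis \<and> length bs \<le> m} \<times> UNIV.
        (1 + norm x) ^ m * norm (iter_partial bs f x))"

text \<open>A distribution is a functional on all functions of which only the values on Schwartz
  functions matter; hence two distributions are compared on \<^const>\<open>schwartz\<close> only.  The pairing is
  bilinear, not sesquilinear.\<close>
type_synonym 'a functional = "('a \<Rightarrow> complex) \<Rightarrow> complex"

definition tempered :: "'a::euclidean_space functional set" where
  "tempered = {T.
     (\<forall>\<phi>\<in>schwartz. \<forall>\<psi>\<in>schwartz. \<forall>a b. T (\<lambda>x. a * \<phi> x + b * \<psi> x) = a * T \<phi> + b * T \<psi>) \<and>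
     (\<exists>C m. \<forall>\<phi>\<in>schwartz. norm (T \<phi>) \<le> C * schwartz_seminorm m \<phi>)}"

definition fun_dist :: "('a::euclidean_space \<Rightarrow> complex) \<Rightarrow> 'a functional" where
  "fun_dist f = (\<lambda>\<phi>. LINT x|lborel. f x * \<phi> x)"

text \<open>The functions that induce a tempered distribution by integration.\<close>
definition tempered_fun :: "('a::euclidean_space \<Rightarrow> complex) set" where
  "tempered_fun = {f. f \<in> borel_measurable borel \<and>
     (\<forall>\<phi>\<in>schwartz. integrable lborel (\<lambda>x. f x * \<phi> x)) \<and> fun_dist f \<in> tempered}"

definition represents :: "('a::euclidean_space \<Rightarrow> complex) \<Rightarrow> 'a functional \<Rightarrow> bool" where
  "represents f T \<longleftrightarrow> f \<in> tempered_fun \<and> (\<forall>\<phi>\<in>schwartz. T \<phi> = fun_dist f \<phi>)"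

definition fourier :: "('a::euclidean_space \<Rightarrow> complex) \<Rightarrow> 'a \<Rightarrow> complex" where
  "fourier f \<xi> = complex_of_real ((2 * pi) powr (- real DIM('a) / 2)) *
     (LINT x|lborel. cis (- (x \<bullet> \<xi>)) * f x)"

definition inv_fourier :: "('a::euclidean_space \<Rightarrow> complex) \<Rightarrow> 'a \<Rightarrow> complex" where
  "inv_fourier f x = complex_of_real ((2 * pi) powr (- real DIM('a) / 2)) *
     (LINT \<xi>|lborel. cis (x \<bullet> \<xi>) * f \<xi>)"

definition dist_fourier :: "'a::euclidean_space functional \<Rightarrow> 'a functional" where
  "dist_fourier T = (\<lambda>\<phi>. T (fourier \<phi>))"

definition dist_inv_fourier :: "'a::euclidean_space functional \<Rightarrow> 'a functional" where
  "dist_inv_fourier T = (\<lambda>\<phi>. T (inv_fourier \<phi>))"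

definition dist_mult :: "('a::euclidean_space \<Rightarrow> real) \<Rightarrow> 'a functional \<Rightarrow> 'a functional" where
  "dist_mult m T = (\<lambda>\<phi>. T (\<lambda>\<xi>. complex_of_real (m \<xi>) * \<phi> \<xi>))"

text \<open>Only used for smooth symbols all of whose derivatives grow at most polynomially.\<close>
definition fourier_multiplier :: "('a::euclidean_space \<Rightarrow> real) \<Rightarrow> 'a functional \<Rightarrow> 'a functional" where
  "fourier_multiplier m T = dist_inv_fourier (dist_mult m (dist_fourier T))"

definition Lp :: "real \<Rightarrow> ('a::euclidean_space \<Rightarrow> complex) set" where
  "Lp r = {f \<in> borel_measurable borel. integrable lborel (\<lambda>x. norm (f x) powr r)}"

definition Lp_norm :: "real \<Rightarrow> ('a::euclidean_space \<Rightarrow> complex) \<Rightarrow> real" where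
  "Lp_norm r f = (LINT x|lborel. norm (f x) powr r) powr (1 / r)"

definition bessel :: "real \<Rightarrow> 'a::euclidean_space functional \<Rightarrow> 'a functional" where
  "bessel s = fourier_multiplier (\<lambda>\<xi>. (1 + (norm \<xi>)\<^sup>2) powr (s / 2))"

definition sobolev :: "real \<Rightarrow> real \<Rightarrow> 'a::euclidean_space functional set" where
  "sobolev s r = {T \<in> tempered. \<exists>g \<in> Lp r. represents g (bessel s T)}"

text \<open>The representing function is unique up to null sets, so the choice is immaterial.\<close>
definition sobolev_norm :: "real \<Rightarrow> real \<Rightarrow> 'a::euclidean_space functional \<Rightarrow> real" where
  "sobolev_norm s r T = Lp_norm r (SOME g. g \<in> Lp r \<and> represents g (bessel s T))"

definition sobolev_fun :: "real \<Rightarrow> real \<Rightarrow> ('a::euclidean_space \<Rightarrow> real) set" where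
  "sobolev_fun s r = {f. complex_of_real \<circ> f \<in> tempered_fun \<and>
     fun_dist (complex_of_real \<circ> f) \<in> sobolev s r}"

definition Lp_fun :: "real \<Rightarrow> ('a::euclidean_space \<Rightarrow> real) set" where
  "Lp_fun r = {f. complex_of_real \<circ> f \<in> Lp r}"

text \<open>Strong measurability and the Bochner integral for maps into \<open>L\<^sup>2\<close>, with values given by
  representatives.  The shape is that of \<^const>\<open>has_bochner_integral\<close>, which does not apply directly
  since it needs the value space to be a type of class
  \<^class>\<open>second_countable_topology\<close> and \<^class>\<open>real_normed_vector\<close>.\<close>

definition L2_simple :: "real measure \<Rightarrow> (real \<Rightarrow> 'a::euclidean_space \<Rightarrow> complex) \<Rightarrow> bool" where
  "L2_simple M S \<longleftrightarrow> simple_function M S \<and> (\<forall>t\<in>space M. S t \<in> Lp 2) \<and>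
     emeasure M {t \<in> space M. S t \<noteq> (\<lambda>_. 0)} \<noteq> \<infinity>"

definition L2_simple_integral ::
    "real measure \<Rightarrow> (real \<Rightarrow> 'a::euclidean_space \<Rightarrow> complex) \<Rightarrow> 'a \<Rightarrow> complex" where
  "L2_simple_integral M S =
     (\<lambda>x. \<Sum>f\<in>S ` space M. complex_of_real (measure M {t \<in> space M. S t = f}) * f x)"

definition L2_measurable :: "real measure \<Rightarrow> (real \<Rightarrow> 'a::euclidean_space \<Rightarrow> complex) \<Rightarrow> bool" where
  "L2_measurable M F \<longleftrightarrow> (AE t in M. F t \<in> Lp 2) \<and>
     (\<exists>S. (\<forall>k::nat. L2_simple M (S k)) \<and>
        (AE t in M. (\<lambda>k. Lp_norm 2 (\<lambda>x. F t x - S k t x)) \<longlonglongrightarrow> 0))"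

definition has_L2_integral ::
    "real measure \<Rightarrow> (real \<Rightarrow> 'a::euclidean_space \<Rightarrow> complex) \<Rightarrow> ('a \<Rightarrow> complex) \<Rightarrow> bool" where
  "has_L2_integral M F I \<longleftrightarrow> L2_measurable M F \<and> I \<in> Lp 2 \<and>
     (\<exists>S. (\<forall>k::nat. L2_simple M (S k)) \<and>
        (\<lambda>k. \<integral>\<^sup>+t. ennreal (Lp_norm 2 (\<lambda>x. F t x - S k t x)) \<partial>M) \<longlonglongrightarrow> 0 \<and>
        (\<lambda>k. Lp_norm 2 (\<lambda>x. L2_simple_integral M (S k) x - I x)) \<longlonglongrightarrow> 0)"

definition Linf_L2 :: "real measure \<Rightarrow> (real \<Rightarrow> 'a::euclidean_space \<Rightarrow> complex) \<Rightarrow> bool" where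
  "Linf_L2 M F \<longleftrightarrow> L2_measurable M F \<and> (\<exists>B. AE t in M. Lp_norm 2 (F t) \<le> B)"

definition continuous_sobolev ::
    "real \<Rightarrow> real set \<Rightarrow> (real \<Rightarrow> 'a::euclidean_space functional) \<Rightarrow> bool" where
  "continuous_sobolev s J U \<longleftrightarrow> (\<forall>t\<in>J. U t \<in> sobolev s 2) \<and>
     (\<forall>t\<in>J. ((\<lambda>\<tau>. sobolev_norm s 2 (\<lambda>\<phi>. U \<tau> \<phi> - U t \<phi>)) \<longlongrightarrow> 0) (at t within J))"

definition sobolev_derivative ::
    "real \<Rightarrow> real set \<Rightarrow> (real \<Rightarrow> 'a::euclidean_space functional) \<Rightarrow> (real \<Rightarrow> 'a functional) \<Rightarrow> bool" where
  "sobolev_derivative s J U V \<longleftrightarrow>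
     (\<forall>t\<in>J. ((\<lambda>\<tau>. sobolev_norm s 2
         (\<lambda>\<phi>. (U \<tau> \<phi> - U t \<phi>) / complex_of_real (\<tau> - t) - V t \<phi>)) \<longlongrightarrow> 0) (at t within J))"

text \<open>On the sphere of radius \<open>1/2\<close> the symbol is given its continuous (in fact real-analytic)
  extension, since multiplying a distribution requires a smooth symbol.\<close>
definition L_symbol :: "real \<Rightarrow> 'a::euclidean_space \<Rightarrow> real" where
  "L_symbol t \<xi> =
     (if norm \<xi> < 1/2 then sinh (t * sqrt (1/4 - (norm \<xi>)\<^sup>2)) / sqrt (1/4 - (norm \<xi>)\<^sup>2)
      else if norm \<xi> > 1/2 then sin (t * sqrt ((norm \<xi>)\<^sup>2 - 1/4)) / sqrt ((norm \<xi>)\<^sup>2 - 1/4)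
      else t)"

definition D_op :: "real \<Rightarrow> 'a::euclidean_space functional \<Rightarrow> 'a functional" where
  "D_op t = fourier_multiplier (\<lambda>\<xi>. exp (- t / 2) * L_symbol t \<xi>)"

definition dt_D_op :: "real \<Rightarrow> 'a::euclidean_space functional \<Rightarrow> 'a functional" where
  "dt_D_op t = fourier_multiplier (\<lambda>\<xi>. deriv (\<lambda>t'. exp (- t' / 2) * L_symbol t' \<xi>) t)"

definition C_k :: "nat \<Rightarrow> (real \<Rightarrow> real) \<Rightarrow> bool" where
  "C_k k f \<longleftrightarrow> (\<forall>l<k. (deriv ^^ l) f differentiable_on UNIV) \<and>
     continuous_on UNIV ((deriv ^^ k) f)"

definition condition_N :: "(real \<Rightarrow> real) \<Rightarrow> real \<Rightarrow> nat \<Rightarrow> bool" where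
  "condition_N N p p0 \<longleftrightarrow> real p0 \<le> p \<and> C_k p0 N \<and>
     (\<exists>C. \<forall>l\<le>p0. (deriv ^^ l) N 0 = 0 \<and>
        (\<forall>u v. \<bar>(deriv ^^ l) N u - (deriv ^^ l) N v\<bar>
             \<le> C * \<bar>u - v\<bar> * (\<bar>u\<bar> + \<bar>v\<bar>) powr (p - real l - 1)))"

text \<open>Solutions are real-valued.  The integrand of the Duhamel term is, for almost every time,
  a tempered distribution represented by an \<open>L\<^sup>2\<close> function, and the term is the Bochner integral of
  these.\<close>
definition has_duhamel ::
    "(real \<Rightarrow> real) \<Rightarrow> (real \<Rightarrow> 'a::euclidean_space \<Rightarrow> real) \<Rightarrow> real \<Rightarrow> ('a \<Rightarrow> complex) \<Rightarrow> bool" where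
  "has_duhamel N u t I \<longleftrightarrow>
     (\<exists>F. (AE \<tau> in restrict_space lborel {0<..<t}.
             (\<lambda>x. complex_of_real (N (u \<tau> x))) \<in> tempered_fun \<and>
             F \<tau> \<in> Lp 2 \<and>
             represents (F \<tau>) (D_op (t - \<tau>) (fun_dist (\<lambda>x. complex_of_real (N (u \<tau> x)))))) \<and>
          has_L2_integral (restrict_space lborel {0<..<t}) F I)"

definition mild_solution ::
    "(real \<Rightarrow> real) \<Rightarrow> ('a::euclidean_space \<Rightarrow> real) \<Rightarrow> ('a \<Rightarrow> real) \<Rightarrow> real \<Rightarrow> ereal \<Rightarrow>
     (real \<Rightarrow> 'a \<Rightarrow> real) \<Rightarrow> bool" where
  "mild_solution N u0 u1 \<epsilon> T u \<longleftrightarrow>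
     (let M = restrict_space lborel {t. 0 < t \<and> ereal t < T} in
      Linf_L2 M (\<lambda>t. complex_of_real \<circ> u t) \<and>
      (AE t in M. \<exists>I. has_duhamel N u t I \<and>
         (\<forall>\<phi>\<in>schwartz. fun_dist (complex_of_real \<circ> u t) \<phi> =
            complex_of_real \<epsilon> * D_op t (fun_dist (\<lambda>x. complex_of_real (u0 x + u1 x))) \<phi> +
            complex_of_real \<epsilon> * dt_D_op t (fun_dist (complex_of_real \<circ> u0)) \<phi> +
            fun_dist I \<phi>)))"

definition Hs_mild_solution ::
    "(real \<Rightarrow> real) \<Rightarrow> real \<Rightarrow> ('a::euclidean_space \<Rightarrow> real) \<Rightarrow> ('a \<Rightarrow> real) \<Rightarrow> real \<Rightarrow> ereal \<Rightarrow>
     (real \<Rightarrow> 'a \<Rightarrow> real) \<Rightarrow> bool" where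
  "Hs_mild_solution N s u0 u1 \<epsilon> T u \<longleftrightarrow>
     mild_solution N u0 u1 \<epsilon> T u \<and>
     (\<forall>t. 0 \<le> t \<and> ereal t < T \<longrightarrow> complex_of_real \<circ> u t \<in> tempered_fun) \<and>
     continuous_sobolev s {t. 0 \<le> t \<and> ereal t < T} (\<lambda>t. fun_dist (complex_of_real \<circ> u t))"

definition C1_Hs_mild_solution ::
    "(real \<Rightarrow> real) \<Rightarrow> real \<Rightarrow> ('a::euclidean_space \<Rightarrow> real) \<Rightarrow> ('a \<Rightarrow> real) \<Rightarrow> real \<Rightarrow> ereal \<Rightarrow>
     (real \<Rightarrow> 'a \<Rightarrow> real) \<Rightarrow> bool" where
  "C1_Hs_mild_solution N s u0 u1 \<epsilon> T u \<longleftrightarrow>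
     Hs_mild_solution N s u0 u1 \<epsilon> T u \<and>
     (\<exists>V. continuous_sobolev (s - 1) {t. 0 \<le> t \<and> ereal t < T} V \<and>
        sobolev_derivative (s - 1) {t. 0 \<le> t \<and> ereal t < T}
          (\<lambda>t. fun_dist (complex_of_real \<circ> u t)) V)"

definition lifespan ::
    "(real \<Rightarrow> real) \<Rightarrow> real \<Rightarrow> ('a::euclidean_space \<Rightarrow> real) \<Rightarrow> ('a \<Rightarrow> real) \<Rightarrow> real \<Rightarrow> ereal" where
  "lifespan N s u0 u1 \<epsilon> =
     Sup {T. 0 < T \<and>
       (\<exists>u. C1_Hs_mild_solution N s u0 u1 \<epsilon> T u \<and>
          (\<forall>v. C1_Hs_mild_solution N s u0 u1 \<epsilon> T v \<longrightarrow>
             (\<forall>t. 0 \<le> t \<and> ereal t < T \<longrightarrow> (AE x in lborel. v t x = u t x))))}"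

end

theory Submission
  imports Defs "HOL-Probability.Probability" "HOL-Complex_Analysis.Complex_Analysis"
begin

text \<open>The proof is the test function method with Gaussians \<open>exp (- |x|\<^sup>2 / R)\<close> in space and a power of
  \<open>1 - t / R\<close> in time.  With \<open>u0 = 0\<close> and \<open>u1 = \<plusminus> w\<close> for some \<open>w \<ge> 0\<close>, the sign being that of the
  nonlinearity, the tested equation and Young's inequality give
  \<open>\<epsilon> \<cdot> \<integral> w exp (- |x|\<^sup>2 / R) \<le> C R powr (n / 2 - 1 / (p - 1))\<close> for every \<open>R\<close> below the lifespan.
  The data \<open>w = \<integral>\<^sub>0\<^sup>1 s powr (m - 1) exp (- s |x|\<^sup>2) ds\<close> decay like \<open>|x| powr (- 2 m)\<close>, so the left side is at
  least \<open>c \<epsilon> R powr (n / 2 - m)\<close>; they lie in \<open>L\<^sup>r\<close> iff \<open>m > n / (2 r)\<close>, and \<open>m\<close> close to this bound gives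
  the exponent up to \<open>\<delta>\<close>.

  The solution is only known to satisfy the mild equation weakly, so the propagator is moved onto the
  test function, where it is an explicit convergent power series in the moments of the Gaussian.  That
  \<open>|u|\<^sup>p\<close> is integrable in time against Gaussians follows from a coercivity estimate: for short times the
  propagator is nearly multiplication by \<open>t\<close> on Gaussians.\<close>

subsection \<open>Gaussians\<close>

text \<open>The mild equation is available only for almost every time and only through tempered
  functionals, and the Bochner integral in it controls the propagated nonlinearity, not the
  nonlinearity itself. So before Fubini and Young can be applied, a bound on \<open>|u|^p\<close>
  has to be recovered from its image under an oscillating propagator. Gaussians serve because the
  heat flow maps them to Gaussians: the powers of \<open>|\<xi>|^2 - 1/4\<close>, in which the
  propagator symbol is entire, have moments with a closed generating function, and this yields
  pointwise bounds by one positive Gaussian. The width is \<open>R\<close> in \<open>|x|^2\<close>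
  and the cutoff lives on \<open>[0, R]\<close> in time because the damping makes low frequencies
  behave as in the heat equation: one time derivative and the Laplacian both cost
  \<open>1 / R\<close>. The condition \<open>m > n / (2 r)\<close> places
  \<open>1 / (p - 1) - m\<close> just below \<omega>, and \<open>p < 1 + 2 r / n\<close> says that
  \<omega> is positive.\<close>

definition gauss :: "real \<Rightarrow> 'a::euclidean_space \<Rightarrow> real" where
  "gauss c x = exp (- c * (norm x)\<^sup>2)"

lemma gauss_nonneg [simp]: "gauss c x \<ge> 0"
  by (simp_all add: gauss_def)

lemma gauss_measurable [measurable]: "gauss c \<in> borel_measurable borel"
  unfolding gauss_def by measurable

lemma cis_measurable [measurable]: "cis \<in> borel_measurable borel"
  by (intro borel_measurable_continuous_onI continuous_intros)

lemma gauss_mono: "c \<le> d \<Longrightarrow> gauss d x \<le> gauss c x"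
  by (auto simp: gauss_def intro!: mult_right_mono)

lemma gauss_mult: "gauss c x * gauss d x = gauss (c + d) x"
  by (simp add: gauss_def exp_add [symmetric] algebra_simps)

lemma integrable_exp_sq_real:
  fixes c :: real assumes "c > 0"
  shows "integrable lborel (\<lambda>x::real. exp (- c * x\<^sup>2))"
proof -
  have "integrable lborel (\<lambda>x::real. exp (- x\<^sup>2))"
  proof -
    have "integrable lborel (\<lambda>x::real. sqrt (2 * pi) * std_normal_density x)"
      using integrable_std_normal_moment[of 0] by simp
    then have "integrable lborel (\<lambda>x::real. exp (- x\<^sup>2 / 2))"
      by (simp add: std_normal_density_def)
    then show ?thesis
      by (subst lborel_integrable_real_affine_iff[of "1/sqrt 2" _ 0, symmetric]) (auto simp: power_divide)
  qed
  then show ?thesis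
    using assms lborel_integrable_real_affine_iff[of "sqrt c" "\<lambda>x. exp (- x\<^sup>2)" 0]
    by (simp add: power_mult_distrib)
qed

text \<open>The characteristic function of the standard normal law, rescaled by
  \<open>sqrt (2 * c)\<close>.\<close>

lemma integral_cis_exp_sq_real:
  fixes c t :: real assumes "c > 0"
  shows "(LINT x|lborel. cis (x * t) * exp (- c * x\<^sup>2)) = sqrt (pi / c) * exp (- t\<^sup>2 / (4 * c))"
proof -
  have *: "(LINT x|lborel. cis (x * t) * complex_of_real (exp (- x\<^sup>2 / 2))) = sqrt (2 * pi) * exp (- t\<^sup>2 / 2)" for t :: real
  proof -
    have "complex_of_real (exp (- (t\<^sup>2) / 2)) = (LINT x|lborel. std_normal_density x *\<^sub>R cis (x * t))"
      using fun_cong[OF char_std_normal_distribution, of t] unfolding char_def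
      by (subst (asm) integral_density) (auto simp: mult_ac cis_conv_exp)
    also have "\<dots> = (LINT x|lborel. complex_of_real (1 / sqrt (2 * pi)) * (cis (x * t) * complex_of_real (exp (- x\<^sup>2 / 2))))"
      by (intro Bochner_Integration.integral_cong) (auto simp: std_normal_density_def scaleR_conv_of_real)
    also have "\<dots> = complex_of_real (1 / sqrt (2 * pi)) * (LINT x|lborel. cis (x * t) * complex_of_real (exp (- x\<^sup>2 / 2)))"
      by simp
    finally show ?thesis by (simp add: field_simps)
  qed
  have "(LINT x|lborel. cis (x * (t / sqrt (2*c))) * complex_of_real (exp (- x\<^sup>2 / 2)))
     = sqrt (2*c) * (LINT x|lborel. cis (x * t) * complex_of_real (exp (- c * x\<^sup>2)))"
    using assms by (subst lborel_integral_real_affine[of "sqrt (2 * c)" _ 0]) (auto simp: power_mult_distrib scaleR_conv_of_real mult_ac)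
  then have "sqrt (2*c) * (LINT x|lborel. cis (x * t) * complex_of_real (exp (- c * x\<^sup>2))) =
      complex_of_real (sqrt (2 * pi) * exp (- (t / sqrt (2*c))\<^sup>2 / 2))"
    by (simp only: *)
  also have "exp (- (t / sqrt (2*c))\<^sup>2 / 2) = exp (- t\<^sup>2 / (4 * c))"
    using assms by (simp add: power_divide)
  also have "sqrt (2 * pi) = sqrt (2 * c) * sqrt (pi / c)"
    using assms by (simp add: real_sqrt_mult[symmetric])
  finally show ?thesis using assms by simp
qed

lemma gauss_prod: "gauss c x = (\<Prod>b\<in>Basis. exp (- c * (x \<bullet> b)\<^sup>2))"
proof -
  have "(norm x)\<^sup>2 = (\<Sum>b\<in>Basis. (x \<bullet> b)\<^sup>2)"
    unfolding power2_norm_eq_inner by (subst euclidean_inner) (simp add: power2_eq_square)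
  then show ?thesis
    by (simp add: gauss_def exp_sum[symmetric] sum_distrib_left sum_negf)
qed

lemma cis_prod: "cis (x \<bullet> \<xi>) = (\<Prod>b\<in>Basis. cis ((x \<bullet> b) * (\<xi> \<bullet> b)))"
proof -
  have "cis (sum f A) = (\<Prod>a\<in>A. cis (f a))" if "finite A" for f and A :: "'a set"
    using that by induction (auto simp: cis_mult[symmetric] )
  then show ?thesis by (subst euclidean_inner) auto
qed

text \<open>\<open>lborel\<close> is the image of the product of one-dimensional Lebesgue measures
  under the coordinate map, so tensor products integrate factor by factor; this lifts the
  one-dimensional Gaussian integral to every dimension.\<close>

lemma integral_lborel_prod:
  fixes f :: "'a::euclidean_space \<Rightarrow> real \<Rightarrow> complex"
  assumes "\<And>b. b \<in> Basis \<Longrightarrow> integrable lborel (f b)"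
  shows "integrable lborel (\<lambda>x. \<Prod>b\<in>Basis. f b (x \<bullet> b))"
    and "(LINT x|lborel. (\<Prod>b\<in>Basis. f b (x \<bullet> b))) = (\<Prod>b\<in>Basis. (LINT x|lborel. f b x))"
proof -
  interpret product_sigma_finite "\<lambda>b::'a. lborel :: real measure" ..
  have [measurable]: "f b \<in> borel_measurable borel" if "b \<in> Basis" for b
    using assms[OF that] by auto
  have *: "(\<Prod>b\<in>Basis. f b ((\<Sum>i\<in>Basis. x i *\<^sub>R i) \<bullet> b)) = (\<Prod>b\<in>Basis. f b (x b))" for x
    by (intro prod.cong refl) (simp add: inner_sum_left inner_Basis if_distrib cong: if_cong)
  show "integrable lborel (\<lambda>x. \<Prod>b\<in>Basis. f b (x \<bullet> b))"
    by (subst lborel_eq, subst integrable_distr_eq) (auto simp: * intro!: product_integrable_prod assms)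
  show "(LINT x|lborel. (\<Prod>b\<in>Basis. f b (x \<bullet> b))) = (\<Prod>b\<in>Basis. (LINT x|lborel. f b x))"
    by (subst lborel_eq, subst integral_distr) (auto simp: * intro!: product_integral_prod assms)
qed

lemma fourier_gauss_aux:
  fixes \<xi> :: "'a::euclidean_space"
  assumes c: "c > 0"
  shows "integrable lborel (\<lambda>x. cis (x \<bullet> \<xi>) * complex_of_real (gauss c x))"
    and "(LINT x|lborel. cis (x \<bullet> \<xi>) * complex_of_real (gauss c x)) =
      complex_of_real ((pi / c) powr (DIM('a) / 2) * gauss (1 / (4 * c)) \<xi>)"
proof -
  have eq: "cis (x \<bullet> \<xi>) * complex_of_real (gauss c x) =
    (\<Prod>b\<in>Basis. (\<lambda>t. cis (t * (\<xi> \<bullet> b)) * complex_of_real (exp (- c * t\<^sup>2))) (x \<bullet> b))" for x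
    unfolding cis_prod[of x] gauss_prod[of c x] by (simp add: prod.distrib)
  have i: "integrable lborel (\<lambda>t. cis (t * (\<xi> \<bullet> b)) * complex_of_real (exp (- c * t\<^sup>2)))" for b
    by (rule Bochner_Integration.integrable_bound[OF integrable_exp_sq_real[OF c]]) (auto simp: norm_mult)
  show "integrable lborel (\<lambda>x. cis (x \<bullet> \<xi>) * complex_of_real (gauss c x))"
    unfolding eq by (rule integral_lborel_prod(1)[OF i])
  have "(LINT x|lborel. cis (x \<bullet> \<xi>) * complex_of_real (gauss c x)) =
     (\<Prod>b\<in>(Basis::'a set). complex_of_real (sqrt (pi / c) * exp (- (\<xi> \<bullet> b)\<^sup>2 / (4 * c))))"
    unfolding eq by (subst integral_lborel_prod(2)[OF i]) (simp only: integral_cis_exp_sq_real[OF c])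
  also have "\<dots> = complex_of_real (sqrt (pi / c) ^ DIM('a) * gauss (1 / (4 * c)) \<xi>)"
    by (simp add: prod.distrib gauss_prod)
  also have "sqrt (pi / c) ^ DIM('a) = (pi / c) powr (DIM('a) / 2)"
    using c by (simp add: powr_half_sqrt[symmetric] powr_realpow[symmetric] powr_powr)
  finally show "(LINT x|lborel. cis (x \<bullet> \<xi>) * complex_of_real (gauss c x)) =
      complex_of_real ((pi / c) powr (DIM('a) / 2) * gauss (1 / (4 * c)) \<xi>)" .
qed

lemma integrable_gauss: "c > 0 \<Longrightarrow> integrable lborel (gauss c)"
  using integrable_norm[OF fourier_gauss_aux(1)[of c 0]] by (simp add: norm_mult)

lemma integral_gauss: "c > 0 \<Longrightarrow> (LINT x|lborel. gauss c (x::'a::euclidean_space)) = (pi / c) powr (DIM('a) / 2)"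
  using fourier_gauss_aux(2)[of c "0::'a"] by (simp add: gauss_def)

lemma fourier_gauss_const:
  assumes "c > 0" shows "(2 * pi) powr (- real n / 2) * (pi / c) powr (n / 2) = (2 * c) powr (- n / 2)"
proof -
  have "(pi / c) powr (n / 2) = (2 * pi) powr (n / 2) * (2 * c) powr (- n / 2)"
    using assms by (simp add: powr_divide powr_mult powr_minus field_simps)
  then show ?thesis by (simp add: powr_minus)
qed

lemma inv_fourier_gauss:
  fixes x :: "'a::euclidean_space"
  assumes "c > 0"
  shows "inv_fourier (\<lambda>\<xi>. complex_of_real (gauss c \<xi>)) x = complex_of_real ((2 * c) powr (- DIM('a) / 2) * gauss (1 / (4 * c)) x)"
  unfolding inv_fourier_def inner_commute[of x] fourier_gauss_aux(2)[OF assms]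
  using fourier_gauss_const[OF assms, of "DIM('a)"] by (simp flip: of_real_mult mult.assoc)

lemma fourier_eq_inv: "fourier f \<xi> = inv_fourier f (- \<xi>)"
  by (simp add: fourier_def inv_fourier_def inner_commute)

lemma fourier_gauss:
  fixes x :: "'a::euclidean_space"
  assumes "c > 0"
  shows "fourier (\<lambda>\<xi>. complex_of_real (gauss c \<xi>)) x = complex_of_real ((2 * c) powr (- DIM('a) / 2) * gauss (1 / (4 * c)) x)"
  by (simp add: fourier_eq_inv inv_fourier_gauss[OF assms]) (simp add: gauss_def)

text \<open>Represents a negative power of \<open>q\<close> as a mixture of exponentials; at
  \<open>q = 1 + |x|^2\<close> powers become mixtures of Gaussians. The nonnegative integral allows
  Tonelli without prior integrability.\<close>

lemma Gamma_nn_integral: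
  fixes m q :: real assumes "m > 0" "q > 0"
  shows "(\<integral>\<^sup>+s. ennreal (indicator {0<..} s * (s powr (m - 1) * exp (- s * q))) \<partial>lborel) = ennreal (Gamma m * q powr (- m))"
proof -
  have *: "(\<integral>\<^sup>+s. ennreal (indicator {0<..} s * (s powr (m - 1) * exp (- s))) \<partial>lborel) = ennreal (Gamma m)"
  proof (rule nn_integral_has_integral_lborel)
    have "((\<lambda>t. t powr (m - 1) / exp t) has_integral Gamma m) {0..}"
      by (rule Gamma_integral_real[OF assms(1)])
    then have "((\<lambda>t. if t \<in> {0..} then t powr (m - 1) / exp t else 0) has_integral Gamma m) UNIV"
      by (simp only: has_integral_restrict_UNIV)
    then show "((\<lambda>s. indicator {0<..} s * (s powr (m - 1) * exp (- s))) has_integral Gamma m) UNIV"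
      by (rule has_integral_spike[of "{0}", rotated 2]) (auto simp: indicator_def exp_minus field_simps)
  qed (auto simp: indicator_def)
  have "(\<integral>\<^sup>+s. ennreal (indicator {0<..} s * (s powr (m - 1) * exp (- s))) \<partial>lborel)
      = ennreal q * (\<integral>\<^sup>+s. ennreal (indicator {0<..} (q * s) * ((q * s) powr (m - 1) * exp (- (q * s)))) \<partial>lborel)"
    using assms by (subst nn_integral_real_affine[of _ q 0]) auto
  also have "\<dots> = ennreal q * (\<integral>\<^sup>+s. ennreal (q powr (m - 1)) * ennreal (indicator {0<..} s * (s powr (m - 1) * exp (- s * q))) \<partial>lborel)"
    using assms by (intro arg_cong2[where f="(*)"] refl nn_integral_cong)
      (auto simp: indicator_def powr_mult zero_less_mult_iff ennreal_mult[symmetric] mult_ac)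
  also have "\<dots> = ennreal (q powr m) * (\<integral>\<^sup>+s. ennreal (indicator {0<..} s * (s powr (m - 1) * exp (- s * q))) \<partial>lborel)"
    using assms by (subst nn_integral_cmult) (auto simp: ennreal_mult[symmetric] mult.assoc[symmetric] powr_diff)
  finally have "ennreal (Gamma m) = ennreal (q powr m) * (\<integral>\<^sup>+s. ennreal (indicator {0<..} s * (s powr (m - 1) * exp (- s * q))) \<partial>lborel)"
    by (simp add: *)
  then have "ennreal (q powr (- m)) * ennreal (Gamma m) = ennreal (q powr (-m)) * ennreal (q powr m) * (\<integral>\<^sup>+s. ennreal (indicator {0<..} s * (s powr (m - 1) * exp (- s * q))) \<partial>lborel)"
    by (simp add: mult.assoc)
  also have "ennreal (q powr (-m)) * ennreal (q powr m) = 1"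
    using assms by (simp add: ennreal_mult[symmetric] powr_minus)
  finally show ?thesis
    using assms by (simp add: ennreal_mult[symmetric] Gamma_real_nonneg mult.commute)
qed

lemma nn_integral_gauss: "c > 0 \<Longrightarrow> (\<integral>\<^sup>+x. ennreal (gauss c (x::'a::euclidean_space)) \<partial>lborel) = ennreal ((pi / c) powr (DIM('a) / 2))"
  by (subst nn_integral_eq_integral) (auto simp: integrable_gauss integral_gauss)

text \<open>Tonelli on the Gamma representation: integrating the Gaussian of rate \<open>s\<close>
  over \<open>x\<close> produces \<open>s powr (- DIM('a) / 2)\<close>, and what remains is a Gamma
  integral at the positive argument \<open>m - DIM('a) / 2\<close>.\<close>

lemma integrable_one_plus_norm_sq_powr:
  fixes m :: real assumes m: "m > DIM('a::euclidean_space) / 2"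
  shows "integrable lborel (\<lambda>x::'a. (1 + (norm x)\<^sup>2) powr (- m))"
proof (rule integrableI_bounded)
  have m0: "m > 0" "m - DIM('a) / 2 > 0" using m by (auto intro: le_less_trans[OF _ m])
  have pos: "0 < 1 + (norm (x::'a))\<^sup>2" for x by (simp add: add_pos_nonneg)
  have G: "Gamma m > 0" using m0 by (simp add: Gamma_real_pos)
  have "(\<integral>\<^sup>+(x::'a). ennreal (norm ((1 + (norm x)\<^sup>2) powr (- m))) \<partial>lborel) =
     (\<integral>\<^sup>+(x::'a). ennreal (1 / Gamma m) * (\<integral>\<^sup>+s. ennreal (indicator {0<..} s * (s powr (m - 1) * exp (- s * (1 + (norm x)\<^sup>2)))) \<partial>lborel) \<partial>lborel)"
    using G by (subst Gamma_nn_integral[OF m0(1) pos]) (auto simp: ennreal_mult[symmetric])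
  also have "\<dots> = ennreal (1 / Gamma m) * (\<integral>\<^sup>+s. (\<integral>\<^sup>+(x::'a). ennreal (indicator {0<..} s * (s powr (m - 1) * exp (- s * (1 + (norm x)\<^sup>2)))) \<partial>lborel) \<partial>lborel)"
    by (subst nn_integral_cmult, measurable, subst lborel_pair.Fubini') auto
  also have "(\<lambda>s. \<integral>\<^sup>+(x::'a). ennreal (indicator {0<..} s * (s powr (m - 1) * exp (- s * (1 + (norm x)\<^sup>2)))) \<partial>lborel) =
     (\<lambda>s. ennreal (pi powr (DIM('a) / 2)) * ennreal (indicator {0<..} s * (s powr ((m - DIM('a) / 2) - 1) * exp (- s * 1))))"
  proof
    fix s :: real
    show "(\<integral>\<^sup>+(x::'a). ennreal (indicator {0<..} s * (s powr (m - 1) * exp (- s * (1 + (norm x)\<^sup>2)))) \<partial>lborel) =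
      ennreal (pi powr (DIM('a) / 2)) * ennreal (indicator {0<..} s * (s powr ((m - DIM('a) / 2) - 1) * exp (- s * 1)))"
    proof (cases "s > 0")
      case True
      have "(\<integral>\<^sup>+(x::'a). ennreal (indicator {0<..} s * (s powr (m - 1) * exp (- s * (1 + (norm x)\<^sup>2)))) \<partial>lborel)
        = (\<integral>\<^sup>+(x::'a). ennreal (s powr (m - 1) * exp (- s)) * ennreal (gauss s x) \<partial>lborel)"
        using True by (intro nn_integral_cong) (auto simp: ennreal_mult[symmetric] gauss_def exp_add[symmetric] algebra_simps exp_diff exp_minus field_simps)
      also have "\<dots> = ennreal (s powr (m - 1) * exp (- s) * (pi / s) powr (DIM('a) / 2))"
        using True by (subst nn_integral_cmult) (auto simp: nn_integral_gauss ennreal_mult[symmetric])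
      also have "s powr (m - 1) * exp (- s) * (pi / s) powr (DIM('a) / 2) = pi powr (DIM('a) / 2) * (s powr ((m - DIM('a) / 2) - 1) * exp (- s * 1))"
      proof -
        have "s powr (m - 1) = s powr ((m - DIM('a) / 2) - 1) * s powr (DIM('a) / 2)"
          by (simp add: powr_add[symmetric])
        then show ?thesis using True by (simp add: powr_divide)
      qed
      finally show ?thesis using True by (simp add: ennreal_mult[symmetric])
    qed auto
  qed
  also have "(\<integral>\<^sup>+s. \<dots> s \<partial>lborel) = ennreal (pi powr (DIM('a) / 2)) * ennreal (Gamma (m - DIM('a) / 2) * 1 powr (- (m - DIM('a) / 2)))"
    by (subst nn_integral_cmult, measurable, subst Gamma_nn_integral[OF m0(2)]) auto
  also have "ennreal (1 / Gamma m) * \<dots> < \<infinity>"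
    by (simp add: ennreal_mult_less_top)
  finally show "(\<integral>\<^sup>+(x::'a). ennreal (norm ((1 + (norm x)\<^sup>2) powr (- m))) \<partial>lborel) < \<infinity>" .
qed measurable

subsection \<open>Schwartz functions and tempered functions\<close>

text \<open>The derivative in a fixed direction is again polynomial, which is what closes the class
  under iterated partial derivatives.\<close>

lemma real_polynomial_function_has_derivative:
  assumes "real_polynomial_function P"
  shows "\<exists>P'. (\<forall>x. (P has_derivative P' x) (at x)) \<and> (\<forall>b. real_polynomial_function (\<lambda>x. P' x b))"
  using assms
proof induction
  case (linear f)
  then show ?case
    by (intro exI[of _ "\<lambda>_. f"]) (auto intro: bounded_linear_imp_has_derivative real_polynomial_function.intros)
next
  case (const c)
  then show ?case
    by (intro exI[of _ "\<lambda>_ _. 0"]) (auto intro: real_polynomial_function.intros)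
next
  case (add f g)
  then obtain f' g' where "\<forall>x. (f has_derivative f' x) (at x)" "\<forall>b. real_polynomial_function (\<lambda>x. f' x b)"
    "\<forall>x. (g has_derivative g' x) (at x)" "\<forall>b. real_polynomial_function (\<lambda>x. g' x b)" by auto
  then show ?case
    by (intro exI[of _ "\<lambda>x h. f' x h + g' x h"]) (auto intro!: real_polynomial_function.intros(3) has_derivative_add)
next
  case (mult f g)
  then obtain f' g' where "\<forall>x. (f has_derivative f' x) (at x)" "\<forall>b. real_polynomial_function (\<lambda>x. f' x b)"
    "\<forall>x. (g has_derivative g' x) (at x)" "\<forall>b. real_polynomial_function (\<lambda>x. g' x b)" by auto
  then show ?case using mult
    by (intro exI[of _ "\<lambda>x h. f x * g' x h + f' x h * g x"]) (auto intro!: real_polynomial_function.intros(3,4) has_derivative_mult)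
qed

lemma real_polynomial_function_growth:
  assumes "real_polynomial_function P"
  shows "\<exists>C d. C \<ge> 0 \<and> (\<forall>x. \<bar>P x\<bar> \<le> C * (1 + norm x) ^ d)"
  using assms
proof induction
  case (linear f)
  obtain K where K: "K \<ge> 0" "\<And>x. norm (f x) \<le> norm x * K"
    using bounded_linear.nonneg_bounded[OF linear] by blast
  show ?case
  proof (intro exI[of _ K] exI[of _ 1] conjI allI)
    fix x show "\<bar>f x\<bar> \<le> K * (1 + norm x) ^ 1"
      using K(2)[of x] K(1) by (simp add: algebra_simps)
  qed (use K in auto)
next
  case (const c)
  then show ?case by (intro exI[of _ "\<bar>c\<bar>"] exI[of _ 0]) auto
next
  case (add f g)
  then obtain C D :: real and d e where "C \<ge> 0" "D \<ge> 0" and f: "\<And>x. \<bar>f x\<bar> \<le> C * (1 + norm x) ^ d" and g: "\<And>x. \<bar>g x\<bar> \<le> D * (1 + norm x) ^ e"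
    by blast
  show ?case
  proof (intro exI[of _ "C + D"] exI[of _ "d + e"] conjI allI)
    fix x :: 'a
    have "\<bar>f x + g x\<bar> \<le> C * (1 + norm x) ^ d + D * (1 + norm x) ^ e"
      using f[of x] g[of x] by linarith
    also have "\<dots> \<le> C * (1 + norm x) ^ (d + e) + D * (1 + norm x) ^ (d + e)"
      using \<open>C \<ge> 0\<close> \<open>D \<ge> 0\<close> by (intro add_mono mult_left_mono power_increasing) auto
    finally show "\<bar>f x + g x\<bar> \<le> (C + D) * (1 + norm x) ^ (d + e)" by (simp add: algebra_simps)
  qed (use \<open>C \<ge> 0\<close> \<open>D \<ge> 0\<close> in auto)
next
  case (mult f g)
  then obtain C D :: real and d e where "C \<ge> 0" "D \<ge> 0" and f: "\<And>x. \<bar>f x\<bar> \<le> C * (1 + norm x) ^ d" and g: "\<And>x. \<bar>g x\<bar> \<le> D * (1 + norm x) ^ e"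
    by blast
  show ?case
  proof (intro exI[of _ "C * D"] exI[of _ "d + e"] conjI allI)
    fix x :: 'a
    have "\<bar>f x * g x\<bar> \<le> (C * (1 + norm x) ^ d) * (D * (1 + norm x) ^ e)"
      using f[of x] g[of x] \<open>C \<ge> 0\<close> unfolding abs_mult by (intro mult_mono) auto
    then show "\<bar>f x * g x\<bar> \<le> (C * D) * (1 + norm x) ^ (d + e)" by (simp add: algebra_simps power_add)
  qed (use \<open>C \<ge> 0\<close> \<open>D \<ge> 0\<close> in auto)
qed

text \<open>A single term of the exponential series. The factors \<open>fact k / s ^ k\<close> that
  measure the cost of a moment come from here.\<close>

lemma power_le_fact_mult_exp:
  fixes x :: real assumes "x \<ge> 0" shows "x ^ k \<le> fact k * exp x"
proof -
  have "x ^ k / fact k \<le> (\<Sum>n. x ^ n / fact n)"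
    using sum_le_suminf[of "\<lambda>n. x ^ n / fact n" "{k}"] summable_exp_generic[of x] assms
    by (simp add: scaleR_conv_of_real divide_inverse mult.commute)
  also have "\<dots> = exp x" by (simp add: exp_def scaleR_conv_of_real divide_inverse mult.commute)
  finally show ?thesis by (simp add: field_simps)
qed

lemma power_mult_gauss_bounded:
  assumes "c > 0"
  shows "\<exists>B. \<forall>x::'a::euclidean_space. (1 + norm x) ^ k * gauss c x \<le> B"
proof (intro exI allI)
  fix x :: 'a
  have *: "(1 + norm x) ^ k \<le> fact k * exp (1 + norm x)"
    by (rule power_le_fact_mult_exp) simp
  \<comment> \<open>Completing the square lets the quadratic decay absorb the linear exponent, at
    the price \<open>1 / (4 * c)\<close>.\<close>
  have "0 \<le> (1 / (2 * sqrt c) - sqrt c * norm x)\<^sup>2" by simp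
  also have "\<dots> = 1 / (4 * c) - norm x + c * (norm x)\<^sup>2"
    using assms by (simp add: power2_diff power_divide power_mult_distrib)
  finally have **: "norm x + (- c * (norm x)\<^sup>2) \<le> 1 / (4 * c)" by simp
  have "(1 + norm x) ^ k * gauss c x \<le> fact k * exp (1 + norm x) * gauss c x"
    using * by (intro mult_right_mono) auto
  also have "\<dots> = fact k * exp (1 + (norm x + (- c * (norm x)\<^sup>2)))"
    by (simp add: gauss_def exp_add[symmetric] algebra_simps)
  also have "\<dots> \<le> fact k * exp (1 + 1 / (4 * c))"
    using ** by (intro mult_left_mono) auto
  finally show "(1 + norm x) ^ k * gauss c x \<le> fact k * exp (1 + 1 / (4 * c))" .
qed

lemma gauss_has_derivative:
  "(gauss c has_derivative (\<lambda>h. - 2 * c * (x \<bullet> h) * gauss c x)) (at x)"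
  unfolding gauss_def power2_norm_eq_inner
  by (auto intro!: derivative_eq_intros simp: inner_commute)

text \<open>A partial derivative of a polynomial times a Gaussian changes only the polynomial, so
  the Schwartz bounds reduce to polynomial growth against one fixed Gaussian.\<close>

lemma iter_partial_poly_gauss:
  assumes "real_polynomial_function P"
  shows "\<exists>Q. real_polynomial_function Q \<and>
    iter_partial bs (\<lambda>x. complex_of_real (P x * gauss c x)) = (\<lambda>x. complex_of_real (Q x * gauss c x))"
proof (induction bs)
  case Nil
  then show ?case using assms by auto
next
  case (Cons b bs)
  then obtain Q where Q: "real_polynomial_function Q"
    "iter_partial bs (\<lambda>x. complex_of_real (P x * gauss c x)) = (\<lambda>x. complex_of_real (Q x * gauss c x))" by blast
  obtain Q' where Q': "\<And>x. (Q has_derivative Q' x) (at x)" "\<And>b. real_polynomial_function (\<lambda>x. Q' x b)"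
    using real_polynomial_function_has_derivative[OF Q(1)] by blast
  have D: "((\<lambda>x. complex_of_real (Q x * gauss c x)) has_derivative
      (\<lambda>h. complex_of_real (Q x * (- 2 * c * (x \<bullet> h) * gauss c x) + Q' x h * gauss c x))) (at x)" for x
    by (intro derivative_intros Q' gauss_has_derivative)
  have F: "frechet_derivative (\<lambda>x. complex_of_real (Q x * gauss c x)) (at x) b =
     complex_of_real (Q x * (- 2 * c * (x \<bullet> b) * gauss c x) + Q' x b * gauss c x)" for x
    by (simp only: frechet_derivative_at[OF D, symmetric])
  have "real_polynomial_function (\<lambda>x. Q x * (- 2 * c * (x \<bullet> b)) + Q' x b)"
    by (intro real_polynomial_function.intros Q Q' bounded_linear_inner_left)
  moreover have "iter_partial (b # bs) (\<lambda>x. complex_of_real (P x * gauss c x)) =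
      (\<lambda>x. complex_of_real ((Q x * (- 2 * c * (x \<bullet> b)) + Q' x b) * gauss c x))"
    unfolding iter_partial.simps Q(2) F by (simp add: algebra_simps)
  ultimately show ?case by blast
qed

lemma poly_gauss_schwartz:
  assumes "real_polynomial_function P" "c > 0"
  shows "(\<lambda>x. complex_of_real (P x * gauss c x)) \<in> schwartz"
  unfolding schwartz_def smooth_def
proof (intro CollectI conjI allI impI)
  fix bs
  obtain Q where Q: "real_polynomial_function Q"
    "iter_partial bs (\<lambda>x. complex_of_real (P x * gauss c x)) = (\<lambda>x. complex_of_real (Q x * gauss c x))"
    using iter_partial_poly_gauss[OF assms(1)] by blast
  obtain Q' where Q': "\<And>x. (Q has_derivative Q' x) (at x)"
    using real_polynomial_function_has_derivative[OF Q(1)] by blast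
  have "((\<lambda>x. complex_of_real (Q x * gauss c x)) has_derivative
      (\<lambda>h. complex_of_real (Q x * (- 2 * c * (x \<bullet> h) * gauss c x) + Q' x h * gauss c x))) (at x)" for x
    by (intro derivative_intros Q' gauss_has_derivative)
  then show "iter_partial bs (\<lambda>x. complex_of_real (P x * gauss c x)) differentiable_on UNIV"
    unfolding Q(2) by (auto simp: differentiable_on_def differentiable_def)
  fix k
  obtain C d where C: "C \<ge> 0" "\<And>x. \<bar>Q x\<bar> \<le> C * (1 + norm x) ^ d"
    using real_polynomial_function_growth[OF Q(1)] by blast
  obtain B where B: "\<And>x::'a. (1 + norm x) ^ (k + d) * gauss c x \<le> B"
    using power_mult_gauss_bounded[OF assms(2)] by blast
  have "norm ((1 + norm x) ^ k *\<^sub>R complex_of_real (Q x * gauss c x)) \<le> C * B" for x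
  proof -
    have "norm ((1 + norm x) ^ k *\<^sub>R complex_of_real (Q x * gauss c x)) = (1 + norm x) ^ k * (\<bar>Q x\<bar> * gauss c x)"
      by (simp add: norm_mult)
    also have "\<dots> \<le> (1 + norm x) ^ k * ((C * (1 + norm x) ^ d) * gauss c x)"
      by (intro mult_left_mono mult_right_mono C) auto
    also have "\<dots> = C * ((1 + norm x) ^ (k + d) * gauss c x)" by (simp add: power_add)
    also have "\<dots> \<le> C * B" by (intro mult_left_mono B C)
    finally show ?thesis .
  qed
  then show "bounded (range (\<lambda>x. (1 + norm x) ^ k *\<^sub>R iter_partial bs (\<lambda>x. complex_of_real (P x * gauss c x)) x))"
    unfolding Q(2) by (intro boundedI[of _ "C * B"]) auto
qed

lemma gauss_schwartz: "c > 0 \<Longrightarrow> (\<lambda>x. complex_of_real (gauss c x)) \<in> schwartz"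
  using poly_gauss_schwartz[of "\<lambda>_. 1" c] by (simp add: real_polynomial_function.intros)

section \<open>Seminorms and decay of Schwartz functions\<close>

lemma finite_multiindices: "finite {bs. set bs \<subseteq> (Basis::'a::euclidean_space set) \<and> length bs \<le> m}"
  by (rule finite_lists_length_le) simp

text \<open>\<open>schwartz_seminorm\<close> is a real supremum and yields upper bounds only once
  its range is bounded. There are finitely many multi-indices, and the sum of their individual
  bounds serves for all.\<close>

lemma schwartz_seminorm_bdd:
  assumes "f \<in> schwartz"
  shows "bdd_above ((\<lambda>(bs, x). (1 + norm x) ^ m * norm (iter_partial bs f x)) ` ({bs. set bs \<subseteq> Basis \<and> length bs \<le> m} \<times> UNIV))"
proof -
  have "\<exists>B. \<forall>x. (1 + norm x) ^ m * norm (iter_partial bs f x) \<le> B" if "set bs \<subseteq> Basis" for bs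
  proof -
    have "bounded (range (\<lambda>x. (1 + norm x) ^ m *\<^sub>R iter_partial bs f x))"
      using assms that by (auto simp: schwartz_def)
    then show ?thesis by (auto simp: bounded_iff)
  qed
  then obtain B where B: "\<And>bs x. set bs \<subseteq> Basis \<Longrightarrow> (1 + norm x) ^ m * norm (iter_partial bs f x) \<le> B bs" by metis
  let ?A = "{bs. set bs \<subseteq> (Basis::'a set) \<and> length bs \<le> m}"
  show ?thesis
  proof (intro bdd_aboveI2[where M="\<Sum>bs\<in>?A. \<bar>B bs\<bar>"], clarsimp)
    fix bs :: "'a list" and x assume bs: "set bs \<subseteq> Basis" "length bs \<le> m"
    have "(1 + norm x) ^ m * norm (iter_partial bs f x) \<le> \<bar>B bs\<bar>" using B[OF bs(1), of x] by linarith
    also have "\<dots> \<le> (\<Sum>bs\<in>?A. \<bar>B bs\<bar>)"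
      using bs by (intro member_le_sum finite_multiindices) auto
    finally show "(1 + norm x) ^ m * norm (iter_partial bs f x) \<le> (\<Sum>bs\<in>?A. \<bar>B bs\<bar>)" .
  qed
qed

lemma schwartz_seminorm_upper:
  assumes "f \<in> schwartz" "set bs \<subseteq> Basis" "length bs \<le> m"
  shows "(1 + norm x) ^ m * norm (iter_partial bs f x) \<le> schwartz_seminorm m f"
  unfolding schwartz_seminorm_def
  using cSUP_upper[OF _ schwartz_seminorm_bdd[OF assms(1)], of "(bs, x)" m] assms(2,3) by simp

lemma iter_partial_scale:
  assumes "smooth f" "set bs \<subseteq> Basis"
  shows "iter_partial bs (\<lambda>x. f (a *\<^sub>R x)) = (\<lambda>x. a ^ length bs *\<^sub>R iter_partial bs f (a *\<^sub>R x))"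
  using assms(2)
proof (induction bs)
  case (Cons b bs)
  have d: "(iter_partial bs f has_derivative frechet_derivative (iter_partial bs f) (at y)) (at y)" for y
    using assms(1) Cons.prems by (auto simp: smooth_def differentiable_on_def frechet_derivative_works)
  have D: "((\<lambda>x. a ^ length bs *\<^sub>R iter_partial bs f (a *\<^sub>R x)) has_derivative
     (\<lambda>h. a ^ length bs *\<^sub>R frechet_derivative (iter_partial bs f) (at (a *\<^sub>R x)) (a *\<^sub>R h))) (at x)" for x
    by (intro has_derivative_scaleR_right has_derivative_compose[OF _ d]) (auto intro!: derivative_eq_intros)
  have F: "frechet_derivative (\<lambda>x. a ^ length bs *\<^sub>R iter_partial bs f (a *\<^sub>R x)) (at x) b =
     a ^ length bs *\<^sub>R frechet_derivative (iter_partial bs f) (at (a *\<^sub>R x)) (a *\<^sub>R b)" for x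
    by (simp only: frechet_derivative_at[OF D, symmetric])
  have G: "frechet_derivative (iter_partial bs f) (at (a *\<^sub>R x)) (a *\<^sub>R b) = a *\<^sub>R frechet_derivative (iter_partial bs f) (at (a *\<^sub>R x)) b" for x
    using d[of "a *\<^sub>R x"] by (simp add: has_derivative_def bounded_linear.linear linear_scale)
  have "iter_partial bs (\<lambda>x. f (a *\<^sub>R x)) = (\<lambda>x. a ^ length bs *\<^sub>R iter_partial bs f (a *\<^sub>R x))"
    using Cons by simp
  then show ?case unfolding iter_partial.simps by (simp only: F G) (simp add: mult.commute)
qed simp

text \<open>The wide Gaussian is \<open>gauss 1\<close> dilated by \<open>1 / sqrt R\<close>:
  derivatives pick up factors at most 1, and only the weight loses, by \<open>sqrt R ^ m\<close>.
  This polynomial growth in \<open>R\<close> is later beaten by a geometric factor.\<close>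

lemma schwartz_seminorm_gauss_le:
  assumes R: "R \<ge> 1"
  shows "schwartz_seminorm m (\<lambda>x::'a::euclidean_space. complex_of_real (gauss (1 / R) x)) \<le>
     sqrt R ^ m * schwartz_seminorm m (\<lambda>x::'a. complex_of_real (gauss 1 x))"
  unfolding schwartz_seminorm_def[of m "\<lambda>x. complex_of_real (gauss (1 / R) x)"]
proof (rule cSUP_least, goal_cases)
  case 1
  have "[] \<in> {bs. set bs \<subseteq> (Basis::'a set) \<and> length bs \<le> m}" by simp
  then show ?case by blast
next
  case (2 y)
  obtain bs x where y: "y = (bs, x)" "set bs \<subseteq> (Basis::'a set)" "length bs \<le> m" using 2 by auto
  let ?g = "\<lambda>x::'a. complex_of_real (gauss 1 x)"
  have g: "?g \<in> schwartz" by (rule gauss_schwartz) simp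
  have R1: "1 / sqrt R \<le> 1" "0 < 1 / sqrt R" using R by auto
  have eq: "(\<lambda>x::'a. complex_of_real (gauss (1 / R) x)) = (\<lambda>x. ?g ((1 / sqrt R) *\<^sub>R x))"
    using R by (auto simp: gauss_def power_divide)
  have "(1 + norm x) ^ m * norm (iter_partial bs (\<lambda>x::'a. complex_of_real (gauss (1 / R) x)) x) =
     (1 + norm x) ^ m * ((1 / sqrt R) ^ length bs * norm (iter_partial bs ?g ((1 / sqrt R) *\<^sub>R x)))"
    unfolding eq using g R1 R by (subst iter_partial_scale) (auto simp: schwartz_def y power_divide)
  also have "\<dots> \<le> (sqrt R * (1 + norm ((1 / sqrt R) *\<^sub>R x))) ^ m * (1 * norm (iter_partial bs ?g ((1 / sqrt R) *\<^sub>R x)))"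
  proof (intro mult_mono power_mono)
    show "1 + norm x \<le> sqrt R * (1 + norm ((1 / sqrt R) *\<^sub>R x))"
      using R by (simp add: algebra_simps)
    show "(1 / sqrt R) ^ length bs \<le> 1" using R1 by (intro power_le_one) auto
  qed (use R in auto)
  also have "\<dots> = sqrt R ^ m * ((1 + norm ((1 / sqrt R) *\<^sub>R x)) ^ m * norm (iter_partial bs ?g ((1 / sqrt R) *\<^sub>R x)))"
    by (simp add: power_mult_distrib)
  also have "\<dots> \<le> sqrt R ^ m * schwartz_seminorm m ?g"
    using R by (intro mult_left_mono schwartz_seminorm_upper g y) auto
  finally show ?case unfolding y by simp
qed

lemma schwartz_continuous: "f \<in> schwartz \<Longrightarrow> continuous_on UNIV f"
  unfolding schwartz_def smooth_def
  by (auto intro!: differentiable_imp_continuous_on elim!: allE[of _ "[]"])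

lemma schwartz_measurable: "f \<in> schwartz \<Longrightarrow> f \<in> borel_measurable borel"
  by (intro borel_measurable_continuous_onI schwartz_continuous)

text \<open>The weight \<open>(1 + norm x) ^ (2 * k)\<close> of the seminorm dominates
  \<open>(1 + |x|^2) ^ k\<close>, the form whose integrability is known.\<close>

lemma schwartz_decay:
  assumes "f \<in> schwartz" "set bs \<subseteq> Basis" "length bs \<le> 2 * k"
  shows "norm (iter_partial bs f x) \<le> schwartz_seminorm (2 * k) f * (1 + (norm x)\<^sup>2) powr (- real k)"
proof -
  have pos: "0 < 1 + (norm x)\<^sup>2" by (simp add: add_pos_nonneg)
  have "(1 + (norm x)\<^sup>2) ^ k * norm (iter_partial bs f x) \<le> (1 + norm x) ^ (2 * k) * norm (iter_partial bs f x)"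
    unfolding power_mult by (intro mult_right_mono power_mono) (auto simp: power2_eq_square algebra_simps)
  also have "\<dots> \<le> schwartz_seminorm (2 * k) f" by (rule schwartz_seminorm_upper[OF assms])
  finally show ?thesis using pos by (simp add: powr_minus powr_realpow field_simps)
qed

text \<open>Decay of order \<open>DIM('a)\<close> lies above the critical order
  \<open>DIM('a) / 2\<close>. The bound by a seminorm is what makes bounded functions
  tempered.\<close>

lemma schwartz_integrable:
  fixes f :: "'a::euclidean_space \<Rightarrow> complex"
  assumes "f \<in> schwartz"
  shows "integrable lborel f"
    and "(LINT x|lborel. norm (f x)) \<le> schwartz_seminorm (2 * DIM('a)) f * (LINT x|lborel. (1 + (norm (x::'a))\<^sup>2) powr (- real DIM('a)))"
proof -
  have [measurable]: "f \<in> borel_measurable borel" by (rule schwartz_measurable[OF assms])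
  have i: "integrable lborel (\<lambda>x::'a. schwartz_seminorm (2 * DIM('a)) f * (1 + (norm x)\<^sup>2) powr (- real DIM('a)))"
    by (intro integrable_mult_right integrable_one_plus_norm_sq_powr) auto
  have b: "norm (f x) \<le> schwartz_seminorm (2 * DIM('a)) f * (1 + (norm x)\<^sup>2) powr (- real DIM('a))" for x
    using schwartz_decay[OF assms, of "[]"] by simp
  show f: "integrable lborel f"
    by (rule Bochner_Integration.integrable_bound[OF i]) (auto intro!: AE_I2 order_trans[OF b abs_ge_self])
  show "(LINT x|lborel. norm (f x)) \<le> schwartz_seminorm (2 * DIM('a)) f * (LINT x|lborel. (1 + (norm (x::'a))\<^sup>2) powr (- real DIM('a)))"
    unfolding integral_mult_right_zero[symmetric] by (intro integral_mono b i integrable_norm f)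
qed

lemma bounded_tempered_fun:
  fixes f :: "'a::euclidean_space \<Rightarrow> complex"
  assumes [measurable]: "f \<in> borel_measurable borel" and B: "\<And>x. norm (f x) \<le> B"
  shows "f \<in> tempered_fun"
proof -
  have B0: "B \<ge> 0" using norm_ge_zero B order_trans by blast
  have i: "integrable lborel (\<lambda>x. f x * \<phi> x)" and n: "norm (LINT x|lborel. f x * \<phi> x) \<le> B * (LINT x|lborel. norm (\<phi> x))"
    if \<phi>: "\<phi> \<in> schwartz" for \<phi>
  proof -
    have [measurable]: "\<phi> \<in> borel_measurable borel" using \<phi> by (rule schwartz_measurable)
    have i0: "integrable lborel (\<lambda>x. B * norm (\<phi> x))" using schwartz_integrable(1)[OF \<phi>] by auto
    show i: "integrable lborel (\<lambda>x. f x * \<phi> x)"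
      by (rule Bochner_Integration.integrable_bound[OF i0])
        (use B0 in \<open>simp_all add: norm_mult AE_I2 mult_right_mono B\<close>)
    have "norm (LINT x|lborel. f x * \<phi> x) \<le> (LINT x|lborel. norm (f x * \<phi> x))" by simp
    also have "\<dots> \<le> (LINT x|lborel. B * norm (\<phi> x))"
      by (intro integral_mono integrable_norm i i0) (auto simp: norm_mult intro!: mult_right_mono B)
    finally show "norm (LINT x|lborel. f x * \<phi> x) \<le> B * (LINT x|lborel. norm (\<phi> x))" by simp
  qed
  have "fun_dist f \<in> tempered"
    unfolding tempered_def fun_dist_def
  proof (intro CollectI conjI ballI allI)
    fix \<phi> \<psi> a b assume *: "\<phi> \<in> (schwartz :: ('a \<Rightarrow> complex) set)" "\<psi> \<in> (schwartz :: ('a \<Rightarrow> complex) set)"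
    have "(LINT x|lborel. f x * (a * \<phi> x + b * \<psi> x)) = (LINT x|lborel. a * (f x * \<phi> x) + b * (f x * \<psi> x))"
      by (simp add: algebra_simps)
    also have "\<dots> = (LINT x|lborel. a * (f x * \<phi> x)) + (LINT x|lborel. b * (f x * \<psi> x))"
      by (intro Bochner_Integration.integral_add integrable_mult_right i *)
    finally show "(LINT x|lborel. f x * (a * \<phi> x + b * \<psi> x)) = a * (LINT x|lborel. f x * \<phi> x) + b * (LINT x|lborel. f x * \<psi> x)"
      by simp
  next
    show "\<exists>C m. \<forall>\<phi>\<in>schwartz. norm (LINT x|lborel. f x * \<phi> x) \<le> C * schwartz_seminorm m \<phi>"
    proof (intro exI ballI)
      fix \<phi> :: "'a \<Rightarrow> complex" assume \<phi>: "\<phi> \<in> schwartz"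
      have "norm (LINT x|lborel. f x * \<phi> x) \<le> B * (LINT x|lborel. norm (\<phi> x))" by (rule n[OF \<phi>])
      also have "\<dots> \<le> B * (schwartz_seminorm (2 * DIM('a)) \<phi> * (LINT x|lborel. (1 + (norm (x::'a))\<^sup>2) powr (- real DIM('a))))"
        by (intro mult_left_mono schwartz_integrable(2) \<phi> B0)
      finally show "norm (LINT x|lborel. f x * \<phi> x) \<le> (B * (LINT x|lborel. (1 + (norm (x::'a))\<^sup>2) powr (- real DIM('a)))) * schwartz_seminorm (2 * DIM('a)) \<phi>"
        by (simp add: algebra_simps)
    qed
  qed
  then show ?thesis using i by (auto simp: tempered_fun_def)
qed

subsection \<open>Fourier moments of Gaussians\<close>

lemma integrable_dominated:
  fixes f :: "'a \<Rightarrow> 'b::{banach, second_countable_topology}"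
  assumes "integrable M g" "f \<in> borel_measurable M" "\<And>x. norm (f x) \<le> g x"
  shows "integrable M f"
  using assms(1,2) by (rule Bochner_Integration.integrable_bound) (auto intro!: AE_I2 order_trans[OF assms(3) abs_ge_self])

text \<open>Cauchy's inequality on the circle of radius \<rho>; the given coefficients are
  identified with the Taylor coefficients through the formal power series expansion of
  \<open>f\<close> at 0.\<close>

lemma power_series_coeff_bound:
  fixes a :: "nat \<Rightarrow> complex"
  assumes s: "\<And>z. z \<in> ball 0 r \<Longrightarrow> (\<lambda>n. a n * z ^ n) sums f z"
    and "0 < \<rho>" "\<rho> < r" and B: "\<And>z. norm z = \<rho> \<Longrightarrow> norm (f z) \<le> B"
  shows "norm (a n) \<le> B / \<rho> ^ n"
proof -
  have hol: "f holomorphic_on ball 0 r"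
    using power_series_holomorphic[of 0 r a f] s by simp
  have "eventually (\<lambda>z. z \<in> ball 0 r) (nhds (0::complex))"
    using assms by (intro eventually_nhds_in_open) auto
  then have "f has_fps_expansion Abs_fps a"
    by (intro has_fps_expansionI) (auto elim!: eventually_mono intro: s)
  then have "norm (a n) = norm ((deriv ^^ n) f 0) / fact n"
    using fps_nth_fps_expansion[of f "Abs_fps a" n] by (simp add: norm_divide)
  moreover have le: "norm ((deriv ^^ n) f 0) \<le> fact n * B / \<rho> ^ n"
  proof (rule Cauchy_inequality)
    have "cball 0 \<rho> \<subseteq> ball 0 r" using assms by auto
    then show "continuous_on (cball 0 \<rho>) f"
      using hol holomorphic_on_imp_continuous_on continuous_on_subset by blast
    show "f holomorphic_on ball 0 \<rho>" using hol by (rule holomorphic_on_subset) (use assms in auto)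
  qed (use assms in auto)
  ultimately show ?thesis using divide_right_mono[OF le, of "fact n"] by simp
qed

text \<open>The quantity under the root in \<open>L_symbol\<close>, taken with its sign. In this
  variable the symbol is a single entire function, so the branches at \<open>|\<xi>| = 1/2\<close>
  disappear.\<close>

abbreviation shift_sq :: "'a::euclidean_space \<Rightarrow> real" where
  "shift_sq \<xi> \<equiv> (norm \<xi>)\<^sup>2 - 1 / 4"

text \<open>An exponential moment of rate \<open>s\<close> pays for the \<open>k\<close>-th power of
  \<open>shift_sq\<close> with the factor \<open>fact k / s ^ k\<close>.\<close>

lemma fourier_moments:
  fixes H :: "'a::euclidean_space \<Rightarrow> complex"
  assumes [measurable]: "H \<in> borel_measurable borel" and s: "s > 0"
    and i: "integrable lborel (\<lambda>\<xi>. exp (s * \<bar>shift_sq \<xi>\<bar>) * norm (H \<xi>))"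
  shows "integrable lborel (\<lambda>\<xi>. complex_of_real (shift_sq \<xi> ^ k) * H \<xi>)"
    and "(LINT \<xi>|lborel. norm (complex_of_real (shift_sq \<xi> ^ k) * H \<xi>)) \<le> fact k / s ^ k * (LINT \<xi>|lborel. exp (s * \<bar>shift_sq \<xi>\<bar>) * norm (H \<xi>))"
proof -
  have b: "norm (complex_of_real (shift_sq \<xi> ^ k) * H \<xi>) \<le> fact k / s ^ k * (exp (s * \<bar>shift_sq \<xi>\<bar>) * norm (H \<xi>))" for \<xi>
  proof -
    have "(s * \<bar>shift_sq \<xi>\<bar>) ^ k \<le> fact k * exp (s * \<bar>shift_sq \<xi>\<bar>)"
      using s by (intro power_le_fact_mult_exp) auto
    then have "\<bar>shift_sq \<xi>\<bar> ^ k \<le> fact k / s ^ k * exp (s * \<bar>shift_sq \<xi>\<bar>)"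
      using s by (simp add: power_mult_distrib field_simps)
    then have "\<bar>shift_sq \<xi>\<bar> ^ k * norm (H \<xi>) \<le> fact k / s ^ k * exp (s * \<bar>shift_sq \<xi>\<bar>) * norm (H \<xi>)"
      by (rule mult_right_mono) simp
    then show ?thesis by (simp add: norm_mult norm_power mult.assoc flip: of_real_power of_real_diff power_abs)
  qed
  have i': "integrable lborel (\<lambda>\<xi>. fact k / s ^ k * (exp (s * \<bar>shift_sq \<xi>\<bar>) * norm (H \<xi>)))"
    by (intro integrable_mult_right i)
  show i1: "integrable lborel (\<lambda>\<xi>. complex_of_real (shift_sq \<xi> ^ k) * H \<xi>)"
    by (rule integrable_dominated[OF i' _ b]) simp
  show "(LINT \<xi>|lborel. norm (complex_of_real (shift_sq \<xi> ^ k) * H \<xi>)) \<le> fact k / s ^ k * (LINT \<xi>|lborel. exp (s * \<bar>shift_sq \<xi>\<bar>) * norm (H \<xi>))"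
    unfolding integral_mult_right_zero[symmetric] by (intro integral_mono b i' integrable_norm i1)
qed

lemma integrable_cis_mult:
  fixes H :: "'a::euclidean_space \<Rightarrow> complex"
  assumes "integrable lborel H"
  shows "integrable lborel (\<lambda>\<xi>. cis (- (\<xi> \<bullet> x)) * H \<xi>)"
    "integrable lborel (\<lambda>\<xi>. cis (\<xi> \<bullet> x) * H \<xi>)"
    "integrable lborel (\<lambda>\<xi>. cis (x \<bullet> \<xi>) * H \<xi>)"
proof -
  have [measurable]: "H \<in> borel_measurable borel" using assms by auto
  show "integrable lborel (\<lambda>\<xi>. cis (- (\<xi> \<bullet> x)) * H \<xi>)"
    "integrable lborel (\<lambda>\<xi>. cis (\<xi> \<bullet> x) * H \<xi>)"
    "integrable lborel (\<lambda>\<xi>. cis (x \<bullet> \<xi>) * H \<xi>)"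
    by (rule Bochner_Integration.integrable_bound[OF assms]; simp add: norm_mult)+
qed

text \<open>The series and the Fourier integral are exchanged by dominated summation; the
  summability hypothesis on \<open>d\<close> weighs each coefficient by exactly the price of its
  moment in \<open>fourier_moments\<close>.\<close>

lemma fourier_suminf:
  fixes H :: "'a::euclidean_space \<Rightarrow> complex"
  assumes [measurable]: "H \<in> borel_measurable borel" and s: "s > 0"
    and i: "integrable lborel (\<lambda>\<xi>. exp (s * \<bar>shift_sq \<xi>\<bar>) * norm (H \<xi>))"
    and d: "summable (\<lambda>k. \<bar>d k\<bar> * fact k / s ^ k)"
    and D: "\<And>\<xi>. (\<lambda>k. d k * shift_sq \<xi> ^ k) sums D \<xi>"
  shows "(\<lambda>k. complex_of_real (d k) * fourier (\<lambda>\<xi>. complex_of_real (shift_sq \<xi> ^ k) * H \<xi>) x) sums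
    fourier (\<lambda>\<xi>. complex_of_real (D \<xi>) * H \<xi>) x"
proof -
  let ?f = "\<lambda>k \<xi>. cis (- (\<xi> \<bullet> x)) * (complex_of_real (d k) * (complex_of_real (shift_sq \<xi> ^ k) * H \<xi>))"
  let ?I = "LINT \<xi>|lborel. exp (s * \<bar>shift_sq \<xi>\<bar>) * norm (H \<xi>)"
  have nf: "norm (?f k \<xi>) = \<bar>d k\<bar> * norm (complex_of_real (shift_sq \<xi> ^ k) * H \<xi>)" for k \<xi>
    by (simp add: norm_mult)
  have abs: "summable (\<lambda>k. \<bar>d k\<bar> * \<bar>shift_sq \<xi>\<bar> ^ k)" for \<xi> :: 'a
  proof (rule summable_comparison_test'[of "\<lambda>k. exp (s * \<bar>shift_sq \<xi>\<bar>) * (\<bar>d k\<bar> * fact k / s ^ k)" 0])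
    fix k
    have "(s * \<bar>shift_sq \<xi>\<bar>) ^ k \<le> fact k * exp (s * \<bar>shift_sq \<xi>\<bar>)"
      using s by (intro power_le_fact_mult_exp) auto
    then have "\<bar>shift_sq \<xi>\<bar> ^ k \<le> exp (s * \<bar>shift_sq \<xi>\<bar>) * (fact k / s ^ k)"
      using s by (simp add: power_mult_distrib field_simps)
    then have "\<bar>d k\<bar> * \<bar>shift_sq \<xi>\<bar> ^ k \<le> \<bar>d k\<bar> * (exp (s * \<bar>shift_sq \<xi>\<bar>) * (fact k / s ^ k))"
      by (rule mult_left_mono) simp
    then show "norm (\<bar>d k\<bar> * \<bar>shift_sq \<xi>\<bar> ^ k) \<le> exp (s * \<bar>shift_sq \<xi>\<bar>) * (\<bar>d k\<bar> * fact k / s ^ k)"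
      by (simp add: mult_ac)
  qed (intro summable_mult d)
  have S: "(\<lambda>k. ?f k \<xi>) sums (cis (- (\<xi> \<bullet> x)) * (complex_of_real (D \<xi>) * H \<xi>))" for \<xi>
    using sums_mult[OF sums_mult2[OF sums_of_real[OF D[of \<xi>]], of "H \<xi>"], of "cis (- (\<xi> \<bullet> x))"]
    by (simp add: mult.assoc)
  have "(\<lambda>k. integral\<^sup>L lborel (?f k)) sums (LINT \<xi>|lborel. (\<Sum>k. ?f k \<xi>))"
  proof (rule sums_integral)
    show "integrable lborel (?f k)" for k
      by (intro integrable_cis_mult integrable_mult_right fourier_moments(1)[OF _ s i]) simp
    show "AE \<xi> in lborel. summable (\<lambda>k. norm (?f k \<xi>))"
    proof (rule AE_I2)
      fix \<xi> show "summable (\<lambda>k. norm (?f k \<xi>))"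
        using summable_mult2[OF abs[of \<xi>], of "norm (H \<xi>)"]
        by (simp add: norm_mult norm_power mult.assoc flip: of_real_power of_real_diff power_abs)
    qed
    show "summable (\<lambda>k. LINT \<xi>|lborel. norm (?f k \<xi>))"
    proof (rule summable_comparison_test'[of "\<lambda>k. (\<bar>d k\<bar> * fact k / s ^ k) * ?I" 0])
      fix k
      have "(LINT \<xi>|lborel. norm (?f k \<xi>)) = \<bar>d k\<bar> * (LINT \<xi>|lborel. norm (complex_of_real (shift_sq \<xi> ^ k) * H \<xi>))"
        unfolding nf by simp
      also have "\<dots> \<le> \<bar>d k\<bar> * (fact k / s ^ k * ?I)"
        by (intro mult_left_mono fourier_moments(2)[OF _ s i]) auto
      finally show "norm (LINT \<xi>|lborel. norm (?f k \<xi>)) \<le> (\<bar>d k\<bar> * fact k / s ^ k) * ?I" by simp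
    qed (intro summable_mult2 d)
  qed
  also have "(LINT \<xi>|lborel. (\<Sum>k. ?f k \<xi>)) = (LINT \<xi>|lborel. cis (- (\<xi> \<bullet> x)) * (complex_of_real (D \<xi>) * H \<xi>))"
    by (intro Bochner_Integration.integral_cong refl sums_unique[symmetric] S)
  finally have "(\<lambda>k. complex_of_real (d k) * (LINT \<xi>|lborel. cis (- (\<xi> \<bullet> x)) * (complex_of_real (shift_sq \<xi> ^ k) * H \<xi>))) sums
      (LINT \<xi>|lborel. cis (- (\<xi> \<bullet> x)) * (complex_of_real (D \<xi>) * H \<xi>))"
    by (simp only: mult.left_commute[of "cis _" "complex_of_real (d _)"] integral_mult_right_zero)
  from sums_mult[OF this, of "complex_of_real ((2 * pi) powr (- real DIM('a) / 2))"]
  show ?thesis unfolding fourier_def by (simp only: mult.left_commute[of "complex_of_real (d _)"])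
qed

section \<open>Moments of the Gaussian and their generating function\<close>

lemma fourier_cmult: "fourier (\<lambda>\<xi>. c * f \<xi>) x = c * fourier f x"
  unfolding fourier_def by (simp only: mult.left_commute[of _ c] integral_mult_right_zero)

lemma fourier_add:
  assumes "integrable lborel f" "integrable lborel g"
  shows "fourier (\<lambda>\<xi>. f \<xi> + g \<xi>) x = fourier f x + fourier g x"
  unfolding fourier_def
  by (simp add: distrib_left inner_commute integrable_cis_mult assms)

text \<open>The inverse Fourier transform of \<open>gauss (1 / R)\<close>.\<close>

definition gauss_hat :: "real \<Rightarrow> 'a::euclidean_space \<Rightarrow> real" where
  "gauss_hat R \<xi> = (R / 2) powr (DIM('a) / 2) * gauss (R / 4) \<xi>"

lemma gauss_hat_measurable [measurable]: "gauss_hat R \<in> borel_measurable borel"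
  unfolding gauss_hat_def by measurable

lemma gauss_hat_nonneg [simp]: "gauss_hat R \<xi> \<ge> 0"
  by (simp add: gauss_hat_def)

lemma inv_fourier_gauss_hat:
  assumes "R > 0"
  shows "inv_fourier (\<lambda>x. complex_of_real (gauss (1 / R) x)) = (\<lambda>\<xi>. complex_of_real (gauss_hat R \<xi>))"
proof
  fix \<xi> :: 'a
  have "(2 * (1 / R)) powr (- DIM('a) / 2) = (R / 2) powr (DIM('a) / 2)"
    using assms by (simp add: powr_divide powr_minus field_simps)
  then show "inv_fourier (\<lambda>x. complex_of_real (gauss (1 / R) x)) \<xi> = complex_of_real (gauss_hat R \<xi>)"
    using assms by (subst inv_fourier_gauss) (simp_all add: gauss_hat_def)
qed

text \<open>The Gaussian rate \<open>R / 4\<close> of \<open>gauss_hat\<close> limits the admissible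
  exponential moments; it reappears as the radius of the disc on which the generating function of
  the moments converges.\<close>

lemma integrable_exp_gauss_hat:
  assumes "0 < s" "s < R / 4"
  shows "integrable lborel (\<lambda>\<xi>::'a::euclidean_space. exp (s * \<bar>shift_sq \<xi>\<bar>) * norm (complex_of_real (gauss_hat R \<xi>)))"
proof (rule integrable_dominated)
  show "integrable lborel (\<lambda>\<xi>::'a. (exp (s / 4) * (R / 2) powr (DIM('a) / 2)) * gauss (R / 4 - s) \<xi>)"
    using assms by (intro integrable_mult_right integrable_gauss) auto
  fix \<xi> :: 'a
  have "\<bar>shift_sq \<xi>\<bar> \<le> 1 / 4 + (norm \<xi>)\<^sup>2" by (simp add: abs_le_iff)
  then have "exp (s * \<bar>shift_sq \<xi>\<bar>) \<le> exp (s * (1 / 4 + (norm \<xi>)\<^sup>2))"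
    using assms by simp
  then have "exp (s * \<bar>shift_sq \<xi>\<bar>) * gauss_hat R \<xi> \<le> exp (s * (1 / 4 + (norm \<xi>)\<^sup>2)) * gauss_hat R \<xi>"
    by (rule mult_right_mono) simp
  also have "\<dots> = (exp (s / 4) * (R / 2) powr (DIM('a) / 2)) * gauss (R / 4 - s) \<xi>"
    by (simp add: gauss_hat_def gauss_def algebra_simps exp_add[symmetric])
  finally show "norm (exp (s * \<bar>shift_sq \<xi>\<bar>) * norm (complex_of_real (gauss_hat R \<xi>))) \<le> (exp (s / 4) * (R / 2) powr (DIM('a) / 2)) * gauss (R / 4 - s) \<xi>"
    by simp
qed measurable

text \<open>This is \<open>(- \<Delta> - 1/4)^k\<close> applied to \<open>gauss (1 / R)\<close>,
  written on the Fourier side.\<close>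

definition mom :: "real \<Rightarrow> nat \<Rightarrow> 'a::euclidean_space \<Rightarrow> complex" where
  "mom R k = fourier (\<lambda>\<xi>. complex_of_real (shift_sq \<xi> ^ k) * complex_of_real (gauss_hat R \<xi>))"

text \<open>The weights \<open>(- s) ^ k / fact k\<close> sum to the multiplier
  \<open>exp (- s * (|\<xi>|^2 - 1/4))\<close>, which is the heat flow for time \<open>s\<close>
  times \<open>exp (s / 4)\<close>. It sends a Gaussian to a Gaussian with \<open>R + 4 * s\<close>
  in place of \<open>R\<close>, for negative \<open>s\<close> too as long as the width stays
  positive.\<close>

lemma mom_genfun:
  fixes x :: "'a::euclidean_space"
  assumes s: "\<bar>s\<bar> < R / 4"
  shows "(\<lambda>k. complex_of_real ((- s) ^ k / fact k) * mom R k x) sums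
    complex_of_real (exp (s / 4) * (1 + 4 * s / R) powr (- DIM('a) / 2) * gauss (1 / (R + 4 * s)) x)"
proof -
  \<comment> \<open>With an exponential moment of a rate \<open>s'\<close> strictly between
    \<open>|s|\<close> and \<open>R / 4\<close> the dominating series is geometric of ratio
    \<open>|s| / s'\<close>.\<close>
  obtain s' where s': "\<bar>s\<bar> < s'" "s' < R / 4" using s dense by blast
  then have s'0: "0 < s'" and R: "R > 0" "R + 4 * s > 0" using s by auto
  have "(\<lambda>k. complex_of_real ((- s) ^ k / fact k) * mom R k x) sums
     fourier (\<lambda>\<xi>. complex_of_real (exp (- s * shift_sq \<xi>)) * complex_of_real (gauss_hat R \<xi>)) x"
    unfolding mom_def
  proof (rule fourier_suminf[OF _ s'0 integrable_exp_gauss_hat[OF s'0 s'(2)]])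
    have eq: "\<bar>(- s) ^ k / fact k\<bar> * fact k / s' ^ k = (\<bar>s\<bar> / s') ^ k" for k
      by (simp add: power_abs power_divide)
    show "summable (\<lambda>k. \<bar>(- s) ^ k / fact k\<bar> * fact k / s' ^ k)"
      unfolding eq by (rule summable_geometric) (use s' s'0 in simp)
    show "(\<lambda>k. (- s) ^ k / fact k * shift_sq \<xi> ^ k) sums exp (- s * shift_sq \<xi>)" for \<xi> :: 'a
    proof -
      have "(\<lambda>k. (- s) ^ k / fact k * shift_sq \<xi> ^ k) = (\<lambda>k. (- s * shift_sq \<xi>) ^ k /\<^sub>R fact k)"
        unfolding power_mult_distrib real_scaleR_def divide_inverse by (simp only: mult_ac)
      then show ?thesis using exp_converges[of "- s * shift_sq \<xi>"] by (simp only:)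
    qed
  qed simp
  also have "(\<lambda>\<xi>::'a. complex_of_real (exp (- s * shift_sq \<xi>)) * complex_of_real (gauss_hat R \<xi>)) =
      (\<lambda>\<xi>. complex_of_real (exp (s / 4) * (R / 2) powr (DIM('a) / 2)) * complex_of_real (gauss (R / 4 + s) \<xi>))"
  proof
    fix \<xi> :: 'a
    have "exp (- s * shift_sq \<xi>) * gauss (R / 4) \<xi> = exp (s / 4) * gauss (R / 4 + s) \<xi>"
      unfolding gauss_def exp_add[symmetric] by (simp add: algebra_simps)
    then have "exp (- s * shift_sq \<xi>) * gauss_hat R \<xi> = exp (s / 4) * (R / 2) powr (DIM('a) / 2) * gauss (R / 4 + s) \<xi>"
      by (simp add: gauss_hat_def)
    then show "complex_of_real (exp (- s * shift_sq \<xi>)) * complex_of_real (gauss_hat R \<xi>) =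
      complex_of_real (exp (s / 4) * (R / 2) powr (DIM('a) / 2)) * complex_of_real (gauss (R / 4 + s) \<xi>)"
      by (simp only: of_real_mult[symmetric])
  qed
  also have "fourier \<dots> x = complex_of_real (exp (s / 4) * (R / 2) powr (DIM('a) / 2)) *
      complex_of_real ((2 * (R / 4 + s)) powr (- DIM('a) / 2) * gauss (1 / (4 * (R / 4 + s))) x)"
    using R by (simp only: fourier_cmult) (subst fourier_gauss, auto)
  also have "\<dots> = complex_of_real (exp (s / 4) * ((R / 2) powr (DIM('a) / 2) * (2 * (R / 4 + s)) powr (- DIM('a) / 2)) * gauss (1 / (4 * (R / 4 + s))) x)"
    by (simp add: mult.assoc)
  also have "(R / 2) powr (DIM('a) / 2) * (2 * (R / 4 + s)) powr (- DIM('a) / 2) = (1 + 4 * s / R) powr (- DIM('a) / 2)"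
  proof -
    have "2 * (R / 4 + s) = (R / 2) * (1 + 4 * s / R)" using R by (simp add: field_simps)
    moreover have "1 + 4 * s / R > 0" using R by (simp add: field_simps)
    ultimately have "(2 * (R / 4 + s)) powr (- DIM('a) / 2) = (R / 2) powr (- DIM('a) / 2) * (1 + 4 * s / R) powr (- DIM('a) / 2)"
      using R by (simp only: powr_mult)
    moreover have "(R / 2) powr (DIM('a) / 2) * (R / 2) powr (- DIM('a) / 2) = 1"
      using R by (simp add: powr_add[symmetric] del: powr_divide)
    ultimately show ?thesis by simp
  qed
  also have "4 * (R / 4 + s) = R + 4 * s" by simp
  finally show ?thesis .
qed

text \<open>Inversion maps the disc with diameter from 0 to \<open>R + 1\<close> onto the half plane
  \<open>Re \<ge> 1 / (R + 1)\<close>; the unit circle around \<open>R\<close> lies in that disc,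
  which is the inequality \<open>|w|^2 \<le> Re w * (R + 1)\<close> in the proof.\<close>

lemma Re_inverse_ge:
  fixes w :: complex and R :: real
  assumes "R > 1" "norm (w - R) = 1"
  shows "1 / (R + 1) \<le> Re (1 / w)" "norm w \<ge> R - 1"
proof -
  define u where "u = w - complex_of_real R"
  have w: "w = complex_of_real R + u" and u: "norm u = 1" using assms by (auto simp: u_def)
  have u2: "(Re u)\<^sup>2 + (Im u)\<^sup>2 = 1" using u by (simp add: cmod_def)
  have "Re u \<le> 1" using complex_Re_le_cmod[of u] u by simp
  then have "0 \<le> (R - 1) * (1 - Re u)" using assms by simp
  moreover have "(norm w)\<^sup>2 = (R + Re u)\<^sup>2 + (Im u)\<^sup>2" by (simp add: cmod_power2 w)
  moreover have "Re w = R + Re u" by (simp add: w)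
  ultimately have "(norm w)\<^sup>2 \<le> Re w * (R + 1)"
    using u2 by (simp add: power2_eq_square algebra_simps)
  moreover have n: "norm w \<ge> R - 1"
    using norm_triangle_ineq4[of w u] u assms by (simp add: w)
  moreover have "Re (1 / w) = Re w / (norm w)\<^sup>2" by (simp add: Re_divide cmod_power2)
  moreover have "norm w > 0" using n assms by linarith
  then have "(norm w)\<^sup>2 > 0" by simp
  moreover have "1 / b \<le> r / N" if "N \<le> r * b" "N > 0" "b > 0" for b r N :: real
    using that by (simp add: field_simps)
  ultimately show "1 / (R + 1) \<le> Re (1 / w)"
    using assms by simp
  show "norm w \<ge> R - 1" by (rule n)
qed

text \<open>The maximum on the circle \<open>|z| = 1/4\<close> of the factors of the generating
  function other than the Gaussian: \<open>exp (1 / 16)\<close> bounds \<open>exp (z / 4)\<close>,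
  and the power of 2 comes from \<open>|1 + 4 z / R| \<ge> 1/2\<close> for
  \<open>R \<ge> 2\<close>.\<close>

definition mom_const :: "nat \<Rightarrow> real" where
  "mom_const n = exp (1 / 16) * 2 powr (n / 2)"

text \<open>The generating function of the moments extends to a disc of radius \<open>R / 4 > 1 / 4\<close>, and Cauchy's
  inequality on the circle of radius \<open>1 / 4\<close> only costs an enlargement of the width \<open>R\<close> by \<open>1\<close>.\<close>
lemma mom_bound:
  fixes x :: "'a::euclidean_space"
  assumes R: "R \<ge> 2"
  shows "norm (mom R k x) \<le> mom_const DIM('a) * gauss (1 / (R + 1)) x * fact k * 4 ^ k"
proof -
  \<comment> \<open>The sign is moved into the coefficient so that \<open>mom_genfun\<close>, stated
    in \<open>- s\<close>, becomes a power series in \<open>z = s\<close>.\<close>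
  define a where "a k = (- 1) ^ k / fact k * mom R k x" for k
  define \<Phi> where "\<Phi> z = exp (z / 4) * exp (- of_real (DIM('a) / 2) * Ln (1 + 4 * z / of_real R)) * exp (- of_real ((norm x)\<^sup>2) / (of_real R + 4 * z))" for z :: complex
  define A where "A z = (\<Sum>k. a k * z ^ k)" for z
  have sums_real: "(\<lambda>k. a k * complex_of_real s ^ k) sums \<Phi> (complex_of_real s)" if s: "\<bar>s\<bar> < R / 4" for s
  proof -
    have pos: "R + 4 * s > 0" "1 + 4 * s / R > 0" using s R by (auto simp: field_simps)
    have "(\<lambda>k. a k * complex_of_real s ^ k) = (\<lambda>k. complex_of_real ((- s) ^ k / fact k) * mom R k x)"
      by (simp add: a_def power_minus[of s] fun_eq_iff)
    moreover have "\<Phi> (complex_of_real s) = complex_of_real (exp (s / 4) * (1 + 4 * s / R) powr (- DIM('a) / 2) * gauss (1 / (R + 4 * s)) x)"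
    proof -
      have "Ln (1 + 4 * complex_of_real s / of_real R) = complex_of_real (ln (1 + 4 * s / R))"
        using Ln_of_real[OF pos(2)] by simp
      then show ?thesis
        using pos unfolding \<Phi>_def gauss_def powr_def by (simp add: exp_of_real[symmetric])
    qed
    ultimately show ?thesis using mom_genfun[OF s, of x] by simp
  qed
  \<comment> \<open>Convergence at a real point of larger modulus gives convergence at every complex
    point of the disc.\<close>
  have sums_A: "(\<lambda>k. a k * z ^ k) sums A z" if z: "z \<in> ball 0 (R / 4)" for z
  proof -
    obtain s where s: "norm z < s" "s < R / 4" using z dense[of "norm z" "R / 4"] by auto
    have "summable (\<lambda>k. a k * complex_of_real s ^ k)"
      using sums_real[of s] s norm_ge_zero[of z] by (intro sums_summable[of _ "\<Phi> (complex_of_real s)"]) auto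
    then have "summable (\<lambda>k. a k * z ^ k)"
      by (rule powser_inside) (use s in auto)
    then show ?thesis by (simp add: A_def summable_sums)
  qed
  have half: "Re (1 + 4 * z / of_real R) > 0" if z: "z \<in> ball 0 (R / 4)" for z :: complex
  proof -
    have "\<bar>Re z\<bar> < R / 4" using z abs_Re_le_cmod[of z] by (auto simp: dist_norm)
    then show ?thesis using R by (auto simp: field_simps)
  qed
  have half': "1 + 4 * z / of_real R \<notin> \<real>\<^sub>\<le>\<^sub>0" if z: "z \<in> ball 0 (R / 4)" for z :: complex
    using half[OF z] by (auto simp: complex_nonpos_Reals_iff)
  have nz: "of_real R + 4 * z \<noteq> 0" if z: "z \<in> ball 0 (R / 4)" for z :: complex
  proof
    assume "of_real R + 4 * z = 0"
    then have "1 + 4 * z / of_real R = 0" using R by (simp add: field_simps)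
    then show False using half[OF z] by simp
  qed
  \<comment> \<open>Identity theorem: the power series and the closed form agree on a real segment
    that accumulates at 0, hence on the whole disc.\<close>
  have eq: "A z - \<Phi> z = 0" if z: "z \<in> ball 0 (R / 4)" for z
  proof (rule analytic_continuation[of "\<lambda>z. A z - \<Phi> z" "ball 0 (R / 4)" "complex_of_real ` {0<..<R / 4}" 0])
    have "A holomorphic_on ball 0 (R / 4)"
      using power_series_holomorphic[of 0 "R / 4" a A] sums_A by simp
    moreover have "\<Phi> holomorphic_on ball 0 (R / 4)"
      unfolding \<Phi>_def using R by (intro holomorphic_intros half' nz) auto
    ultimately show "(\<lambda>z. A z - \<Phi> z) holomorphic_on ball 0 (R / 4)" by (rule holomorphic_on_diff)
    show "(0::complex) islimpt complex_of_real ` {0<..<R / 4}"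
      unfolding islimpt_approachable
    proof (intro allI impI)
      fix e :: real assume e: "e > 0"
      define s where "s = min (e / 2) (R / 8)"
      have "0 < s" "s < R / 4" "s < e" using e R by (auto simp: s_def)
      then show "\<exists>x'\<in>complex_of_real ` {0<..<R / 4}. x' \<noteq> 0 \<and> dist x' 0 < e"
        by (intro bexI[of _ "complex_of_real s"]) auto
    qed
    fix w assume "w \<in> complex_of_real ` {0<..<R / 4}"
    then obtain s where s: "w = complex_of_real s" "0 < s" "s < R / 4" by auto
    then show "A w - \<Phi> w = 0"
      using sums_unique2[OF sums_A[of w] sums_real[of s, folded s(1)]] by auto
  qed (use z R in auto)
  have "norm (a k) \<le> (mom_const DIM('a) * gauss (1 / (R + 1)) x) / (1 / 4) ^ k"
  proof (rule power_series_coeff_bound)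
    show "(\<lambda>n. a n * z ^ n) sums A z" if "z \<in> ball 0 (R / 4)" for z
      by (rule sums_A[OF that])
    fix z :: complex assume z: "norm z = 1 / 4"
    then have zb: "z \<in> ball 0 (R / 4)" using R by auto
    \<comment> \<open>For \<open>|z| = 1/4\<close> the point \<open>R + 4 * z\<close> runs through
      the unit circle around \<open>R\<close>; this is where \<open>R\<close> turns into
      \<open>R + 1\<close> in the Gaussian.\<close>
    have w: "1 / (R + 1) \<le> Re (1 / (of_real R + 4 * z))" "norm (of_real R + 4 * z) \<ge> R - 1"
      using Re_inverse_ge[of R "of_real R + 4 * z"] R z by (auto simp: norm_mult)
    have 1: "norm (exp (z / 4)) \<le> exp (1 / 16)"
      using complex_Re_le_cmod[of "z / 4"] z by simp
    have h: "1 / 2 \<le> norm (1 + 4 * z / of_real R)"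
    proof -
      have "1 + 4 * z / of_real R = (of_real R + 4 * z) / of_real R" using R by (simp add: field_simps)
      then have "norm (1 + 4 * z / of_real R) = norm (of_real R + 4 * z) / R" using R by (simp add: norm_divide)
      also have "\<dots> \<ge> (R - 1) / R" using w R by (intro divide_right_mono) auto
      also have "(R - 1) / R \<ge> 1 / 2" using R by (simp add: field_simps)
      finally show ?thesis by simp
    qed
    have "1 + 4 * z / of_real R \<noteq> 0" using h by auto
    moreover have "ln (1 / 2) \<le> ln (norm (1 + 4 * z / of_real R))" using h by (subst ln_le_cancel_iff) auto
    ultimately have "ln (1 / 2) \<le> Re (Ln (1 + 4 * z / of_real R))" by simp
    then have "real DIM('a) / 2 * ln (1 / 2) \<le> real DIM('a) / 2 * Re (Ln (1 + 4 * z / of_real R))"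
      by (intro mult_left_mono) auto
    then have 2: "norm (exp (- of_real (DIM('a) / 2) * Ln (1 + 4 * z / of_real R))) \<le> 2 powr (DIM('a) / 2)"
      by (simp add: powr_def ln_div)
    have "(norm x)\<^sup>2 * (1 / (R + 1)) \<le> (norm x)\<^sup>2 * Re (1 / (of_real R + 4 * z))"
      by (intro mult_left_mono w) auto
    also have "\<dots> = Re (of_real ((norm x)\<^sup>2) / (of_real R + 4 * z))"
      by (simp add: Re_divide del: Re_divide_of_real)
    finally have 3: "norm (exp (- of_real ((norm x)\<^sup>2) / (of_real R + 4 * z))) \<le> gauss (1 / (R + 1)) x"
      by (simp add: gauss_def)
    have "norm (A z) = norm (\<Phi> z)" using eq[OF zb] by simp
    also have "\<dots> \<le> exp (1 / 16) * 2 powr (DIM('a) / 2) * gauss (1 / (R + 1)) x"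
      unfolding \<Phi>_def norm_mult by (intro mult_mono 1 2 3) auto
    finally show "norm (A z) \<le> mom_const DIM('a) * gauss (1 / (R + 1)) x" by (simp add: mom_const_def)
  qed (use R in auto)
  moreover have "norm (mom R k x) = fact k * norm (a k)"
    by (simp add: a_def norm_mult norm_divide norm_power)
  ultimately show ?thesis by (simp add: power_divide field_simps)
qed

subsection \<open>The damped wave propagator on Gaussians\<close>

text \<open>Moments grow like \<open>k!\<close> and the sine series divides by
  \<open>(2 k + 1)!\<close>; since \<open>k! j!\<close> divides \<open>(k + j)!\<close>, a
  convergent \<open>1 / k!\<close> is left. The second form keeps \<open>1 / k!\<close> for the
  series without its first term.\<close>

lemma fact_ratio_bounds:
  "fact k / fact (2 * k + 1) \<le> (1 / fact k :: real)"
  "fact (Suc k) / fact (2 * Suc k + 1) \<le> (1 / fact k :: real)"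
proof -
  have 1: "fact k * fact k \<le> (fact (2 * k + 1) :: nat)"
  proof -
    have "fact k * fact k \<le> (fact (k + k) :: nat)"
      using dvd_imp_le[OF fact_fact_dvd_fact[of k k, where 'a = nat]] by simp
    also have "\<dots> \<le> fact (2 * k + 1)" by (intro fact_mono_nat) auto
    finally show ?thesis .
  qed
  have 2: "fact (Suc k) * fact k \<le> (fact (2 * Suc k + 1) :: nat)"
  proof -
    have "fact (Suc k) * fact k \<le> (fact (Suc k + k) :: nat)"
      using dvd_imp_le[OF fact_fact_dvd_fact[of "Suc k" k, where 'a = nat]] by simp
    also have "\<dots> \<le> fact (2 * Suc k + 1)" by (intro fact_mono_nat) auto
    finally show ?thesis .
  qed
  have "real (fact k * fact k) \<le> real (fact (2 * k + 1))" using 1 by (rule of_nat_mono)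
  then show "fact k / fact (2 * k + 1) \<le> (1 / fact k :: real)"
    by (simp add: divide_simps del: fact_Suc)
  have "real (fact (Suc k) * fact k) \<le> real (fact (2 * Suc k + 1))" using 2 by (rule of_nat_mono)
  then show "fact (Suc k) / fact (2 * Suc k + 1) \<le> (1 / fact k :: real)"
    by (simp add: divide_simps del: fact_Suc)
qed

text \<open>For \<open>a k = y ^ k\<close> this is \<open>sin (z * sqrt y) / sqrt y\<close>, and
  \<open>cos_ser\<close> below is \<open>cos (z * sqrt y)\<close>. Powers of \<open>y\<close> are
  replaced by an arbitrary sequence so that moments can be inserted.\<close>

definition sin_ser :: "(nat \<Rightarrow> complex) \<Rightarrow> complex \<Rightarrow> complex" where
  "sin_ser a z = (\<Sum>k. (- 1) ^ k * z ^ (2 * k + 1) / fact (2 * k + 1) * a k)"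

definition cos_ser :: "(nat \<Rightarrow> complex) \<Rightarrow> complex \<Rightarrow> complex" where
  "cos_ser a z = (\<Sum>k. (- 1) ^ k * z ^ (2 * k) / fact (2 * k) * a k)"

text \<open>The growth supplied by \<open>mom_bound\<close>. The dependence on the point sits
  entirely in \<open>B\<close>, while \<open>q\<close> governs the growth in time.\<close>

definition fact_growth :: "real \<Rightarrow> real \<Rightarrow> (nat \<Rightarrow> complex) \<Rightarrow> bool" where
  "fact_growth B q a \<longleftrightarrow> B \<ge> 0 \<and> q > 0 \<and> (\<forall>k. norm (a k) \<le> B * fact k * q ^ k)"

text \<open>The extra factor \<open>k + 1\<close> of a shifted factorial is absorbed by
  \<open>2 ^ k\<close>, which doubles \<open>q\<close>.\<close>

lemma fact_growth_shift:
  assumes "fact_growth B q a"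
  shows "fact_growth (B * q) (2 * q) (\<lambda>k. - a (Suc k))"
  unfolding fact_growth_def
proof (intro conjI allI)
  fix k
  have q: "q > 0" "B \<ge> 0" "norm (a (Suc k)) \<le> B * fact (Suc k) * q ^ Suc k"
    using assms by (auto simp: fact_growth_def simp del: fact_Suc power_Suc)
  have "Suc k \<le> 2 ^ k" by (rule Suc_leI) simp
  then have "real (Suc k) \<le> 2 ^ k" by (metis of_nat_le_iff of_nat_numeral of_nat_power)
  then have "real (Suc k) * (B * fact k * q ^ Suc k) \<le> 2 ^ k * (B * fact k * q ^ Suc k)"
    using q by (intro mult_right_mono) auto
  then show "norm (- a (Suc k)) \<le> B * q * fact k * (2 * q) ^ k"
    using q(3) by (simp add: power_mult_distrib algebra_simps)
qed (use assms in \<open>auto simp: fact_growth_def\<close>)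

text \<open>The second bound concerns the series from its second term on and carries an additional
  factor \<open>q * |z|^2\<close>, the source of smallness at short times.\<close>

lemma fact_growth_term:
  assumes "fact_growth B q a"
  shows "norm ((- 1) ^ k * z ^ (2 * k + 1) / fact (2 * k + 1) * a k) \<le> B * norm z * ((q * (norm z)\<^sup>2) ^ k / fact k)"
    and "norm ((- 1) ^ Suc k * z ^ (2 * Suc k + 1) / fact (2 * Suc k + 1) * a (Suc k)) \<le>
      B * norm z * (q * (norm z)\<^sup>2) * ((q * (norm z)\<^sup>2) ^ k / fact k)"
proof -
  have q: "q > 0" "B \<ge> 0" "norm (a k) \<le> B * fact k * q ^ k" for k
    using assms by (auto simp: fact_growth_def)
  have *: "norm ((- 1) ^ k * z ^ (2 * k + 1) / fact (2 * k + 1) * a k) \<le> B * norm z * (q * (norm z)\<^sup>2) ^ k * (fact k / fact (2 * k + 1))" for k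
  proof -
    have "norm ((- 1) ^ k * z ^ (2 * k + 1) / fact (2 * k + 1) * a k) = norm z ^ (2 * k + 1) / fact (2 * k + 1) * norm (a k)"
      by (simp add: norm_mult norm_divide norm_power del: fact_Suc)
    also have "\<dots> \<le> norm z ^ (2 * k + 1) / fact (2 * k + 1) * (B * fact k * q ^ k)"
      by (intro mult_left_mono q) auto
    also have "\<dots> = B * norm z * (q * (norm z)\<^sup>2) ^ k * (fact k / fact (2 * k + 1))"
      by (simp add: power_mult_distrib power_mult[symmetric] del: fact_Suc)
    finally show ?thesis .
  qed
  have "B * norm z * (q * (norm z)\<^sup>2) ^ k * (fact k / fact (2 * k + 1)) \<le> B * norm z * (q * (norm z)\<^sup>2) ^ k * (1 / fact k)"
    using q by (intro mult_left_mono fact_ratio_bounds) auto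
  with *[of k] show "norm ((- 1) ^ k * z ^ (2 * k + 1) / fact (2 * k + 1) * a k) \<le> B * norm z * ((q * (norm z)\<^sup>2) ^ k / fact k)"
    by (simp del: fact_Suc)
  have "B * norm z * (q * (norm z)\<^sup>2) ^ Suc k * (fact (Suc k) / fact (2 * Suc k + 1)) \<le> B * norm z * (q * (norm z)\<^sup>2) ^ Suc k * (1 / fact k)"
    using q by (intro mult_left_mono fact_ratio_bounds) auto
  with *[of "Suc k"] show "norm ((- 1) ^ Suc k * z ^ (2 * Suc k + 1) / fact (2 * Suc k + 1) * a (Suc k)) \<le>
      B * norm z * (q * (norm z)\<^sup>2) * ((q * (norm z)\<^sup>2) ^ k / fact k)"
    by (simp add: mult.assoc del: fact_Suc)
qed

lemma summable_exp_div: "summable (\<lambda>k. (x::real) ^ k / fact k)"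
  using summable_exp[of x] by (simp add: divide_inverse mult.commute)

lemma suminf_exp_div: "(\<Sum>k. (x::real) ^ k / fact k) = exp x"
  by (simp add: exp_def divide_inverse mult.commute)

lemma sin_ser_summable:
  assumes "fact_growth B q a"
  shows "summable (\<lambda>k. norm ((- 1) ^ k * z ^ (2 * k + 1) / fact (2 * k + 1) * a k))"
proof (rule summable_comparison_test')
  show "summable (\<lambda>k. B * norm z * ((q * (norm z)\<^sup>2) ^ k / fact k))"
    by (intro summable_mult summable_exp_div)
  show "norm (norm ((- 1) ^ k * z ^ (2 * k + 1) / fact (2 * k + 1) * a k)) \<le> B * norm z * ((q * (norm z)\<^sup>2) ^ k / fact k)" for k
    unfolding real_norm_def abs_norm_cancel by (rule fact_growth_term(1)[OF assms])
qed

lemma sin_ser_sums: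
  assumes "fact_growth B q a"
  shows "(\<lambda>k. (- 1) ^ k * z ^ (2 * k + 1) / fact (2 * k + 1) * a k) sums sin_ser a z"
  unfolding sin_ser_def by (rule summable_sums[OF summable_norm_cancel[OF sin_ser_summable[OF assms]]])

lemma sin_ser_bound:
  assumes "fact_growth B q a"
  shows "norm (sin_ser a z) \<le> B * norm z * exp (q * (norm z)\<^sup>2)"
proof -
  have "norm (sin_ser a z) \<le> (\<Sum>k. norm ((- 1) ^ k * z ^ (2 * k + 1) / fact (2 * k + 1) * a k))"
    unfolding sin_ser_def by (rule summable_norm[OF sin_ser_summable[OF assms]])
  also have "\<dots> \<le> (\<Sum>k. B * norm z * ((q * (norm z)\<^sup>2) ^ k / fact k))"
    by (intro suminf_le fact_growth_term[OF assms] sin_ser_summable[OF assms] summable_mult summable_exp_div)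
  also have "\<dots> = B * norm z * exp (q * (norm z)\<^sup>2)"
    by (subst suminf_mult[OF summable_exp_div]) (simp add: suminf_exp_div)
  finally show ?thesis .
qed

text \<open>After removal of the leading term \<open>z * a 0\<close> the remainder is of third order
  in \<open>z\<close>.\<close>

lemma sin_ser_bound_first:
  assumes "fact_growth B q a"
  shows "norm (sin_ser a z - z * a 0) \<le> B * norm z * (q * (norm z)\<^sup>2) * exp (q * (norm z)\<^sup>2)"
proof -
  define f where "f k = (- 1) ^ k * z ^ (2 * k + 1) / fact (2 * k + 1) * a k" for k
  have sf: "summable (\<lambda>k. norm (f k))" unfolding f_def by (rule sin_ser_summable[OF assms])
  have s: "summable (\<lambda>k. norm (f (Suc k)))"
    by (subst summable_Suc_iff[of "\<lambda>k. norm (f k)"]) (rule sf)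
  have b: "norm (f (Suc k)) \<le> B * norm z * (q * (norm z)\<^sup>2) * ((q * (norm z)\<^sup>2) ^ k / fact k)" for k
    unfolding f_def by (rule fact_growth_term(2)[OF assms])
  have "sin_ser a z = (\<Sum>k. f k)" by (simp only: sin_ser_def f_def)
  also have "\<dots> = z * a 0 + (\<Sum>k. f (Suc k))"
    using suminf_split_head[OF summable_norm_cancel[OF sf]] by (simp add: f_def[of 0])
  finally have "sin_ser a z - z * a 0 = (\<Sum>k. f (Suc k))" by simp
  also have "norm \<dots> \<le> (\<Sum>k. norm (f (Suc k)))" by (rule summable_norm[OF s])
  also have "\<dots> \<le> (\<Sum>k. B * norm z * (q * (norm z)\<^sup>2) * ((q * (norm z)\<^sup>2) ^ k / fact k))"
    by (rule suminf_le[OF b s]) (rule summable_mult[OF summable_exp_div])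
  also have "\<dots> = B * norm z * (q * (norm z)\<^sup>2) * exp (q * (norm z)\<^sup>2)"
    by (subst suminf_mult[OF summable_exp_div]) (simp add: suminf_exp_div)
  finally show ?thesis .
qed

text \<open>In the model case \<open>a k = y ^ k\<close> these are the rules for
  \<open>sin (z * sqrt y) / sqrt y\<close> and its derivative \<open>cos (z * sqrt y)\<close>. The
  lacunary series are refilled with zero coefficients (\<open>sc\<close>, \<open>cc\<close>,
  \<open>sc'\<close>) so that termwise differentiation of power series applies.\<close>

lemma sin_cos_ser_derivative:
  assumes "fact_growth B q a"
  shows "(sin_ser a has_field_derivative cos_ser a z) (at z)"
    and "(cos_ser a has_field_derivative sin_ser (\<lambda>k. - a (Suc k)) z) (at z)"
proof -
  define sc :: "nat \<Rightarrow> complex" where "sc m = (if even m then 0 else (- 1) ^ (m div 2) * a (m div 2) / fact m)" for m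
  define cc :: "nat \<Rightarrow> complex" where "cc m = (if even m then (- 1) ^ (m div 2) * a (m div 2) / fact m else 0)" for m
  define sc' :: "nat \<Rightarrow> complex" where "sc' m = (if even m then 0 else (- 1) ^ (m div 2) * (- a (Suc (m div 2))) / fact m)" for m
  have odd: "n \<in> range (\<lambda>k. 2 * k + 1)" if "odd n" for n :: nat using that by (auto elim!: oddE)
  have even: "n \<in> range (\<lambda>k. 2 * k)" if "even n" for n :: nat using that by (auto elim!: evenE)
  have m1: "strict_mono (\<lambda>k::nat. 2 * k + 1)" and m2: "strict_mono (\<lambda>k::nat. 2 * k)" by (auto simp: strict_mono_def)
  have S: "(\<lambda>m. sc m * z ^ m) sums sin_ser a z" for z
    using sin_ser_sums[OF assms, of z] odd
    by (subst sums_mono_reindex[OF m1, symmetric]) (auto simp: sc_def mult_ac simp del: fact_Suc)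
  have S': "(\<lambda>m. sc' m * z ^ m) sums sin_ser (\<lambda>k. - a (Suc k)) z" for z
    using sin_ser_sums[OF fact_growth_shift[OF assms], of z] odd
    by (subst sums_mono_reindex[OF m1, symmetric]) (auto simp: sc'_def mult_ac simp del: fact_Suc)
  have d1: "diffs sc = cc"
  proof
    fix m show "diffs sc m = cc m"
      by (auto simp: diffs_def sc_def cc_def divide_simps simp del: of_nat_Suc)
  qed
  have d2: "diffs cc = sc'"
  proof
    fix m show "diffs cc m = sc' m"
      by (auto simp: diffs_def sc'_def cc_def divide_simps simp del: of_nat_Suc elim!: oddE)
  qed
  have sS: "summable (\<lambda>m. sc m * z ^ m)" for z using S sums_summable by blast
  have sC: "summable (\<lambda>m. cc m * z ^ m)" for z
    using termdiff_converges_all[OF sS] by (simp add: d1)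
  have C: "cos_ser a z = (\<Sum>m. cc m * z ^ m)" for z
  proof -
    have "(\<lambda>m. cc m * z ^ m) sums (\<Sum>m. cc m * z ^ m)" using sC summable_sums by blast
    then have "(\<lambda>k. cc (2 * k) * z ^ (2 * k)) sums (\<Sum>m. cc m * z ^ m)"
      using even by (subst sums_mono_reindex[OF m2, of "\<lambda>m. cc m * z ^ m"]) (auto simp: cc_def)
    then show ?thesis unfolding cos_ser_def by (simp add: cc_def mult_ac sums_iff)
  qed
  have "sin_ser a = (\<lambda>z. \<Sum>m. sc m * z ^ m)" using S by (simp add: sums_iff fun_eq_iff)
  then show "(sin_ser a has_field_derivative cos_ser a z) (at z)"
    using termdiffs_strong_converges_everywhere[OF sS, of z] by (simp add: d1 C)
  have "cos_ser a = (\<lambda>z. \<Sum>m. cc m * z ^ m)" by (simp add: C fun_eq_iff)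
  moreover have "sin_ser (\<lambda>k. - a (Suc k)) z = (\<Sum>m. sc' m * z ^ m)" using S' by (simp add: sums_iff)
  ultimately show "(cos_ser a has_field_derivative sin_ser (\<lambda>k. - a (Suc k)) z) (at z)"
    using termdiffs_strong_converges_everywhere[OF sC, of z] by (simp add: d2)
qed

lemma sin_ser_0: "sin_ser a 0 = 0" and cos_ser_0: "cos_ser a 0 = a 0"
proof -
  show "sin_ser a 0 = 0" by (simp add: sin_ser_def)
  have "(\<lambda>k. (- 1) ^ k * 0 ^ (2 * k) / fact (2 * k) * a k) sums (\<Sum>k\<in>{0}. (- 1) ^ k * 0 ^ (2 * k) / fact (2 * k) * a k)"
    by (rule sums_finite) auto
  then show "cos_ser a 0 = a 0" by (simp add: cos_ser_def sums_iff)
qed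

lemma sin_ser_linear:
  assumes a: "fact_growth B q a" and b: "fact_growth B' q' b"
  shows "sin_ser (\<lambda>k. a k + c * b k) z = sin_ser a z + c * sin_ser b z"
  using sums_add[OF sin_ser_sums[OF a, of z] sums_mult[OF sin_ser_sums[OF b, of z], of c]]
  unfolding sin_ser_def[of "\<lambda>k. a k + c * b k"] distrib_left mult.left_commute[of _ c] by (simp only: sums_iff)

text \<open>When \<open>a k\<close> is the \<open>k\<close>-th power of \<open>|\<xi>|\<^sup>2 - 1 / 4\<close>, \<open>damped_ser a t\<close> is the symbol of \<open>D_op t\<close> at \<open>\<xi>\<close>,
  and \<open>lap_coeff\<close> is multiplication by \<open>- |\<xi>|\<^sup>2\<close>.\<close>
definition damped_ser :: "(nat \<Rightarrow> complex) \<Rightarrow> real \<Rightarrow> complex" where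
  "damped_ser a t = complex_of_real (exp (- t / 2)) * sin_ser a (complex_of_real t)"

definition lap_coeff :: "(nat \<Rightarrow> complex) \<Rightarrow> nat \<Rightarrow> complex" where
  "lap_coeff a k = - a (Suc k) + (- 1 / 4) * a k"

text \<open>\<open>y = damped_ser a\<close> solves
  \<open>y'' + y' = damped_ser (lap_coeff a)\<close> with \<open>y(0) = 0\<close> and
  \<open>y'(0) = a 0\<close>. Integrating twice by parts against \<open>h\<close> leaves only the
  boundary term from the initial velocity.\<close>

lemma damped_ser_weak:
  assumes g: "fact_growth B q a" and \<tau>: "\<tau> \<le> R"
    and h: "\<And>t. t \<in> {\<tau>..R} \<Longrightarrow> (h has_real_derivative h1 t) (at t)"
      "\<And>t. t \<in> {\<tau>..R} \<Longrightarrow> (h1 has_real_derivative h2 t) (at t)" "continuous_on {\<tau>..R} h2"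
    and R: "h R = 0" "h1 R = 0"
  shows "(LINT t|lborel. indicator {\<tau>..R} t *\<^sub>R
      (complex_of_real (h2 t - h1 t) * damped_ser a (t - \<tau>) - complex_of_real (h t) * damped_ser (lap_coeff a) (t - \<tau>))) =
    complex_of_real (h \<tau>) * a 0"
proof -
  define E where "E t = complex_of_real (exp (- t / 2))" for t
  define S where "S t = sin_ser a (complex_of_real t)" for t
  define C where "C t = cos_ser a (complex_of_real t)" for t
  define S' where "S' t = sin_ser (\<lambda>k. - a (Suc k)) (complex_of_real t)" for t
  \<comment> \<open>With \<open>y = E * S\<close> this is \<open>h' y - h (y' + y)\<close>, a
    primitive of the integrand; a single use of the fundamental theorem replaces two integrations by
    parts.\<close>
  define F where "F t = complex_of_real (h1 t) * (E (t - \<tau>) * S (t - \<tau>)) -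
     complex_of_real (h t) * (E (t - \<tau>) * (C (t - \<tau>) + S (t - \<tau>) / 2))" for t
  have dof: "((\<lambda>t. complex_of_real (t - \<tau>)) has_vector_derivative 1) (at t)" for t
    by (auto intro!: derivative_eq_intros has_vector_derivative_of_real)
  have dS: "((\<lambda>t. S (t - \<tau>)) has_vector_derivative C (t - \<tau>)) (at t)" for t
    using field_vector_diff_chain_at[OF dof sin_cos_ser_derivative(1)[OF g]] by (simp add: S_def C_def o_def)
  have dC: "((\<lambda>t. C (t - \<tau>)) has_vector_derivative S' (t - \<tau>)) (at t)" for t
    using field_vector_diff_chain_at[OF dof sin_cos_ser_derivative(2)[OF g]] by (simp add: S'_def C_def o_def)
  have dS': "((\<lambda>t. S' (t - \<tau>)) has_vector_derivative cos_ser (\<lambda>k. - a (Suc k)) (complex_of_real (t - \<tau>))) (at t)" for t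
    using field_vector_diff_chain_at[OF dof sin_cos_ser_derivative(1)[OF fact_growth_shift[OF g]]] by (simp add: S'_def o_def)
  have cd: "continuous_on {\<tau>..R} f" if "\<And>t. (f has_vector_derivative f' t) (at t)" for f f' :: "real \<Rightarrow> complex"
    using that by (intro continuous_at_imp_continuous_on ballI has_vector_derivative_continuous)
  have dE: "((\<lambda>t. E (t - \<tau>)) has_vector_derivative - E (t - \<tau>) / 2) (at t)" for t
  proof -
    have "((\<lambda>t. exp (- (t - \<tau>) / 2)) has_real_derivative - exp (- (t - \<tau>) / 2) / 2) (at t)"
      by (auto intro!: derivative_eq_intros)
    then have "((\<lambda>t. complex_of_real (exp (- (t - \<tau>) / 2))) has_vector_derivative complex_of_real (- exp (- (t - \<tau>) / 2) / 2)) (at t)"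
      by (rule has_vector_derivative_of_real)
    then show ?thesis by (simp add: E_def)
  qed
  \<comment> \<open>The right-hand side of the damped equation: the damping factor
    \<open>exp (- t / 2)\<close> contributes the term \<open>- S / 4\<close>.\<close>
  have lap: "damped_ser (lap_coeff a) t = E t * (S' t - S t / 4)" for t
    unfolding damped_ser_def lap_coeff_def
    by (subst sin_ser_linear[OF fact_growth_shift[OF g] g]) (simp add: E_def S_def S'_def)

  have D: "(F has_vector_derivative (complex_of_real (h2 t - h1 t) * damped_ser a (t - \<tau>) - complex_of_real (h t) * damped_ser (lap_coeff a) (t - \<tau>))) (at t)"
    if t: "t \<in> {\<tau>..R}" for t
  proof -
    have dh: "((\<lambda>t. complex_of_real (h t)) has_vector_derivative complex_of_real (h1 t)) (at t)"
      "((\<lambda>t. complex_of_real (h1 t)) has_vector_derivative complex_of_real (h2 t)) (at t)"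
      by (rule has_vector_derivative_of_real h(1)[OF t] h(2)[OF t])+
    let ?E = "E (t - \<tau>)" and ?S = "S (t - \<tau>)" and ?C = "C (t - \<tau>)" and ?S' = "S' (t - \<tau>)"
    have "(F has_vector_derivative
       (complex_of_real (h1 t) * (?E * ?C + - ?E / 2 * ?S) + complex_of_real (h2 t) * (?E * ?S)) -
       (complex_of_real (h t) * (?E * (?S' + ?C / 2) + - ?E / 2 * (?C + ?S / 2)) + complex_of_real (h1 t) * (?E * (?C + ?S / 2)))) (at t)"
      unfolding F_def
      by (intro has_vector_derivative_diff has_vector_derivative_mult has_vector_derivative_add has_vector_derivative_divide dh dE dC dS)
    also have "(complex_of_real (h1 t) * (?E * ?C + - ?E / 2 * ?S) + complex_of_real (h2 t) * (?E * ?S)) -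
       (complex_of_real (h t) * (?E * (?S' + ?C / 2) + - ?E / 2 * (?C + ?S / 2)) + complex_of_real (h1 t) * (?E * (?C + ?S / 2)))
      = complex_of_real (h2 t - h1 t) * (?E * ?S) - complex_of_real (h t) * (?E * (?S' - ?S / 4))"
      by (simp add: field_simps)
    finally show ?thesis unfolding lap by (simp add: damped_ser_def E_def S_def)
  qed
  have cont: "continuous_on {\<tau>..R} (\<lambda>t. complex_of_real (h2 t - h1 t) * damped_ser a (t - \<tau>) - complex_of_real (h t) * damped_ser (lap_coeff a) (t - \<tau>))"
  proof -
    have "continuous_on {\<tau>..R} h1" "continuous_on {\<tau>..R} h"
      using h(1,2) by (meson DERIV_isCont continuous_at_imp_continuous_on)+
    moreover have "continuous_on {\<tau>..R} (\<lambda>t. E (t - \<tau>))" "continuous_on {\<tau>..R} (\<lambda>t. S (t - \<tau>))" "continuous_on {\<tau>..R} (\<lambda>t. S' (t - \<tau>))"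
      by (rule cd, rule dE, rule cd, rule dS, rule cd, rule dS')
    moreover have "(\<lambda>t. complex_of_real (h2 t - h1 t) * damped_ser a (t - \<tau>) - complex_of_real (h t) * damped_ser (lap_coeff a) (t - \<tau>)) =
       (\<lambda>t. complex_of_real (h2 t - h1 t) * (E (t - \<tau>) * S (t - \<tau>)) - complex_of_real (h t) * (E (t - \<tau>) * (S' (t - \<tau>) - S (t - \<tau>) / 4)))"
      unfolding lap by (simp add: damped_ser_def E_def S_def)
    ultimately show ?thesis using h(3)
      by (simp only:) (intro continuous_on_diff continuous_on_mult continuous_on_of_real continuous_on_divide continuous_on_const; simp)
  qed
  have "(LINT t|lborel. indicator {\<tau>..R} t *\<^sub>R
      (complex_of_real (h2 t - h1 t) * damped_ser a (t - \<tau>) - complex_of_real (h t) * damped_ser (lap_coeff a) (t - \<tau>))) = F R - F \<tau>"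
    by (rule integral_FTC_Icc[OF \<tau> _ cont]) (rule has_vector_derivative_at_within[OF D], simp)
  \<comment> \<open>At \<open>R\<close> both \<open>h\<close> and \<open>h1\<close> vanish; at
    \<tau> the sine series is 0 and the cosine series is \<open>a 0\<close>.\<close>
  also have "\<dots> = complex_of_real (h \<tau>) * a 0"
    by (simp add: F_def R E_def S_def C_def sin_ser_0 cos_ser_0)
  finally show ?thesis .
qed

definition wave_coeff :: "real \<Rightarrow> nat \<Rightarrow> real" where
  "wave_coeff t k = exp (- t / 2) * ((- 1) ^ k * t ^ (2 * k + 1) / fact (2 * k + 1))"

text \<open>The three branches are one entire function of \<open>shift_sq\<close>: the hyperbolic
  sine series for negative values, the sine series for positive ones, and the \<open>k = 0\<close>
  term \<open>t\<close> at 0, in agreement with the value that \<open>L_symbol\<close> has on the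
  critical sphere.\<close>

lemma L_symbol_sums:
  fixes \<xi> :: "'a::euclidean_space"
  shows "(\<lambda>k. wave_coeff t k * shift_sq \<xi> ^ k) sums (exp (- t / 2) * L_symbol t \<xi>)"
proof -
  have "(\<lambda>k. (- 1) ^ k * t ^ (2 * k + 1) / fact (2 * k + 1) * shift_sq \<xi> ^ k) sums L_symbol t \<xi>"
  proof (cases "norm \<xi>" "1 / 2 :: real" rule: linorder_cases)
    case less
    define a where "a = sqrt (1 / 4 - (norm \<xi>)\<^sup>2)"
    have "(norm \<xi>)\<^sup>2 < (1 / 2)\<^sup>2" using less by (intro power_strict_mono) auto
    then have "a > 0" and a2: "shift_sq \<xi> = - (a\<^sup>2)" by (auto simp: a_def power2_eq_square)
    have m1: "strict_mono (\<lambda>k::nat. 2 * k + 1)" by (auto simp: strict_mono_def)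
    have "(\<lambda>n. (if even n then 0 else (t * a) ^ n /\<^sub>R fact n)) sums sinh (t * a)" by (rule sinh_converges)
    then have "(\<lambda>k. (t * a) ^ (2 * k + 1) /\<^sub>R fact (2 * k + 1)) sums sinh (t * a)"
      by (subst (asm) sums_mono_reindex[OF m1, symmetric]) (auto elim!: oddE simp del: fact_Suc)
    then have "(\<lambda>k. (t * a) ^ (2 * k + 1) /\<^sub>R fact (2 * k + 1) / a) sums (sinh (t * a) / a)"
      by (rule sums_divide)
    moreover have "(t * a) ^ (2 * k + 1) /\<^sub>R fact (2 * k + 1) / a = (- 1) ^ k * t ^ (2 * k + 1) / fact (2 * k + 1) * shift_sq \<xi> ^ k" for k
    proof -
      have "(- 1) ^ k * shift_sq \<xi> ^ k = (a\<^sup>2) ^ k" unfolding a2 power_mult_distrib[symmetric] by simp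
      then have "(- 1) ^ k * t ^ (2 * k + 1) / fact (2 * k + 1) * shift_sq \<xi> ^ k = t ^ (2 * k + 1) / fact (2 * k + 1) * (a\<^sup>2) ^ k"
        by (simp del: fact_Suc add: field_simps)
      also have "\<dots> = (t * a) ^ (2 * k + 1) /\<^sub>R fact (2 * k + 1) / a"
        using \<open>a > 0\<close> by (simp add: power_mult_distrib power_mult[symmetric] field_simps del: fact_Suc)
      finally show ?thesis ..
    qed
    ultimately show ?thesis using less by (simp add: L_symbol_def a_def del: fact_Suc)
  next
    case equal
    have z: "shift_sq \<xi> = 0" by (simp add: equal power2_eq_square)
    have "(\<lambda>k. (- 1) ^ k * t ^ (2 * k + 1) / fact (2 * k + 1) * shift_sq \<xi> ^ k) sums
       (\<Sum>k\<in>{0}. (- 1) ^ k * t ^ (2 * k + 1) / fact (2 * k + 1) * shift_sq \<xi> ^ k)"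
      by (rule sums_finite) (auto simp: z)
    also have "(\<Sum>k\<in>{0}. (- 1) ^ k * t ^ (2 * k + 1) / fact (2 * k + 1) * shift_sq \<xi> ^ k) = L_symbol t \<xi>"
      by (simp add: L_symbol_def equal)
    finally show ?thesis .
  next
    case greater
    define a where "a = sqrt ((norm \<xi>)\<^sup>2 - 1 / 4)"
    have "(1 / 2)\<^sup>2 < (norm \<xi>)\<^sup>2" using greater by (intro power_strict_mono) auto
    then have "a > 0" and a2: "shift_sq \<xi> = a\<^sup>2" by (auto simp: a_def power2_eq_square)
    have "(\<lambda>k. (- 1) ^ k / fact (2 * k + 1) * (t * a) ^ (2 * k + 1) / a) sums (sin (t * a) / a)"
      by (intro sums_divide sin_paired)
    moreover have "(- 1) ^ k / fact (2 * k + 1) * (t * a) ^ (2 * k + 1) / a = (- 1) ^ k * t ^ (2 * k + 1) / fact (2 * k + 1) * shift_sq \<xi> ^ k" for k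
      using \<open>a > 0\<close> unfolding a2 by (simp add: power_mult_distrib power_mult[symmetric] field_simps del: fact_Suc)
    ultimately show ?thesis using greater by (simp add: L_symbol_def a_def del: fact_Suc)
  qed
  from sums_mult[OF this, of "exp (- t / 2)"] show ?thesis
    by (simp add: wave_coeff_def mult.assoc del: fact_Suc)
qed

text \<open>The factorials leave \<open>(t^2 / s)^k / k!\<close>, so the propagator is entire enough
  to be expanded against any positive exponential rate.\<close>

lemma wave_coeff_summable:
  assumes s: "s > 0"
  shows "summable (\<lambda>k. \<bar>wave_coeff t k\<bar> * fact k / s ^ k)"
proof (rule summable_comparison_test')
  show "summable (\<lambda>k. exp (- t / 2) * \<bar>t\<bar> * ((t\<^sup>2 / s) ^ k / fact k))"
    by (intro summable_mult summable_exp_div)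
  fix k
  have e: "\<bar>t\<bar> ^ (2 * k + 1) = \<bar>t\<bar> * (t\<^sup>2) ^ k" by (simp add: power_mult)
  have "\<bar>wave_coeff t k\<bar> = exp (- t / 2) * (\<bar>t\<bar> ^ (2 * k + 1) / fact (2 * k + 1))"
    by (simp add: wave_coeff_def abs_mult power_abs del: fact_Suc)
  then have "\<bar>wave_coeff t k\<bar> * fact k / s ^ k = exp (- t / 2) * \<bar>t\<bar> * (t\<^sup>2 / s) ^ k * (fact k / fact (2 * k + 1))"
    unfolding e by (simp add: power_divide mult_ac del: fact_Suc)
  also have "\<dots> \<le> exp (- t / 2) * \<bar>t\<bar> * (t\<^sup>2 / s) ^ k * (1 / fact k)"
    using s by (intro mult_left_mono fact_ratio_bounds) auto
  finally show "norm (\<bar>wave_coeff t k\<bar> * fact k / s ^ k) \<le> exp (- t / 2) * \<bar>t\<bar> * ((t\<^sup>2 / s) ^ k / fact k)"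
    using s by simp
qed

text \<open>Two evaluations of one series: exchanging sum and Fourier integral gives the transform
  with the propagator symbol, summing the moments directly gives \<open>damped_ser\<close>.\<close>

lemma fourier_wave:
  fixes x :: "'a::euclidean_space"
  assumes "H \<in> borel_measurable borel" "s > 0"
    "integrable lborel (\<lambda>\<xi>. exp (s * \<bar>shift_sq \<xi>\<bar>) * norm (H \<xi>))"
    and g: "fact_growth B q (\<lambda>k. fourier (\<lambda>\<xi>. complex_of_real (shift_sq \<xi> ^ k) * H \<xi>) x)"
  shows "fourier (\<lambda>\<xi>. complex_of_real (exp (- t / 2) * L_symbol t \<xi>) * H \<xi>) x =
    damped_ser (\<lambda>k. fourier (\<lambda>\<xi>. complex_of_real (shift_sq \<xi> ^ k) * H \<xi>) x) t"
proof -
  let ?a = "\<lambda>k. fourier (\<lambda>\<xi>. complex_of_real (shift_sq \<xi> ^ k) * H \<xi>) x"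
  have "(\<lambda>k. complex_of_real (wave_coeff t k) * ?a k) sums fourier (\<lambda>\<xi>. complex_of_real (exp (- t / 2) * L_symbol t \<xi>) * H \<xi>) x"
    by (rule fourier_suminf[OF assms(1-3) wave_coeff_summable[OF assms(2)] L_symbol_sums])
  moreover have "(\<lambda>k. complex_of_real (wave_coeff t k) * ?a k) sums damped_ser ?a t"
    using sums_mult[OF sin_ser_sums[OF g, of "complex_of_real t"], of "complex_of_real (exp (- t / 2))"]
    by (simp add: wave_coeff_def damped_ser_def mult.assoc del: fact_Suc)
  ultimately show ?thesis by (rule sums_unique2)
qed

lemma fact_growth_mom:
  "R \<ge> 2 \<Longrightarrow> fact_growth (mom_const DIM('a) * gauss (1 / (R + 1)) x) 4 (\<lambda>k. mom R k (x::'a::euclidean_space))"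
  unfolding fact_growth_def by (auto simp: mom_bound) (simp add: mom_const_def)

lemma fact_growth_lap_coeff:
  assumes "fact_growth B q a" "q \<ge> 1"
  shows "fact_growth (2 * B * q) (2 * q) (lap_coeff a)"
  unfolding fact_growth_def
proof (intro conjI allI)
  fix k
  have B: "B \<ge> 0" "norm (a k) \<le> B * fact k * q ^ k" using assms by (auto simp: fact_growth_def)
  have "norm (- a (Suc k)) \<le> B * q * fact k * (2 * q) ^ k"
    using fact_growth_shift[OF assms(1)] unfolding fact_growth_def by blast
  moreover have "norm ((- 1 / 4) * a k) \<le> B * q * fact k * (2 * q) ^ k"
  proof -
    have "norm ((- 1 / 4) * a k) \<le> norm (a k)" by (simp add: norm_mult)
    also have "\<dots> \<le> B * fact k * q ^ k" by (rule B)
    also have "\<dots> \<le> B * q * fact k * (2 * q) ^ k"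
    proof -
      have "B * 1 \<le> B * q" using assms B by (intro mult_left_mono) auto
      moreover have "q ^ k \<le> (2 * q) ^ k" using assms by (intro power_mono) auto
      ultimately show ?thesis using B assms by (intro mult_mono) auto
    qed
    finally show ?thesis .
  qed
  ultimately show "norm (lap_coeff a k) \<le> 2 * B * q * fact k * (2 * q) ^ k"
    unfolding lap_coeff_def using norm_triangle_ineq[of "- a (Suc k)" "(- 1 / 4) * a k"] by linarith
qed (use assms in \<open>auto simp: fact_growth_def\<close>)

text \<open>The factor \<open>|\<xi>|^2\<close> is paid for by halving the exponential rate, from
  \<open>R / 8\<close> to \<open>R / 16\<close>.\<close>

lemma integrable_exp_gauss_hat_sq:
  assumes "R > 0"
  shows "integrable lborel (\<lambda>\<xi>::'a::euclidean_space. exp (R / 16 * \<bar>shift_sq \<xi>\<bar>) * norm (complex_of_real (- (norm \<xi>)\<^sup>2 * gauss_hat R \<xi>)))"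
proof (rule integrable_dominated)
  show "integrable lborel (\<lambda>\<xi>::'a. (16 / R + 1 / 4) * (exp (R / 8 * \<bar>shift_sq \<xi>\<bar>) * norm (complex_of_real (gauss_hat R \<xi>))))"
    using assms by (intro integrable_mult_right integrable_exp_gauss_hat) auto
  fix \<xi> :: 'a
  let ?e = "exp (R / 16 * \<bar>shift_sq \<xi>\<bar>)"
  have e1: "?e \<ge> 1" using assms by simp
  have "R / 16 * \<bar>shift_sq \<xi>\<bar> \<le> ?e" using exp_ge_add_one_self[of "R / 16 * \<bar>shift_sq \<xi>\<bar>"] by linarith
  then have "\<bar>shift_sq \<xi>\<bar> \<le> 16 / R * ?e" using assms by (simp add: field_simps)
  moreover have "(norm \<xi>)\<^sup>2 \<le> \<bar>shift_sq \<xi>\<bar> + 1 / 4 * 1" by simp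
  moreover have "1 / 4 * 1 \<le> 1 / 4 * ?e" using e1 by (intro mult_left_mono) auto
  ultimately have "(norm \<xi>)\<^sup>2 \<le> (16 / R + 1 / 4) * ?e" unfolding distrib_right by linarith
  then have "?e * ((norm \<xi>)\<^sup>2 * gauss_hat R \<xi>) \<le> ?e * (((16 / R + 1 / 4) * ?e) * gauss_hat R \<xi>)"
    by (intro mult_left_mono mult_right_mono) auto
  also have "\<dots> = (16 / R + 1 / 4) * ((?e * ?e) * gauss_hat R \<xi>)" by (simp only: mult_ac)
  also have "?e * ?e = exp (R / 8 * \<bar>shift_sq \<xi>\<bar>)" by (simp add: exp_add[symmetric])
  finally show "norm (?e * norm (complex_of_real (- (norm \<xi>)\<^sup>2 * gauss_hat R \<xi>))) \<le>
      (16 / R + 1 / 4) * (exp (R / 8 * \<bar>shift_sq \<xi>\<bar>) * norm (complex_of_real (gauss_hat R \<xi>)))"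
    by (simp add: abs_mult del: of_real_mult of_real_minus of_real_power)
qed measurable

text \<open>\<open>- |\<xi>|^2 = - shift_sq \<xi> - 1/4\<close> produces the two terms of
  \<open>lap_coeff\<close>.\<close>

lemma mom_lap:
  fixes x :: "'a::euclidean_space"
  assumes "R > 0"
  shows "fourier (\<lambda>\<xi>. complex_of_real (shift_sq \<xi> ^ k) * complex_of_real (- (norm \<xi>)\<^sup>2 * gauss_hat R \<xi>)) x = lap_coeff (\<lambda>k. mom R k x) k"
proof -
  have i: "integrable lborel (\<lambda>\<xi>::'a. complex_of_real (shift_sq \<xi> ^ k) * complex_of_real (gauss_hat R \<xi>))" for k
    using assms by (intro fourier_moments(1)[of _ "R / 8"] integrable_exp_gauss_hat) auto
  have "(\<lambda>\<xi>::'a. complex_of_real (shift_sq \<xi> ^ k) * complex_of_real (- (norm \<xi>)\<^sup>2 * gauss_hat R \<xi>)) =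
    (\<lambda>\<xi>. (- 1) * (complex_of_real (shift_sq \<xi> ^ Suc k) * complex_of_real (gauss_hat R \<xi>)) +
       (- 1 / 4) * (complex_of_real (shift_sq \<xi> ^ k) * complex_of_real (gauss_hat R \<xi>)))"
    by (simp add: fun_eq_iff algebra_simps)
  then show ?thesis
    by (simp only: fourier_add[OF integrable_mult_right[OF i] integrable_mult_right[OF i]] fourier_cmult)
      (simp add: lap_coeff_def mom_def)
qed

section \<open>The Laplacian of a Gaussian and its propagation\<close>

lemma mom_0: "R > 0 \<Longrightarrow> mom R 0 x = complex_of_real (gauss (1 / R) x)"
proof -
  assume R: "R > 0"
  have "(\<lambda>k. complex_of_real ((- 0) ^ k / fact k) * mom R k x) sums
     complex_of_real (exp (0 / 4) * (1 + 4 * 0 / R) powr (- DIM('a) / 2) * gauss (1 / (R + 4 * 0)) x)"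
    by (rule mom_genfun) (use R in simp)
  moreover have "(\<lambda>k. complex_of_real ((- 0) ^ k / fact k) * mom R k x) sums (\<Sum>k\<in>{0}. complex_of_real ((- 0) ^ k / fact k) * mom R k x)"
    by (rule sums_finite) auto
  ultimately show ?thesis using sums_unique2 by fastforce
qed

text \<open>The Laplacian of \<open>gauss (1 / R)\<close>.\<close>

definition gauss_lap :: "real \<Rightarrow> 'a::euclidean_space \<Rightarrow> real" where
  "gauss_lap R x = (4 * (norm x)\<^sup>2 / R\<^sup>2 - 2 * DIM('a) / R) * gauss (1 / R) x"

lemma gauss_lap_measurable [measurable]: "gauss_lap R \<in> borel_measurable borel"
  unfolding gauss_lap_def by measurable

text \<open>The derivative at \<open>s = 0\<close> of both sides of \<open>mom_genfun\<close>: the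
  series gives \<open>- mom R 1\<close>, the closed form gives
  \<open>gauss (1 / R) / 4 + gauss_lap R\<close>.\<close>

lemma mom_1:
  fixes x :: "'a::euclidean_space"
  assumes R: "R > 0"
  shows "mom R 1 x = complex_of_real (- gauss (1 / R) x / 4 - gauss_lap R x)"
proof -
  define E where "E s = exp (s / 4) * (1 + 4 * s / R) powr (- DIM('a) / 2) * gauss (1 / (R + 4 * s)) x" for s
  define c where "c k = (- 1) ^ k / fact k * mom R k x" for k
  have sums: "(\<lambda>k. c k * complex_of_real s ^ k) sums complex_of_real (E s)" if s: "\<bar>s\<bar> < R / 4" for s
    using mom_genfun[OF s, of x] by (simp add: c_def E_def power_minus[of s] mult_ac)
  have "((\<lambda>z. \<Sum>k. c k * z ^ k) has_field_derivative (\<Sum>k. diffs c k * 0 ^ k)) (at (0::complex))"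
    by (rule termdiffs_strong[OF sums_summable[OF sums[of "R / 8"]]]) (use R in auto)
  also have "(\<Sum>k. diffs c k * 0 ^ k) = - mom R 1 x"
    by (subst powser_zero) (simp add: diffs_def c_def)
  finally have "((\<lambda>z. \<Sum>k. c k * z ^ k) has_field_derivative (- mom R 1 x)) (at (complex_of_real 0))" by simp
  from has_vector_derivative_real_field[OF this]
  have "((\<lambda>s. \<Sum>k. c k * complex_of_real s ^ k) has_vector_derivative (- mom R 1 x)) (at 0)" by simp
  moreover have "((\<lambda>s. \<Sum>k. c k * complex_of_real s ^ k) has_vector_derivative complex_of_real (gauss (1 / R) x / 4 + gauss_lap R x)) (at 0)"
  proof (rule has_vector_derivative_transform_within_open)
    have d: "(E has_real_derivative (gauss (1 / R) x / 4 + gauss_lap R x)) (at 0)"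
      unfolding E_def gauss_def gauss_lap_def using R
      by (auto intro!: derivative_eq_intros simp: power2_eq_square field_simps)
    show "((\<lambda>s. complex_of_real (E s)) has_vector_derivative complex_of_real (gauss (1 / R) x / 4 + gauss_lap R x)) (at 0)"
      by (rule has_vector_derivative_of_real[OF d])
    show "complex_of_real (E s) = (\<Sum>k. c k * complex_of_real s ^ k)" if "s \<in> {- (R / 4)<..<R / 4}" for s
    proof -
      have "\<bar>s\<bar> < R / 4" using that by auto
      then show ?thesis using sums[of s] by (simp add: sums_iff)
    qed
  qed (use R in auto)
  ultimately have "- mom R 1 x = complex_of_real (gauss (1 / R) x / 4 + gauss_lap R x)"
    by (rule vector_derivative_unique_at)
  then have "mom R 1 x = - complex_of_real (gauss (1 / R) x / 4 + gauss_lap R x)" by (metis minus_minus)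
  then show ?thesis by simp
qed

lemma gauss_lap_schwartz:
  assumes "R > 0"
  shows "(\<lambda>x::'a::euclidean_space. complex_of_real (gauss_lap R x)) \<in> schwartz"
  unfolding gauss_lap_def
proof (rule poly_gauss_schwartz)
  have "(norm (x::'a))\<^sup>2 = (\<Sum>b\<in>Basis. (x \<bullet> b) * (x \<bullet> b))" for x
    unfolding power2_norm_eq_inner by (rule euclidean_inner)
  then have eq: "(\<lambda>x::'a. 4 * (norm x)\<^sup>2 / R\<^sup>2 - 2 * DIM('a) / R) =
     (\<lambda>x. (4 / R\<^sup>2) * (\<Sum>b\<in>Basis. (x \<bullet> b) * (x \<bullet> b)) + (- 2 * DIM('a) / R))"
    by (simp add: fun_eq_iff)
  show "real_polynomial_function (\<lambda>x::'a. 4 * (norm x)\<^sup>2 / R\<^sup>2 - 2 * DIM('a) / R)"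
    unfolding eq
    by (intro real_polynomial_function.intros real_polynomial_function_sum bounded_linear_inner_left finite_Basis)
qed (use assms in auto)

text \<open>Gaussians are self-dual: for \<open>R' = 4 / R\<close> the function
  \<open>gauss_hat R'\<close> is a multiple of \<open>gauss (1 / R)\<close>. So
  \<open>gauss_lap R\<close> is a combination of the first two moment integrands at
  \<open>R'\<close>, and its transform is read off from \<open>mom_0\<close> and
  \<open>mom_1\<close>.\<close>

lemma inv_fourier_gauss_lap:
  fixes \<xi> :: "'a::euclidean_space"
  assumes R: "R > 0"
  shows "inv_fourier (\<lambda>x. complex_of_real (gauss_lap R x)) \<xi> = complex_of_real (- (norm \<xi>)\<^sup>2 * gauss_hat R \<xi>)"
proof -
  define R' where "R' = 4 / R"
  have R': "R' > 0" "R' / 4 = 1 / R" "1 / R' = R / 4" using R by (auto simp: R'_def)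
  have i: "integrable lborel (\<lambda>\<xi>::'a. complex_of_real (shift_sq \<xi> ^ k) * complex_of_real (gauss_hat R' \<xi>))" for k
    using R'(1) by (intro fourier_moments(1)[of _ "R' / 8"] integrable_exp_gauss_hat) auto
  define K where "K = (R' / 2) powr (DIM('a) / 2)"
  have K: "K > 0" "gauss_hat R' x = K * gauss (1 / R) x" for x :: 'a
    using R' by (auto simp: K_def gauss_hat_def)
  have KK: "(R / 2) powr (DIM('a) / 2) = 1 / K"
    using R by (simp add: K_def R'_def powr_divide)
  have eq: "complex_of_real (gauss_lap R x) =
     complex_of_real (4 / (R\<^sup>2 * K)) * (complex_of_real (shift_sq x ^ 1) * complex_of_real (gauss_hat R' x)) +
     complex_of_real ((1 / R\<^sup>2 - 2 * DIM('a) / R) / K) * (complex_of_real (shift_sq x ^ 0) * complex_of_real (gauss_hat R' x))" for x :: 'a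
    unfolding of_real_mult[symmetric] of_real_add[symmetric] of_real_eq_iff K gauss_lap_def
    using K(1) R by (simp add: field_simps)
  have "inv_fourier (\<lambda>x. complex_of_real (gauss_lap R x)) \<xi> = fourier (\<lambda>x. complex_of_real (gauss_lap R x)) (- \<xi>)"
    by (simp add: fourier_eq_inv)
  also have "\<dots> = complex_of_real (4 / (R\<^sup>2 * K)) * mom R' 1 (- \<xi>) + complex_of_real ((1 / R\<^sup>2 - 2 * DIM('a) / R) / K) * mom R' 0 (- \<xi>)"
    unfolding eq mom_def by (simp only: fourier_add[OF integrable_mult_right[OF i] integrable_mult_right[OF i]] fourier_cmult)
  also have "\<dots> = complex_of_real (4 / (R\<^sup>2 * K) * (- gauss (1 / R') \<xi> / 4 - gauss_lap R' \<xi>) + (1 / R\<^sup>2 - 2 * DIM('a) / R) / K * gauss (1 / R') \<xi>)"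
    by (simp only: mom_0[OF R'(1)] mom_1[OF R'(1)] of_real_mult of_real_add) (simp add: gauss_lap_def gauss_def)
  also have "4 / (R\<^sup>2 * K) * (- gauss (1 / R') \<xi> / 4 - gauss_lap R' \<xi>) + (1 / R\<^sup>2 - 2 * DIM('a) / R) / K * gauss (1 / R') \<xi>
     = - (norm \<xi>)\<^sup>2 * gauss_hat R \<xi>"
    using K(1) R unfolding gauss_lap_def gauss_hat_def KK R'
    by (simp add: R'_def power2_eq_square field_simps)
  finally show ?thesis .
qed

text \<open>The propagator applied to \<open>gauss (1 / R)\<close>, and in the next definition to
  its Laplacian. The series form gives pointwise bounds and joint measurability in time and
  space.\<close>

definition damped_gauss :: "real \<Rightarrow> real \<Rightarrow> 'a::euclidean_space \<Rightarrow> complex" where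
  "damped_gauss R t x = damped_ser (\<lambda>k. mom R k x) t"

definition damped_gauss_lap :: "real \<Rightarrow> real \<Rightarrow> 'a::euclidean_space \<Rightarrow> complex" where
  "damped_gauss_lap R t x = damped_ser (lap_coeff (\<lambda>k. mom R k x)) t"

text \<open>A multiplier acts on a functional through
  \<open>fourier (symbol * inv_fourier \<phi>)\<close> inserted as test function. The identity is
  one between test functions and therefore passes to every functional \<open>T\<close>.\<close>

lemma D_op_gauss:
  assumes R: "R \<ge> 2"
  shows "D_op t T (\<lambda>x::'a::euclidean_space. complex_of_real (gauss (1 / R) x)) = T (damped_gauss R t)"
    and "D_op t T (\<lambda>x::'a. complex_of_real (gauss_lap R x)) = T (damped_gauss_lap R t)"
proof -
  have "fourier (\<lambda>\<xi>. complex_of_real (exp (- t / 2) * L_symbol t \<xi>) * complex_of_real (gauss_hat R \<xi>)) x = damped_gauss R t x" for x :: 'a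
    unfolding damped_gauss_def mom_def
    by (rule fourier_wave[of _ "R / 8", OF _ _ integrable_exp_gauss_hat fact_growth_mom[OF R, unfolded mom_def]])
      (use R in auto)
  then have eq: "fourier (\<lambda>\<xi>. complex_of_real (exp (- t / 2) * L_symbol t \<xi>) * complex_of_real (gauss_hat R \<xi>)) = (damped_gauss R t :: 'a \<Rightarrow> complex)"
    by (rule ext)
  have R0: "R > 0" using R by simp
  show "D_op t T (\<lambda>x::'a. complex_of_real (gauss (1 / R) x)) = T (damped_gauss R t)"
    unfolding D_op_def fourier_multiplier_def dist_inv_fourier_def dist_mult_def dist_fourier_def inv_fourier_gauss_hat[OF R0] eq ..
  have "fourier (\<lambda>\<xi>. complex_of_real (exp (- t / 2) * L_symbol t \<xi>) * complex_of_real (- (norm \<xi>)\<^sup>2 * gauss_hat R \<xi>)) x = damped_gauss_lap R t x" for x :: 'a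
    unfolding damped_gauss_lap_def mom_lap[OF R0, symmetric]
    apply (rule fourier_wave[OF _ _ integrable_exp_gauss_hat_sq])
    apply (measurable, use R in auto)[3]
    unfolding mom_lap[OF R0] by (rule fact_growth_lap_coeff[OF fact_growth_mom[OF R]]) simp
  then have eq: "fourier (\<lambda>\<xi>. complex_of_real (exp (- t / 2) * L_symbol t \<xi>) * complex_of_real (- (norm \<xi>)\<^sup>2 * gauss_hat R \<xi>)) = (damped_gauss_lap R t :: 'a \<Rightarrow> complex)"
    by (rule ext)
  show "D_op t T (\<lambda>x::'a. complex_of_real (gauss_lap R x)) = T (damped_gauss_lap R t)"
    unfolding D_op_def fourier_multiplier_def dist_inv_fourier_def dist_mult_def dist_fourier_def inv_fourier_gauss_lap[OF R0] eq ..
qed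

lemma mom_const_pos: "mom_const n > 0"
  by (simp add: mom_const_def)

lemma norm_damped_ser_le:
  assumes "fact_growth B q a" "t \<ge> 0"
  shows "norm (damped_ser a t) \<le> t * exp (q * t\<^sup>2) * B"
proof -
  have "norm (damped_ser a t) = exp (- t / 2) * norm (sin_ser a (complex_of_real t))"
    by (simp add: damped_ser_def norm_mult)
  also have "\<dots> \<le> 1 * (B * norm (complex_of_real t) * exp (q * (norm (complex_of_real t))\<^sup>2))"
    using assms(2) by (intro mult_mono sin_ser_bound[OF assms(1)]) auto
  also have "\<dots> = t * exp (q * t\<^sup>2) * B" using assms(2) by simp
  finally show ?thesis .
qed

lemma damped_gauss_bound:
  fixes x :: "'a::euclidean_space"
  assumes "R \<ge> 2" "t \<ge> 0"
  shows "norm (damped_gauss R t x) \<le> t * exp (4 * t\<^sup>2) * (mom_const DIM('a) * gauss (1 / (R + 1)) x)"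
    and "norm (damped_gauss_lap R t x) \<le> t * exp (8 * t\<^sup>2) * (8 * mom_const DIM('a) * gauss (1 / (R + 1)) x)"
proof -
  show "norm (damped_gauss R t x) \<le> t * exp (4 * t\<^sup>2) * (mom_const DIM('a) * gauss (1 / (R + 1)) x)"
    unfolding damped_gauss_def by (intro norm_damped_ser_le fact_growth_mom assms)
  have "fact_growth (2 * (mom_const DIM('a) * gauss (1 / (R + 1)) x) * 4) (2 * 4) (lap_coeff (\<lambda>k. mom R k x))"
    by (intro fact_growth_lap_coeff fact_growth_mom assms) auto
  from norm_damped_ser_le[OF this assms(2)]
  show "norm (damped_gauss_lap R t x) \<le> t * exp (8 * t\<^sup>2) * (8 * mom_const DIM('a) * gauss (1 / (R + 1)) x)"
    unfolding damped_gauss_lap_def by (simp add: mult_ac)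
qed

text \<open>For short times the solution operator is a small perturbation of multiplication by \<open>t\<close>; the width
  loss from \<open>R\<close> to \<open>R + 1\<close> is harmless because it does not degrade as \<open>R\<close> grows.\<close>
lemma damped_gauss_short_time:
  obtains t0 where "0 < t0" "\<And>R t (x::'a::euclidean_space). \<lbrakk>R \<ge> 2; 0 \<le> t; t \<le> t0\<rbrakk> \<Longrightarrow>
    norm (damped_gauss R t x - complex_of_real (t * exp (- t / 2) * gauss (1 / R) x)) \<le>
      t * exp (- t / 2) * (gauss (1 / (R + 1)) x / 2)"
proof
  define C where "C = mom_const DIM('a)"
  have C: "C > 0" by (simp add: C_def mom_const_pos)
  \<comment> \<open>\<open>t \<le> 1\<close> bounds the exponential by \<open>exp 4\<close>, and the
    second entry then makes the relative error at most 1/2. Only the dimension enters, through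
    \<open>C\<close>, so \<open>t0\<close> is the same for all \<open>R\<close>.\<close>
  define t0 where "t0 = min 1 (1 / sqrt (8 * C * exp 4))"
  show "0 < t0" using C by (simp add: t0_def)
  fix R t :: real and x :: 'a assume R: "R \<ge> 2" and t: "0 \<le> t" "t \<le> t0"
  have t1: "t \<le> 1" "t \<le> 1 / sqrt (8 * C * exp 4)" using t by (auto simp: t0_def)
  have "t\<^sup>2 \<le> (1 / sqrt (8 * C * exp 4))\<^sup>2" using t t1 by (intro power_mono) auto
  also have "\<dots> = 1 / (8 * C * exp 4)" using C by (simp add: power_divide)
  finally have "C * (4 * t\<^sup>2) * exp 4 \<le> 1 / 2" using C by (simp add: field_simps)
  moreover have "C * (4 * t\<^sup>2) * exp (4 * t\<^sup>2) \<le> C * (4 * t\<^sup>2) * exp 4"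
    using C t t1 by (intro mult_left_mono) (auto simp: power_le_one)
  ultimately have small: "C * (4 * t\<^sup>2) * exp (4 * t\<^sup>2) \<le> 1 / 2" by simp
  let ?a = "\<lambda>k. mom R k x" and ?g = "gauss (1 / (R + 1)) x"
  have "damped_gauss R t x - complex_of_real (t * exp (- t / 2) * gauss (1 / R) x) =
     complex_of_real (exp (- t / 2)) * (sin_ser ?a (complex_of_real t) - complex_of_real t * ?a 0)"
    using R by (simp add: damped_gauss_def damped_ser_def mom_0 algebra_simps)
  also have "norm \<dots> \<le> exp (- t / 2) * ((C * ?g) * norm (complex_of_real t) * (4 * (norm (complex_of_real t))\<^sup>2) * exp (4 * (norm (complex_of_real t))\<^sup>2))"
    unfolding norm_mult using sin_ser_bound_first[OF fact_growth_mom[OF R, of x], of "complex_of_real t"]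
    by (intro mult_mono) (auto simp: C_def)
  also have "\<dots> = t * exp (- t / 2) * ?g * (C * (4 * t\<^sup>2) * exp (4 * t\<^sup>2))"
    using t by (simp add: mult_ac)
  also have "\<dots> \<le> t * exp (- t / 2) * ?g * (1 / 2)"
    using t small by (intro mult_left_mono) auto
  finally show "norm (damped_gauss R t x - complex_of_real (t * exp (- t / 2) * gauss (1 / R) x)) \<le>
      t * exp (- t / 2) * (?g / 2)" by simp
qed

lemma fourier_measurable [measurable]:
  assumes [measurable]: "f \<in> borel_measurable borel"
  shows "fourier f \<in> borel_measurable borel" "inv_fourier f \<in> borel_measurable borel"
  unfolding fourier_def inv_fourier_def by measurable

lemma mom_measurable [measurable]: "mom R k \<in> borel_measurable borel"
  unfolding mom_def by measurable

lemma damped_gauss_measurable [measurable]: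
  assumes [measurable]: "f \<in> borel_measurable M" "g \<in> borel_measurable M"
  shows "(\<lambda>z. damped_gauss R (f z) (g z)) \<in> borel_measurable M"
    "(\<lambda>z. damped_gauss_lap R (f z) (g z)) \<in> borel_measurable M"
  unfolding damped_gauss_def damped_gauss_lap_def damped_ser_def sin_ser_def lap_coeff_def
  by measurable

lemma damped_gauss_weak:
  fixes x :: "'a::euclidean_space"
  assumes "R \<ge> 2" "\<tau> \<le> S"
    and "\<And>t. t \<in> {\<tau>..S} \<Longrightarrow> (h has_real_derivative h1 t) (at t)"
      "\<And>t. t \<in> {\<tau>..S} \<Longrightarrow> (h1 has_real_derivative h2 t) (at t)" "continuous_on {\<tau>..S} h2"
    and "h S = 0" "h1 S = 0"
  shows "(LINT t|lborel. indicator {\<tau>..S} t *\<^sub>R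
      (complex_of_real (h2 t - h1 t) * damped_gauss R (t - \<tau>) x - complex_of_real (h t) * damped_gauss_lap R (t - \<tau>) x)) =
    complex_of_real (h \<tau> * gauss (1 / R) x)"
  using damped_ser_weak[OF fact_growth_mom[OF assms(1), of x] assms(2-)] assms(1)
  by (simp add: damped_gauss_def damped_gauss_lap_def mom_0)

subsection \<open>Integrals of square-integrable functions\<close>

lemma powr_two: "norm z powr 2 = (norm z)\<^sup>2"
  by (simp add: powr_numeral)

lemma Lp_2_iff: "f \<in> Lp 2 \<longleftrightarrow> f \<in> borel_measurable borel \<and> integrable lborel (\<lambda>x. (norm (f x))\<^sup>2)"
  by (simp add: Lp_def powr_two)

lemma Lp_2_measurable: "f \<in> Lp 2 \<Longrightarrow> f \<in> borel_measurable borel"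
  by (simp add: Lp_2_iff)

lemma Lp_norm_2_sq: "(Lp_norm 2 f)\<^sup>2 = (LINT x|lborel. (norm (f x))\<^sup>2)"
proof -
  have "(LINT x|lborel. (norm (f x))\<^sup>2) \<ge> 0" by simp
  then show ?thesis unfolding Lp_norm_def powr_two
    by (simp add: powr_half_sqrt)
qed

lemma Lp_norm_nonneg: "Lp_norm r f \<ge> 0"
  by (simp add: Lp_norm_def)

lemma norm_add_sq_le: "(norm (a + b))\<^sup>2 \<le> 2 * (norm a)\<^sup>2 + 2 * (norm b)\<^sup>2" for a b :: "'a::real_normed_vector"
proof -
  have "(norm (a + b))\<^sup>2 \<le> (norm a + norm b)\<^sup>2" by (intro power_mono norm_triangle_ineq) simp
  also have "\<dots> \<le> 2 * (norm a)\<^sup>2 + 2 * (norm b)\<^sup>2"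
    using sum_squares_bound[of "norm a" "norm b"] by (simp add: power2_sum)
  finally show ?thesis .
qed

lemma Lp_2_diff:
  assumes "f \<in> Lp 2" "g \<in> Lp 2"
  shows "(\<lambda>x. f x - g x) \<in> Lp 2"
proof -
  have [measurable]: "f \<in> borel_measurable borel" "g \<in> borel_measurable borel" using assms by (auto simp: Lp_2_iff)
  have "integrable lborel (\<lambda>x. (norm (f x - g x))\<^sup>2)"
  proof (rule integrable_dominated)
    show "integrable lborel (\<lambda>x. 2 * (norm (f x))\<^sup>2 + 2 * (norm (g x))\<^sup>2)" using assms by (auto simp: Lp_2_iff)
    show "norm ((norm (f x - g x))\<^sup>2) \<le> 2 * (norm (f x))\<^sup>2 + 2 * (norm (g x))\<^sup>2" for x
      using norm_add_sq_le[of "f x" "- g x"] by simp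
  qed measurable
  then show ?thesis by (simp add: Lp_2_iff)
qed

lemma nn_integral_sq_Lp:
  "f \<in> Lp 2 \<Longrightarrow> (\<integral>\<^sup>+x. ennreal ((norm (f x))\<^sup>2) \<partial>lborel) = ennreal ((Lp_norm 2 f)\<^sup>2)"
  by (subst nn_integral_eq_integral) (auto simp: Lp_2_iff Lp_norm_2_sq)

lemma Lp_2_Cauchy_Schwarz:
  assumes "f \<in> Lp 2" "g \<in> Lp 2"
  shows "integrable lborel (\<lambda>x. f x * g x)" "(LINT x|lborel. norm (f x * g x)) \<le> Lp_norm 2 f * Lp_norm 2 g"
    "norm (LINT x|lborel. f x * g x) \<le> Lp_norm 2 f * Lp_norm 2 g"
proof -
  have [measurable]: "f \<in> borel_measurable borel" "g \<in> borel_measurable borel" using assms by (auto simp: Lp_2_iff)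
  show i: "integrable lborel (\<lambda>x. f x * g x)"
  proof (rule integrable_dominated)
    show "integrable lborel (\<lambda>x. (norm (f x))\<^sup>2 + (norm (g x))\<^sup>2)" using assms by (auto simp: Lp_2_iff)
    show "norm (f x * g x) \<le> (norm (f x))\<^sup>2 + (norm (g x))\<^sup>2" for x
    proof -
      have "2 * (norm (f x) * norm (g x)) \<le> (norm (f x))\<^sup>2 + (norm (g x))\<^sup>2"
        using sum_squares_bound[of "norm (f x)" "norm (g x)"] by (simp only: mult.assoc)
      moreover have "0 \<le> norm (f x) * norm (g x)" by simp
      ultimately show ?thesis by (simp only: norm_mult)
    qed
  qed measurable
  have "(\<integral>\<^sup>+x. ennreal (norm (f x)) * ennreal (norm (g x)) \<partial>lborel)\<^sup>2 \<le>
     (\<integral>\<^sup>+x. (ennreal (norm (f x)))\<^sup>2 \<partial>lborel) * (\<integral>\<^sup>+x. (ennreal (norm (g x)))\<^sup>2 \<partial>lborel)"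
    by (intro Cauchy_Schwarz_nn_integral) auto
  also have "\<dots> = ennreal ((Lp_norm 2 f)\<^sup>2) * ennreal ((Lp_norm 2 g)\<^sup>2)"
    by (simp add: ennreal_power nn_integral_sq_Lp[OF assms(1)] nn_integral_sq_Lp[OF assms(2)])
  also have "\<dots> = ennreal ((Lp_norm 2 f * Lp_norm 2 g)\<^sup>2)"
    by (simp add: ennreal_mult[symmetric] power_mult_distrib)
  also have "(\<integral>\<^sup>+x. ennreal (norm (f x)) * ennreal (norm (g x)) \<partial>lborel) = ennreal (LINT x|lborel. norm (f x * g x))"
    using integrable_norm[OF i] by (subst nn_integral_eq_integral[symmetric]) (auto simp: norm_mult ennreal_mult)
  finally have "(LINT x|lborel. norm (f x * g x))\<^sup>2 \<le> (Lp_norm 2 f * Lp_norm 2 g)\<^sup>2"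
    by (simp add: ennreal_power)
  then show le: "(LINT x|lborel. norm (f x * g x)) \<le> Lp_norm 2 f * Lp_norm 2 g"
    by (rule power2_le_imp_le) (simp add: Lp_norm_nonneg)
  have "norm (LINT x|lborel. f x * g x) \<le> (LINT x|lborel. norm (f x * g x))" by (rule integral_norm_bound)
  with le show "norm (LINT x|lborel. f x * g x) \<le> Lp_norm 2 f * Lp_norm 2 g" by linarith
qed

lemma L2_simple_sum:
  fixes h :: "('a::euclidean_space \<Rightarrow> complex) \<Rightarrow> 'b::real_vector"
  assumes "L2_simple M S" "t \<in> space M"
  shows "(\<Sum>f\<in>S ` space M. indicator {t \<in> space M. S t = f} t *\<^sub>R h f) = h (S t)"
proof -
  have "finite (S ` space M)" using assms by (simp add: L2_simple_def simple_function_def)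
  then have "(\<Sum>f\<in>S ` space M. indicator {t \<in> space M. S t = f} t *\<^sub>R h f) = (\<Sum>f\<in>S ` space M. if f = S t then h f else 0)"
    using assms(2) by (intro sum.cong) auto
  then show ?thesis using \<open>finite (S ` space M)\<close> assms(2) by simp
qed

lemma L2_simple_sets:
  assumes "L2_simple M S"
  shows "{t \<in> space M. S t = f} \<in> sets M"
proof (cases "f \<in> S ` space M")
  case True
  then have "S -` {f} \<inter> space M \<in> sets M" using assms by (auto simp: L2_simple_def simple_function_def)
  also have "S -` {f} \<inter> space M = {t \<in> space M. S t = f}" by auto
  finally show ?thesis .
next
  case False
  then have "{t \<in> space M. S t = f} = {}" by auto
  then show ?thesis by (simp only: sets.empty_sets)
qed

lemma L2_simple_joint_measurable:
  assumes S: "L2_simple M S"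
  shows "(\<lambda>(t, x). S t x) \<in> borel_measurable (M \<Otimes>\<^sub>M lborel)"
proof -
  have [measurable]: "{t \<in> space M. S t = f} \<in> sets M" for f by (rule L2_simple_sets[OF S])
  have [measurable]: "f \<in> borel_measurable lborel" if "f \<in> S ` space M" for f
    using S that by (auto simp: L2_simple_def Lp_2_iff)
  have "(\<lambda>(t, x). \<Sum>f\<in>S ` space M. indicator {t \<in> space M. S t = f} t *\<^sub>R f x) \<in> borel_measurable (M \<Otimes>\<^sub>M lborel)"
    by measurable
  also have "?this \<longleftrightarrow> ?thesis"
  proof (rule measurable_cong)
    fix z assume "z \<in> space (M \<Otimes>\<^sub>M lborel :: (real \<times> 'a) measure)"
    then obtain t x where z: "z = (t, x)" "t \<in> space M" by (auto simp: space_pair_measure)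
    show "(case z of (t, x) \<Rightarrow> \<Sum>f\<in>S ` space M. indicator {t \<in> space M. S t = f} t *\<^sub>R f x) = (case z of (t, x) \<Rightarrow> S t x)"
      using L2_simple_sum[OF S z(2), of "\<lambda>f. f x"] by (simp add: z)
  qed
  finally show ?thesis .
qed

text \<open>Strong measurability concerns maps into L^2, whereas Fubini needs a function measurable
  in time and space jointly. Simple approximants are jointly measurable; a subsequence selected
  measurably in \<open>t\<close> converges so fast in L^2 that it converges almost everywhere in
  \<open>x\<close>, and \<open>G\<close> is its pointwise limit.\<close>

lemma L2_measurable_joint:
  fixes F :: "real \<Rightarrow> 'a::euclidean_space \<Rightarrow> complex"
  assumes "L2_measurable M F"
  obtains G where "(\<lambda>(t, x). G t x) \<in> borel_measurable (M \<Otimes>\<^sub>M lborel)"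
    "AE t in M. AE x in lborel. F t x = G t x"
proof -
  from assms obtain S where S: "\<And>k. L2_simple M (S k)"
    and lim: "AE t in M. (\<lambda>k. Lp_norm 2 (\<lambda>x. F t x - S k t x)) \<longlonglongrightarrow> 0"
    and FL: "AE t in M. F t \<in> Lp 2"
    unfolding L2_measurable_def by blast
  have Sm[measurable]: "(\<lambda>(t, x). S k t x) \<in> borel_measurable (M \<Otimes>\<^sub>M lborel)" for k
    by (rule L2_simple_joint_measurable[OF S])
  define D where "D j k t = (\<integral>\<^sup>+x. ennreal ((norm (S j t x - S k t x))\<^sup>2) \<partial>lborel)" for j k t
  have [measurable]: "D j k \<in> borel_measurable M" for j k
    unfolding D_def by measurable
  \<comment> \<open>The selection compares the approximants with each other and not with
    \<open>F\<close>, whose distances to them are not known to be measurable in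
    \<open>t\<close>.\<close>
  define K where "K i t = (LEAST k. \<forall>j\<ge>k. D j k t \<le> ennreal ((1 / 4) ^ i))" for i t
  have [measurable]: "K i \<in> measurable M (count_space UNIV)" for i
    unfolding K_def by measurable
  define V where "V i t x = S (K i t) t x" for i t x
  have V[measurable]: "(\<lambda>(t, x). V i t x) \<in> borel_measurable (M \<Otimes>\<^sub>M lborel)" for i
  proof -
    have "(\<lambda>z. (\<lambda>k z. case z of (t, x) \<Rightarrow> S k t x) (K i (fst z)) z) \<in> borel_measurable (M \<Otimes>\<^sub>M lborel)"
      by (rule measurable_compose_countable) measurable
    then show ?thesis by (simp add: V_def case_prod_beta)
  qed
  define G where "G t x = lim (\<lambda>i. V i t x)" for t x
  have "(\<lambda>z. lim (\<lambda>i. case z of (t, x) \<Rightarrow> V i t x)) \<in> borel_measurable (M \<Otimes>\<^sub>M lborel)"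
    by (rule borel_measurable_lim_metric) (rule V)
  then have "(\<lambda>(t, x). G t x) \<in> borel_measurable (M \<Otimes>\<^sub>M lborel)"
    by (simp add: G_def case_prod_beta)
  moreover have "AE t in M. AE x in lborel. F t x = G t x"
    using lim FL AE_space
  proof eventually_elim
    fix t assume l: "(\<lambda>k. Lp_norm 2 (\<lambda>x. F t x - S k t x)) \<longlonglongrightarrow> 0" and F: "F t \<in> Lp 2" and t: "t \<in> space M"
    have SL: "S k t \<in> Lp 2" for k using S t by (auto simp: L2_simple_def)
    have [measurable]: "F t \<in> borel_measurable borel" "S k t \<in> borel_measurable borel" for k
      using F SL by (auto simp: Lp_2_iff)
    define E where "E k = (\<integral>\<^sup>+x. ennreal ((norm (F t x - S k t x))\<^sup>2) \<partial>lborel)" for k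
    have E: "E k = ennreal ((Lp_norm 2 (\<lambda>x. F t x - S k t x))\<^sup>2)" for k
      unfolding E_def by (rule nn_integral_sq_Lp[OF Lp_2_diff[OF F SL]])
    have "(\<lambda>k. ennreal ((Lp_norm 2 (\<lambda>x. F t x - S k t x))\<^sup>2)) \<longlonglongrightarrow> ennreal (0\<^sup>2)"
      by (intro tendsto_intros l)
    moreover have "E = (\<lambda>k. ennreal ((Lp_norm 2 (\<lambda>x. F t x - S k t x))\<^sup>2))" by (rule ext) (rule E)
    ultimately have E0: "E \<longlonglongrightarrow> 0" by simp
    have D_le: "D j k t \<le> 2 * E j + 2 * E k" for j k
    proof -
      have "D j k t \<le> (\<integral>\<^sup>+x. 2 * ennreal ((norm (F t x - S j t x))\<^sup>2) + 2 * ennreal ((norm (F t x - S k t x))\<^sup>2) \<partial>lborel)"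
        unfolding D_def
      proof (rule nn_integral_mono)
        fix x
        have "(norm (S j t x - S k t x))\<^sup>2 \<le> 2 * (norm (F t x - S j t x))\<^sup>2 + 2 * (norm (F t x - S k t x))\<^sup>2"
          using norm_add_sq_le[of "S j t x - F t x" "F t x - S k t x"] by (simp add: norm_minus_commute)
        then have "ennreal ((norm (S j t x - S k t x))\<^sup>2) \<le> ennreal (2 * (norm (F t x - S j t x))\<^sup>2 + 2 * (norm (F t x - S k t x))\<^sup>2)"
          by (rule ennreal_leI)
        then show "ennreal ((norm (S j t x - S k t x))\<^sup>2) \<le> 2 * ennreal ((norm (F t x - S j t x))\<^sup>2) + 2 * ennreal ((norm (F t x - S k t x))\<^sup>2)"
          by (simp add: ennreal_plus ennreal_mult)
      qed
      also have "\<dots> = 2 * E j + 2 * E k"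
        unfolding E_def by (simp add: nn_integral_add nn_integral_cmult)
      finally show ?thesis .
    qed
    have E_le: "E k \<le> 2 * E j + 2 * D j k t" for j k
    proof -
      have "E k \<le> (\<integral>\<^sup>+x. 2 * ennreal ((norm (F t x - S j t x))\<^sup>2) + 2 * ennreal ((norm (S j t x - S k t x))\<^sup>2) \<partial>lborel)"
        unfolding E_def
      proof (rule nn_integral_mono)
        fix x
        have "(norm (F t x - S k t x))\<^sup>2 \<le> 2 * (norm (F t x - S j t x))\<^sup>2 + 2 * (norm (S j t x - S k t x))\<^sup>2"
          using norm_add_sq_le[of "F t x - S j t x" "S j t x - S k t x"] by simp
        then have "ennreal ((norm (F t x - S k t x))\<^sup>2) \<le> ennreal (2 * (norm (F t x - S j t x))\<^sup>2 + 2 * (norm (S j t x - S k t x))\<^sup>2)"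
          by (rule ennreal_leI)
        then show "ennreal ((norm (F t x - S k t x))\<^sup>2) \<le> 2 * ennreal ((norm (F t x - S j t x))\<^sup>2) + 2 * ennreal ((norm (S j t x - S k t x))\<^sup>2)"
          by (simp add: ennreal_plus ennreal_mult)
      qed
      also have "\<dots> = 2 * E j + 2 * D j k t"
        unfolding E_def D_def by (simp add: nn_integral_add nn_integral_cmult)
      finally show ?thesis .
    qed
    have ev: "\<exists>k0. \<forall>k\<ge>k0. E k \<le> ennreal e" if "e > 0" for e :: real
    proof -
      have "eventually (\<lambda>k. E k < ennreal e) sequentially"
        using order_tendstoD(2)[OF E0] that by simp
      then show ?thesis unfolding eventually_sequentially using less_imp_le by blast
    qed
    have K: "\<forall>j\<ge>K i t. D j (K i t) t \<le> ennreal ((1 / 4) ^ i)" for i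
      unfolding K_def
    proof (rule LeastI_ex)
      obtain k0 where k0: "\<forall>k\<ge>k0. E k \<le> ennreal ((1 / 4) ^ i / 4)" using ev[of "(1 / 4) ^ i / 4"] by auto
      have "D j k0 t \<le> ennreal ((1 / 4) ^ i)" if "j \<ge> k0" for j
      proof -
        have "D j k0 t \<le> 2 * ennreal ((1 / 4) ^ i / 4) + 2 * ennreal ((1 / 4) ^ i / 4)"
          using k0 that by (intro order_trans[OF D_le] add_mono mult_left_mono) auto
        also have "\<dots> = ennreal (2 * ((1 / 4) ^ i / 4) + 2 * ((1 / 4) ^ i / 4))"
          by (simp only: ennreal_plus ennreal_mult ennreal_numeral zero_le_numeral zero_le_power divide_nonneg_nonneg mult_nonneg_nonneg zero_le_one)
        finally show ?thesis by simp
      qed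
      then show "\<exists>k. \<forall>j\<ge>k. D j k t \<le> ennreal ((1 / 4) ^ i)" by blast
    qed
    \<comment> \<open>A late index \<open>j\<close>, close to \<open>F\<close> and past
      \<open>K i t\<close>, links the two distances; the triangle inequality for squares gives the
      factor 4.\<close>
    have EK: "E (K i t) \<le> ennreal (4 * (1 / 4) ^ i)" for i
    proof -
      obtain k0 where k0: "\<forall>k\<ge>k0. E k \<le> ennreal ((1 / 4) ^ i)" using ev[of "(1 / 4) ^ i"] by auto
      define j where "j = max k0 (K i t)"
      have "E (K i t) \<le> 2 * ennreal ((1 / 4) ^ i) + 2 * ennreal ((1 / 4) ^ i)"
        using k0 K[of i] by (intro order_trans[OF E_le[of "K i t" j]] add_mono mult_left_mono) (auto simp: j_def)
      also have "\<dots> = ennreal (2 * (1 / 4) ^ i + 2 * (1 / 4) ^ i)"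
        by (simp only: ennreal_plus ennreal_mult ennreal_numeral zero_le_numeral zero_le_power divide_nonneg_nonneg mult_nonneg_nonneg zero_le_one)
      finally show ?thesis by simp
    qed
    have "(\<integral>\<^sup>+x. (\<Sum>i. ennreal ((norm (F t x - V i t x))\<^sup>2)) \<partial>lborel) = (\<Sum>i. E (K i t))"
      unfolding V_def E_def by (subst nn_integral_suminf) auto
    also have "\<dots> \<le> (\<Sum>i. ennreal (4 * (1 / 4) ^ i))" by (intro suminf_le EK) auto
    also have "\<dots> = ennreal (\<Sum>i. 4 * (1 / 4) ^ i)"
      by (intro suminf_ennreal2 summable_mult summable_geometric) auto
    also have "\<dots> < \<infinity>" by simp
    \<comment> \<open>Summable squared L^2 distances make the pointwise squares summable for almost
      every \<open>x\<close>, which forces \<open>V i t x\<close> to converge to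
      \<open>F t x\<close>.\<close>
    finally have "AE x in lborel. (\<Sum>i. ennreal ((norm (F t x - V i t x))\<^sup>2)) \<noteq> \<infinity>"
      by (intro nn_integral_noteq_infinite) (auto simp: V_def)
    then show "AE x in lborel. F t x = G t x"
    proof eventually_elim
      fix x assume "(\<Sum>i. ennreal ((norm (F t x - V i t x))\<^sup>2)) \<noteq> \<infinity>"
      then have "summable (\<lambda>i. (norm (F t x - V i t x))\<^sup>2)"
        by (intro summable_suminf_not_top) auto
      then have "(\<lambda>i. (norm (F t x - V i t x))\<^sup>2) \<longlonglongrightarrow> 0" by (rule summable_LIMSEQ_zero)
      then have "(\<lambda>i. sqrt ((norm (F t x - V i t x))\<^sup>2)) \<longlonglongrightarrow> sqrt 0" by (intro tendsto_real_sqrt)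
      then have "(\<lambda>i. F t x - V i t x) \<longlonglongrightarrow> 0" by (simp add: tendsto_norm_zero_iff)
      then have "(\<lambda>i. F t x - (F t x - V i t x)) \<longlonglongrightarrow> F t x - 0" by (intro tendsto_diff tendsto_const)
      then show "F t x = G t x" unfolding G_def by (simp add: limI)
    qed
  qed
  ultimately show ?thesis by (rule that)
qed

text \<open>Finite linearity over the values of \<open>S\<close>; the general pairing follows from
  it by approximation.\<close>

lemma L2_simple_pairing:
  assumes "finite_measure M" and S: "L2_simple M S" and \<psi>: "\<psi> \<in> Lp 2"
  shows "integrable M (\<lambda>t. LINT x|lborel. S t x * \<psi> x)"
    "(LINT t|M. LINT x|lborel. S t x * \<psi> x) = (LINT x|lborel. L2_simple_integral M S x * \<psi> x)"
proof -
  interpret finite_measure M by fact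
  let ?h = "\<lambda>f. LINT x|lborel. f x * \<psi> x"
  have fin: "finite (S ` space M)" using S by (simp add: L2_simple_def simple_function_def)
  have [measurable]: "{t \<in> space M. S t = f} \<in> sets M" for f by (rule L2_simple_sets[OF S])
  have eq: "(\<Sum>f\<in>S ` space M. indicator {t \<in> space M. S t = f} t *\<^sub>R ?h f) = ?h (S t)" if "t \<in> space M" for t
    by (rule L2_simple_sum[OF S that])
  have i: "integrable M (\<lambda>t. indicator {t \<in> space M. S t = f} t *\<^sub>R ?h f)" for f
    by (intro integrable_scaleR_left) (simp add: emeasure_eq_measure)
  have "integrable M (\<lambda>t. \<Sum>f\<in>S ` space M. indicator {t \<in> space M. S t = f} t *\<^sub>R ?h f)"
    by (intro Bochner_Integration.integrable_sum i)
  also have "?this \<longleftrightarrow> integrable M (\<lambda>t. ?h (S t))"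
    by (rule Bochner_Integration.integrable_cong) (auto simp: eq)
  finally show "integrable M (\<lambda>t. ?h (S t))" .
  have "(LINT t|M. ?h (S t)) = (LINT t|M. (\<Sum>f\<in>S ` space M. indicator {t \<in> space M. S t = f} t *\<^sub>R ?h f))"
    by (rule Bochner_Integration.integral_cong) (auto simp: eq)
  also have "\<dots> = (\<Sum>f\<in>S ` space M. measure M {t \<in> space M. S t = f} *\<^sub>R ?h f)"
    by (subst Bochner_Integration.integral_sum[OF i]) (auto intro!: sum.cong simp: emeasure_eq_measure Int_absorb2)
  also have "\<dots> = (\<Sum>f\<in>S ` space M. (LINT x|lborel. complex_of_real (measure M {t \<in> space M. S t = f}) * f x * \<psi> x))"
    by (simp add: scaleR_conv_of_real mult.assoc)
  also have "\<dots> = (LINT x|lborel. (\<Sum>f\<in>S ` space M. complex_of_real (measure M {t \<in> space M. S t = f}) * f x * \<psi> x))"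
  proof (rule Bochner_Integration.integral_sum[symmetric])
    fix f assume "f \<in> S ` space M"
    then have "f \<in> Lp 2" using S by (auto simp: L2_simple_def)
    from Lp_2_Cauchy_Schwarz(1)[OF this \<psi>]
    show "integrable lborel (\<lambda>x. complex_of_real (measure M {t \<in> space M. S t = f}) * f x * \<psi> x)"
      by (simp add: mult.assoc)
  qed
  also have "\<dots> = (LINT x|lborel. L2_simple_integral M S x * \<psi> x)"
    by (simp add: L2_simple_integral_def sum_distrib_right)
  finally show "(LINT t|M. ?h (S t)) = (LINT x|lborel. L2_simple_integral M S x * \<psi> x)" .
qed

lemma Lp_2_cmult: "f \<in> Lp 2 \<Longrightarrow> (\<lambda>x. c * f x) \<in> Lp 2"
  by (auto simp: Lp_2_iff norm_mult power_mult_distrib)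

lemma Lp_2_add: "f \<in> Lp 2 \<Longrightarrow> g \<in> Lp 2 \<Longrightarrow> (\<lambda>x. f x + g x) \<in> Lp 2"
  using Lp_2_diff[of f "\<lambda>x. (- 1) * g x"] Lp_2_cmult[of g "- 1"] by simp

lemma L2_simple_integral_Lp:
  assumes S: "L2_simple M S"
  shows "L2_simple_integral M S \<in> Lp 2"
proof -
  have fin: "finite (S ` space M)" using S by (simp add: L2_simple_def simple_function_def)
  have L: "f \<in> Lp 2" if "f \<in> S ` space M" for f using S that by (auto simp: L2_simple_def)
  have "(\<lambda>x. \<Sum>f\<in>A. complex_of_real (measure M {t \<in> space M. S t = f}) * f x) \<in> Lp 2" if "finite A" "A \<subseteq> S ` space M" for A
    using that
  proof (induction A)
    case empty
    then show ?case by (simp add: Lp_2_iff)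
  next
    case (insert f A)
    then show ?case using L by (simp add: Lp_2_add Lp_2_cmult)
  qed
  from this[OF fin] show ?thesis by (simp add: L2_simple_integral_def)
qed

text \<open>The bound \<open>B\<close> replaces the integral of \<open>t \<mapsto> Lp_norm 2 (F t)\<close>, whose measurability is not needed.\<close>
lemma has_L2_integral_pairing:
  assumes fm: "finite_measure M" and F: "has_L2_integral M F I"
  obtains B where "B \<ge> 0" "\<And>\<psi>. \<psi> \<in> Lp 2 \<Longrightarrow> \<exists>g. integrable M g \<and> (AE t in M. g t = (LINT x|lborel. F t x * \<psi> x)) \<and>
     integral\<^sup>L M g = (LINT x|lborel. I x * \<psi> x) \<and> (LINT t|M. norm (g t)) \<le> B * (Lp_norm 2 \<psi> + 1)"
proof -
  interpret finite_measure M by fact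
  from F have Fm: "L2_measurable M F" and I: "I \<in> Lp 2" by (auto simp: has_L2_integral_def)
  from F obtain S where S: "\<And>k::nat. L2_simple M (S k)"
    and e0: "(\<lambda>k. \<integral>\<^sup>+t. ennreal (Lp_norm 2 (\<lambda>x. F t x - S k t x)) \<partial>M) \<longlonglongrightarrow> 0"
    and I0: "(\<lambda>k. Lp_norm 2 (\<lambda>x. L2_simple_integral M (S k) x - I x)) \<longlonglongrightarrow> 0"
    unfolding has_L2_integral_def by blast
  define e where "e k = (\<integral>\<^sup>+t. ennreal (Lp_norm 2 (\<lambda>x. F t x - S k t x)) \<partial>M)" for k
  have "e = (\<lambda>k. \<integral>\<^sup>+t. ennreal (Lp_norm 2 (\<lambda>x. F t x - S k t x)) \<partial>M)" by (simp add: e_def fun_eq_iff)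
  with e0 have e0: "e \<longlonglongrightarrow> 0" by simp
  \<comment> \<open>One approximant at finite distance suffices both for the integrability of the
    pairing and for its bound: the constant 1 in the final \<open>B\<close> is this distance, the
    other summand comes from the values of \<open>S k0\<close>.\<close>
  have "eventually (\<lambda>k. e k < 1) sequentially" using order_tendstoD(2)[OF e0, of 1] by simp
  then obtain k0 where k0: "\<And>k. k \<ge> k0 \<Longrightarrow> e k < 1" by (auto simp: eventually_sequentially)
  define m0 where "m0 = (\<Sum>f\<in>S k0 ` space M. Lp_norm 2 f)"
  have m0: "Lp_norm 2 (S k0 t) \<le> m0" "m0 \<ge> 0" if "t \<in> space M" for t
  proof -
    have "finite (S k0 ` space M)" using S[of k0] by (simp add: L2_simple_def simple_function_def)
    then show "Lp_norm 2 (S k0 t) \<le> m0" unfolding m0_def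
      using that by (intro member_le_sum) (auto simp: Lp_norm_nonneg)
  qed (simp add: m0_def sum_nonneg Lp_norm_nonneg)
  have FL: "AE t in M. F t \<in> Lp 2" using Fm by (simp add: L2_measurable_def)
  from L2_measurable_joint[OF Fm] obtain G where G[measurable]: "(\<lambda>(t, x). G t x) \<in> borel_measurable (M \<Otimes>\<^sub>M lborel)"
    and FG: "AE t in M. AE x in lborel. F t x = G t x" .
  have "m0 \<ge> 0" by (simp add: m0_def sum_nonneg Lp_norm_nonneg)
  show ?thesis
  proof (rule that[of "1 + m0 * measure M (space M)"])
    show "1 + m0 * measure M (space M) \<ge> 0" using \<open>m0 \<ge> 0\<close> by simp
    fix \<psi> :: "'a \<Rightarrow> complex" assume \<psi>: "\<psi> \<in> Lp 2"
    have [measurable]: "\<psi> \<in> borel_measurable lborel" using \<psi> by (simp add: Lp_2_iff)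
    \<comment> \<open>The added 1 keeps \<open>c\<close> positive, so that division by it is allowed
      also when \<psi> is null.\<close>
    define c where "c = Lp_norm 2 \<psi> + 1"
    have c: "c > 0" "Lp_norm 2 \<psi> \<le> c" using Lp_norm_nonneg[of 2 \<psi>] by (auto simp: c_def)
    \<comment> \<open>Pairing with the joint representative \<open>G\<close> makes \<open>g\<close>
      measurable in time.\<close>
    define g where "g t = (LINT x|lborel. G t x * \<psi> x)" for t
    define s where "s k t = (LINT x|lborel. S k t x * \<psi> x)" for k t
    have [measurable]: "g \<in> borel_measurable M" unfolding g_def by measurable
    have si: "integrable M (s k)" and sI: "integral\<^sup>L M (s k) = (LINT x|lborel. L2_simple_integral M (S k) x * \<psi> x)" for k
      unfolding s_def[abs_def] by (rule L2_simple_pairing[OF fm S \<psi>])+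
    have gF: "AE t in M. g t = (LINT x|lborel. F t x * \<psi> x)"
      using FG FL AE_space
    proof eventually_elim
      fix t assume 1: "AE x in lborel. F t x = G t x" and 2: "F t \<in> Lp 2" and t: "t \<in> space M"
      have [measurable]: "F t \<in> borel_measurable borel" using 2 by (simp add: Lp_2_iff)
      have [measurable]: "G t \<in> borel_measurable borel" using measurable_Pair2[OF G t] by simp
      show "g t = (LINT x|lborel. F t x * \<psi> x)"
        unfolding g_def using 1 by (intro integral_cong_AE) auto
    qed
    have diff: "AE t in M. norm (g t - s k t) \<le> c * Lp_norm 2 (\<lambda>x. F t x - S k t x)" for k
      using gF FL AE_space
    proof eventually_elim
      fix t assume g: "g t = (LINT x|lborel. F t x * \<psi> x)" and F: "F t \<in> Lp 2" and t: "t \<in> space M"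
      have SL: "S k t \<in> Lp 2" using S t by (auto simp: L2_simple_def)
      have "g t - s k t = (LINT x|lborel. (F t x - S k t x) * \<psi> x)"
        unfolding g s_def left_diff_distrib
        by (rule Bochner_Integration.integral_diff[symmetric]) (rule Lp_2_Cauchy_Schwarz(1)[OF F \<psi>], rule Lp_2_Cauchy_Schwarz(1)[OF SL \<psi>])
      also have "norm \<dots> \<le> Lp_norm 2 (\<lambda>x. F t x - S k t x) * Lp_norm 2 \<psi>"
        by (rule Lp_2_Cauchy_Schwarz(3)[OF Lp_2_diff[OF F SL] \<psi>])
      also have "\<dots> \<le> Lp_norm 2 (\<lambda>x. F t x - S k t x) * c" by (intro mult_left_mono c Lp_norm_nonneg)
      finally show "norm (g t - s k t) \<le> c * Lp_norm 2 (\<lambda>x. F t x - S k t x)" by (simp add: mult.commute)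
    qed
    have [measurable]: "s k \<in> borel_measurable M" for k using si by auto
    have nn: "(\<integral>\<^sup>+t. ennreal (norm (g t - s k t)) \<partial>M) \<le> ennreal c * e k" for k
    proof -
      have "(\<integral>\<^sup>+t. ennreal (norm (g t - s k t)) \<partial>M) = (\<integral>\<^sup>+t. ennreal c * ennreal (norm (g t - s k t) / c) \<partial>M)"
        using c by (intro nn_integral_cong) (simp add: ennreal_mult[symmetric])
      also have "\<dots> = ennreal c * (\<integral>\<^sup>+t. ennreal (norm (g t - s k t) / c) \<partial>M)"
        by (rule nn_integral_cmult) measurable
      also have "(\<integral>\<^sup>+t. ennreal (norm (g t - s k t) / c) \<partial>M) \<le> e k"
        unfolding e_def
        by (rule nn_integral_mono_AE) (use diff[of k] c in \<open>auto elim!: eventually_mono intro!: ennreal_leI simp: field_simps\<close>)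
      finally show ?thesis by (simp add: mult_left_mono)
    qed
    have di: "integrable M (\<lambda>t. g t - s k t)" and dn: "ennreal (LINT t|M. norm (g t - s k t)) \<le> ennreal c * e k" if "k \<ge> k0" for k
    proof -
      have "ennreal c * e k < \<infinity>" using k0[OF that] by (simp add: ennreal_mult_less_top order_less_trans[OF _ ennreal_one_less_top])
      then show di: "integrable M (\<lambda>t. g t - s k t)"
        using nn[of k] by (intro integrableI_bounded) auto
      show "ennreal (LINT t|M. norm (g t - s k t)) \<le> ennreal c * e k"
        using nn[of k] di by (subst nn_integral_eq_integral[symmetric]) auto
    qed
    have gi: "integrable M g"
      using Bochner_Integration.integrable_add[OF di[OF order_refl] si[of k0]] by simp
    have 1: "(\<lambda>k. integral\<^sup>L M (s k)) \<longlonglongrightarrow> integral\<^sup>L M g"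
    proof (rule Lim_transform2[OF tendsto_const])
      have "(\<lambda>k. ennreal c * e k) \<longlonglongrightarrow> ennreal c * 0" by (intro ennreal_tendsto_cmult e0) simp
      then have z: "(\<lambda>k. enn2real (ennreal c * e k)) \<longlonglongrightarrow> 0"
        by (auto intro: tendsto_enn2real[of _ 0, simplified])
      show "(\<lambda>k. integral\<^sup>L M g - integral\<^sup>L M (s k)) \<longlonglongrightarrow> 0"
      proof (rule Lim_null_comparison[OF _ z], unfold eventually_sequentially, intro exI allI impI)
        fix k assume k: "k \<ge> k0"
        have "norm (integral\<^sup>L M g - integral\<^sup>L M (s k)) = norm (LINT t|M. g t - s k t)"
          using gi si by simp
        also have "\<dots> \<le> (LINT t|M. norm (g t - s k t))" by (rule integral_norm_bound)
        also have "\<dots> \<le> enn2real (ennreal c * e k)"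
          using dn[OF k] k0[OF k] enn2real_mono[OF dn[OF k]]
          by (simp add: ennreal_mult_less_top order_less_trans[OF _ ennreal_one_less_top])
        finally show "norm (integral\<^sup>L M g - integral\<^sup>L M (s k)) \<le> enn2real (ennreal c * e k)" .
      qed
    qed
    have 2: "(\<lambda>k. integral\<^sup>L M (s k)) \<longlonglongrightarrow> (LINT x|lborel. I x * \<psi> x)"
    proof (rule Lim_transform[OF tendsto_const])
      show "(\<lambda>k. integral\<^sup>L M (s k) - (LINT x|lborel. I x * \<psi> x)) \<longlonglongrightarrow> 0"
      proof (rule Lim_null_comparison)
        show "(\<lambda>k. Lp_norm 2 (\<lambda>x. L2_simple_integral M (S k) x - I x) * Lp_norm 2 \<psi>) \<longlonglongrightarrow> 0"
          using tendsto_mult_left_zero[OF I0] by simp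
        show "\<forall>\<^sub>F k in sequentially. norm (integral\<^sup>L M (s k) - (LINT x|lborel. I x * \<psi> x)) \<le>
          Lp_norm 2 (\<lambda>x. L2_simple_integral M (S k) x - I x) * Lp_norm 2 \<psi>"
        proof (rule always_eventually, rule allI)
          fix k
          note SI = L2_simple_integral_Lp[OF S[of k]]
          have "integral\<^sup>L M (s k) - (LINT x|lborel. I x * \<psi> x) = (LINT x|lborel. (L2_simple_integral M (S k) x - I x) * \<psi> x)"
            unfolding sI left_diff_distrib
            by (rule Bochner_Integration.integral_diff[symmetric]) (rule Lp_2_Cauchy_Schwarz(1)[OF SI \<psi>], rule Lp_2_Cauchy_Schwarz(1)[OF I \<psi>])
          then show "norm (integral\<^sup>L M (s k) - (LINT x|lborel. I x * \<psi> x)) \<le>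
            Lp_norm 2 (\<lambda>x. L2_simple_integral M (S k) x - I x) * Lp_norm 2 \<psi>"
            using Lp_2_Cauchy_Schwarz(3)[OF Lp_2_diff[OF SI I] \<psi>] by simp
        qed
      qed
    qed
    have "(LINT t|M. norm (g t)) \<le> (LINT t|M. norm (g t - s k0 t) + norm (s k0 t))"
      using gi si di[OF order_refl]
      by (intro integral_mono Bochner_Integration.integrable_add integrable_norm) (auto intro: order_trans[OF _ norm_triangle_ineq])
    also have "\<dots> = (LINT t|M. norm (g t - s k0 t)) + (LINT t|M. norm (s k0 t))"
      using si di[OF order_refl] by (intro Bochner_Integration.integral_add integrable_norm)
    also have "(LINT t|M. norm (g t - s k0 t)) \<le> c"
    proof -
      have "ennreal c * e k0 \<le> ennreal c * 1" using k0[of k0] by (intro mult_left_mono) auto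
      then have "ennreal (LINT t|M. norm (g t - s k0 t)) \<le> ennreal c"
        using dn[of k0] by simp
      then show ?thesis using c by (simp add: ennreal_le_iff)
    qed
    also have "(LINT t|M. norm (s k0 t)) \<le> (LINT t|M. m0 * c)"
    proof (intro integral_mono integrable_norm si integrable_const)
      fix t assume t: "t \<in> space M"
      have "norm (s k0 t) \<le> Lp_norm 2 (S k0 t) * Lp_norm 2 \<psi>"
        unfolding s_def using S t by (intro Lp_2_Cauchy_Schwarz(3) \<psi>) (auto simp: L2_simple_def)
      also have "\<dots> \<le> m0 * c" using m0[OF t] c by (intro mult_mono) (auto simp: Lp_norm_nonneg)
      finally show "norm (s k0 t) \<le> m0 * c" .
    qed
    also have "c + (LINT t|M. m0 * c) = (1 + m0 * measure M (space M)) * c"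
      by (simp add: algebra_simps)
    finally have "(LINT t|M. norm (g t)) \<le> (1 + m0 * measure M (space M)) * (Lp_norm 2 \<psi> + 1)"
      by (simp add: c_def)
    with gi gF LIMSEQ_unique[OF 1 2]
    show "\<exists>g. integrable M g \<and> (AE t in M. g t = (LINT x|lborel. F t x * \<psi> x)) \<and>
     integral\<^sup>L M g = (LINT x|lborel. I x * \<psi> x) \<and> (LINT t|M. norm (g t)) \<le> (1 + m0 * measure M (space M)) * (Lp_norm 2 \<psi> + 1)"
      by blast
  qed
qed

subsection \<open>Time integrability of the nonlinearity\<close>

text \<open>The rate 1/4 is small enough that \<open>exp (1 / 4) < 2\<close>; any power of
  \<open>j\<close> is then summable against \<open>(1 / 2) ^ j\<close>.\<close>

lemma real_power_le_exp: "real j ^ m \<le> 4 ^ m * fact m * exp (1 / 4) ^ j"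
proof -
  have "(real j / 4) ^ m \<le> fact m * exp (real j / 4)" by (rule power_le_fact_mult_exp) simp
  also have "exp (real j / 4) = exp (1 / 4) ^ j" by (simp add: exp_of_nat_mult[symmetric])
  finally show ?thesis by (simp add: power_divide field_simps)
qed

lemma exp_quarter: "exp (1 / 4 :: real) / 2 < 1"
proof -
  have "exp (1 / 4 :: real) \<le> 1 + 1 / 4 + (1 / 4)\<^sup>2" by (rule exp_bound) auto
  then show ?thesis by (simp add: power2_eq_square)
qed

lemma summable_poly_half: "summable (\<lambda>i. (1 / 2) ^ i * real (J + i) ^ m)"
proof (rule summable_comparison_test')
  show "summable (\<lambda>i. (4 ^ m * fact m * exp (1 / 4) ^ J) * (exp (1 / 4) / 2 :: real) ^ i)"
    using exp_quarter by (intro summable_mult summable_geometric) auto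
  fix i
  have "(1 / 2) ^ i * real (J + i) ^ m \<le> (1 / 2) ^ i * (4 ^ m * fact m * exp (1 / 4) ^ (J + i))"
    by (intro mult_left_mono real_power_le_exp) auto
  also have "\<dots> = (4 ^ m * fact m * exp (1 / 4) ^ J) * (exp (1 / 4) / 2) ^ i"
    by (simp add: power_add power_divide)
  finally show "norm ((1 / 2) ^ i * real (J + i) ^ m) \<le> (4 ^ m * fact m * exp (1 / 4) ^ J) * (exp (1 / 4) / 2) ^ i"
    by simp
qed

lemma Lp_2_gauss:
  assumes "c > 0"
  shows "(\<lambda>x. complex_of_real (gauss c x)) \<in> Lp 2"
    "Lp_norm 2 (\<lambda>x::'a::euclidean_space. complex_of_real (gauss c x)) = sqrt ((pi / (2 * c)) powr (DIM('a) / 2))"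
proof -
  have sq: "(norm (complex_of_real (gauss c x)))\<^sup>2 = gauss (2 * c) x" for x :: 'b
    by (simp add: power2_eq_square gauss_mult)
  show "(\<lambda>x::'b. complex_of_real (gauss c x)) \<in> Lp 2"
    unfolding Lp_2_iff sq using assms by (auto intro: integrable_gauss)
next
  have sq: "(norm (complex_of_real (gauss c x)))\<^sup>2 = gauss (2 * c) x" for x :: 'a
    by (simp add: power2_eq_square gauss_mult)
  have "(Lp_norm 2 (\<lambda>x::'a. complex_of_real (gauss c x)))\<^sup>2 = (pi / (2 * c)) powr (DIM('a) / 2)"
    unfolding Lp_norm_2_sq sq using assms by (subst integral_gauss) auto
  then show "Lp_norm 2 (\<lambda>x::'a. complex_of_real (gauss c x)) = sqrt ((pi / (2 * c)) powr (DIM('a) / 2))"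
    using Lp_norm_nonneg by (metis real_sqrt_unique)
qed

text \<open>A polynomial bound in \<open>j\<close> is all that the geometric series requires, so the
  true exponent \<open>DIM('a) / 4\<close> is raised to a natural number.\<close>

lemma Lp_norm_gauss_le:
  assumes "j \<ge> 1"
  shows "Lp_norm 2 (\<lambda>x::'a::euclidean_space. complex_of_real (gauss (1 / real j) x)) \<le> 2 ^ DIM('a) * real j ^ DIM('a)"
proof -
  have b: "1 \<le> pi * real j / 2"
  proof -
    have "2 * 1 \<le> pi * real j" using assms pi_ge_two by (intro mult_mono) auto
    then show ?thesis by simp
  qed
  have "sqrt ((pi * real j / 2) powr (DIM('a) / 2)) = (pi * real j / 2) powr (DIM('a) / 4)"
    by (simp add: powr_half_sqrt[symmetric] powr_powr)
  also have "\<dots> \<le> (pi * real j / 2) powr (real DIM('a))"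
    using b by (intro powr_mono) auto
  also have "\<dots> = (pi * real j / 2) ^ DIM('a)" using b by (subst powr_realpow) auto
  also have "\<dots> \<le> (2 * real j) ^ DIM('a)"
    using assms pi_less_4 by (intro power_mono) auto
  finally show ?thesis using assms by (subst Lp_2_gauss) (auto simp: power_mult_distrib)
qed

text \<open>The type argument records the space, since the admissible \<open>t0\<close> depends on
  the dimension.\<close>

definition short_time :: "'a::euclidean_space itself \<Rightarrow> real \<Rightarrow> bool" where
  "short_time _ t0 \<longleftrightarrow> t0 > 0 \<and> (\<forall>R t (x::'a). R \<ge> 2 \<longrightarrow> 0 \<le> t \<longrightarrow> t \<le> t0 \<longrightarrow>
    norm (damped_gauss R t x - complex_of_real (t * exp (- t / 2) * gauss (1 / R) x)) \<le>
      t * exp (- t / 2) * (gauss (1 / (R + 1)) x / 2))"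

lemma short_time_exists: "\<exists>t0. short_time TYPE('a::euclidean_space) t0"
  using damped_gauss_short_time[where 'a='a] unfolding short_time_def by metis

lemma tempered_fun_gauss:
  fixes f :: "'a::euclidean_space \<Rightarrow> real"
  assumes "(\<lambda>x. complex_of_real (f x)) \<in> tempered_fun" "c > 0"
  shows "integrable lborel (\<lambda>x. \<bar>f x\<bar> * gauss c x)" "f \<in> borel_measurable borel"
proof -
  have "\<forall>\<phi>\<in>schwartz. integrable lborel (\<lambda>x. complex_of_real (f x) * \<phi> x)"
    using assms(1) by (simp add: tempered_fun_def)
  from bspec[OF this gauss_schwartz[OF assms(2)]]
  have "integrable lborel (\<lambda>x. complex_of_real (f x) * complex_of_real (gauss c x))" .
  from integrable_norm[OF this] show "integrable lborel (\<lambda>x. \<bar>f x\<bar> * gauss c x)" by (simp add: norm_mult)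
  have [measurable]: "(\<lambda>x. complex_of_real (f x)) \<in> borel_measurable borel"
    using assms(1) by (simp add: tempered_fun_def)
  have "(\<lambda>x. Re (complex_of_real (f x))) \<in> borel_measurable borel"
    by measurable
  then show "f \<in> borel_measurable borel" by simp
qed

text \<open>Since \<open>f\<close> has a constant sign, the Gaussian mean of \<open>|f|\<close> is
  up to that sign a value of the functional, and temperedness bounds it by a seminorm of a wide
  Gaussian.\<close>

lemma tempered_fun_gauss_growth:
  fixes f :: "'a::euclidean_space \<Rightarrow> real"
  assumes f: "(\<lambda>x. complex_of_real (f x)) \<in> tempered_fun" and sgn: "\<And>x. \<kappa> * f x = \<bar>f x\<bar>" and k: "\<bar>\<kappa>\<bar> = 1"
  shows "\<exists>C m. \<forall>j\<ge>1. (LINT x|lborel. \<bar>f x\<bar> * gauss (1 / real j) x) \<le> C * real j ^ m"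
proof -
  obtain C m where C: "\<And>\<phi>. \<phi> \<in> schwartz \<Longrightarrow> norm (fun_dist (\<lambda>x. complex_of_real (f x)) \<phi>) \<le> C * schwartz_seminorm m \<phi>"
    using f unfolding tempered_fun_def tempered_def by blast
  let ?s = "schwartz_seminorm m (\<lambda>x::'a. complex_of_real (gauss 1 x))"
  show ?thesis
  proof (intro exI allI impI)
    fix j :: nat assume j: "1 \<le> j"
    then have c: "1 / real j > 0" by simp
    let ?\<phi> = "\<lambda>x::'a. complex_of_real (gauss (1 / real j) x)"
    note i = tempered_fun_gauss(1)[OF f c]
    have "complex_of_real (LINT x|lborel. \<bar>f x\<bar> * gauss (1 / real j) x) = (LINT x|lborel. complex_of_real (\<bar>f x\<bar> * gauss (1 / real j) x))"
      by (rule integral_complex_of_real[symmetric])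
    also have "\<dots> = (LINT x|lborel. complex_of_real \<kappa> * (complex_of_real (f x) * ?\<phi> x))"
      by (simp only: sgn[symmetric] of_real_mult mult.assoc)
    also have "\<dots> = complex_of_real \<kappa> * fun_dist (\<lambda>x. complex_of_real (f x)) ?\<phi>"
      by (simp add: fun_dist_def)
    finally have eq: "complex_of_real (LINT x|lborel. \<bar>f x\<bar> * gauss (1 / real j) x) = complex_of_real \<kappa> * fun_dist (\<lambda>x. complex_of_real (f x)) ?\<phi>" .
    have "(LINT x|lborel. \<bar>f x\<bar> * gauss (1 / real j) x) \<le> norm (complex_of_real (LINT x|lborel. \<bar>f x\<bar> * gauss (1 / real j) x))"
      by simp
    also have "\<dots> = norm (fun_dist (\<lambda>x. complex_of_real (f x)) ?\<phi>)" unfolding eq by (simp add: norm_mult k)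
    also have "\<dots> \<le> C * schwartz_seminorm m ?\<phi>" by (rule C[OF gauss_schwartz[OF c]])
    also have "\<dots> \<le> \<bar>C\<bar> * (sqrt (real j) ^ m * ?s)"
    proof -
      have "0 \<le> schwartz_seminorm m ?\<phi>"
        using schwartz_seminorm_upper[OF gauss_schwartz[OF c], of "[]" m 0] by (auto intro: order_trans[rotated])
      then have "C * schwartz_seminorm m ?\<phi> \<le> \<bar>C\<bar> * schwartz_seminorm m ?\<phi>" by (intro mult_right_mono) auto
      also have "\<dots> \<le> \<bar>C\<bar> * (sqrt (real j) ^ m * ?s)"
        using schwartz_seminorm_gauss_le[of "real j" m, where 'a='a] j by (intro mult_left_mono) auto
      finally show ?thesis .
    qed
    also have "\<dots> \<le> \<bar>C\<bar> * (real j ^ m * ?s)"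
    proof -
      have "sqrt (real j) \<le> real j" using j by (intro real_le_lsqrt) (auto simp: power2_eq_square)
      moreover have "0 \<le> ?s"
        using schwartz_seminorm_upper[OF gauss_schwartz[of 1], of "[]" m "0::'a"] by (auto intro: order_trans[rotated])
      ultimately show ?thesis by (intro mult_left_mono mult_right_mono power_mono) auto
    qed
    finally show "(LINT x|lborel. \<bar>f x\<bar> * gauss (1 / real j) x) \<le> (\<bar>C\<bar> * ?s) * real j ^ m" by (simp add: mult_ac)
  qed
qed

text \<open>Transfers the propagator from the distribution to the test function, where its pointwise
  bounds can be used.\<close>

lemma represents_damped_gauss:
  fixes f :: "'a::euclidean_space \<Rightarrow> complex"
  assumes "represents F (D_op \<sigma> (fun_dist f))" "R \<ge> 2"
  shows "(LINT x|lborel. f x * damped_gauss R \<sigma> x) = (LINT x|lborel. F x * complex_of_real (gauss (1 / R) x))"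
    "(LINT x|lborel. f x * damped_gauss_lap R \<sigma> x) = (LINT x|lborel. F x * complex_of_real (gauss_lap R x))"
proof -
  have "D_op \<sigma> (fun_dist f) (\<lambda>x. complex_of_real (gauss (1 / R) x)) = fun_dist F (\<lambda>x. complex_of_real (gauss (1 / R) x))"
    using assms gauss_schwartz[of "1 / R", where 'a='a] by (auto simp: represents_def)
  then show "(LINT x|lborel. f x * damped_gauss R \<sigma> x) = (LINT x|lborel. F x * complex_of_real (gauss (1 / R) x))"
    by (simp add: D_op_gauss[OF assms(2)] fun_dist_def)
  have "D_op \<sigma> (fun_dist f) (\<lambda>x. complex_of_real (gauss_lap R x)) = fun_dist F (\<lambda>x. complex_of_real (gauss_lap R x))"
    using assms gauss_lap_schwartz[of "R", where 'a='a] by (auto simp: represents_def)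
  then show "(LINT x|lborel. f x * damped_gauss_lap R \<sigma> x) = (LINT x|lborel. F x * complex_of_real (gauss_lap R x))"
    by (simp add: D_op_gauss[OF assms(2)] fun_dist_def)
qed

text \<open>Absorbing the error at width \<open>j + 1\<close> successively into the next width gives a geometric series; the
  remainder vanishes because a positive tempered function has polynomially growing Gaussian means.\<close>
lemma duhamel_coercive:
  fixes f :: "'a::euclidean_space \<Rightarrow> real"
  assumes f: "(\<lambda>x. complex_of_real (f x)) \<in> tempered_fun" and sgn: "\<And>x. \<kappa> * f x = \<bar>f x\<bar>" and k: "\<bar>\<kappa>\<bar> = 1"
    and F: "represents F (D_op \<sigma> (fun_dist (\<lambda>x. complex_of_real (f x))))"
    and t0: "short_time TYPE('a) t0" and \<sigma>: "0 \<le> \<sigma>" "\<sigma> \<le> t0" and J: "J \<ge> 2"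
  shows "ennreal (\<sigma> * exp (- \<sigma> / 2) * (LINT x|lborel. \<bar>f x\<bar> * gauss (1 / real J) x)) \<le>
    (\<Sum>i. ennreal ((1 / 2) ^ i * norm (LINT x|lborel. F x * complex_of_real (gauss (1 / real (J + i)) x))))"
proof -
  define c where "c = \<sigma> * exp (- \<sigma> / 2)"
  have c: "c \<ge> 0" using \<sigma> by (simp add: c_def)
  define a where "a j = (LINT x|lborel. \<bar>f x\<bar> * gauss (1 / real j) x)" for j
  define b where "b j = norm (LINT x|lborel. F x * complex_of_real (gauss (1 / real j) x))" for j
  have fm[measurable]: "f \<in> borel_measurable borel" by (rule tempered_fun_gauss(2)[OF f, of 1]) simp
  have a0: "a j \<ge> 0" for j unfolding a_def by (intro integral_nonneg_AE AE_I2) auto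
  \<comment> \<open>The propagated Gaussian is \<open>c\<close> times the Gaussian plus an error of
    at most half of \<open>c\<close> times the next wider one; the sign of \<open>f\<close> turns
    the main part into \<open>c * a j\<close>.\<close>
  have step: "c * a j \<le> b j + c * (a (Suc j) / 2)" if j: "j \<ge> 2" for j
  proof -
    have jR: "real j \<ge> 2" using j by simp
    let ?K = "damped_gauss (real j) \<sigma> :: 'a \<Rightarrow> complex"
    let ?g = "\<lambda>x::'a. complex_of_real (gauss (1 / real j) x)"
    have i1: "integrable lborel (\<lambda>x. \<bar>f x\<bar> * gauss (1 / real j) x)" using j by (intro tempered_fun_gauss[OF f]) auto
    have i2: "integrable lborel (\<lambda>x. \<bar>f x\<bar> * gauss (1 / (real j + 1)) x)" using j by (intro tempered_fun_gauss[OF f]) auto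
    have diff: "norm (?K x - complex_of_real (c * gauss (1 / real j) x)) \<le> c * (gauss (1 / (real j + 1)) x / 2)" for x
      using t0 jR \<sigma> unfolding short_time_def c_def by blast
    have id: "integrable lborel (\<lambda>x. complex_of_real (f x) * (?K x - complex_of_real (c * gauss (1 / real j) x)))"
    proof (rule integrable_dominated)
      show "integrable lborel (\<lambda>x. (c / 2) * (\<bar>f x\<bar> * gauss (1 / (real j + 1)) x))" by (intro integrable_mult_right i2)
      fix x :: 'a
      have "norm (complex_of_real (f x) * (?K x - complex_of_real (c * gauss (1 / real j) x))) \<le> \<bar>f x\<bar> * (c * (gauss (1 / (real j + 1)) x / 2))"
        unfolding norm_mult using diff[of x] by (intro mult_mono) auto
      then show "norm (complex_of_real (f x) * (?K x - complex_of_real (c * gauss (1 / real j) x))) \<le> (c / 2) * (\<bar>f x\<bar> * gauss (1 / (real j + 1)) x)"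
        by (simp add: mult_ac)
    qed measurable
    have ig: "integrable lborel (\<lambda>x. complex_of_real c * (complex_of_real (f x) * ?g x))"
    proof (rule integrable_mult_right)
      show "integrable lborel (\<lambda>x. complex_of_real (f x) * ?g x)"
        by (rule integrable_dominated[OF i1]) (auto simp: norm_mult)
    qed
    have "(LINT x|lborel. complex_of_real (f x) * ?K x) =
      (LINT x|lborel. complex_of_real (f x) * (?K x - complex_of_real (c * gauss (1 / real j) x)) + complex_of_real c * (complex_of_real (f x) * ?g x))"
      by (rule Bochner_Integration.integral_cong) (auto simp: algebra_simps)
    also have "\<dots> = (LINT x|lborel. complex_of_real (f x) * (?K x - complex_of_real (c * gauss (1 / real j) x))) + (LINT x|lborel. complex_of_real c * (complex_of_real (f x) * ?g x))"
      by (rule Bochner_Integration.integral_add[OF id ig])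
    finally have eq: "(LINT x|lborel. complex_of_real c * (complex_of_real (f x) * ?g x)) = (LINT x|lborel. complex_of_real (f x) * ?K x)
       - (LINT x|lborel. complex_of_real (f x) * (?K x - complex_of_real (c * gauss (1 / real j) x)))" by simp
    have 1: "norm (LINT x|lborel. complex_of_real c * (complex_of_real (f x) * ?g x)) = c * a j"
    proof -
      have "complex_of_real (a j) = (LINT x|lborel. complex_of_real (\<bar>f x\<bar> * gauss (1 / real j) x))"
        unfolding a_def by (rule integral_complex_of_real[symmetric])
      also have "\<dots> = (LINT x|lborel. complex_of_real \<kappa> * (complex_of_real (f x) * ?g x))"
        by (simp only: sgn[symmetric] of_real_mult mult.assoc)
      also have "\<dots> = complex_of_real \<kappa> * (LINT x|lborel. complex_of_real (f x) * ?g x)" by simp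
      finally have "norm (complex_of_real (a j)) = norm (LINT x|lborel. complex_of_real (f x) * ?g x)"
        by (simp add: norm_mult k)
      then have "norm (LINT x|lborel. complex_of_real (f x) * ?g x) = a j" using a0[of j] by simp
      then show ?thesis using c by (simp add: norm_mult)
    qed
    have 2: "(LINT x|lborel. complex_of_real (f x) * ?K x) = (LINT x|lborel. F x * ?g x)"
      by (rule represents_damped_gauss(1)[OF F jR])
    have 3: "norm (LINT x|lborel. complex_of_real (f x) * (?K x - complex_of_real (c * gauss (1 / real j) x))) \<le> c * (a (Suc j) / 2)"
    proof -
      have "norm (LINT x|lborel. complex_of_real (f x) * (?K x - complex_of_real (c * gauss (1 / real j) x))) \<le>
         (LINT x|lborel. (c / 2) * (\<bar>f x\<bar> * gauss (1 / (real j + 1)) x))"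
      proof (rule Bochner_Integration.integral_norm_bound_integral[OF id])
        show "integrable lborel (\<lambda>x. (c / 2) * (\<bar>f x\<bar> * gauss (1 / (real j + 1)) x))" by (intro integrable_mult_right i2)
        fix x :: 'a
        have "norm (complex_of_real (f x) * (?K x - complex_of_real (c * gauss (1 / real j) x))) \<le> \<bar>f x\<bar> * (c * (gauss (1 / (real j + 1)) x / 2))"
          unfolding norm_mult using diff[of x] by (intro mult_mono) auto
        then show "norm (complex_of_real (f x) * (?K x - complex_of_real (c * gauss (1 / real j) x))) \<le> (c / 2) * (\<bar>f x\<bar> * gauss (1 / (real j + 1)) x)"
          by (simp add: mult_ac)
      qed
      then show ?thesis by (simp add: a_def add.commute)
    qed
    show ?thesis
      using norm_triangle_ineq4[of "LINT x|lborel. complex_of_real (f x) * ?K x" "LINT x|lborel. complex_of_real (f x) * (?K x - complex_of_real (c * gauss (1 / real j) x))"]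
      unfolding eq[symmetric] 1 using 3 by (simp add: 2 b_def)
  qed
  \<comment> \<open>Each use of \<open>step\<close> replaces the mean at one width by half the mean
    at the next.\<close>
  have iter: "c * a J \<le> (\<Sum>i<m. (1 / 2) ^ i * b (J + i)) + c * ((1 / 2) ^ m * a (J + m))" for m
  proof (induction m)
    case (Suc m)
    have "(1 / 2) ^ m * (c * a (J + m)) \<le> (1 / 2) ^ m * (b (J + m) + c * (a (Suc (J + m)) / 2))"
      using J by (intro mult_left_mono step) auto
    then show ?case using Suc by (simp add: algebra_simps)
  qed simp
  obtain C m where C: "\<And>j. j \<ge> 1 \<Longrightarrow> a j \<le> C * real j ^ m"
    using tempered_fun_gauss_growth[OF f sgn k] unfolding a_def by blast
  \<comment> \<open>The remainder has a mean of polynomial growth against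
    \<open>(1 / 2) ^ i\<close>.\<close>
  have lim: "(\<lambda>i. c * ((1 / 2) ^ i * a (J + i))) \<longlonglongrightarrow> 0"
  proof (rule Lim_null_comparison)
    have "(\<lambda>i. (c * C) * ((1 / 2) ^ i * real (J + i) ^ m)) \<longlonglongrightarrow> (c * C) * 0"
      by (intro tendsto_mult_left summable_LIMSEQ_zero summable_poly_half)
    then show "(\<lambda>i. (c * C) * ((1 / 2) ^ i * real (J + i) ^ m)) \<longlonglongrightarrow> 0" by simp
    show "\<forall>\<^sub>F i in sequentially. norm (c * ((1 / 2) ^ i * a (J + i))) \<le> (c * C) * ((1 / 2) ^ i * real (J + i) ^ m)"
    proof (rule always_eventually, rule allI)
      fix i
      have "(c * (1 / 2) ^ i) * a (J + i) \<le> (c * (1 / 2) ^ i) * (C * real (J + i) ^ m)"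
        using c J by (intro mult_left_mono C) auto
      then show "norm (c * ((1 / 2) ^ i * a (J + i))) \<le> (c * C) * ((1 / 2) ^ i * real (J + i) ^ m)"
        using c a0[of "J + i"] by (simp add: abs_mult mult_ac)
    qed
  qed
  have b0: "b j \<ge> 0" for j by (simp add: b_def)
  have "ennreal (c * a J) \<le> (\<Sum>i. ennreal ((1 / 2) ^ i * b (J + i))) + 0"
  proof (rule LIMSEQ_le_const)
    have "(\<lambda>m. ennreal (c * ((1 / 2) ^ m * a (J + m)))) \<longlonglongrightarrow> ennreal 0" by (intro tendsto_ennrealI lim)
    then show "(\<lambda>m. (\<Sum>i. ennreal ((1 / 2) ^ i * b (J + i))) + ennreal (c * ((1 / 2) ^ m * a (J + m)))) \<longlonglongrightarrow> (\<Sum>i. ennreal ((1 / 2) ^ i * b (J + i))) + 0"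
      by (intro tendsto_add tendsto_const) simp
    show "\<exists>N. \<forall>m\<ge>N. ennreal (c * a J) \<le> (\<Sum>i. ennreal ((1 / 2) ^ i * b (J + i))) + ennreal (c * ((1 / 2) ^ m * a (J + m)))"
    proof (intro exI allI impI)
      fix m
      have "ennreal (c * a J) \<le> ennreal ((\<Sum>i<m. (1 / 2) ^ i * b (J + i)) + c * ((1 / 2) ^ m * a (J + m)))"
        by (rule ennreal_leI[OF iter])
      also have "\<dots> = (\<Sum>i<m. ennreal ((1 / 2) ^ i * b (J + i))) + ennreal (c * ((1 / 2) ^ m * a (J + m)))"
        using b0 a0 c by (subst ennreal_plus) (auto intro!: sum_nonneg simp: sum_ennreal)
      also have "\<dots> \<le> (\<Sum>i. ennreal ((1 / 2) ^ i * b (J + i))) + ennreal (c * ((1 / 2) ^ m * a (J + m)))"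
        by (intro add_right_mono sum_le_suminf) auto
      finally show "ennreal (c * a J) \<le> (\<Sum>i. ennreal ((1 / 2) ^ i * b (J + i))) + ennreal (c * ((1 / 2) ^ m * a (J + m)))" .
    qed
  qed
  then show ?thesis by (simp add: c_def a_def b_def)
qed

lemma sgn_power: "\<bar>\<kappa>\<bar> = 1 \<Longrightarrow> \<kappa> * (\<kappa> * \<bar>v\<bar> powr p) = \<bar>\<kappa> * \<bar>v\<bar> powr p\<bar>" for \<kappa> :: real
  by (auto simp: abs_mult abs_if split: if_splits)

lemma finite_measure_interval: "finite_measure (restrict_space lborel {0<..<t::real})"
  using emeasure_bounded_finite[of "{0<..<t}"]
  by (intro finite_measureI) (auto simp: emeasure_restrict_space space_restrict_space)

text \<open>Integrates \<open>duhamel_coercive\<close> over the last \<open>t0\<close> units of time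
  before \<open>t\<close>. The pairings with Gaussians of all widths share one constant
  \<open>B\<close> and grow polynomially in the width, so the series with weights
  \<open>(1 / 2) ^ i\<close> converges.\<close>

lemma duhamel_time_bound:
  fixes u :: "real \<Rightarrow> 'a::euclidean_space \<Rightarrow> real"
  assumes d: "has_duhamel (\<lambda>v. \<kappa> * \<bar>v\<bar> powr p) u t I" and k: "\<bar>\<kappa>\<bar> = 1"
    and t0: "short_time TYPE('a) t0" and J: "J \<ge> 2"
  shows "(\<integral>\<^sup>+\<tau>. indicator {t - t0..} \<tau> * ennreal ((t - \<tau>) * exp (- (t - \<tau>) / 2) *
      (LINT x|lborel. \<bar>\<kappa> * \<bar>u \<tau> x\<bar> powr p\<bar> * gauss (1 / real J) x)) \<partial>restrict_space lborel {0<..<t}) < \<infinity>"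
proof -
  let ?M = "restrict_space lborel {0<..<t}"
  let ?\<psi> = "\<lambda>i x. complex_of_real (gauss (1 / real (J + i)) (x::'a))"
  obtain F where F: "AE \<tau> in ?M. (\<lambda>x. complex_of_real (\<kappa> * \<bar>u \<tau> x\<bar> powr p)) \<in> tempered_fun \<and> F \<tau> \<in> Lp 2 \<and>
      represents (F \<tau>) (D_op (t - \<tau>) (fun_dist (\<lambda>x. complex_of_real (\<kappa> * \<bar>u \<tau> x\<bar> powr p))))"
    and FI: "has_L2_integral ?M F I"
    using d unfolding has_duhamel_def by blast
  obtain B where B: "B \<ge> 0" "\<And>\<psi>. \<psi> \<in> Lp 2 \<Longrightarrow> \<exists>g. integrable ?M g \<and> (AE \<tau> in ?M. g \<tau> = (LINT x|lborel. F \<tau> x * \<psi> x)) \<and>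
     integral\<^sup>L ?M g = (LINT x|lborel. I x * \<psi> x) \<and> (LINT \<tau>|?M. norm (g \<tau>)) \<le> B * (Lp_norm 2 \<psi> + 1)"
    using has_L2_integral_pairing[OF finite_measure_interval FI] by blast
  have "\<exists>g. integrable ?M g \<and> (AE \<tau> in ?M. g \<tau> = (LINT x|lborel. F \<tau> x * ?\<psi> i x)) \<and> (LINT \<tau>|?M. norm (g \<tau>)) \<le> B * (Lp_norm 2 (?\<psi> i) + 1)" for i
  proof -
    have "1 / real (J + i) > 0" using J by simp
    from B(2)[OF Lp_2_gauss(1)[OF this]] show ?thesis by blast
  qed
  then have "\<forall>i. \<exists>g. integrable ?M g \<and> (AE \<tau> in ?M. g \<tau> = (LINT x|lborel. F \<tau> x * ?\<psi> i x)) \<and> (LINT \<tau>|?M. norm (g \<tau>)) \<le> B * (Lp_norm 2 (?\<psi> i) + 1)"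
    by (rule allI)
  \<comment> \<open>One measurable representative per width, since the pairing itself is determined
    only almost everywhere.\<close>
  from choice[OF this] obtain g where "\<forall>i. integrable ?M (g i) \<and> (AE \<tau> in ?M. g i \<tau> = (LINT x|lborel. F \<tau> x * ?\<psi> i x)) \<and>
    (LINT \<tau>|?M. norm (g i \<tau>)) \<le> B * (Lp_norm 2 (?\<psi> i) + 1)" by (rule exE)
  then have g: "\<And>i. integrable ?M (g i)" "\<And>i. AE \<tau> in ?M. g i \<tau> = (LINT x|lborel. F \<tau> x * ?\<psi> i x)"
    "\<And>i. (LINT \<tau>|?M. norm (g i \<tau>)) \<le> B * (Lp_norm 2 (?\<psi> i) + 1)" by blast+
  have gall: "AE \<tau> in ?M. \<forall>i. g i \<tau> = (LINT x|lborel. F \<tau> x * ?\<psi> i x)"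
    unfolding AE_all_countable using g(2) by blast
  have [measurable]: "g i \<in> borel_measurable ?M" for i using g(1) by auto
  have "(\<integral>\<^sup>+\<tau>. indicator {t - t0..} \<tau> * ennreal ((t - \<tau>) * exp (- (t - \<tau>) / 2) *
      (LINT x|lborel. \<bar>\<kappa> * \<bar>u \<tau> x\<bar> powr p\<bar> * gauss (1 / real J) x)) \<partial>?M) \<le> (\<integral>\<^sup>+\<tau>. (\<Sum>i. ennreal ((1 / 2) ^ i * norm (g i \<tau>))) \<partial>?M)"
  proof (rule nn_integral_mono_AE)
    show "AE \<tau> in ?M. indicator {t - t0..} \<tau> * ennreal ((t - \<tau>) * exp (- (t - \<tau>) / 2) *
      (LINT x|lborel. \<bar>\<kappa> * \<bar>u \<tau> x\<bar> powr p\<bar> * gauss (1 / real J) x)) \<le> (\<Sum>i. ennreal ((1 / 2) ^ i * norm (g i \<tau>)))"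
      using F gall AE_space
    proof eventually_elim
      fix \<tau> assume 1: "(\<lambda>x. complex_of_real (\<kappa> * \<bar>u \<tau> x\<bar> powr p)) \<in> tempered_fun \<and> F \<tau> \<in> Lp 2 \<and>
          represents (F \<tau>) (D_op (t - \<tau>) (fun_dist (\<lambda>x. complex_of_real (\<kappa> * \<bar>u \<tau> x\<bar> powr p))))"
        and 2: "\<forall>i. g i \<tau> = (LINT x|lborel. F \<tau> x * ?\<psi> i x)" and 3: "\<tau> \<in> space ?M"
      show "indicator {t - t0..} \<tau> * ennreal ((t - \<tau>) * exp (- (t - \<tau>) / 2) *
        (LINT x|lborel. \<bar>\<kappa> * \<bar>u \<tau> x\<bar> powr p\<bar> * gauss (1 / real J) x)) \<le> (\<Sum>i. ennreal ((1 / 2) ^ i * norm (g i \<tau>)))"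
      proof (cases "t - t0 \<le> \<tau>")
        case True
        have "ennreal ((t - \<tau>) * exp (- (t - \<tau>) / 2) * (LINT x|lborel. \<bar>\<kappa> * \<bar>u \<tau> x\<bar> powr p\<bar> * gauss (1 / real J) x)) \<le>
          (\<Sum>i. ennreal ((1 / 2) ^ i * norm (LINT x|lborel. F \<tau> x * ?\<psi> i x)))"
        proof (rule duhamel_coercive[of "\<lambda>x. \<kappa> * \<bar>u \<tau> x\<bar> powr p" \<kappa> "F \<tau>" "t - \<tau>" t0 J])
          show "0 \<le> t - \<tau>" "t - \<tau> \<le> t0" using 3 True by (auto simp: space_restrict_space)
          show "(\<lambda>x. complex_of_real (\<kappa> * \<bar>u \<tau> x\<bar> powr p)) \<in> tempered_fun"
            "represents (F \<tau>) (D_op (t - \<tau>) (fun_dist (\<lambda>x. complex_of_real (\<kappa> * \<bar>u \<tau> x\<bar> powr p))))"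
            using 1 by blast+
        qed (rule sgn_power[OF k] k t0 J)+
        then show ?thesis using True 2 by simp
      qed simp
    qed
  qed
  also have "\<dots> = (\<Sum>i. \<integral>\<^sup>+\<tau>. ennreal ((1 / 2) ^ i * norm (g i \<tau>)) \<partial>?M)"
    by (rule nn_integral_suminf) measurable
  also have "\<dots> = (\<Sum>i. ennreal ((1 / 2) ^ i * (LINT \<tau>|?M. norm (g i \<tau>))))"
  proof (rule suminf_cong)
    fix i
    show "(\<integral>\<^sup>+\<tau>. ennreal ((1 / 2) ^ i * norm (g i \<tau>)) \<partial>?M) = ennreal ((1 / 2) ^ i * (LINT \<tau>|?M. norm (g i \<tau>)))"
      by (subst nn_integral_eq_integral) (auto intro!: integrable_mult_right integrable_norm g(1))
  qed
  also have "\<dots> \<le> (\<Sum>i. ennreal (B * 2 ^ DIM('a) * ((1 / 2) ^ i * real (J + i) ^ DIM('a)) + B * (1 / 2) ^ i))"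
  proof (intro suminf_le ennreal_leI)
    fix i
    have "(1 / 2) ^ i * (LINT \<tau>|?M. norm (g i \<tau>)) \<le> (1 / 2) ^ i * (B * (2 ^ DIM('a) * real (J + i) ^ DIM('a) + 1))"
      using B J by (intro mult_left_mono order_trans[OF g(3)] add_mono Lp_norm_gauss_le) auto
    then show "(1 / 2) ^ i * (LINT \<tau>|?M. norm (g i \<tau>)) \<le> B * 2 ^ DIM('a) * ((1 / 2) ^ i * real (J + i) ^ DIM('a)) + B * (1 / 2) ^ i"
      by (simp add: algebra_simps)
  qed auto
  also have "\<dots> = ennreal (\<Sum>i. B * 2 ^ DIM('a) * ((1 / 2) ^ i * real (J + i) ^ DIM('a)) + B * (1 / 2) ^ i)"
    using B by (intro suminf_ennreal2 summable_add summable_mult summable_poly_half summable_geometric) auto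
  also have "\<dots> < \<infinity>" by simp
  finally show ?thesis .
qed

text \<open>A single observation time controls only a short window before it, with a weight that
  vanishes at the observation time. The interval is therefore cut into windows of length \<theta>,
  each observed from a time at distance between \<theta> and \<open>3 * \<theta>\<close> from its
  points.\<close>

lemma solution_time_integrable:
  fixes u v :: "real \<Rightarrow> 'a::euclidean_space \<Rightarrow> real"
  assumes d: "AE t in lborel. 0 < t \<and> ereal t < T \<longrightarrow> (\<exists>I. has_duhamel (\<lambda>v. \<kappa> * \<bar>v\<bar> powr p) u t I)"
    and k: "\<bar>\<kappa>\<bar> = 1"
    and v[measurable]: "(\<lambda>(t, x). v t x) \<in> borel_measurable (lborel \<Otimes>\<^sub>M lborel)"
    and uv: "AE t in lborel. 0 < t \<and> ereal t < T \<longrightarrow> (AE x in lborel. u t x = v t x)"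
    and S: "0 < S" "ereal S < T" and J: "J \<ge> 2"
  shows "(\<integral>\<^sup>+\<tau>. indicator {0<..<S} \<tau> * (\<integral>\<^sup>+x. ennreal (\<bar>v \<tau> x\<bar> powr p * gauss (1 / real J) x) \<partial>lborel) \<partial>lborel) < \<infinity>"
proof -
  define a where "a \<tau> = (\<integral>\<^sup>+x. ennreal (\<bar>v \<tau> x\<bar> powr p * gauss (1 / real J) x) \<partial>lborel)" for \<tau>
  have [measurable]: "a \<in> borel_measurable lborel" unfolding a_def by measurable
  obtain t0 where t0: "short_time TYPE('a) t0" using short_time_exists by blast
  then have t0pos: "t0 > 0" by (simp add: short_time_def)
  \<comment> \<open>\<open>T\<close> may be infinite; a real \<open>T'\<close> leaves a finite gap
    beyond \<open>S\<close> in which the last observation times are placed.\<close>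
  obtain T' where T': "S < T'" "ereal T' \<le> T"
    using S(2) ereal_dense2 by (metis less_ereal.simps(1) order_less_imp_le)
  \<comment> \<open>\<open>3 * \<theta>\<close> must fit into the short-time range and into the gap
    behind \<open>S\<close>, so that \<open>real (i + 3) * \<theta>\<close> does not exceed
    \<open>T'\<close> for the last window.\<close>
  define \<theta> where "\<theta> = min (t0 / 3) ((T' - S) / 3)"
  have \<theta>: "\<theta> > 0" "3 * \<theta> \<le> t0" "3 * \<theta> \<le> T' - S" using t0pos T' by (auto simp: \<theta>_def min_def)
  define m where "m = nat \<lceil>S / \<theta>\<rceil>"
  have m: "S \<le> real m * \<theta>" "real m * \<theta> < S + \<theta>"
  proof -
    have "S / \<theta> \<le> real m" unfolding m_def by (rule real_nat_ceiling_ge)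
    then show "S \<le> real m * \<theta>" using \<theta> by (simp add: field_simps)
    have "real m < S / \<theta> + 1" unfolding m_def using S \<theta> by (simp add: of_nat_nat ceiling_less_iff) linarith
    then show "real m * \<theta> < S + \<theta>" using \<theta> by (simp add: field_simps)
  qed
  have piece: "(\<integral>\<^sup>+\<tau>. indicator {0<..} \<tau> * indicator {real i * \<theta>..real (Suc i) * \<theta>} \<tau> * a \<tau> \<partial>lborel) < \<infinity>" if i: "i < m" for i
  proof -
    have "real (i + 3) * \<theta> \<le> T'"
    proof -
      have "real i + 1 \<le> real m" using i by linarith
      then have "(real i + 1) * \<theta> \<le> real m * \<theta>" using \<theta> by (intro mult_right_mono) auto
      then show ?thesis using m \<theta> by (simp add: algebra_simps)
    qed
    then have inT: "ereal t < T" if "t < real (i + 3) * \<theta>" for t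
      using that T' by (metis ereal_less_eq(3) less_ereal.simps(1) order_less_le_trans)
    \<comment> \<open>The equation holds for almost every time, so an observation time exists in any
      interval of positive length. This one begins \<theta> beyond the end of the window.\<close>
    have "\<exists>t\<in>{real (i + 2) * \<theta><..<real (i + 3) * \<theta>}. \<exists>I. has_duhamel (\<lambda>v. \<kappa> * \<bar>v\<bar> powr p) u t I"
    proof (rule ccontr)
      assume "\<not> ?thesis"
      then have none: "\<forall>t\<in>{real (i + 2) * \<theta><..<real (i + 3) * \<theta>}. \<not> (\<exists>I. has_duhamel (\<lambda>v. \<kappa> * \<bar>v\<bar> powr p) u t I)" by blast
      have pos: "0 < t" if "t \<in> {real (i + 2) * \<theta><..<real (i + 3) * \<theta>}" for t
      proof -
        have "0 \<le> real (i + 2) * \<theta>" using \<theta> by (intro mult_nonneg_nonneg) auto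
        also have "\<dots> < t" using that by (rule greaterThanLessThan_iff[THEN iffD1, THEN conjunct1])
        finally show ?thesis .
      qed
      have "AE t in lborel. t \<notin> {real (i + 2) * \<theta><..<real (i + 3) * \<theta>}"
        using d
      proof eventually_elim
        case (elim t)
        show ?case
        proof
          assume t: "t \<in> {real (i + 2) * \<theta><..<real (i + 3) * \<theta>}"
          then have "t < real (i + 3) * \<theta>" by (rule greaterThanLessThan_iff[THEN iffD1, THEN conjunct2])
          then show False using none t pos[OF t] inT elim by blast
        qed
      qed
      then have "emeasure lborel {real (i + 2) * \<theta><..<real (i + 3) * \<theta>} = 0"
        by (subst (asm) AE_iff_null_sets[symmetric]) (simp, rule null_setsD1)
      moreover have "real (i + 2) * \<theta> < real (i + 3) * \<theta>" using \<theta> by (intro mult_strict_right_mono) auto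
      ultimately show False by simp
    qed
    then obtain t I where t: "real (i + 2) * \<theta> < t" "t < real (i + 3) * \<theta>"
      and dt: "has_duhamel (\<lambda>v. \<kappa> * \<bar>v\<bar> powr p) u t I" by auto
    let ?M = "restrict_space lborel {0<..<t}"
    let ?L = "\<lambda>\<tau>. LINT x|lborel. \<bar>\<kappa> * \<bar>u \<tau> x\<bar> powr p\<bar> * gauss (1 / real J) x"
    have fin: "(\<integral>\<^sup>+\<tau>. indicator {t - t0..} \<tau> * ennreal ((t - \<tau>) * exp (- (t - \<tau>) / 2) * ?L \<tau>) \<partial>?M) < \<infinity>"
      by (rule duhamel_time_bound[OF dt k t0 J])
    have temp: "AE \<tau> in ?M. (\<lambda>x. complex_of_real (\<kappa> * \<bar>u \<tau> x\<bar> powr p)) \<in> tempered_fun"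
      using dt unfolding has_duhamel_def by (auto elim!: eventually_mono)
    \<comment> \<open>A lower bound on the window for the weight
      \<open>(t - \<tau>) * exp (- (t - \<tau>) / 2)\<close>.\<close>
    define c where "c = \<theta> * exp (- t0 / 2)"
    have c: "c > 0" using \<theta> by (simp add: c_def)
    have uvM: "AE \<tau> in ?M. AE x in lborel. u \<tau> x = v \<tau> x"
    proof -
      have "AE \<tau> in lborel. \<tau> \<in> {0<..<t} \<longrightarrow> (AE x in lborel. u \<tau> x = v \<tau> x)"
        using uv by eventually_elim (use inT t in auto)
      then show ?thesis by (subst AE_restrict_space_iff) auto
    qed
    have "(\<integral>\<^sup>+\<tau>. ennreal c * (indicator {0<..} \<tau> * indicator {real i * \<theta>..real (Suc i) * \<theta>} \<tau> * a \<tau>) \<partial>lborel)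
      = (\<integral>\<^sup>+\<tau>. (ennreal c * (indicator {real i * \<theta>..real (Suc i) * \<theta>} \<tau> * a \<tau>)) * indicator {0<..<t} \<tau> \<partial>lborel)"
    proof (rule nn_integral_cong)
      fix \<tau> show "ennreal c * (indicator {0<..} \<tau> * indicator {real i * \<theta>..real (Suc i) * \<theta>} \<tau> * a \<tau>) =
        (ennreal c * (indicator {real i * \<theta>..real (Suc i) * \<theta>} \<tau> * a \<tau>)) * indicator {0<..<t} \<tau>"
        using t \<theta> by (auto simp: indicator_def algebra_simps)
    qed
    also have "\<dots> = (\<integral>\<^sup>+\<tau>. ennreal c * (indicator {real i * \<theta>..real (Suc i) * \<theta>} \<tau> * a \<tau>) \<partial>?M)"
      by (subst nn_integral_restrict_space) auto
    also have "\<dots> \<le> (\<integral>\<^sup>+\<tau>. indicator {t - t0..} \<tau> * ennreal ((t - \<tau>) * exp (- (t - \<tau>) / 2) * ?L \<tau>) \<partial>?M)"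
    proof (rule nn_integral_mono_AE)
      show "AE \<tau> in ?M. ennreal c * (indicator {real i * \<theta>..real (Suc i) * \<theta>} \<tau> * a \<tau>) \<le>
        indicator {t - t0..} \<tau> * ennreal ((t - \<tau>) * exp (- (t - \<tau>) / 2) * ?L \<tau>)"
        using temp uvM AE_space
      proof eventually_elim
        fix \<tau> assume temp: "(\<lambda>x. complex_of_real (\<kappa> * \<bar>u \<tau> x\<bar> powr p)) \<in> tempered_fun"
          and uv: "AE x in lborel. u \<tau> x = v \<tau> x" and \<tau>: "\<tau> \<in> space ?M"
        show "ennreal c * (indicator {real i * \<theta>..real (Suc i) * \<theta>} \<tau> * a \<tau>) \<le>
          indicator {t - t0..} \<tau> * ennreal ((t - \<tau>) * exp (- (t - \<tau>) / 2) * ?L \<tau>)"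
        proof (cases "\<tau> \<in> {real i * \<theta>..real (Suc i) * \<theta>}")
          case True
          then have ineqs: "\<theta> \<le> t - \<tau>" "t - \<tau> \<le> t0" using t \<theta> by (auto simp: algebra_simps)
          have J0: "1 / real J > 0" using J by simp
          have "a \<tau> = (\<integral>\<^sup>+x. ennreal (\<bar>\<kappa> * \<bar>u \<tau> x\<bar> powr p\<bar> * gauss (1 / real J) x) \<partial>lborel)"
            unfolding a_def using uv by (intro nn_integral_cong_AE) (auto elim!: eventually_mono simp: abs_mult k)
          also have "\<dots> = ennreal (?L \<tau>)"
            using tempered_fun_gauss(1)[OF temp J0] by (intro nn_integral_eq_integral) auto
          finally have a: "a \<tau> = ennreal (?L \<tau>)" .
          have L0: "?L \<tau> \<ge> 0" by (intro integral_nonneg_AE AE_I2) auto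
          have "c \<le> (t - \<tau>) * exp (- (t - \<tau>) / 2)"
            unfolding c_def using ineqs \<theta> by (intro mult_mono) auto
          then have "c * ?L \<tau> \<le> (t - \<tau>) * exp (- (t - \<tau>) / 2) * ?L \<tau>" using L0 by (rule mult_right_mono)
          then have "ennreal (c * ?L \<tau>) \<le> ennreal ((t - \<tau>) * exp (- (t - \<tau>) / 2) * ?L \<tau>)" by (rule ennreal_leI)
          then show ?thesis using True ineqs c L0 by (simp add: a ennreal_mult)
        qed simp
      qed
    qed
    also have "\<dots> < \<infinity>" by (rule fin)
    finally have "ennreal c * (\<integral>\<^sup>+\<tau>. indicator {0<..} \<tau> * indicator {real i * \<theta>..real (Suc i) * \<theta>} \<tau> * a \<tau> \<partial>lborel) < \<infinity>"
      by (subst (asm) nn_integral_cmult) measurable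
    then show ?thesis using c by (auto simp: ennreal_mult_less_top)
  qed
  have "(\<integral>\<^sup>+\<tau>. indicator {0<..<S} \<tau> * a \<tau> \<partial>lborel) \<le> (\<integral>\<^sup>+\<tau>. (\<Sum>i<m. indicator {0<..} \<tau> * indicator {real i * \<theta>..real (Suc i) * \<theta>} \<tau> * a \<tau>) \<partial>lborel)"
  proof (rule nn_integral_mono)
    fix \<tau> show "indicator {0<..<S} \<tau> * a \<tau> \<le> (\<Sum>i<m. indicator {0<..} \<tau> * indicator {real i * \<theta>..real (Suc i) * \<theta>} \<tau> * a \<tau>)"
    proof (cases "\<tau> \<in> {0<..<S}")
      case True
      define i where "i = nat \<lfloor>\<tau> / \<theta>\<rfloor>"
      have fl: "real i \<le> \<tau> / \<theta>" "\<tau> / \<theta> < real i + 1"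
        using True \<theta> unfolding i_def by (simp_all add: of_nat_nat)
      then have \<tau>: "real i * \<theta> \<le> \<tau>" "\<tau> \<le> real (Suc i) * \<theta>" using \<theta> by (auto simp: field_simps)
      have "\<tau> < S" using True by simp
      then have "real i * \<theta> < real m * \<theta>" using \<tau>(1) m(1) by linarith
      then have "real i < real m" using \<theta>(1) by (rule mult_right_less_imp_less[OF _ less_imp_le])
      then have "i < m" by simp
      then have "(\<lambda>i. indicator {0<..} \<tau> * indicator {real i * \<theta>..real (Suc i) * \<theta>} \<tau> * a \<tau>) i \<le> (\<Sum>i<m. indicator {0<..} \<tau> * indicator {real i * \<theta>..real (Suc i) * \<theta>} \<tau> * a \<tau>)"
        by (intro member_le_sum) auto
      then show ?thesis using True \<tau> by (simp del: of_nat_Suc)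
    qed simp
  qed
  also have "\<dots> = (\<Sum>i<m. \<integral>\<^sup>+\<tau>. indicator {0<..} \<tau> * indicator {real i * \<theta>..real (Suc i) * \<theta>} \<tau> * a \<tau> \<partial>lborel)"
    by (rule nn_integral_sum) measurable
  also have "\<dots> < \<infinity>" using piece by (auto simp: less_top[symmetric])
  finally show ?thesis by (simp add: a_def)
qed

subsection \<open>The adjoint of the Duhamel term\<close>

lemma integrable_pair_mult:
  fixes f :: "'a \<Rightarrow> real" and g :: "'b \<Rightarrow> real"
  assumes "sigma_finite_measure M" "sigma_finite_measure N" "integrable M f" "integrable N g"
  shows "integrable (M \<Otimes>\<^sub>M N) (\<lambda>z. f (fst z) * g (snd z))"
proof -
  interpret pair_sigma_finite M N using assms by (simp add: pair_sigma_finite_def)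
  have [measurable]: "f \<in> borel_measurable M" "g \<in> borel_measurable N" using assms by auto
  have "integrable (M \<Otimes>\<^sub>M N) (\<lambda>(x, y). f x * g y)"
  proof (rule Fubini_integrable)
    show "integrable M (\<lambda>x. LINT y|N. norm (case (x, y) of (x, y) \<Rightarrow> f x * g y))"
      using assms by (simp add: abs_mult)
    show "AE x in M. integrable N (\<lambda>y. case (x, y) of (x, y) \<Rightarrow> f x * g y)" using assms by simp
  qed measurable
  then show ?thesis by (simp add: case_prod_unfold)
qed

text \<open>One dominating Gaussian for both kernels and all times up to \<open>S\<close>, as
  required for Fubini in time and source.\<close>

lemma damped_gauss_uniform_bound:
  fixes x :: "'a::euclidean_space"
  assumes R: "R \<ge> 2" and t: "0 \<le> t" "t \<le> S"
  shows "norm (damped_gauss R t x) \<le> S * exp (8 * S\<^sup>2) * (8 * mom_const DIM('a)) * gauss (1 / (R + 1)) x"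
    and "norm (damped_gauss_lap R t x) \<le> S * exp (8 * S\<^sup>2) * (8 * mom_const DIM('a)) * gauss (1 / (R + 1)) x"
proof -
  have t2: "t\<^sup>2 \<le> S\<^sup>2" using t by (intro power_mono) auto
  have "t * exp (4 * t\<^sup>2) * (mom_const DIM('a) * gauss (1 / (R + 1)) x) \<le> S * exp (8 * S\<^sup>2) * (8 * mom_const DIM('a) * gauss (1 / (R + 1)) x)"
  proof (intro mult_mono)
    have "4 * t\<^sup>2 \<le> 8 * S\<^sup>2" using t2 zero_le_power2[of S] by linarith
    then show "exp (4 * t\<^sup>2) \<le> exp (8 * S\<^sup>2)" by simp
  qed (use t mom_const_pos[of "DIM('a)"] in auto)
  then show "norm (damped_gauss R t x) \<le> S * exp (8 * S\<^sup>2) * (8 * mom_const DIM('a)) * gauss (1 / (R + 1)) x"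
    using damped_gauss_bound(1)[OF R t(1), of x] by (simp add: mult_ac)
  have "t * exp (8 * t\<^sup>2) * (8 * mom_const DIM('a) * gauss (1 / (R + 1)) x) \<le> S * exp (8 * S\<^sup>2) * (8 * mom_const DIM('a) * gauss (1 / (R + 1)) x)"
    using t t2 mom_const_pos[of "DIM('a)"] by (intro mult_right_mono mult_mono) auto
  then show "norm (damped_gauss_lap R t x) \<le> S * exp (8 * S\<^sup>2) * (8 * mom_const DIM('a)) * gauss (1 / (R + 1)) x"
    using damped_gauss_bound(2)[OF R t(1), of x] by (simp add: mult_ac)
qed

text \<open>The adjoint of the Duhamel term.  Here \<open>q\<close> ranges over the source points, each with a time \<open>\<tau> q\<close>, a
  position \<open>X q\<close> and a density \<open>\<nu> q\<close>; initial data are sources at time \<open>0\<close>.\<close>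
lemma damped_adjoint:
  fixes X :: "'q \<Rightarrow> 'a::euclidean_space" and \<tau> \<nu> :: "'q \<Rightarrow> real"
  assumes Q: "sigma_finite_measure Q"
    and [measurable]: "\<tau> \<in> borel_measurable Q" "X \<in> borel_measurable Q" "\<nu> \<in> borel_measurable Q"
    and i\<nu>: "integrable Q (\<lambda>q. \<bar>\<nu> q\<bar> * gauss (1 / (R + 1)) (X q))"
    and \<tau>0: "\<And>q. \<nu> q \<noteq> 0 \<Longrightarrow> 0 \<le> \<tau> q"
    and R: "R \<ge> 2" and S: "S > 0"
    and h: "\<And>t. (h has_real_derivative h1 t) (at t)" "\<And>t. (h1 has_real_derivative h2 t) (at t)"
      "continuous_on UNIV h2" "h S = 0" "h1 S = 0"
    and H: "\<And>t. t \<in> {0..S} \<Longrightarrow> \<bar>h2 t - h1 t\<bar> \<le> H" "\<And>t. t \<in> {0..S} \<Longrightarrow> \<bar>h t\<bar> \<le> H"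
  defines "k \<equiv> \<lambda>t. LINT q|Q. indicator {..<t} (\<tau> q) *\<^sub>R (complex_of_real (\<nu> q) * damped_gauss R (t - \<tau> q) (X q))"
    and "kL \<equiv> \<lambda>t. LINT q|Q. indicator {..<t} (\<tau> q) *\<^sub>R (complex_of_real (\<nu> q) * damped_gauss_lap R (t - \<tau> q) (X q))"
  shows "integrable lborel (\<lambda>t. indicator {0<..<S} t *\<^sub>R (complex_of_real (h2 t - h1 t) * k t - complex_of_real (h t) * kL t))"
    "(LINT t|lborel. indicator {0<..<S} t *\<^sub>R (complex_of_real (h2 t - h1 t) * k t - complex_of_real (h t) * kL t)) =
      (LINT q|Q. complex_of_real (indicator {..<S} (\<tau> q) * (\<nu> q * (h (\<tau> q) * gauss (1 / R) (X q)))))"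
proof -
  interpret Q: sigma_finite_measure Q by fact
  interpret P: pair_sigma_finite lborel Q ..
  have ch: "continuous_on UNIV h" "continuous_on UNIV h1"
    by (intro continuous_at_imp_continuous_on ballI DERIV_isCont[OF h(1)] DERIV_isCont[OF h(2)])+
  have [measurable]: "h \<in> borel_measurable borel" "h1 \<in> borel_measurable borel" "h2 \<in> borel_measurable borel"
    using ch h(3) by (auto intro: borel_measurable_continuous_onI)
  define B where "B = S * exp (8 * S\<^sup>2) * (8 * mom_const DIM('a))"
  have B0: "B \<ge> 0" using S by (simp add: B_def mom_const_def)
  have H0: "H \<ge> 0" using H(2)[of 0] S by (auto intro: order_trans[OF abs_ge_zero])
  have K: "norm (damped_gauss R t x) \<le> B * gauss (1 / (R + 1)) x" "norm (damped_gauss_lap R t x) \<le> B * gauss (1 / (R + 1)) x"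
    if t: "0 \<le> t" "t \<le> S" for t and x :: 'a
    unfolding B_def by (rule damped_gauss_uniform_bound[OF R t])+
  have ik: "integrable Q (\<lambda>q. indicator {..<t} (\<tau> q) *\<^sub>R (complex_of_real (\<nu> q) * damped_gauss R (t - \<tau> q) (X q)))"
    "integrable Q (\<lambda>q. indicator {..<t} (\<tau> q) *\<^sub>R (complex_of_real (\<nu> q) * damped_gauss_lap R (t - \<tau> q) (X q)))"
    if t: "t \<in> {0<..<S}" for t
  proof -
    have *: "norm (indicator {..<t} (\<tau> q) *\<^sub>R (complex_of_real (\<nu> q) * D)) \<le> B * (\<bar>\<nu> q\<bar> * gauss (1 / (R + 1)) (X q))"
      if D: "0 \<le> t - \<tau> q \<Longrightarrow> t - \<tau> q \<le> S \<Longrightarrow> norm D \<le> B * gauss (1 / (R + 1)) (X q)" for q D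
    proof (cases "\<tau> q < t \<and> \<nu> q \<noteq> 0")
      case True
      then have "norm D \<le> B * gauss (1 / (R + 1)) (X q)" using \<tau>0[of q] t by (intro D) auto
      then have "\<bar>\<nu> q\<bar> * norm D \<le> \<bar>\<nu> q\<bar> * (B * gauss (1 / (R + 1)) (X q))" by (intro mult_left_mono) auto
      then show ?thesis using True by (simp add: norm_mult mult_ac)
    next
      case False
      have "0 \<le> B * (\<bar>\<nu> q\<bar> * gauss (1 / (R + 1)) (X q))" using B0 by simp
      then show ?thesis using False by (auto simp: indicator_def)
    qed
    show "integrable Q (\<lambda>q. indicator {..<t} (\<tau> q) *\<^sub>R (complex_of_real (\<nu> q) * damped_gauss R (t - \<tau> q) (X q)))"
      by (rule integrable_dominated[OF integrable_mult_right[OF i\<nu>, of B]]) (measurable, rule *, rule K)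
    show "integrable Q (\<lambda>q. indicator {..<t} (\<tau> q) *\<^sub>R (complex_of_real (\<nu> q) * damped_gauss_lap R (t - \<tau> q) (X q)))"
      by (rule integrable_dominated[OF integrable_mult_right[OF i\<nu>, of B]]) (measurable, rule *, rule K)
  qed
  \<comment> \<open>The integrand on the product of time and source space; the two orders of
    integration give the two sides of the claim.\<close>
  define Z where "Z t q = (indicator {0<..<S} t * indicator {..<t} (\<tau> q)) *\<^sub>R (complex_of_real (\<nu> q) *
     (complex_of_real (h2 t - h1 t) * damped_gauss R (t - \<tau> q) (X q) - complex_of_real (h t) * damped_gauss_lap R (t - \<tau> q) (X q)))" for t q
  have Zb: "norm (Z t q) \<le> (indicator {0..S} t * (2 * H * B)) * (\<bar>\<nu> q\<bar> * gauss (1 / (R + 1)) (X q))" for t q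
  proof (cases "t \<in> {0<..<S} \<and> \<tau> q < t \<and> \<nu> q \<noteq> 0")
    case True
    then have s: "0 \<le> t - \<tau> q" "t - \<tau> q \<le> S" "t \<in> {0..S}" using \<tau>0[of q] by auto
    let ?g = "gauss (1 / (R + 1)) (X q)"
    have "norm (complex_of_real (h2 t - h1 t) * damped_gauss R (t - \<tau> q) (X q)) \<le> H * (B * ?g)"
      unfolding norm_mult norm_of_real by (intro mult_mono H K s H0) auto
    moreover have "norm (complex_of_real (h t) * damped_gauss_lap R (t - \<tau> q) (X q)) \<le> H * (B * ?g)"
      unfolding norm_mult norm_of_real by (intro mult_mono H K s H0) auto
    ultimately have "norm (complex_of_real (h2 t - h1 t) * damped_gauss R (t - \<tau> q) (X q) - complex_of_real (h t) * damped_gauss_lap R (t - \<tau> q) (X q)) \<le> 2 * H * B * ?g"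
      using norm_triangle_ineq4[of "complex_of_real (h2 t - h1 t) * damped_gauss R (t - \<tau> q) (X q)" "complex_of_real (h t) * damped_gauss_lap R (t - \<tau> q) (X q)"]
      by (simp add: mult.assoc)
    then have "\<bar>\<nu> q\<bar> * norm (complex_of_real (h2 t - h1 t) * damped_gauss R (t - \<tau> q) (X q) - complex_of_real (h t) * damped_gauss_lap R (t - \<tau> q) (X q)) \<le> \<bar>\<nu> q\<bar> * (2 * H * B * ?g)"
      by (rule mult_left_mono) simp
    moreover have "norm (Z t q) = \<bar>\<nu> q\<bar> * norm (complex_of_real (h2 t - h1 t) * damped_gauss R (t - \<tau> q) (X q) - complex_of_real (h t) * damped_gauss_lap R (t - \<tau> q) (X q))"
      using True unfolding Z_def by (simp add: norm_mult)
    moreover have "(indicator {0..S} t * (2 * H * B)) * (\<bar>\<nu> q\<bar> * ?g) = \<bar>\<nu> q\<bar> * (2 * H * B * ?g)"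
      using s by simp
    ultimately show ?thesis by (simp only:)
  next
    case False
    then have "Z t q = 0" by (auto simp: Z_def indicator_def)
    then show ?thesis using H0 B0 by simp
  qed
  have iZ: "integrable (lborel \<Otimes>\<^sub>M Q) (\<lambda>(t, q). Z t q)"
  proof (rule integrable_dominated)
    show "integrable (lborel \<Otimes>\<^sub>M Q) (\<lambda>z. (indicator {0..S} (fst z) * (2 * H * B)) * (\<bar>\<nu> (snd z)\<bar> * gauss (1 / (R + 1)) (X (snd z))))"
      by (rule integrable_pair_mult[OF sigma_finite_lborel Q _ i\<nu>])
        (intro integrable_mult_left integrable_real_indicator; use S in simp)
    show "(\<lambda>(t, q). Z t q) \<in> borel_measurable (lborel \<Otimes>\<^sub>M Q)"
      unfolding Z_def indicator_def[of "{..<_}"] lessThan_iff by measurable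
    show "norm (case z of (t, q) \<Rightarrow> Z t q) \<le> (indicator {0..S} (fst z) * (2 * H * B)) * (\<bar>\<nu> (snd z)\<bar> * gauss (1 / (R + 1)) (X (snd z)))" for z
      using Zb by (simp add: case_prod_beta)
  qed
  \<comment> \<open>Sources first: the field generated by all of them, tested at time
    \<open>t\<close>.\<close>
  have qZ: "(LINT q|Q. Z t q) = indicator {0<..<S} t *\<^sub>R (complex_of_real (h2 t - h1 t) * k t - complex_of_real (h t) * kL t)" for t
  proof (cases "t \<in> {0<..<S}")
    case True
    let ?a = "\<lambda>q. complex_of_real (h2 t - h1 t) * (indicator {..<t} (\<tau> q) *\<^sub>R (complex_of_real (\<nu> q) * damped_gauss R (t - \<tau> q) (X q)))"
    let ?b = "\<lambda>q. complex_of_real (h t) * (indicator {..<t} (\<tau> q) *\<^sub>R (complex_of_real (\<nu> q) * damped_gauss_lap R (t - \<tau> q) (X q)))"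
    have "(LINT q|Q. Z t q) = (LINT q|Q. ?a q - ?b q)"
      using True by (intro Bochner_Integration.integral_cong) (auto simp: Z_def indicator_def algebra_simps)
    also have "\<dots> = (LINT q|Q. ?a q) - (LINT q|Q. ?b q)"
      by (intro Bochner_Integration.integral_diff integrable_mult_right ik True)
    also have "\<dots> = complex_of_real (h2 t - h1 t) * k t - complex_of_real (h t) * kL t"
      unfolding k_def kL_def by (simp only: integral_mult_right_zero)
    finally show ?thesis using True by simp
  qed (simp add: Z_def)
  \<comment> \<open>Time first: for a fixed source the damped equation leaves only its value against
    \<open>h\<close> and the unpropagated Gaussian.\<close>
  have tZ: "(LINT t|lborel. Z t q) = complex_of_real (indicator {..<S} (\<tau> q) * (\<nu> q * (h (\<tau> q) * gauss (1 / R) (X q))))" for q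
  proof (cases "\<tau> q < S \<and> \<nu> q \<noteq> 0")
    case True
    then have \<tau>: "0 \<le> \<tau> q" "\<tau> q \<le> S" using \<tau>0[of q] by auto
    let ?d = "\<lambda>t. complex_of_real (h2 t - h1 t) * damped_gauss R (t - \<tau> q) (X q) - complex_of_real (h t) * damped_gauss_lap R (t - \<tau> q) (X q)"
    have "(LINT t|lborel. Z t q) = (LINT t|lborel. complex_of_real (\<nu> q) * (indicator {\<tau> q..S} t *\<^sub>R ?d t))"
    proof (rule integral_cong_AE)
      \<comment> \<open>The open conditions in \<open>Z\<close> and the closed interval of
        \<open>damped_gauss_weak\<close> differ only at two times.\<close>
      show "AE t in lborel. Z t q = complex_of_real (\<nu> q) * (indicator {\<tau> q..S} t *\<^sub>R ?d t)"
        using AE_lborel_singleton[of "\<tau> q"] AE_lborel_singleton[of S]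
        by eventually_elim (use \<tau> in \<open>auto simp: Z_def indicator_def\<close>)
      show "(\<lambda>t. Z t q) \<in> borel_measurable lborel"
        unfolding Z_def indicator_def[of "{..<_}"] lessThan_iff by measurable
    qed measurable
    also have "\<dots> = complex_of_real (\<nu> q) * (LINT t|lborel. indicator {\<tau> q..S} t *\<^sub>R ?d t)"
      by (rule integral_mult_right_zero)
    also have "(LINT t|lborel. indicator {\<tau> q..S} t *\<^sub>R ?d t) = complex_of_real (h (\<tau> q) * gauss (1 / R) (X q))"
      by (rule damped_gauss_weak[OF R \<tau>(2) h(1,2) _ h(4,5)]) (rule continuous_on_subset[OF h(3)], simp)
    finally show ?thesis using True by simp
  next
    case False
    then have "Z t q = 0" for t by (auto simp: Z_def indicator_def)
    then show ?thesis using False by auto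
  qed
  show "integrable lborel (\<lambda>t. indicator {0<..<S} t *\<^sub>R (complex_of_real (h2 t - h1 t) * k t - complex_of_real (h t) * kL t))"
    using P.integrable_fst[OF iZ] by (simp add: qZ)
  show "(LINT t|lborel. indicator {0<..<S} t *\<^sub>R (complex_of_real (h2 t - h1 t) * k t - complex_of_real (h t) * kL t)) =
      (LINT q|Q. complex_of_real (indicator {..<S} (\<tau> q) * (\<nu> q * (h (\<tau> q) * gauss (1 / R) (X q)))))"
    using P.Fubini_integral[OF iZ] by (simp add: qZ tZ)
qed

lemma schwartz_Lp_2:
  assumes "f \<in> schwartz"
  shows "f \<in> Lp 2"
proof -
  have [measurable]: "f \<in> borel_measurable borel" by (rule schwartz_measurable[OF assms])
  have b: "norm (f x) \<le> schwartz_seminorm 0 f" for x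
    using schwartz_seminorm_upper[OF assms, of "[]" 0 x] by simp
  have "integrable lborel (\<lambda>x. (norm (f x))\<^sup>2)"
  proof (rule integrable_dominated)
    show "integrable lborel (\<lambda>x. schwartz_seminorm 0 f * norm (f x))"
      by (intro integrable_mult_right integrable_norm schwartz_integrable assms)
    show "norm ((norm (f x))\<^sup>2) \<le> schwartz_seminorm 0 f * norm (f x)" for x
      using b[of x] by (simp add: power2_eq_square mult_right_mono)
  qed measurable
  then show ?thesis by (simp add: Lp_2_iff)
qed

lemma has_L2_integral_pairing_eq:
  assumes "finite_measure M" "has_L2_integral M F I" "\<psi> \<in> Lp 2"
  shows "\<exists>g. integrable M g \<and> (AE t in M. g t = (LINT x|lborel. F t x * \<psi> x)) \<and> integral\<^sup>L M g = (LINT x|lborel. I x * \<psi> x)"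
proof (rule has_L2_integral_pairing[OF assms(1,2)])
  fix B assume "\<And>\<psi>. \<psi> \<in> Lp 2 \<Longrightarrow> \<exists>g. integrable M g \<and> (AE t in M. g t = (LINT x|lborel. F t x * \<psi> x)) \<and>
     integral\<^sup>L M g = (LINT x|lborel. I x * \<psi> x) \<and> (LINT t|M. norm (g t)) \<le> B * (Lp_norm 2 \<psi> + 1)"
  from this[OF assms(3)] show ?thesis by blast
qed

text \<open>Rewrites the tested Bochner integral as an absolutely convergent integral over times and
  positions. \<open>K\<close> stands for either propagated test function,
  \<open>damped_gauss\<close> or \<open>damped_gauss_lap\<close>, and \<open>rep\<close> is the
  transfer of the propagator to it.\<close>

lemma duhamel_slice:
  fixes u v :: "real \<Rightarrow> 'a::euclidean_space \<Rightarrow> real" and K :: "real \<Rightarrow> 'a \<Rightarrow> complex"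
  assumes d: "has_duhamel (\<lambda>v. \<kappa> * \<bar>v\<bar> powr p) u t I" and t: "0 < t" "t < S"
    and v[measurable]: "(\<lambda>(t, x). v t x) \<in> borel_measurable (lborel \<Otimes>\<^sub>M lborel)"
    and uv: "AE \<tau> in lborel. 0 < \<tau> \<and> \<tau> < t \<longrightarrow> (AE x in lborel. u \<tau> x = v \<tau> x)"
    and int: "integrable (lborel \<Otimes>\<^sub>M lborel) (\<lambda>q. \<bar>indicator {0<..<S} (fst q) * (\<kappa> * \<bar>v (fst q) (snd q)\<bar> powr p)\<bar> * gauss c (snd q))"
    and \<psi>: "\<psi> \<in> Lp 2"
    and rep: "\<And>F f \<sigma>. represents F (D_op \<sigma> (fun_dist f)) \<Longrightarrow> (LINT x|lborel. f x * K \<sigma> x) = (LINT x|lborel. F x * \<psi> x)"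
    and K[measurable]: "(\<lambda>q. K (t - fst q) (snd q)) \<in> borel_measurable (lborel \<Otimes>\<^sub>M lborel)"
    and Kb: "\<And>\<sigma> x. 0 \<le> \<sigma> \<Longrightarrow> \<sigma> \<le> S \<Longrightarrow> norm (K \<sigma> x) \<le> B * gauss c x"
  shows "(LINT x|lborel. I x * \<psi> x) =
    (LINT q|(lborel \<Otimes>\<^sub>M lborel). indicator {..<t} (fst q) *\<^sub>R (complex_of_real (indicator {0<..<S} (fst q) * (\<kappa> * \<bar>v (fst q) (snd q)\<bar> powr p)) * K (t - fst q) (snd q)))"
proof -
  let ?M = "restrict_space lborel {0<..<t}"
  let ?Z = "\<lambda>q. indicator {..<t} (fst q) *\<^sub>R (complex_of_real (indicator {0<..<S} (fst q) * (\<kappa> * \<bar>v (fst q) (snd q)\<bar> powr p)) * K (t - fst q) (snd q))"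
  obtain F where F: "AE \<tau> in ?M. (\<lambda>x. complex_of_real (\<kappa> * \<bar>u \<tau> x\<bar> powr p)) \<in> tempered_fun \<and> F \<tau> \<in> Lp 2 \<and>
      represents (F \<tau>) (D_op (t - \<tau>) (fun_dist (\<lambda>x. complex_of_real (\<kappa> * \<bar>u \<tau> x\<bar> powr p))))"
    and FI: "has_L2_integral ?M F I"
    using d unfolding has_duhamel_def by blast
  obtain g where g: "integrable ?M g" "AE \<tau> in ?M. g \<tau> = (LINT x|lborel. F \<tau> x * \<psi> x)" "integral\<^sup>L ?M g = (LINT x|lborel. I x * \<psi> x)"
    using has_L2_integral_pairing_eq[OF finite_measure_interval FI \<psi>] by blast
  have iZ: "integrable (lborel \<Otimes>\<^sub>M lborel) ?Z"
  proof (rule integrable_dominated[OF integrable_mult_right[OF int, of B]])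
    fix q :: "real \<times> 'a"
    let ?n = "indicator {0<..<S} (fst q) * (\<kappa> * \<bar>v (fst q) (snd q)\<bar> powr p)"
    show "norm (?Z q) \<le> B * (\<bar>?n\<bar> * gauss c (snd q))"
    proof (cases "0 < fst q \<and> fst q < t")
      case True
      then have "norm (K (t - fst q) (snd q)) \<le> B * gauss c (snd q)" using t by (intro Kb) auto
      then have "\<bar>?n\<bar> * norm (K (t - fst q) (snd q)) \<le> \<bar>?n\<bar> * (B * gauss c (snd q))" by (rule mult_left_mono) simp
      moreover have "norm (?Z q) = \<bar>?n\<bar> * norm (K (t - fst q) (snd q))" using True by (simp only: norm_scaleR norm_mult norm_of_real) simp
      ultimately show ?thesis by (simp only: mult_ac)
    next
      case False
      have "0 \<le> B * gauss c (snd q)" using Kb[of 0 "snd q"] t order_trans[OF norm_ge_zero] by fastforce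
      then have "0 \<le> \<bar>?n\<bar> * (B * gauss c (snd q))" by simp
      then have "0 \<le> B * (\<bar>?n\<bar> * gauss c (snd q))" by (simp only: mult_ac)
      moreover have "?Z q = 0" using False by (auto simp: indicator_def)
      ultimately show ?thesis by (simp only: norm_zero)
    qed
  qed measurable
  have "(LINT x|lborel. I x * \<psi> x) = (LINT \<tau>|?M. (LINT x|lborel. ?Z (\<tau>, x)))"
    unfolding g(3)[symmetric]
  proof (rule integral_cong_AE)
    show "g \<in> borel_measurable ?M" using g(1) by auto
    have "(\<lambda>\<tau>. LINT x|lborel. ?Z (\<tau>, x)) \<in> borel_measurable lborel" by measurable
    then show "(\<lambda>\<tau>. LINT x|lborel. ?Z (\<tau>, x)) \<in> borel_measurable ?M"
      by (rule measurable_restrict_space1)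
    have "AE \<tau> in lborel. \<tau> \<in> {0<..<t} \<longrightarrow> (AE x in lborel. u \<tau> x = v \<tau> x)"
      using uv by eventually_elim auto
    then have uvM: "AE \<tau> in ?M. AE x in lborel. u \<tau> x = v \<tau> x" by (subst AE_restrict_space_iff) auto
    show "AE \<tau> in ?M. g \<tau> = (LINT x|lborel. ?Z (\<tau>, x))"
      using g(2) F uvM AE_space
    proof eventually_elim
      fix \<tau> assume 1: "g \<tau> = (LINT x|lborel. F \<tau> x * \<psi> x)"
        and 2: "(\<lambda>x. complex_of_real (\<kappa> * \<bar>u \<tau> x\<bar> powr p)) \<in> tempered_fun \<and> F \<tau> \<in> Lp 2 \<and>
          represents (F \<tau>) (D_op (t - \<tau>) (fun_dist (\<lambda>x. complex_of_real (\<kappa> * \<bar>u \<tau> x\<bar> powr p))))"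
        and 3: "AE x in lborel. u \<tau> x = v \<tau> x" and \<tau>: "\<tau> \<in> space ?M"
      then have \<tau>t: "0 < \<tau>" "\<tau> < t" by (auto simp: space_restrict_space)
      have [measurable]: "(\<lambda>x. complex_of_real (\<kappa> * \<bar>u \<tau> x\<bar> powr p)) \<in> borel_measurable borel"
        using 2 by (auto simp: tempered_fun_def)
      have [measurable]: "(\<lambda>x. K (t - \<tau>) x) \<in> borel_measurable borel"
        using measurable_compose[OF _ K, of "\<lambda>x. (\<tau>, x)" borel] by simp
      have [measurable]: "v \<tau> \<in> borel_measurable borel"
        using measurable_compose[OF _ v, of "\<lambda>x. (\<tau>, x)" borel] by simp
      have "g \<tau> = (LINT x|lborel. complex_of_real (\<kappa> * \<bar>u \<tau> x\<bar> powr p) * K (t - \<tau>) x)"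
        unfolding 1 using 2 rep by metis
      also have "\<dots> = (LINT x|lborel. complex_of_real (\<kappa> * \<bar>v \<tau> x\<bar> powr p) * K (t - \<tau>) x)"
      proof (rule integral_cong_AE)
        show "AE x in lborel. complex_of_real (\<kappa> * \<bar>u \<tau> x\<bar> powr p) * K (t - \<tau>) x = complex_of_real (\<kappa> * \<bar>v \<tau> x\<bar> powr p) * K (t - \<tau>) x"
          using 3 by eventually_elim simp
      qed measurable
      also have "\<dots> = (LINT x|lborel. ?Z (\<tau>, x))" using \<tau>t t by simp
      finally show "g \<tau> = (LINT x|lborel. ?Z (\<tau>, x))" .
    qed
  qed
  also have "\<dots> = (LINT \<tau>|lborel. indicator {0<..<t} \<tau> *\<^sub>R (LINT x|lborel. ?Z (\<tau>, x)))"
    by (rule integral_restrict_space) simp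
  also have "\<dots> = (LINT \<tau>|lborel. (LINT x|lborel. ?Z (\<tau>, x)))"
    by (intro Bochner_Integration.integral_cong refl) (auto simp: indicator_def)
  also have "\<dots> = integral\<^sup>L (lborel \<Otimes>\<^sub>M lborel) ?Z"
    by (rule lborel_pair.integral_fst'[OF iZ])
  finally show ?thesis .
qed

subsection \<open>Test functions\<close>

text \<open>Either \<open>b \<le> a powr (p - 1)\<close>, and the first term alone dominates the
  product, or the second one does.\<close>

lemma young_powr:
  fixes a b p :: real
  assumes "p > 1" "a \<ge> 0" "b \<ge> 0"
  shows "a * b \<le> a powr p + b powr (p / (p - 1))"
proof (cases "a = 0 \<or> b = 0")
  case False
  then have a: "a > 0" and b: "b > 0" using assms by auto
  show ?thesis
  proof (cases "b \<le> a powr (p - 1)")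
    case True
    then have "a * b \<le> a * a powr (p - 1)" using a by (intro mult_left_mono) auto
    also have "\<dots> = a powr p" using a by (simp add: powr_diff)
    finally show ?thesis using powr_ge_zero[of b "p / (p - 1)"] by linarith
  next
    case False
    then have "(a powr (p - 1)) powr (1 / (p - 1)) \<le> b powr (1 / (p - 1))"
      using assms by (intro powr_mono2) auto
    then have "a \<le> b powr (1 / (p - 1))" using a assms by (simp add: powr_powr)
    then have "a * b \<le> b powr (1 / (p - 1)) * b powr 1" using b by (intro mult_mono) auto
    also have "\<dots> = b powr (p / (p - 1))"
      using assms by (simp only: powr_add[symmetric]) (simp add: field_simps)
    finally show ?thesis using powr_ge_zero[of a p] by linarith
  qed
qed (use assms in auto)

text \<open>Half of the exponential is spent on absorbing the power.\<close>

lemma powr_mult_exp_le: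
  fixes q :: real
  obtains C where "C > 0" "\<And>z. z \<ge> 0 \<Longrightarrow> (1 + z) powr q * exp (- z) \<le> C * exp (- z / 2)"
proof
  define m where "m = nat \<lceil>q\<rceil>"
  have m: "q \<le> real m" unfolding m_def by (rule real_nat_ceiling_ge)
  show "fact m * 2 ^ m * exp (1 / 2) > (0::real)" by simp
  fix z :: real assume z: "z \<ge> 0"
  have "(1 + z) powr q \<le> (1 + z) powr real m" using z m by (intro powr_mono) auto
  also have "\<dots> = 2 ^ m * ((1 + z) / 2) ^ m" using z by (simp add: powr_realpow power_divide)
  also have "\<dots> \<le> 2 ^ m * (fact m * exp ((1 + z) / 2))"
    using z by (intro mult_left_mono power_le_fact_mult_exp) auto
  finally have "(1 + z) powr q * exp (- z) \<le> 2 ^ m * (fact m * exp ((1 + z) / 2)) * exp (- z)"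
    by (rule mult_right_mono) simp
  also have "\<dots> = fact m * 2 ^ m * (exp ((1 + z) / 2) * exp (- z))" by (simp only: mult_ac)
  also have "exp ((1 + z) / 2) * exp (- z) = exp (1 / 2) * exp (- z / 2)"
    by (simp add: exp_add[symmetric] field_simps)
  finally show "(1 + z) powr q * exp (- z) \<le> fact m * 2 ^ m * exp (1 / 2) * exp (- z / 2)" by (simp only: mult_ac)
qed

text \<open>The Laplacian costs \<open>1 / R\<close>, as much as one time derivative of the cutoff;
  this balance fixes the parabolic scaling.\<close>

lemma gauss_lap_le:
  fixes x :: "'a::euclidean_space"
  assumes "R > 0"
  shows "\<bar>gauss_lap R x\<bar> \<le> (4 + 2 * DIM('a)) / R * (1 + (norm x)\<^sup>2 / R) * gauss (1 / R) x"
proof -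
  have "\<bar>4 * (norm x)\<^sup>2 / R\<^sup>2 - 2 * DIM('a) / R\<bar> \<le> 4 * (norm x)\<^sup>2 / R\<^sup>2 + 2 * DIM('a) / R"
    using assms by (intro abs_leI) auto
  also have "\<dots> \<le> (4 + 2 * DIM('a)) / R * (1 + (norm x)\<^sup>2 / R)"
    using assms by (simp add: field_simps power2_eq_square)
  finally have "\<bar>4 * (norm x)\<^sup>2 / R\<^sup>2 - 2 * DIM('a) / R\<bar> \<le> (4 + 2 * DIM('a)) / R * (1 + (norm x)\<^sup>2 / R)" .
  from mult_right_mono[OF this gauss_nonneg[of "1 / R" x]]
  show ?thesis unfolding gauss_lap_def abs_mult by (simp only: abs_of_nonneg[OF gauss_nonneg])
qed

text \<open>Left untruncated: a polynomial is smooth on the whole line, and on the interval up to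
  \<open>R\<close> where it is integrated its zero at \<open>R\<close> supplies the end
  conditions.\<close>

definition cutoff :: "nat \<Rightarrow> real \<Rightarrow> real \<Rightarrow> real" where
  "cutoff l R t = (1 - t / R) ^ l"

definition cutoff1 :: "nat \<Rightarrow> real \<Rightarrow> real \<Rightarrow> real" where
  "cutoff1 l R t = - (real l / R) * (1 - t / R) ^ (l - 1)"

definition cutoff2 :: "nat \<Rightarrow> real \<Rightarrow> real \<Rightarrow> real" where
  "cutoff2 l R t = real l * real (l - 1) / R\<^sup>2 * (1 - t / R) ^ (l - 2)"

lemma cutoff_derivative:
  "(cutoff l R has_real_derivative cutoff1 l R t) (at t)"
  "(cutoff1 l R has_real_derivative cutoff2 l R t) (at t)"
  "continuous_on UNIV (cutoff2 l R)"
  unfolding cutoff_def cutoff1_def cutoff2_def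
  by (auto intro!: derivative_eq_intros continuous_intros simp: power2_eq_square divide_inverse numeral_2_eq_2)

text \<open>The power \<open>l\<close> of the cutoff is taken so large that the powers of \<open>1 - t / R\<close> left over in Young's
  inequality are nonnegative.\<close>
lemma test_function_young:
  fixes p :: real
  assumes p: "p > 1"
  obtains l C where "l \<ge> 3" "C > 0"
    "\<And>R t V (x::'a::euclidean_space). \<lbrakk>R \<ge> 1; 0 < t; t < R; V \<ge> 0\<rbrakk> \<Longrightarrow>
      V * \<bar>(cutoff2 l R t - cutoff1 l R t) * gauss (1 / R) x - cutoff l R t * gauss_lap R x\<bar> \<le>
      cutoff l R t * (V powr p * gauss (1 / R) x) + C * R powr (- (p / (p - 1))) * gauss (1 / (2 * R)) x"
proof -
  define q where "q = p / (p - 1)"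
  have q: "q > 1" using p by (simp add: q_def field_simps)
  \<comment> \<open>\<open>l \<ge> 2 * q\<close> is the condition
    \<open>l - 2 - l / p \<ge> 0\<close> for the conjugate exponent \<open>q\<close>.\<close>
  define l where "l = max 3 (nat \<lceil>2 * q\<rceil>)"
  have l: "l \<ge> 3" "real l \<ge> 2 * q"
    using real_nat_ceiling_ge[of "2 * q"] by (auto simp: l_def)
  obtain C2 where C2: "C2 > 0" "\<And>z. z \<ge> 0 \<Longrightarrow> (1 + z) powr q * exp (- z) \<le> C2 * exp (- z / 2)"
    using powr_mult_exp_le by blast
  \<comment> \<open>\<open>2 * l^2\<close> comes from the two time derivatives of the cutoff,
    \<open>4 + 2 * DIM('a)\<close> from the Laplacian.\<close>
  define D where "D = 2 * (real l)\<^sup>2 + (4 + 2 * DIM('a))"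
  have D: "D > 0" using l by (simp add: D_def add_pos_pos)
  show ?thesis
  proof (rule that[of l "D powr q * C2"])
    show "l \<ge> 3" by (rule l)
    show "D powr q * C2 > 0" using D C2 by simp
    fix R t V :: real and x :: 'a assume R: "R \<ge> 1" and t: "0 < t" "t < R" and V: "V \<ge> 0"
    define y where "y = 1 - t / R"
    have y: "0 < y" "y \<le> 1" using R t by (auto simp: y_def)
    define z where "z = (norm x)\<^sup>2 / R"
    have z: "z \<ge> 0" using R by (simp add: z_def)
    let ?g = "gauss (1 / R) x"
    have g: "?g = exp (- z)" "gauss (1 / (2 * R)) x = exp (- z / 2)" by (auto simp: gauss_def z_def)
    define B where "B = D / R * (1 + z)"
    have B: "B \<ge> 0" using D R z by (simp add: B_def)
    \<comment> \<open>Both derivatives are reduced to the common size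
      \<open>y ^ (l - 2) / R\<close>; for the second one this uses \<open>R \<ge> 1\<close>.\<close>
    have c21: "\<bar>cutoff2 l R t - cutoff1 l R t\<bar> \<le> 2 * (real l)\<^sup>2 / R * y ^ (l - 2)"
    proof -
      have "y ^ (l - 1) \<le> y ^ (l - 2)" using y by (intro power_decreasing) auto
      then have "real l / R * y ^ (l - 1) \<le> (real l)\<^sup>2 / R * y ^ (l - 2)"
        using R l y by (intro mult_mono divide_right_mono) (auto simp: power2_eq_square)
      moreover have "real l * real (l - 1) / R\<^sup>2 \<le> (real l)\<^sup>2 / R"
      proof -
        have "real l * real (l - 1) \<le> (real l)\<^sup>2" unfolding power2_eq_square by (intro mult_left_mono) auto
        moreover have "R \<le> R\<^sup>2" using R by (simp add: power2_eq_square)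
        ultimately show ?thesis using R by (intro frac_le) auto
      qed
      then have "real l * real (l - 1) / R\<^sup>2 * y ^ (l - 2) \<le> (real l)\<^sup>2 / R * y ^ (l - 2)"
        using y by (intro mult_right_mono) auto
      moreover have "cutoff2 l R t - cutoff1 l R t = real l * real (l - 1) / R\<^sup>2 * y ^ (l - 2) + real l / R * y ^ (l - 1)"
        by (simp add: cutoff2_def cutoff1_def y_def)
      moreover have "0 \<le> real l * real (l - 1) / R\<^sup>2 * y ^ (l - 2)" "0 \<le> real l / R * y ^ (l - 1)"
        using y R by auto
      moreover have "2 * (real l)\<^sup>2 / R * y ^ (l - 2) = (real l)\<^sup>2 / R * y ^ (l - 2) + (real l)\<^sup>2 / R * y ^ (l - 2)" by simp
      moreover have "\<bar>a\<bar> \<le> e" if "c \<le> d" "b \<le> d" "a = b + c" "0 \<le> b" "0 \<le> c" "e = d + d" for a b c d e :: real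
        using that by simp
      ultimately show ?thesis by blast
    qed
    have "\<bar>(cutoff2 l R t - cutoff1 l R t) * ?g - cutoff l R t * gauss_lap R x\<bar> \<le> y ^ (l - 2) * B * ?g"
    proof -
      have "\<bar>(cutoff2 l R t - cutoff1 l R t) * ?g\<bar> \<le> (2 * (real l)\<^sup>2 / R * y ^ (l - 2)) * ?g * (1 + z)"
      proof -
        have "\<bar>(cutoff2 l R t - cutoff1 l R t) * ?g\<bar> \<le> (2 * (real l)\<^sup>2 / R * y ^ (l - 2)) * ?g"
          unfolding abs_mult abs_of_nonneg[OF gauss_nonneg] by (rule mult_right_mono[OF c21 gauss_nonneg])
        also have "\<dots> * 1 \<le> (2 * (real l)\<^sup>2 / R * y ^ (l - 2)) * ?g * (1 + z)"
          using z y R by (intro mult_left_mono) auto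
        finally show ?thesis by simp
      qed
      moreover have "\<bar>cutoff l R t * gauss_lap R x\<bar> \<le> y ^ (l - 2) * ((4 + 2 * DIM('a)) / R * (1 + z) * ?g)"
      proof -
        have "y ^ l \<le> y ^ (l - 2)" using y by (intro power_decreasing) auto
        moreover have "\<bar>cutoff l R t\<bar> = y ^ l" using y by (simp add: cutoff_def y_def[symmetric] power_abs)
        moreover have "\<bar>gauss_lap R x\<bar> \<le> (4 + 2 * DIM('a)) / R * (1 + z) * ?g"
          using gauss_lap_le[of R x] R by (simp add: z_def)
        ultimately show ?thesis unfolding abs_mult using y by (intro mult_mono) auto
      qed
      ultimately have "\<bar>(cutoff2 l R t - cutoff1 l R t) * ?g - cutoff l R t * gauss_lap R x\<bar> \<le>
        (2 * (real l)\<^sup>2 / R * y ^ (l - 2)) * ?g * (1 + z) + y ^ (l - 2) * ((4 + 2 * DIM('a)) / R * (1 + z) * ?g)"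
        by linarith
      also have "\<dots> = y ^ (l - 2) * B * ?g"
        unfolding B_def D_def by (simp add: add_divide_distrib algebra_simps)
      finally show ?thesis .
    qed
    then have "V * \<bar>(cutoff2 l R t - cutoff1 l R t) * ?g - cutoff l R t * gauss_lap R x\<bar> \<le> V * (y ^ (l - 2) * B * ?g)"
      using V by (rule mult_left_mono)
    \<comment> \<open>The power of \<open>y\<close> is split so that \<open>V\<close> receives
      \<open>y powr (l / p)\<close>, whose \<open>p\<close>-th power is the cutoff itself.\<close>
    also have "\<dots> = ((V * y powr (l / p)) * (B * y powr (real (l - 2) - l / p))) * ?g"
    proof -
      have "y powr (l / p) * y powr (real (l - 2) - l / p) = y ^ (l - 2)"
        using y by (simp add: powr_add[symmetric] powr_realpow)
      then show ?thesis by (simp add: mult_ac)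
    qed
    also have "\<dots> \<le> ((V * y powr (l / p)) powr p + (B * y powr (real (l - 2) - l / p)) powr q) * ?g"
      unfolding q_def using p V B by (intro mult_right_mono young_powr) auto
    also have "\<dots> \<le> (V powr p * y ^ l + B powr q) * ?g"
    proof (intro mult_right_mono add_mono)
      show "(V * y powr (l / p)) powr p \<le> V powr p * y ^ l"
        using V y p by (simp add: powr_mult powr_powr powr_realpow)
      have "0 \<le> real (l - 2) - l / p"
      proof -
        have "real l * (1 - 1 / p) \<ge> 2 * q * (1 - 1 / p)" using l p by (intro mult_right_mono) auto
        moreover have "2 * q * (1 - 1 / p) = 2" using p by (simp add: q_def field_simps)
        ultimately have "real l - real l / p \<ge> 2" by (simp add: algebra_simps)
        then show ?thesis using l by (simp add: of_nat_diff)
      qed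
      then have "y powr (real (l - 2) - l / p) \<le> 1" using y by (intro powr_le1) auto
      then have "B * y powr (real (l - 2) - l / p) \<le> B * 1" using B by (rule mult_left_mono)
      then show "(B * y powr (real (l - 2) - l / p)) powr q \<le> B powr q"
        using q B by (intro powr_mono2) auto
    qed auto
    also have "\<dots> = cutoff l R t * (V powr p * ?g) + B powr q * ?g"
      by (simp add: cutoff_def y_def algebra_simps)
    \<comment> \<open>The Gaussian absorbs the power of \<open>1 + z\<close> and keeps half of its
      rate, hence the doubled width in the claim.\<close>
    also have "B powr q * ?g = D powr q * R powr (- q) * ((1 + z) powr q * exp (- z))"
    proof -
      have "B = D * inverse R * (1 + z)" by (simp add: B_def divide_inverse)
      also have "\<dots> powr q = D powr q * inverse R powr q * (1 + z) powr q"
        using D R z by (simp only: powr_mult)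
      also have "inverse R powr q = R powr (- q)" using R by (simp add: powr_minus inverse_powr)
      finally show ?thesis unfolding g by simp
    qed
    also have "\<dots> \<le> D powr q * R powr (- q) * (C2 * exp (- z / 2))"
      using C2(2)[OF z] by (intro mult_left_mono) auto
    also have "D powr q * R powr (- q) * (C2 * exp (- z / 2)) = D powr q * C2 * R powr (- (p / (p - 1))) * gauss (1 / (2 * R)) x"
      unfolding g q_def by simp
    finally show "V * \<bar>(cutoff2 l R t - cutoff1 l R t) * ?g - cutoff l R t * gauss_lap R x\<bar> \<le>
      cutoff l R t * (V powr p * ?g) + D powr q * C2 * R powr (- (p / (p - 1))) * gauss (1 / (2 * R)) x"
      by simp
  qed
qed

text \<open>Extends the joint representative from the time set \<open>A\<close> to the whole line
  and takes real parts, so that later integrals run over plain \<open>lborel\<close>.\<close>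

lemma joint_representative:
  fixes u :: "real \<Rightarrow> 'a::euclidean_space \<Rightarrow> real"
  assumes "L2_measurable (restrict_space lborel A) (\<lambda>t. complex_of_real \<circ> u t)" and A: "A \<in> sets lborel" "A \<noteq> {}"
  obtains v where "(\<lambda>(t, x). v t x) \<in> borel_measurable (lborel \<Otimes>\<^sub>M lborel)"
    "AE t in lborel. t \<in> A \<longrightarrow> (AE x in lborel. u t x = v t x)"
proof -
  obtain G where G: "(\<lambda>(t, x). G t x) \<in> borel_measurable (restrict_space lborel A \<Otimes>\<^sub>M lborel)"
    "AE t in restrict_space lborel A. AE x in lborel. (complex_of_real \<circ> u t) x = G t x"
    using L2_measurable_joint[OF assms(1)] by blast
  obtain t1 where t1: "t1 \<in> A" using A by blast
  \<comment> \<open>Times outside \<open>A\<close> are sent to one fixed point of \<open>A\<close>,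
    which keeps the composition measurable.\<close>
  define r where "r t = (if t \<in> A then t else t1)" for t
  have "r \<in> measurable lborel (restrict_space lborel A)"
  proof (rule measurable_restrict_space2)
    show "r \<in> space lborel \<rightarrow> A" using t1 by (auto simp: r_def)
    show "r \<in> measurable lborel lborel" unfolding r_def using A by measurable
  qed
  then have [measurable]: "(\<lambda>z::real \<times> 'a. (r (fst z), snd z)) \<in> measurable (lborel \<Otimes>\<^sub>M lborel) (restrict_space lborel A \<Otimes>\<^sub>M lborel)"
    by (intro measurable_Pair measurable_compose[OF measurable_fst]) auto
  have "(\<lambda>z. Re (case (r (fst z), snd z) of (t, x) \<Rightarrow> G t x)) \<in> borel_measurable (lborel \<Otimes>\<^sub>M lborel)"
    using measurable_compose[OF \<open>(\<lambda>z::real \<times> 'a. (r (fst z), snd z)) \<in> measurable (lborel \<Otimes>\<^sub>M lborel) (restrict_space lborel A \<Otimes>\<^sub>M lborel)\<close> G(1)]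
    by simp
  then have "(\<lambda>(t, x). Re (G (r t) x)) \<in> borel_measurable (lborel \<Otimes>\<^sub>M lborel)"
    by (simp add: case_prod_unfold)
  moreover have "AE t in lborel. t \<in> A \<longrightarrow> (AE x in lborel. u t x = Re (G (r t) x))"
  proof -
    have "AE t in lborel. t \<in> A \<longrightarrow> (AE x in lborel. (complex_of_real \<circ> u t) x = G t x)"
      using G(2) A by (subst (asm) AE_restrict_space_iff) auto
    then show ?thesis
    proof eventually_elim
      case (elim t)
      show ?case
      proof
        assume "t \<in> A"
        with elim have "AE x in lborel. (complex_of_real \<circ> u t) x = G t x" by blast
        then show "AE x in lborel. u t x = Re (G (r t) x)"
          by eventually_elim (use \<open>t \<in> A\<close> in \<open>auto simp: r_def\<close>, metis Re_complex_of_real)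
      qed
    qed
  qed
  ultimately show ?thesis by (rule that)
qed

subsection \<open>The tested mild equation\<close>

lemma integrable_bounded_mult:
  fixes w g :: "'a \<Rightarrow> real"
  assumes "integrable M g" "w \<in> borel_measurable M" "\<And>x. \<bar>w x\<bar> \<le> W" "\<And>x. g x \<ge> 0"
  shows "integrable M (\<lambda>x. w x * g x)"
proof (rule integrable_dominated)
  show "integrable M (\<lambda>x. W * g x)" by (intro integrable_mult_right assms)
  show "(\<lambda>x. w x * g x) \<in> borel_measurable M" using assms by auto
  show "norm (w x * g x) \<le> W * g x" for x using assms(3,4) by (simp add: abs_mult mult_right_mono)
qed

text \<open>Testing the mild formulation at almost every time against a Gaussian and its Laplacian, integrating
  against the cutoff in time, and absorbing the right-hand side by Young's inequality.\<close>
lemma mild_solution_test: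
  fixes u :: "real \<Rightarrow> 'a::euclidean_space \<Rightarrow> real"
  assumes mild: "mild_solution (\<lambda>v. \<kappa> * \<bar>v\<bar> powr p) (\<lambda>_. 0) (\<lambda>x. \<kappa> * w x) \<epsilon> T u"
    and k: "\<bar>\<kappa>\<bar> = 1" and p: "p > 1"
    and w[measurable]: "w \<in> borel_measurable borel" and w0: "\<And>x. w x \<ge> 0" and wW: "\<And>x. w x \<le> W"
    and \<epsilon>: "\<epsilon> > 0" and R: "R \<ge> 2" "ereal R < T"
    and l: "l \<ge> 3" and C: "C > 0"
    and young: "\<And>t V (x::'a). \<lbrakk>0 < t; t < R; V \<ge> 0\<rbrakk> \<Longrightarrow>
      V * \<bar>(cutoff2 l R t - cutoff1 l R t) * gauss (1 / R) x - cutoff l R t * gauss_lap R x\<bar> \<le>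
      cutoff l R t * (V powr p * gauss (1 / R) x) + C * R powr (- (p / (p - 1))) * gauss (1 / (2 * R)) x"
  shows "\<epsilon> * (LINT x|lborel. w x * gauss (1 / R) x) \<le> R * (C * R powr (- (p / (p - 1))) * (2 * pi * R) powr (DIM('a) / 2))"
proof -
  let ?A = "{t. 0 < t \<and> ereal t < T}"
  have R0: "R > 0" using R by simp
  have Aset: "?A \<in> sets lborel"
  proof -
    have "(\<lambda>t. ereal t) \<in> borel_measurable borel" by measurable
    then have "{t \<in> space borel. ereal t < T} \<in> sets borel" by measurable
    moreover have "{t::real. 0 < t} \<in> sets borel" by measurable
    ultimately show ?thesis by (auto simp: Collect_conj_eq)
  qed
  have Ane: "?A \<noteq> {}" using R by (auto intro!: exI[of _ R])
  define N where "N = (\<lambda>v. \<kappa> * \<bar>v\<bar> powr p)"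
  let ?M = "restrict_space lborel ?A"
  have Linf: "Linf_L2 ?M (\<lambda>t. complex_of_real \<circ> u t)"
    and mildA: "AE t in ?M. \<exists>I. has_duhamel N u t I \<and>
         (\<forall>\<phi>\<in>schwartz. fun_dist (complex_of_real \<circ> u t) \<phi> =
            complex_of_real \<epsilon> * D_op t (fun_dist (\<lambda>x. complex_of_real (0 + \<kappa> * w x))) \<phi> +
            complex_of_real \<epsilon> * dt_D_op t (fun_dist (complex_of_real \<circ> (\<lambda>_. 0))) \<phi> +
            fun_dist I \<phi>)"
    using mild unfolding mild_solution_def Let_def N_def by blast+
  have uL2: "L2_measurable ?M (\<lambda>t. complex_of_real \<circ> u t)" using Linf by (simp add: Linf_L2_def)
  obtain v where v[measurable]: "(\<lambda>(t, x). v t x) \<in> borel_measurable (lborel \<Otimes>\<^sub>M lborel)"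
    and uvA: "AE t in lborel. t \<in> ?A \<longrightarrow> (AE x in lborel. u t x = v t x)"
    using joint_representative[OF uL2 Aset Ane] by blast
  have uv: "AE t in lborel. 0 < t \<and> ereal t < T \<longrightarrow> (AE x in lborel. u t x = v t x)"
    using uvA by eventually_elim simp
  have mildt: "AE t in lborel. t \<in> ?A \<longrightarrow> (\<exists>I. has_duhamel N u t I \<and>
         (\<forall>\<phi>\<in>schwartz. fun_dist (complex_of_real \<circ> u t) \<phi> =
            complex_of_real \<epsilon> * D_op t (fun_dist (\<lambda>x. complex_of_real (0 + \<kappa> * w x))) \<phi> +
            complex_of_real \<epsilon> * dt_D_op t (fun_dist (complex_of_real \<circ> (\<lambda>_. 0))) \<phi> +
            fun_dist I \<phi>))"
    using mildA Aset by (subst (asm) AE_restrict_space_iff) auto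
  have uLp: "AE t in lborel. t \<in> ?A \<longrightarrow> (complex_of_real \<circ> u t) \<in> Lp 2"
    using uL2 Aset unfolding L2_measurable_def by (subst (asm) AE_restrict_space_iff) auto
  have duh: "AE t in lborel. 0 < t \<and> ereal t < T \<longrightarrow> (\<exists>I. has_duhamel (\<lambda>v. \<kappa> * \<bar>v\<bar> powr p) u t I)"
    using mildt unfolding N_def by eventually_elim blast

  have [measurable]: "(\<lambda>q. v (fst q) (snd q)) \<in> borel_measurable (lborel \<Otimes>\<^sub>M lborel)"
    using v by (simp add: case_prod_unfold)
  \<comment> \<open>The nonlinearity before time \<open>R\<close>, regarded as a source density in
    time and space.\<close>
  define \<nu> where "\<nu> q = indicator {0<..<R} (fst q) * (\<kappa> * \<bar>v (fst q) (snd q)\<bar> powr p)" for q :: "real \<times> 'a"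
  have \<nu>[measurable]: "\<nu> \<in> borel_measurable (lborel \<Otimes>\<^sub>M lborel)" unfolding \<nu>_def by measurable
  have abs\<nu>: "\<bar>\<nu> q\<bar> = indicator {0<..<R} (fst q) * \<bar>v (fst q) (snd q)\<bar> powr p" for q
    by (simp add: \<nu>_def abs_mult k)
  have int: "integrable (lborel \<Otimes>\<^sub>M lborel) (\<lambda>q. \<bar>\<nu> q\<bar> * gauss (1 / (R + 1)) (snd q))"
  proof (rule integrableI_bounded)
    \<comment> \<open>The time integrability is stated for integer widths; rounding
      \<open>R + 1\<close> up only widens the Gaussian.\<close>
    define J where "J = nat \<lceil>R + 1\<rceil>"
    have J: "real J \<ge> R + 1" unfolding J_def by (rule real_nat_ceiling_ge)
    then have J2: "J \<ge> 2" using R by linarith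
    have "(\<integral>\<^sup>+q. ennreal (norm (\<bar>\<nu> q\<bar> * gauss (1 / (R + 1)) (snd q))) \<partial>(lborel \<Otimes>\<^sub>M lborel)) \<le>
       (\<integral>\<^sup>+q. indicator {0<..<R} (fst q) * ennreal (\<bar>v (fst q) (snd q)\<bar> powr p * gauss (1 / real J) (snd q)) \<partial>(lborel \<Otimes>\<^sub>M lborel))"
    proof (rule nn_integral_mono)
      fix q :: "real \<times> 'a"
      have "1 / real J \<le> 1 / (R + 1)" using J R by (intro divide_left_mono) auto
      then have "gauss (1 / (R + 1)) (snd q) \<le> gauss (1 / real J) (snd q)" by (rule gauss_mono)
      then show "ennreal (norm (\<bar>\<nu> q\<bar> * gauss (1 / (R + 1)) (snd q))) \<le> indicator {0<..<R} (fst q) * ennreal (\<bar>v (fst q) (snd q)\<bar> powr p * gauss (1 / real J) (snd q))"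
        unfolding abs\<nu> by (auto simp: indicator_def abs_mult intro!: ennreal_leI mult_left_mono)
    qed
    also have "\<dots> = (\<integral>\<^sup>+\<tau>. (\<integral>\<^sup>+x. indicator {0<..<R} \<tau> * ennreal (\<bar>v \<tau> x\<bar> powr p * gauss (1 / real J) x) \<partial>lborel) \<partial>lborel)"
      by (subst lborel.nn_integral_fst[symmetric]) auto
    also have "\<dots> = (\<integral>\<^sup>+\<tau>. indicator {0<..<R} \<tau> * (\<integral>\<^sup>+x. ennreal (\<bar>v \<tau> x\<bar> powr p * gauss (1 / real J) x) \<partial>lborel) \<partial>lborel)"
      by (intro nn_integral_cong nn_integral_cmult) measurable
    also have "\<dots> < \<infinity>"
      by (rule solution_time_integrable[OF duh k v uv R0 R(2) J2])
    finally show "(\<integral>\<^sup>+q. ennreal (norm (\<bar>\<nu> q\<bar> * gauss (1 / (R + 1)) (snd q))) \<partial>(lborel \<Otimes>\<^sub>M lborel)) < \<infinity>" .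
  qed measurable

  let ?h = "cutoff l R" and ?h1 = "cutoff1 l R" and ?h2 = "cutoff2 l R"
  have hR: "?h R = 0" "?h1 R = 0" using l R0 by (auto simp: cutoff_def cutoff1_def)
  have bounded: "\<exists>B. \<forall>t\<in>{0..R}. \<bar>f t\<bar> \<le> B" if "continuous_on UNIV f" for f :: "real \<Rightarrow> real"
  proof -
    have "compact (f ` {0..R})"
      by (intro compact_continuous_image continuous_on_subset[OF that]) auto
    then show ?thesis by (auto dest!: compact_imp_bounded simp: bounded_iff)
  qed
  have ch: "continuous_on UNIV ?h" "continuous_on UNIV ?h1"
    by (intro continuous_at_imp_continuous_on ballI DERIV_isCont[OF cutoff_derivative(1)] DERIV_isCont[OF cutoff_derivative(2)])+
  obtain H1 where H1: "\<forall>t\<in>{0..R}. \<bar>?h2 t - ?h1 t\<bar> \<le> H1"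
    using bounded[OF continuous_on_diff[OF cutoff_derivative(3) ch(2)]] by (rule exE)
  obtain H2 where H2: "\<forall>t\<in>{0..R}. \<bar>?h t\<bar> \<le> H2"
    using bounded[OF ch(1)] by (rule exE)
  define H where "H = max H1 H2"
  have H: "\<And>t. t \<in> {0..R} \<Longrightarrow> \<bar>?h2 t - ?h1 t\<bar> \<le> H" "\<And>t. t \<in> {0..R} \<Longrightarrow> \<bar>?h t\<bar> \<le> H"
    unfolding H_def le_max_iff_disj using H1 H2 by blast+
  have [measurable]: "?h \<in> borel_measurable borel" "?h1 \<in> borel_measurable borel" "?h2 \<in> borel_measurable borel"
    using ch cutoff_derivative(3) by (auto intro: borel_measurable_continuous_onI)

  have wabs: "\<bar>w x\<bar> \<le> W" for x using w0[of x] wW[of x] by simp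
  have iw: "integrable lborel (\<lambda>x. w x * gauss c x)" if "c > 0" for c
    by (rule integrable_bounded_mult[OF integrable_gauss[OF that] _ wabs]) auto
  \<comment> \<open>The initial velocity, regarded as a source density at time 0.\<close>
  define \<nu>0 where "\<nu>0 x = \<epsilon> * (\<kappa> * w x)" for x
  have int0: "integrable lborel (\<lambda>x. \<bar>\<nu>0 x\<bar> * gauss (1 / (R + 1)) x)"
    using iw[of "1 / (R + 1)"] R \<epsilon> w0 by (simp add: \<nu>0_def abs_mult k mult.assoc)
  \<comment> \<open>\<open>k0\<close> and \<open>k1\<close> are the linear and the Duhamel part of
    the solution tested against the Gaussian; the variants with \<open>L\<close> are tested against
    its Laplacian.\<close>
  define k0 where "k0 t = (LINT x|lborel. indicator {..<t} (0::real) *\<^sub>R (complex_of_real (\<nu>0 x) * damped_gauss R (t - 0) x))" for t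
  define k0L where "k0L t = (LINT x|lborel. indicator {..<t} (0::real) *\<^sub>R (complex_of_real (\<nu>0 x) * damped_gauss_lap R (t - 0) x))" for t
  define k1 where "k1 t = (LINT q|(lborel \<Otimes>\<^sub>M lborel). indicator {..<t} (fst q) *\<^sub>R (complex_of_real (\<nu> q) * damped_gauss R (t - fst q) (snd q)))" for t
  define k1L where "k1L t = (LINT q|(lborel \<Otimes>\<^sub>M lborel). indicator {..<t} (fst q) *\<^sub>R (complex_of_real (\<nu> q) * damped_gauss_lap R (t - fst q) (snd q)))" for t
  have sf: "sigma_finite_measure (lborel \<Otimes>\<^sub>M lborel :: (real \<times> 'a) measure)"
    by (rule sigma_finite_pair_measure[OF sigma_finite_lborel sigma_finite_lborel])
  have m0: "(\<lambda>x::'a. 0::real) \<in> borel_measurable lborel" "(\<lambda>x::'a. x) \<in> borel_measurable lborel" "\<nu>0 \<in> borel_measurable lborel"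
    unfolding \<nu>0_def by measurable
  have m1: "fst \<in> borel_measurable (lborel \<Otimes>\<^sub>M lborel :: (real \<times> 'a) measure)" "snd \<in> borel_measurable (lborel \<Otimes>\<^sub>M lborel :: (real \<times> 'a) measure)"
    by measurable
  have \<nu>t: "\<nu> q \<noteq> 0 \<Longrightarrow> 0 \<le> fst q" for q by (auto simp: \<nu>_def indicator_def split: if_splits)
  note adj0 = damped_adjoint[where Q = lborel and \<tau> = "\<lambda>_. 0" and X = "\<lambda>x. x" and \<nu> = \<nu>0 and R = R and S = R and h = ?h and ?h1.0 = ?h1 and ?h2.0 = ?h2 and H = H,
      OF sigma_finite_lborel m0 int0 order_refl R(1) R0 cutoff_derivative hR H]
  note adj1 = damped_adjoint[where Q = "lborel \<Otimes>\<^sub>M lborel" and \<tau> = fst and X = snd and \<nu> = \<nu> and R = R and S = R and h = ?h and ?h1.0 = ?h1 and ?h2.0 = ?h2 and H = H,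
      OF sf m1 \<nu> int \<nu>t R(1) R0 cutoff_derivative hR H]
  define e0 where "e0 t = indicator {0<..<R} t *\<^sub>R (complex_of_real (?h2 t - ?h1 t) * k0 t - complex_of_real (?h t) * k0L t)" for t
  define e1 where "e1 t = indicator {0<..<R} t *\<^sub>R (complex_of_real (?h2 t - ?h1 t) * k1 t - complex_of_real (?h t) * k1L t)" for t
  have e0: "integrable lborel e0" "integral\<^sup>L lborel e0 = (LINT x|lborel. complex_of_real (indicator {..<R} (0::real) * (\<nu>0 x * (?h 0 * gauss (1 / R) x))))"
    unfolding e0_def k0_def k0L_def by (rule adj0; assumption)+
  have e1: "integrable lborel e1" "integral\<^sup>L lborel e1 = (LINT q|(lborel \<Otimes>\<^sub>M lborel). complex_of_real (indicator {..<R} (fst q) * (\<nu> q * (?h (fst q) * gauss (1 / R) (snd q)))))"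
    unfolding e1_def k1_def k1L_def by (rule adj1; assumption)+
  \<comment> \<open>At almost every time in the interval this is the solution tested against
    \<open>(h'' - h') * gauss - h * gauss_lap\<close>, the adjoint damped wave operator applied to
    the test function.\<close>
  define E where "E t = indicator {0<..<R} t *\<^sub>R (complex_of_real (?h2 t - ?h1 t) * (k0 t + k1 t) - complex_of_real (?h t) * (k0L t + k1L t))" for t
  define Aw where "Aw = (LINT x|lborel. w x * gauss (1 / R) x)"
  define P where "P = (LINT q|(lborel \<Otimes>\<^sub>M lborel). indicator {0<..<R} (fst q) * \<bar>v (fst q) (snd q)\<bar> powr p * (?h (fst q) * gauss (1 / R) (snd q)))"
  have E_split: "E = (\<lambda>t. e0 t + e1 t)"
    by (simp add: E_def e0_def e1_def fun_eq_iff algebra_simps)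
  have iE: "integrable lborel E"
    unfolding E_split by (intro Bochner_Integration.integrable_add e0(1) e1(1))
  have "integral\<^sup>L lborel E = (LINT x|lborel. complex_of_real (indicator {..<R} (0::real) * (\<nu>0 x * (?h 0 * gauss (1 / R) x)))) +
     (LINT q|(lborel \<Otimes>\<^sub>M lborel). complex_of_real (indicator {..<R} (fst q) * (\<nu> q * (?h (fst q) * gauss (1 / R) (snd q)))))"
    unfolding E_split Bochner_Integration.integral_add[OF e0(1) e1(1)] e0(2) e1(2) ..
  also have "(LINT x|lborel. complex_of_real (indicator {..<R} (0::real) * (\<nu>0 x * (?h 0 * gauss (1 / R) x)))) = complex_of_real (\<kappa> * (\<epsilon> * Aw))"
  proof -
    have "(LINT x|lborel. indicator {..<R} (0::real) * (\<nu>0 x * (?h 0 * gauss (1 / R) x))) = (LINT x|lborel. (\<kappa> * \<epsilon>) * (w x * gauss (1 / R) x))"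
      using R0 by (intro Bochner_Integration.integral_cong) (auto simp: \<nu>0_def cutoff_def)
    then show ?thesis unfolding integral_complex_of_real Aw_def by simp
  qed
  also have "(LINT q|(lborel \<Otimes>\<^sub>M lborel). complex_of_real (indicator {..<R} (fst q) * (\<nu> q * (?h (fst q) * gauss (1 / R) (snd q))))) = complex_of_real (\<kappa> * P)"
  proof -
    have "(LINT q|(lborel \<Otimes>\<^sub>M lborel). indicator {..<R} (fst q) * (\<nu> q * (?h (fst q) * gauss (1 / R) (snd q)))) =
      (LINT q|(lborel \<Otimes>\<^sub>M lborel). \<kappa> * (indicator {0<..<R} (fst q) * \<bar>v (fst q) (snd q)\<bar> powr p * (?h (fst q) * gauss (1 / R) (snd q))))"
      by (intro Bochner_Integration.integral_cong) (auto simp: \<nu>_def indicator_def)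
    then show ?thesis unfolding integral_complex_of_real P_def by simp
  qed
  \<comment> \<open>Data and nonlinearity carry the same sign \<kappa>, so their contributions add
    up and none of the left-hand side is lost in the norm.\<close>
  finally have intE: "integral\<^sup>L lborel E = complex_of_real (\<kappa> * (\<epsilon> * Aw + P))" by (simp add: algebra_simps)
  have Aw0: "Aw \<ge> 0" unfolding Aw_def using w0 by (intro integral_nonneg_AE AE_I2) auto
  have P0: "P \<ge> 0" unfolding P_def
  proof (intro integral_nonneg_AE AE_I2)
    fix q :: "real \<times> 'a"
    show "0 \<le> indicator {0<..<R} (fst q) * \<bar>v (fst q) (snd q)\<bar> powr p * (?h (fst q) * gauss (1 / R) (snd q))"
      by (cases "fst q \<in> {0<..<R}") (auto simp: cutoff_def)
  qed
  have normE: "\<epsilon> * Aw + P \<le> (LINT t|lborel. norm (E t))"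
  proof -
    have "\<epsilon> * Aw + P = norm (integral\<^sup>L lborel E)"
      unfolding intE norm_of_real abs_mult k using Aw0 P0 \<epsilon> by simp
    also have "\<dots> \<le> (LINT t|lborel. norm (E t))" by (rule integral_norm_bound)
    finally show ?thesis .
  qed

  have iP: "integrable (lborel \<Otimes>\<^sub>M lborel) (\<lambda>q. indicator {0<..<R} (fst q) * \<bar>v (fst q) (snd q)\<bar> powr p * (?h (fst q) * gauss (1 / R) (snd q)))"
  proof (rule integrable_dominated[OF int])
    fix q :: "real \<times> 'a"
    have "gauss (1 / R) (snd q) \<le> gauss (1 / (R + 1)) (snd q)" using R0 by (intro gauss_mono) (simp add: field_simps)
    moreover have "\<bar>?h (fst q)\<bar> \<le> 1" if "fst q \<in> {0<..<R}"
      using that R0 unfolding cutoff_def power_abs by (intro power_le_one) (auto simp: field_simps)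
    ultimately show "norm (indicator {0<..<R} (fst q) * \<bar>v (fst q) (snd q)\<bar> powr p * (?h (fst q) * gauss (1 / R) (snd q))) \<le> \<bar>\<nu> q\<bar> * gauss (1 / (R + 1)) (snd q)"
      unfolding abs\<nu> using mult_mono[of "\<bar>?h (fst q)\<bar>" 1 "gauss (1 / R) (snd q)" "gauss (1 / (R + 1)) (snd q)"]
      by (cases "fst q \<in> {0<..<R}") (auto simp: abs_mult mult.assoc intro!: mult_left_mono)
  qed measurable
  \<comment> \<open>The part of Young's bound that reproduces the nonlinear term; its time integral
    is \<open>P\<close>.\<close>
  define a where "a t = (LINT x|lborel. indicator {0<..<R} t * \<bar>v t x\<bar> powr p * (?h t * gauss (1 / R) x))" for t
  have ia: "integrable lborel a" unfolding a_def
    using lborel_pair.integrable_fst'[OF iP] by simp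
  have Pa: "integral\<^sup>L lborel a = P" unfolding a_def P_def
    using lborel_pair.integral_fst'[OF iP] by simp
  define c where "c = C * R powr (- (p / (p - 1))) * (2 * pi * R) powr (DIM('a) / 2)"
  have aex: "AE t in lborel. integrable lborel (\<lambda>x. indicator {0<..<R} t * \<bar>v t x\<bar> powr p * (?h t * gauss (1 / R) x))"
    using lborel_pair.AE_integrable_fst'[OF iP] by simp

  \<comment> \<open>At a fixed time the mild equation identifies \<open>E t\<close> with an integral
    of \<open>v t\<close>, to which Young's inequality applies pointwise; \<open>c\<close> is the
    integral of its remainder.\<close>
  have key: "AE t in lborel. norm (E t) \<le> a t + indicator {0<..<R} t * c"
    using mildt uLp uv aex
  proof eventually_elim
    fix t
    assume 1: "t \<in> ?A \<longrightarrow> (\<exists>I. has_duhamel N u t I \<and>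
         (\<forall>\<phi>\<in>schwartz. fun_dist (complex_of_real \<circ> u t) \<phi> =
            complex_of_real \<epsilon> * D_op t (fun_dist (\<lambda>x. complex_of_real (0 + \<kappa> * w x))) \<phi> +
            complex_of_real \<epsilon> * dt_D_op t (fun_dist (complex_of_real \<circ> (\<lambda>_. 0))) \<phi> +
            fun_dist I \<phi>))"
      and 2: "t \<in> ?A \<longrightarrow> (complex_of_real \<circ> u t) \<in> Lp 2"
      and 3: "0 < t \<and> ereal t < T \<longrightarrow> (AE x in lborel. u t x = v t x)"
      and 4: "integrable lborel (\<lambda>x. indicator {0<..<R} t * \<bar>v t x\<bar> powr p * (?h t * gauss (1 / R) x))"
    show "norm (E t) \<le> a t + indicator {0<..<R} t * c"
    proof (cases "t \<in> {0<..<R}")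
      case False
      then show ?thesis by (simp add: E_def a_def)
    next
      case True
      then have t: "0 < t" "t < R" by auto
      then have tT: "ereal t < T" using R(2) by (metis ereal_less_eq(3) less_imp_le order_le_less_trans)
      then have tA: "t \<in> ?A" using t by simp
      obtain I where I: "has_duhamel N u t I" and eqI: "\<And>\<phi>. \<phi> \<in> schwartz \<Longrightarrow> fun_dist (complex_of_real \<circ> u t) \<phi> =
            complex_of_real \<epsilon> * D_op t (fun_dist (\<lambda>x. complex_of_real (0 + \<kappa> * w x))) \<phi> +
            complex_of_real \<epsilon> * dt_D_op t (fun_dist (complex_of_real \<circ> (\<lambda>_. 0))) \<phi> + fun_dist I \<phi>"
        using 1 tA by blast
      have uL: "(complex_of_real \<circ> u t) \<in> Lp 2" using 2 tA by blast
      have uvt: "AE x in lborel. u t x = v t x" using 3 t tT by blast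
      have uvpast: "AE \<tau> in lborel. 0 < \<tau> \<and> \<tau> < t \<longrightarrow> (AE x in lborel. u \<tau> x = v \<tau> x)"
        using uv by eventually_elim (metis tT less_ereal.simps(1) order_less_trans)
      \<comment> \<open>The initial position is zero, so the term with the differentiated propagator
        vanishes.\<close>
      have dt0: "dt_D_op t (fun_dist (complex_of_real \<circ> (\<lambda>_. 0))) \<phi> = 0" for \<phi> :: "'a \<Rightarrow> complex"
        by (simp add: dt_D_op_def fourier_multiplier_def dist_inv_fourier_def dist_mult_def dist_fourier_def fun_dist_def)
      have um[measurable]: "(\<lambda>x. complex_of_real (u t x)) \<in> borel_measurable borel"
        using Lp_2_measurable[OF uL] by (simp add: comp_def)
      have vm[measurable]: "v t \<in> borel_measurable borel"
        using measurable_compose[OF _ v, of "\<lambda>x. (t, x)" borel] by simp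
      have toV: "(LINT x|lborel. complex_of_real (u t x) * \<psi> x) = (LINT x|lborel. complex_of_real (v t x) * \<psi> x)"
        if [measurable]: "\<psi> \<in> borel_measurable borel" for \<psi>
        using uvt by (intro integral_cong_AE) (auto elim!: eventually_mono)
      let ?g = "\<lambda>x::'a. complex_of_real (gauss (1 / R) x)" and ?gl = "\<lambda>x::'a. complex_of_real (gauss_lap R x)"
      have sg: "?g \<in> schwartz" "?gl \<in> schwartz" using R0 by (auto intro: gauss_schwartz gauss_lap_schwartz)
      have bd: "norm (damped_gauss R \<sigma> x) \<le> (R * exp (8 * R\<^sup>2) * (8 * mom_const DIM('a))) * gauss (1 / (R + 1)) x"
        "norm (damped_gauss_lap R \<sigma> x) \<le> (R * exp (8 * R\<^sup>2) * (8 * mom_const DIM('a))) * gauss (1 / (R + 1)) x"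
        if s: "0 \<le> \<sigma>" "\<sigma> \<le> R" for \<sigma> and x :: 'a
        by (rule damped_gauss_uniform_bound[OF R(1) s])+
      \<comment> \<open>\<open>duhamel_slice\<close> turns the Duhamel term into \<open>k1\<close>,
        and \<open>D_op_gauss\<close> turns the linear term into \<open>k0\<close>.\<close>
      have f1: "(LINT x|lborel. complex_of_real (v t x) * ?g x) = k0 t + k1 t"
      proof -
        have "(LINT x|lborel. I x * ?g x) = k1 t"
          unfolding k1_def \<nu>_def
          by (rule duhamel_slice[OF I[unfolded N_def] t v uvpast int[unfolded \<nu>_def] schwartz_Lp_2[OF sg(1)] represents_damped_gauss(1)[OF _ R(1)] _ bd(1)])
            measurable
        moreover have "complex_of_real \<epsilon> * D_op t (fun_dist (\<lambda>x. complex_of_real (0 + \<kappa> * w x))) ?g = k0 t"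
          unfolding D_op_gauss(1)[OF R(1)] k0_def fun_dist_def
          using t by (simp add: \<nu>0_def mult.assoc)
        ultimately show ?thesis using eqI[OF sg(1)] dt0 toV[of ?g]
          by (simp add: fun_dist_def)
      qed
      have f2: "(LINT x|lborel. complex_of_real (v t x) * ?gl x) = k0L t + k1L t"
      proof -
        have "(LINT x|lborel. I x * ?gl x) = k1L t"
          unfolding k1L_def \<nu>_def
          by (rule duhamel_slice[OF I[unfolded N_def] t v uvpast int[unfolded \<nu>_def] schwartz_Lp_2[OF sg(2)] represents_damped_gauss(2)[OF _ R(1)] _ bd(2)])
            measurable
        moreover have "complex_of_real \<epsilon> * D_op t (fun_dist (\<lambda>x. complex_of_real (0 + \<kappa> * w x))) ?gl = k0L t"
          unfolding D_op_gauss(2)[OF R(1)] k0L_def fun_dist_def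
          using t by (simp add: \<nu>0_def mult.assoc)
        ultimately show ?thesis using eqI[OF sg(2)] dt0 toV[of ?gl]
          by (simp add: fun_dist_def)
      qed
      have vi: "integrable lborel (\<lambda>x. complex_of_real (v t x) * \<psi> x)" if "\<psi> \<in> schwartz" for \<psi>
      proof -
        have [measurable]: "\<psi> \<in> borel_measurable borel" by (rule schwartz_measurable[OF that])
        have "integrable lborel (\<lambda>x. complex_of_real (u t x) * \<psi> x)"
          using Lp_2_Cauchy_Schwarz(1)[OF uL schwartz_Lp_2[OF that]] by simp
        then show ?thesis
          by (rule integrable_cong_AE_imp) (measurable, use uvt in \<open>auto elim!: eventually_mono\<close>)
      qed
      let ?q = "\<lambda>x. (?h2 t - ?h1 t) * gauss (1 / R) x - ?h t * gauss_lap R x"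
      have "complex_of_real (?h2 t - ?h1 t) * (k0 t + k1 t) - complex_of_real (?h t) * (k0L t + k1L t) =
        (LINT x|lborel. complex_of_real (?h2 t - ?h1 t) * (complex_of_real (v t x) * ?g x)) - (LINT x|lborel. complex_of_real (?h t) * (complex_of_real (v t x) * ?gl x))"
        unfolding f1[symmetric] f2[symmetric] by (simp only: integral_mult_right_zero)
      also have "\<dots> = (LINT x|lborel. complex_of_real (?h2 t - ?h1 t) * (complex_of_real (v t x) * ?g x) - complex_of_real (?h t) * (complex_of_real (v t x) * ?gl x))"
        by (intro Bochner_Integration.integral_diff[symmetric] integrable_mult_right vi sg)
      also have "\<dots> = (LINT x|lborel. complex_of_real (v t x * ?q x))"
        by (intro Bochner_Integration.integral_cong refl) (simp add: algebra_simps)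
      finally have Et: "E t = (LINT x|lborel. complex_of_real (v t x * ?q x))" using True by (simp add: E_def)
      have iq: "integrable lborel (\<lambda>x. complex_of_real (v t x * ?q x))"
      proof -
        have "integrable lborel (\<lambda>x. complex_of_real (?h2 t - ?h1 t) * (complex_of_real (v t x) * ?g x) - complex_of_real (?h t) * (complex_of_real (v t x) * ?gl x))"
          by (intro Bochner_Integration.integrable_diff integrable_mult_right vi sg)
        then show ?thesis by (simp add: algebra_simps)
      qed
      have i4: "integrable lborel (\<lambda>x. ?h t * (\<bar>v t x\<bar> powr p * gauss (1 / R) x))"
        using 4 True by (simp add: mult_ac)
      have i5: "integrable lborel (\<lambda>x::'a. C * R powr (- (p / (p - 1))) * gauss (1 / (2 * R)) x)"
        using R0 by (intro integrable_mult_right integrable_gauss) simp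
      have ir: "integrable lborel (\<lambda>x. ?h t * (\<bar>v t x\<bar> powr p * gauss (1 / R) x) + C * R powr (- (p / (p - 1))) * gauss (1 / (2 * R)) x)"
        by (rule Bochner_Integration.integrable_add[OF i4 i5])
      have "norm (E t) \<le> (LINT x|lborel. ?h t * (\<bar>v t x\<bar> powr p * gauss (1 / R) x) + C * R powr (- (p / (p - 1))) * gauss (1 / (2 * R)) x)"
        unfolding Et
      proof (rule Bochner_Integration.integral_norm_bound_integral[OF iq ir])
        fix x
        show "norm (complex_of_real (v t x * ?q x)) \<le> ?h t * (\<bar>v t x\<bar> powr p * gauss (1 / R) x) + C * R powr (- (p / (p - 1))) * gauss (1 / (2 * R)) x"
          using young[OF t, of "\<bar>v t x\<bar>" x] unfolding norm_of_real abs_mult by simp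
      qed
      also have "\<dots> = (LINT x|lborel. ?h t * (\<bar>v t x\<bar> powr p * gauss (1 / R) x)) + (LINT x|lborel. C * R powr (- (p / (p - 1))) * gauss (1 / (2 * R)) (x::'a))"
        by (rule Bochner_Integration.integral_add[OF i4 i5])
      also have "(LINT x|lborel. ?h t * (\<bar>v t x\<bar> powr p * gauss (1 / R) x)) = a t"
        unfolding a_def using True by (simp add: mult_ac)
      also have "(LINT x|lborel. C * R powr (- (p / (p - 1))) * gauss (1 / (2 * R)) (x::'a)) = c"
        using R0 by (simp add: integral_gauss c_def mult_ac)
      finally show ?thesis using True by simp
    qed
  qed
  have "(LINT t|lborel. norm (E t)) \<le> (LINT t|lborel. a t + indicator {0<..<R} t * c)"
    using R0 by (intro integral_mono_AE integrable_norm iE Bochner_Integration.integrable_add ia integrable_mult_left integrable_real_indicator key) auto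
  also have "\<dots> = integral\<^sup>L lborel a + (LINT t|lborel. indicator {0<..<R} t * c)"
    using R0 by (intro Bochner_Integration.integral_add ia integrable_mult_left integrable_real_indicator) auto
  \<comment> \<open>\<open>P\<close> is a finite real number by \<open>iP\<close>, so it cancels
    against the same term in \<open>normE\<close>.\<close>
  also have "\<dots> = P + R * c" using R0 by (simp add: Pa)
  finally have "\<epsilon> * Aw \<le> R * c" using normE by linarith
  then show ?thesis by (simp add: Aw_def c_def)
qed

subsection \<open>Fourier transforms of Schwartz and square-integrable functions\<close>

lemma iter_partial_append: "iter_partial bs (iter_partial cs f) = iter_partial (bs @ cs) f"
  by (induction bs) auto

lemma schwartz_iter_partial:
  assumes "f \<in> schwartz" "set cs \<subseteq> Basis"
  shows "iter_partial cs f \<in> schwartz"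
  using assms unfolding schwartz_def smooth_def by (simp add: iter_partial_append)

lemma schwartz_has_derivative:
  assumes "f \<in> schwartz"
  shows "(f has_derivative frechet_derivative f (at x)) (at x)"
proof -
  have "f differentiable_on UNIV"
    using assms unfolding schwartz_def smooth_def by (auto dest: spec[of _ "[]"])
  then show ?thesis by (simp add: differentiable_on_def frechet_derivative_works)
qed

lemma integral_translate:
  fixes f :: "'a::euclidean_space \<Rightarrow> complex"
  assumes [measurable]: "f \<in> borel_measurable borel"
  shows "(LINT x|lborel. f (x + a)) = integral\<^sup>L lborel f"
    "integrable lborel f \<Longrightarrow> integrable lborel (\<lambda>x. f (x + a))"
proof -
  have d: "distr lborel borel (\<lambda>x. a + x) = (lborel :: 'a measure)" by (rule lborel_distr_plus)
  have "integral\<^sup>L (distr lborel borel (\<lambda>x. a + x)) f = (LINT x|lborel. f (a + x))"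
    by (rule integral_distr) measurable
  then show "(LINT x|lborel. f (x + a)) = integral\<^sup>L lborel f" unfolding d by (simp only: add.commute[of _ a])
  assume "integrable lborel f"
  then have "integrable (distr lborel borel (\<lambda>x. a + x)) f" unfolding d .
  then show "integrable lborel (\<lambda>x. f (x + a))" by (subst (asm) integrable_distr_eq) (auto simp: add.commute)
qed

text \<open>Difference quotients have integral zero by translation invariance and converge to the
  partial derivative under an integrable bound. This plays the role of integration by parts on the
  whole space.\<close>

lemma integral_partial_eq_0:
  fixes F :: "'a::euclidean_space \<Rightarrow> complex"
  assumes F: "\<And>x. (F has_derivative F' x) (at x)" and b: "norm b = 1"
    and i: "integrable lborel F"
    and bd: "\<And>x. norm (F' x b) \<le> C * (1 + (norm x)\<^sup>2) powr (- real DIM('a))"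
    and m[measurable]: "(\<lambda>x. F' x b) \<in> borel_measurable borel"
  shows "(LINT x|lborel. F' x b) = 0"
proof -
  define h where "h k = 1 / real (Suc k)" for k
  have h: "h k > 0" "h k \<le> 1" for k by (auto simp: h_def)
  have h0: "h \<longlonglongrightarrow> 0" unfolding h_def by (rule LIMSEQ_inverse_real_of_nat[unfolded inverse_eq_divide])
  have [measurable]: "F \<in> borel_measurable borel" using i by auto
  define D where "D k x = (F (x + h k *\<^sub>R b) - F x) /\<^sub>R h k" for k x
  have C0: "C \<ge> 0" using order_trans[OF norm_ge_zero bd[of 0]] by simp
  have deriv: "((\<lambda>t. F (x + t *\<^sub>R b)) has_vector_derivative F' (x + t *\<^sub>R b) b) (at t)" for x t
  proof -
    have "((\<lambda>t. F (x + t *\<^sub>R b)) has_derivative (\<lambda>s. F' (x + t *\<^sub>R b) (s *\<^sub>R b))) (at t)"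
      by (rule has_derivative_compose[OF _ F]) (auto intro!: derivative_eq_intros)
    moreover have "linear (F' (x + t *\<^sub>R b))" using F[of "x + t *\<^sub>R b"] by (simp add: has_derivative_linear)
    ultimately show ?thesis by (simp add: has_vector_derivative_def linear_scale)
  qed
  \<comment> \<open>Mean value inequality with steps of length at most 1; on such a step
    \<open>1 + |x|^2\<close> is at most \<open>3 * (1 + |y|^2)\<close>, whence the power of
    3.\<close>
  have dom: "norm (D k x) \<le> C * 3 ^ DIM('a) * (1 + (norm x)\<^sup>2) powr (- real DIM('a))" for k x
  proof -
    have "norm (F (x + h k *\<^sub>R b) - F (x + 0 *\<^sub>R b)) \<le> (C * 3 ^ DIM('a) * (1 + (norm x)\<^sup>2) powr (- real DIM('a))) * norm (h k - 0)"
    proof (rule differentiable_bound[of "{0..h k}" "\<lambda>t. F (x + t *\<^sub>R b)" "\<lambda>t s. s *\<^sub>R F' (x + t *\<^sub>R b) b"])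
      fix t assume t: "t \<in> {0..h k}"
      show "((\<lambda>t. F (x + t *\<^sub>R b)) has_derivative (\<lambda>s. s *\<^sub>R F' (x + t *\<^sub>R b) b)) (at t within {0..h k})"
        using deriv[of x t] by (auto simp: has_vector_derivative_def intro: has_derivative_at_withinI)
      let ?y = "x + t *\<^sub>R b"
      have aux: "1 + a \<le> 3 * (1 + m)" if "a \<le> 2 * m + 2" "0 \<le> m" for a m :: real using that by simp
      have "norm x \<le> norm ?y + 1"
        using norm_triangle_ineq4[of ?y "t *\<^sub>R b"] t h(2)[of k] b by auto
      then have "(norm x)\<^sup>2 \<le> (norm ?y + 1)\<^sup>2" by (intro power_mono) auto
      also have "\<dots> \<le> 2 * (norm ?y)\<^sup>2 + 2"
        using sum_squares_bound[of "norm ?y" 1] by (simp add: power2_sum)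
      finally have "1 + (norm x)\<^sup>2 \<le> 3 * (1 + (norm ?y)\<^sup>2)" using zero_le_power2[of "norm ?y"]
        by (rule aux)
      then have "(3 * (1 + (norm ?y)\<^sup>2)) powr (- real DIM('a)) \<le> (1 + (norm x)\<^sup>2) powr (- real DIM('a))"
        by (intro powr_mono2') (auto simp: add_pos_nonneg)
      then have "(1 + (norm ?y)\<^sup>2) powr (- real DIM('a)) \<le> 3 ^ DIM('a) * (1 + (norm x)\<^sup>2) powr (- real DIM('a))"
        by (subst (asm) powr_mult) (simp_all add: powr_minus[of 3] powr_realpow field_simps)
      then have "C * (1 + (norm ?y)\<^sup>2) powr (- real DIM('a)) \<le> C * (3 ^ DIM('a) * (1 + (norm x)\<^sup>2) powr (- real DIM('a)))"
        using C0 by (rule mult_left_mono)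
      then have "norm (F' ?y b) \<le> C * 3 ^ DIM('a) * (1 + (norm x)\<^sup>2) powr (- real DIM('a))"
        using bd[of ?y] by (simp add: mult.assoc)
      then show "onorm (\<lambda>s. s *\<^sub>R F' ?y b) \<le> C * 3 ^ DIM('a) * (1 + (norm x)\<^sup>2) powr (- real DIM('a))"
        by (intro onorm_le) (simp add: mult.commute mult_left_mono)
    qed (use h(1)[of k] in auto)
    then show ?thesis using h(1)[of k] unfolding D_def norm_scaleR by (simp add: field_simps)
  qed
  have "(\<lambda>k. LINT x|lborel. D k x) \<longlonglongrightarrow> (LINT x|lborel. F' x b)"
  proof (rule integral_dominated_convergence)
    show "integrable lborel (\<lambda>x::'a. C * 3 ^ DIM('a) * (1 + (norm x)\<^sup>2) powr (- real DIM('a)))"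
      by (intro integrable_mult_right integrable_one_plus_norm_sq_powr) auto
    show "AE x in lborel. (\<lambda>k. D k x) \<longlonglongrightarrow> F' x b"
    proof (rule AE_I2)
      fix x
      have "((\<lambda>t. (F (x + t *\<^sub>R b) - F (x + 0 *\<^sub>R b)) /\<^sub>R (t - 0)) \<longlongrightarrow> F' (x + 0 *\<^sub>R b) b) (at 0)"
      proof (rule LIM_zero_cancel, subst tendsto_norm_zero_iff[symmetric], rule Lim_transform_eventually)
        show "((\<lambda>t. norm (F (x + (0 + t) *\<^sub>R b) - F (x + 0 *\<^sub>R b) - t *\<^sub>R F' (x + 0 *\<^sub>R b) b) / norm t) \<longlongrightarrow> 0) (at 0)"
          using deriv[of x 0] unfolding has_vector_derivative_def has_derivative_at by blast
        show "\<forall>\<^sub>F t in at 0. norm (F (x + (0 + t) *\<^sub>R b) - F (x + 0 *\<^sub>R b) - t *\<^sub>R F' (x + 0 *\<^sub>R b) b) / norm t =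
          norm ((F (x + t *\<^sub>R b) - F (x + 0 *\<^sub>R b)) /\<^sub>R (t - 0) - F' (x + 0 *\<^sub>R b) b)"
        proof (simp only: eventually_at_filter, rule always_eventually, intro allI impI)
          fix t :: real assume t: "t \<noteq> 0"
          have "norm (F (x + (0 + t) *\<^sub>R b) - F (x + 0 *\<^sub>R b) - t *\<^sub>R F' (x + 0 *\<^sub>R b) b) / norm t =
            norm ((F (x + t *\<^sub>R b) - F (x + 0 *\<^sub>R b) - t *\<^sub>R F' (x + 0 *\<^sub>R b) b) /\<^sub>R t)"
            by (simp add: divide_inverse)
          also have "(F (x + t *\<^sub>R b) - F (x + 0 *\<^sub>R b) - t *\<^sub>R F' (x + 0 *\<^sub>R b) b) /\<^sub>R t = (F (x + t *\<^sub>R b) - F (x + 0 *\<^sub>R b)) /\<^sub>R (t - 0) - F' (x + 0 *\<^sub>R b) b"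
            using t by (simp add: scaleR_diff_right)
          finally show "norm (F (x + (0 + t) *\<^sub>R b) - F (x + 0 *\<^sub>R b) - t *\<^sub>R F' (x + 0 *\<^sub>R b) b) / norm t =
            norm ((F (x + t *\<^sub>R b) - F (x + 0 *\<^sub>R b)) /\<^sub>R (t - 0) - F' (x + 0 *\<^sub>R b) b)" .
        qed
      qed
      moreover have "filterlim h (at 0) sequentially"
        using h0 h(1) by (auto simp: filterlim_at intro!: always_eventually less_imp_neq[symmetric])
      ultimately have "(\<lambda>k. (F (x + h k *\<^sub>R b) - F (x + 0 *\<^sub>R b)) /\<^sub>R (h k - 0)) \<longlonglongrightarrow> F' (x + 0 *\<^sub>R b) b"
        by (rule filterlim_compose)
      then show "(\<lambda>k. D k x) \<longlonglongrightarrow> F' x b" by (simp add: D_def)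
    qed
    show "AE x in lborel. norm (D k x) \<le> C * 3 ^ DIM('a) * (1 + (norm x)\<^sup>2) powr (- real DIM('a))" for k
      using dom by simp
    show "D k \<in> borel_measurable lborel" for k unfolding D_def by measurable
  qed measurable
  moreover have "(LINT x|lborel. D k x) = 0" for k
  proof -
    have "(LINT x|lborel. D k x) = (LINT x|lborel. F (x + h k *\<^sub>R b) - F x) /\<^sub>R h k" by (simp add: D_def)
    also have "(LINT x|lborel. F (x + h k *\<^sub>R b) - F x) = 0"
      using integral_translate[of F "h k *\<^sub>R b"] i by simp
    finally show ?thesis by simp
  qed
  ultimately show ?thesis by (simp add: LIMSEQ_const_iff)
qed

text \<open>The integral of the partial derivative of \<open>cis (x \<bullet> \<xi>) * f x\<close>
  vanishes, and the product rule splits it into the two sides.\<close>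

lemma inv_fourier_partial:
  fixes f :: "'a::euclidean_space \<Rightarrow> complex"
  assumes f: "f \<in> schwartz" and b: "b \<in> Basis"
  shows "inv_fourier (iter_partial [b] f) \<xi> = - \<i> * complex_of_real (\<xi> \<bullet> b) * inv_fourier f \<xi>"
proof -
  let ?e = "\<lambda>x. cis (x \<bullet> \<xi>)"
  let ?f' = "\<lambda>x. frechet_derivative f (at x)"
  have df: "iter_partial [b] f \<in> schwartz" using f b by (intro schwartz_iter_partial) auto
  have [measurable]: "f \<in> borel_measurable borel" "(\<lambda>x. ?f' x b) \<in> borel_measurable borel"
    using schwartz_measurable[OF f] schwartz_measurable[OF df] by auto
  have de: "(?e has_derivative (\<lambda>h. \<i> * complex_of_real (h \<bullet> \<xi>) * ?e x)) (at x)" for x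
  proof -
    have "((\<lambda>x. \<i> * complex_of_real (x \<bullet> \<xi>)) has_derivative (\<lambda>h. \<i> * complex_of_real (h \<bullet> \<xi>))) (at x)"
      by (intro has_derivative_mult_right has_derivative_of_real has_derivative_inner_left has_derivative_ident)
    from has_derivative_compose[OF this DERIV_exp[unfolded has_field_derivative_def]]
    show ?thesis unfolding cis_conv_exp by (simp add: mult_ac)
  qed
  have dF: "((\<lambda>x. ?e x * f x) has_derivative (\<lambda>h. ?e x * ?f' x h + \<i> * complex_of_real (h \<bullet> \<xi>) * ?e x * f x)) (at x)" for x
    by (rule has_derivative_mult[OF de schwartz_has_derivative[OF f]])
  define C where "C = schwartz_seminorm (2 * DIM('a)) (iter_partial [b] f) + \<bar>b \<bullet> \<xi>\<bar> * schwartz_seminorm (2 * DIM('a)) f"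
  have ia: "integrable lborel (\<lambda>x. ?e x * ?f' x b)"
    using integrable_cis_mult(2)[OF schwartz_integrable(1)[OF df]] by simp
  have ib: "integrable lborel (\<lambda>x. ?e x * f x)" by (rule integrable_cis_mult(2)[OF schwartz_integrable(1)[OF f]])
  have "(LINT x|lborel. ?e x * ?f' x b + \<i> * complex_of_real (b \<bullet> \<xi>) * ?e x * f x) = 0"
  proof (rule integral_partial_eq_0[OF dF])
    show "norm b = 1" using b by simp
    show "integrable lborel (\<lambda>x. ?e x * f x)" by (rule ib)
    fix x
    have "norm (?e x * ?f' x b + \<i> * complex_of_real (b \<bullet> \<xi>) * ?e x * f x) \<le> norm (?f' x b) + \<bar>b \<bullet> \<xi>\<bar> * norm (f x)"
      by (rule order_trans[OF norm_triangle_ineq]) (simp add: norm_mult)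
    also have "\<dots> \<le> schwartz_seminorm (2 * DIM('a)) (iter_partial [b] f) * (1 + (norm x)\<^sup>2) powr (- real DIM('a)) +
       \<bar>b \<bullet> \<xi>\<bar> * (schwartz_seminorm (2 * DIM('a)) f * (1 + (norm x)\<^sup>2) powr (- real DIM('a)))"
      using schwartz_decay[OF df, of "[]" "DIM('a)" x] schwartz_decay[OF f, of "[]" "DIM('a)" x]
      by (intro add_mono mult_left_mono) auto
    also have "\<dots> = C * (1 + (norm x)\<^sup>2) powr (- real DIM('a))" by (simp add: C_def algebra_simps)
    finally show "norm (?e x * ?f' x b + \<i> * complex_of_real (b \<bullet> \<xi>) * ?e x * f x) \<le> C * (1 + (norm x)\<^sup>2) powr (- real DIM('a))" .
  qed measurable
  also have "(LINT x|lborel. ?e x * ?f' x b + \<i> * complex_of_real (b \<bullet> \<xi>) * ?e x * f x) =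
     (LINT x|lborel. ?e x * ?f' x b) + \<i> * complex_of_real (b \<bullet> \<xi>) * (LINT x|lborel. ?e x * f x)"
    unfolding mult.assoc[of _ "?e _"] using ia ib by simp
  finally have "(LINT x|lborel. ?e x * ?f' x b) = - (\<i> * complex_of_real (b \<bullet> \<xi>) * (LINT x|lborel. ?e x * f x))"
    by (simp add: eq_neg_iff_add_eq_0)
  then show ?thesis by (simp add: inv_fourier_def inner_commute mult_ac)
qed

lemma norm_inv_fourier_le:
  fixes f :: "'a::euclidean_space \<Rightarrow> complex"
  shows "norm (inv_fourier f \<xi>) \<le> (2 * pi) powr (- real DIM('a) / 2) * (LINT x|lborel. norm (f x))"
    "norm (fourier f \<xi>) \<le> (2 * pi) powr (- real DIM('a) / 2) * (LINT x|lborel. norm (f x))"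
proof -
  have "norm (LINT x|lborel. cis (\<xi> \<bullet> x) * f x) \<le> (LINT x|lborel. norm (cis (\<xi> \<bullet> x) * f x))" for \<xi> by (rule integral_norm_bound)
  then have *: "norm (inv_fourier f \<xi>) \<le> (2 * pi) powr (- real DIM('a) / 2) * (LINT x|lborel. norm (f x))" for \<xi>
    unfolding inv_fourier_def norm_mult by (intro mult_mono) (auto simp: norm_mult)
  then show "norm (inv_fourier f \<xi>) \<le> (2 * pi) powr (- real DIM('a) / 2) * (LINT x|lborel. norm (f x))" .
  show "norm (fourier f \<xi>) \<le> (2 * pi) powr (- real DIM('a) / 2) * (LINT x|lborel. norm (f x))"
    unfolding fourier_eq_inv by (rule *)
qed

text \<open>Derivatives become powers of single coordinates. Taking \<open>2 * k\<close> of them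
  along the largest coordinate of \<xi> controls the full norm.\<close>

lemma inv_fourier_schwartz_decay:
  fixes f :: "'a::euclidean_space \<Rightarrow> complex"
  assumes f: "f \<in> schwartz"
  shows "\<exists>C. \<forall>\<xi>. norm (inv_fourier f \<xi>) \<le> C * (1 + (norm \<xi>)\<^sup>2) powr (- real k)"
proof -
  have rep: "inv_fourier (iter_partial (replicate j b) f) \<xi> = (- \<i> * complex_of_real (\<xi> \<bullet> b)) ^ j * inv_fourier f \<xi>" if b: "b \<in> Basis" for j b \<xi>
  proof (induction j)
    case (Suc j)
    have "iter_partial (replicate j b) f \<in> schwartz" using f b by (intro schwartz_iter_partial) auto
    from inv_fourier_partial[OF this b, of \<xi>] show ?case using Suc by (simp add: mult.assoc)
  qed simp
  define A where "A b j = (2 * pi) powr (- real DIM('a) / 2) * (LINT x|lborel. norm (iter_partial (replicate j b) f x))" for b j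
  have A: "\<bar>\<xi> \<bullet> b\<bar> ^ j * norm (inv_fourier f \<xi>) \<le> A b j" if b: "b \<in> Basis" for b j \<xi>
  proof -
    have "\<bar>\<xi> \<bullet> b\<bar> ^ j * norm (inv_fourier f \<xi>) = norm (inv_fourier (iter_partial (replicate j b) f) \<xi>)"
      unfolding rep[OF b] by (simp add: norm_mult norm_power)
    then show ?thesis using norm_inv_fourier_le(1)[of "iter_partial (replicate j b) f" \<xi>] by (simp add: A_def)
  qed
  obtain b0 :: 'a where b0: "b0 \<in> Basis" using nonempty_Basis by blast
  define C where "C = 2 ^ k * (A b0 0 + (\<Sum>b\<in>Basis. real DIM('a) ^ (2 * k) * A b (2 * k)))"
  have "norm (inv_fourier f \<xi>) \<le> C * (1 + (norm \<xi>)\<^sup>2) powr (- real k)" for \<xi>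
  proof -
    let ?n = "norm (inv_fourier f \<xi>)"
    have "norm \<xi> ^ (2 * k) * ?n \<le> (\<Sum>b\<in>Basis. real DIM('a) ^ (2 * k) * A b (2 * k))"
    proof -
      \<comment> \<open>The direction depends on \<xi>, so the sum over all basis directions appears
        in \<open>C\<close>.\<close>
      obtain bm where bm: "bm \<in> Basis" "\<And>b. b \<in> Basis \<Longrightarrow> \<bar>\<xi> \<bullet> b\<bar> \<le> \<bar>\<xi> \<bullet> bm\<bar>"
        using finite_has_maximal[of "(\<lambda>b. \<bar>\<xi> \<bullet> b\<bar>) ` Basis"] by (force simp: not_less)
      have "norm \<xi> \<le> (\<Sum>b\<in>Basis. \<bar>\<xi> \<bullet> b\<bar>)" by (rule norm_le_l1)
      also have "\<dots> \<le> real DIM('a) * \<bar>\<xi> \<bullet> bm\<bar>" by (rule sum_bounded_above) (rule bm)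
      finally have "norm \<xi> ^ (2 * k) \<le> (real DIM('a) * \<bar>\<xi> \<bullet> bm\<bar>) ^ (2 * k)" by (intro power_mono) auto
      then have "norm \<xi> ^ (2 * k) * ?n \<le> (real DIM('a) * \<bar>\<xi> \<bullet> bm\<bar>) ^ (2 * k) * ?n" by (rule mult_right_mono) simp
      also have "\<dots> = real DIM('a) ^ (2 * k) * (\<bar>\<xi> \<bullet> bm\<bar> ^ (2 * k) * ?n)" by (simp only: power_mult_distrib mult.assoc)
      also have "\<dots> \<le> real DIM('a) ^ (2 * k) * A bm (2 * k)" by (intro mult_left_mono A bm) auto
      also have "\<dots> \<le> (\<Sum>b\<in>Basis. real DIM('a) ^ (2 * k) * A b (2 * k))"
        using bm(1) by (intro member_le_sum[of bm Basis "\<lambda>b. real DIM('a) ^ (2 * k) * A b (2 * k)"]) (auto simp: A_def intro!: mult_nonneg_nonneg)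
      finally show ?thesis .
    qed
    moreover have "?n \<le> A b0 0" using A[OF b0, of \<xi> 0] by simp
    moreover have "(1 + (norm \<xi>)\<^sup>2) ^ k \<le> 2 ^ k * (1 + norm \<xi> ^ (2 * k))"
    proof (cases "norm \<xi> \<le> 1")
      case True
      then have "(norm \<xi>)\<^sup>2 \<le> 1" by (simp add: power_le_one)
      then have "(1 + (norm \<xi>)\<^sup>2) ^ k \<le> 2 ^ k" by (intro power_mono) auto
      also have "\<dots> \<le> 2 ^ k * (1 + norm \<xi> ^ (2 * k))" by simp
      finally show ?thesis .
    next
      case False
      then have "1 \<le> (norm \<xi>)\<^sup>2" by (simp add: one_le_power)
      then have "(1 + (norm \<xi>)\<^sup>2) ^ k \<le> (2 * (norm \<xi>)\<^sup>2) ^ k" by (intro power_mono) auto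
      also have "\<dots> = 2 ^ k * norm \<xi> ^ (2 * k)" by (simp add: power_mult_distrib power_mult)
      also have "\<dots> \<le> 2 ^ k * (1 + norm \<xi> ^ (2 * k))" by simp
      finally show ?thesis .
    qed
    then have "(1 + (norm \<xi>)\<^sup>2) ^ k * ?n \<le> 2 ^ k * (1 + norm \<xi> ^ (2 * k)) * ?n" by (rule mult_right_mono) simp
    ultimately have "(1 + (norm \<xi>)\<^sup>2) ^ k * ?n \<le> 2 ^ k * (?n + norm \<xi> ^ (2 * k) * ?n)" "?n + norm \<xi> ^ (2 * k) * ?n \<le> A b0 0 + (\<Sum>b\<in>Basis. real DIM('a) ^ (2 * k) * A b (2 * k))"
      by (auto simp: algebra_simps)
    then have "(1 + (norm \<xi>)\<^sup>2) ^ k * ?n \<le> C"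
      unfolding C_def by (meson mult_left_mono order_trans zero_le_numeral zero_le_power)
    moreover have "0 < 1 + (norm \<xi>)\<^sup>2" by (simp add: add_pos_nonneg)
    ultimately show ?thesis by (simp add: powr_minus powr_realpow field_simps)
  qed
  then show ?thesis by blast
qed

section \<open>Multiplication formula and square integrability of the transform\<close>

lemma integrable_tensor:
  fixes f g :: "'a::euclidean_space \<Rightarrow> complex"
  assumes f: "integrable lborel f" and g: "integrable lborel g"
    and [measurable]: "k \<in> borel_measurable (lborel \<Otimes>\<^sub>M lborel)" and k: "\<And>z. norm (k z) \<le> B"
  shows "integrable (lborel \<Otimes>\<^sub>M lborel) (\<lambda>(x, y). f x * (k (x, y) * g y))"
proof (rule integrable_dominated)
  have [measurable]: "f \<in> borel_measurable lborel" "g \<in> borel_measurable lborel" using f g by auto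
  show "integrable (lborel \<Otimes>\<^sub>M lborel) (\<lambda>z. B * (norm (f (fst z)) * norm (g (snd z))))"
    by (intro integrable_mult_right integrable_pair_mult sigma_finite_lborel integrable_norm f g)
  show "(\<lambda>(x, y). f x * (k (x, y) * g y)) \<in> borel_measurable (lborel \<Otimes>\<^sub>M lborel)" by measurable
  fix z :: "'a \<times> 'a"
  have "norm (f (fst z)) * (norm (k z) * norm (g (snd z))) \<le> norm (f (fst z)) * (B * norm (g (snd z)))"
    by (intro mult_left_mono mult_right_mono k) auto
  then show "norm (case z of (x, y) \<Rightarrow> f x * (k (x, y) * g y)) \<le> B * (norm (f (fst z)) * norm (g (snd z)))"
    by (simp add: case_prod_unfold norm_mult mult_ac)
qed

text \<open>Fubini with a bounded symmetric kernel; \<open>c = - 1\<close> and \<open>c = 1\<close>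
  give the two transforms.\<close>

lemma fourier_multiplication:
  fixes f g :: "'a::euclidean_space \<Rightarrow> complex"
  assumes f: "integrable lborel f" and g: "integrable lborel g"
  shows "(LINT x|lborel. f x * fourier g x) = (LINT x|lborel. fourier f x * g x)"
    "(LINT x|lborel. f x * inv_fourier g x) = (LINT x|lborel. inv_fourier f x * g x)"
proof -
  let ?K = "complex_of_real ((2 * pi) powr (- real DIM('a) / 2))"
  have *: "(LINT x|lborel. f x * (?K * (LINT y|lborel. cis (c * (x \<bullet> y)) * g y))) = (LINT x|lborel. (?K * (LINT y|lborel. cis (c * (x \<bullet> y)) * f y)) * g x)" for c
  proof -
    have "integrable (lborel \<Otimes>\<^sub>M lborel) (\<lambda>(x, y). f x * ((\<lambda>z. cis (c * (fst z \<bullet> snd z))) (x, y) * g y))"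
      by (rule integrable_tensor[OF f g, of _ 1]) auto
    then have Fub: "(LINT y|lborel. (LINT x|lborel. f x * (cis (c * (x \<bullet> y)) * g y))) = (LINT x|lborel. (LINT y|lborel. f x * (cis (c * (x \<bullet> y)) * g y)))"
      by (intro lborel_pair.Fubini_integral) simp
    have l: "(LINT x|lborel. f x * (cis (c * (x \<bullet> y)) * g y)) = (LINT x|lborel. cis (c * (x \<bullet> y)) * f x) * g y" for y
      unfolding integral_mult_left_zero[symmetric] by (simp only: mult_ac)
    from Fub have "(LINT x|lborel. f x * (LINT y|lborel. cis (c * (x \<bullet> y)) * g y)) = (LINT y|lborel. (LINT x|lborel. cis (c * (x \<bullet> y)) * f x) * g y)"
      unfolding l integral_mult_right_zero by simp
    then have "?K * (LINT x|lborel. f x * (LINT y|lborel. cis (c * (x \<bullet> y)) * g y)) = ?K * (LINT y|lborel. (LINT x|lborel. cis (c * (x \<bullet> y)) * f x) * g y)"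
      by (rule arg_cong)
    moreover have "f x * (?K * I) = ?K * (f x * I)" "(?K * I) * g x = ?K * (I * g x)" for x I by (simp_all only: mult_ac)
    ultimately show ?thesis by (simp only: integral_mult_right_zero inner_commute)
  qed
  show "(LINT x|lborel. f x * fourier g x) = (LINT x|lborel. fourier f x * g x)"
    using *[of "- 1"] by (simp add: fourier_def inner_commute)
  show "(LINT x|lborel. f x * inv_fourier g x) = (LINT x|lborel. inv_fourier f x * g x)"
    using *[of 1] by (simp add: inv_fourier_def)
qed

lemma nn_integral_gauss_shift:
  fixes y :: "'a::euclidean_space"
  assumes "c > 0"
  shows "(\<integral>\<^sup>+x. ennreal (gauss c (x - y)) \<partial>lborel) = ennreal ((pi / c) powr (DIM('a) / 2))"
proof -
  have d: "distr lborel borel (\<lambda>x. - y + x) = (lborel :: 'a measure)" by (rule lborel_distr_plus)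
  have "(\<integral>\<^sup>+x. ennreal (gauss c x) \<partial>distr lborel borel (\<lambda>x. - y + x)) = (\<integral>\<^sup>+x. ennreal (gauss c (- y + x)) \<partial>lborel)"
    by (rule nn_integral_distr) measurable
  then show ?thesis unfolding d nn_integral_gauss[OF assms] by simp
qed

text \<open>The transform of a product is a convolution: the Gaussian factor becomes the heat kernel
  \<open>(4 * pi * c) powr (- DIM('a) / 2) * gauss (1 / (4 * c))\<close>, which has mass
  one.\<close>

lemma fourier_gauss_cnj:
  fixes \<psi> :: "'a::euclidean_space \<Rightarrow> complex"
  assumes c: "c > 0" and i: "integrable lborel \<psi>"
  shows "fourier (\<lambda>x. complex_of_real (gauss c x) * cnj (fourier \<psi> x)) \<xi> =
    complex_of_real ((4 * pi * c) powr (- real DIM('a) / 2)) * (LINT \<eta>|lborel. cnj (\<psi> \<eta>) * complex_of_real (gauss (1 / (4 * c)) (\<xi> - \<eta>)))"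
proof -
  let ?K = "(2 * pi) powr (- real DIM('a) / 2)"
  define G where "G x = complex_of_real (gauss c x) * cnj (fourier \<psi> x)" for x
  have ic: "integrable lborel (\<lambda>x. cnj (\<psi> x))" using i by simp
  have cnjF: "cnj (fourier \<psi> x) = complex_of_real ?K * (LINT \<eta>|lborel. cis (\<eta> \<bullet> x) * cnj (\<psi> \<eta>))" for x
  proof -
    have "cnj (LINT \<eta>|lborel. cis (- (\<eta> \<bullet> x)) * \<psi> \<eta>) = (LINT \<eta>|lborel. cnj (cis (- (\<eta> \<bullet> x)) * \<psi> \<eta>))"
      by (rule Bochner_Integration.integral_cnj[symmetric])
    then show ?thesis by (simp add: fourier_def cis_cnj)
  qed
  have "integrable (lborel \<Otimes>\<^sub>M lborel) (\<lambda>(x, \<eta>). complex_of_real (gauss c x) * ((\<lambda>z. cis (snd z \<bullet> fst z - fst z \<bullet> \<xi>)) (x, \<eta>) * cnj (\<psi> \<eta>)))"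
    by (rule integrable_tensor[OF _ ic, of _ _ 1]) (auto intro: integrable_gauss c)
  then have Fub: "(LINT \<eta>|lborel. (LINT x|lborel. complex_of_real (gauss c x) * (cis (\<eta> \<bullet> x - x \<bullet> \<xi>) * cnj (\<psi> \<eta>)))) =
     (LINT x|lborel. (LINT \<eta>|lborel. complex_of_real (gauss c x) * (cis (\<eta> \<bullet> x - x \<bullet> \<xi>) * cnj (\<psi> \<eta>))))"
    by (intro lborel_pair.Fubini_integral) simp
  have pt: "cis (- (x \<bullet> \<xi>)) * (complex_of_real (gauss c x) * (complex_of_real ?K * (LINT \<eta>|lborel. cis (\<eta> \<bullet> x) * cnj (\<psi> \<eta>)))) =
      complex_of_real ?K * (LINT \<eta>|lborel. complex_of_real (gauss c x) * (cis (\<eta> \<bullet> x - x \<bullet> \<xi>) * cnj (\<psi> \<eta>)))" for x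
  proof -
    have "cis (- (x \<bullet> \<xi>)) * (complex_of_real (gauss c x) * (complex_of_real ?K * (LINT \<eta>|lborel. cis (\<eta> \<bullet> x) * cnj (\<psi> \<eta>)))) =
      complex_of_real ?K * (LINT \<eta>|lborel. cis (- (x \<bullet> \<xi>)) * (complex_of_real (gauss c x) * (cis (\<eta> \<bullet> x) * cnj (\<psi> \<eta>))))"
      unfolding integral_mult_right_zero by (simp only: mult_ac)
    also have "(\<lambda>\<eta>. cis (- (x \<bullet> \<xi>)) * (complex_of_real (gauss c x) * (cis (\<eta> \<bullet> x) * cnj (\<psi> \<eta>)))) =
       (\<lambda>\<eta>. complex_of_real (gauss c x) * (cis (\<eta> \<bullet> x - x \<bullet> \<xi>) * cnj (\<psi> \<eta>)))"
    proof
      fix \<eta>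
      have "cis (\<eta> \<bullet> x - x \<bullet> \<xi>) = cis (\<eta> \<bullet> x) * cis (- (x \<bullet> \<xi>))" by (simp add: cis_mult)
      then show "cis (- (x \<bullet> \<xi>)) * (complex_of_real (gauss c x) * (cis (\<eta> \<bullet> x) * cnj (\<psi> \<eta>))) = complex_of_real (gauss c x) * (cis (\<eta> \<bullet> x - x \<bullet> \<xi>) * cnj (\<psi> \<eta>))"
        by (simp only: mult_ac)
    qed
    finally show ?thesis .
  qed
  have "fourier G \<xi> = complex_of_real ?K * (LINT x|lborel. complex_of_real ?K * (LINT \<eta>|lborel. complex_of_real (gauss c x) * (cis (\<eta> \<bullet> x - x \<bullet> \<xi>) * cnj (\<psi> \<eta>))))"
    unfolding fourier_def[of G] G_def cnjF pt ..
  also have "\<dots> = complex_of_real (?K * ?K) * (LINT \<eta>|lborel. (LINT x|lborel. complex_of_real (gauss c x) * (cis (\<eta> \<bullet> x - x \<bullet> \<xi>) * cnj (\<psi> \<eta>))))"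
    unfolding Fub by simp
  also have "(\<lambda>\<eta>. LINT x|lborel. complex_of_real (gauss c x) * (cis (\<eta> \<bullet> x - x \<bullet> \<xi>) * cnj (\<psi> \<eta>))) =
     (\<lambda>\<eta>. complex_of_real ((pi / c) powr (DIM('a) / 2)) * (cnj (\<psi> \<eta>) * complex_of_real (gauss (1 / (4 * c)) (\<xi> - \<eta>))))"
  proof
    fix \<eta> :: 'a
    have "(LINT x|lborel. complex_of_real (gauss c x) * (cis (\<eta> \<bullet> x - x \<bullet> \<xi>) * cnj (\<psi> \<eta>))) = (LINT x|lborel. (cis (x \<bullet> (\<eta> - \<xi>)) * complex_of_real (gauss c x)) * cnj (\<psi> \<eta>))"
      by (intro Bochner_Integration.integral_cong refl) (simp add: inner_diff_right inner_commute)
    also have "\<dots> = (LINT x|lborel. cis (x \<bullet> (\<eta> - \<xi>)) * complex_of_real (gauss c x)) * cnj (\<psi> \<eta>)" by (rule integral_mult_left_zero)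
    also have "(LINT x|lborel. cis (x \<bullet> (\<eta> - \<xi>)) * complex_of_real (gauss c x)) = complex_of_real ((pi / c) powr (DIM('a) / 2) * gauss (1 / (4 * c)) (\<eta> - \<xi>))"
      by (rule fourier_gauss_aux(2)[OF c])
    also have "gauss (1 / (4 * c)) (\<eta> - \<xi>) = gauss (1 / (4 * c)) (\<xi> - \<eta>)" by (simp add: gauss_def norm_minus_commute)
    finally show "(LINT x|lborel. complex_of_real (gauss c x) * (cis (\<eta> \<bullet> x - x \<bullet> \<xi>) * cnj (\<psi> \<eta>))) =
      complex_of_real ((pi / c) powr (DIM('a) / 2)) * (cnj (\<psi> \<eta>) * complex_of_real (gauss (1 / (4 * c)) (\<xi> - \<eta>)))"
      by (simp add: mult_ac)
  qed
  also have "(LINT \<eta>|lborel. complex_of_real ((pi / c) powr (DIM('a) / 2)) * (cnj (\<psi> \<eta>) * complex_of_real (gauss (1 / (4 * c)) (\<xi> - \<eta>)))) =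
    complex_of_real ((pi / c) powr (DIM('a) / 2)) * (LINT \<eta>|lborel. cnj (\<psi> \<eta>) * complex_of_real (gauss (1 / (4 * c)) (\<xi> - \<eta>)))"
    by (rule integral_mult_right_zero)
  finally have "fourier G \<xi> = complex_of_real (?K * (?K * (pi / c) powr (DIM('a) / 2))) * (LINT \<eta>|lborel. cnj (\<psi> \<eta>) * complex_of_real (gauss (1 / (4 * c)) (\<xi> - \<eta>)))"
    by (simp add: mult_ac)
  also have "?K * (?K * (pi / c) powr (DIM('a) / 2)) = (2 * pi) powr (- real DIM('a) / 2) * (2 * c) powr (- real DIM('a) / 2)"
    unfolding fourier_gauss_const[OF c] ..
  also have "\<dots> = ((2 * pi) * (2 * c)) powr (- real DIM('a) / 2)"
    using c by (subst powr_mult) auto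
  also have "(2 * pi) * (2 * c) = 4 * pi * c" by simp
  finally show ?thesis unfolding G_def .
qed

text \<open>Schur's test in its simplest form: the product of values is at most half the sum of
  their squares, and in each half the Gaussian is integrated out in the other variable.\<close>

lemma nn_integral_gauss_schur:
  fixes \<psi> :: "'a::euclidean_space \<Rightarrow> complex"
  assumes c: "c > 0" and L: "\<psi> \<in> Lp 2"
  shows "(\<integral>\<^sup>+\<xi>. (\<integral>\<^sup>+\<eta>. ennreal (norm (\<psi> \<xi>) * (norm (\<psi> \<eta>) * gauss c (\<xi> - \<eta>))) \<partial>lborel) \<partial>lborel) \<le>
    ennreal ((LINT x|lborel. (norm (\<psi> x))\<^sup>2) * (pi / c) powr (DIM('a) / 2))"
proof -
  have [measurable]: "\<psi> \<in> borel_measurable borel" using L by (rule Lp_2_measurable)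
  define Q where "Q = (LINT x|lborel. (norm (\<psi> x))\<^sup>2)"
  let ?g = "gauss c :: 'a \<Rightarrow> real"
  have gi: "(\<integral>\<^sup>+x. ennreal (?g (x - y)) \<partial>lborel) = ennreal ((pi / c) powr (DIM('a) / 2))" "(\<integral>\<^sup>+x. ennreal (?g (y - x)) \<partial>lborel) = ennreal ((pi / c) powr (DIM('a) / 2))" for y
  proof -
    show "(\<integral>\<^sup>+x. ennreal (?g (x - y)) \<partial>lborel) = ennreal ((pi / c) powr (DIM('a) / 2))"
      using nn_integral_gauss_shift[OF c, of y] by simp
    then show "(\<integral>\<^sup>+x. ennreal (?g (y - x)) \<partial>lborel) = ennreal ((pi / c) powr (DIM('a) / 2))"
      by (simp add: gauss_def norm_minus_commute)
  qed
  have Q: "(\<integral>\<^sup>+x. ennreal ((norm (\<psi> x))\<^sup>2) \<partial>lborel) = ennreal Q"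
    unfolding Q_def using L by (intro nn_integral_eq_integral) (auto simp: Lp_2_iff)
  have Q0: "Q \<ge> 0" by (simp add: Q_def)
  define X where "X = (\<integral>\<^sup>+\<xi>. (\<integral>\<^sup>+\<eta>. ennreal (norm (\<psi> \<xi>) * (norm (\<psi> \<eta>) * ?g (\<xi> - \<eta>))) \<partial>lborel) \<partial>lborel)"
  have "X \<le> (\<integral>\<^sup>+\<xi>. (\<integral>\<^sup>+\<eta>. ennreal (1 / 2) * (ennreal ((norm (\<psi> \<xi>))\<^sup>2) * ennreal (?g (\<xi> - \<eta>))) + ennreal (1 / 2) * (ennreal ((norm (\<psi> \<eta>))\<^sup>2) * ennreal (?g (\<xi> - \<eta>))) \<partial>lborel) \<partial>lborel)"
    unfolding X_def
  proof (intro nn_integral_mono)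
    fix \<xi> \<eta>
    have e: "ennreal (k * (a * b) + k * (d * b)) = ennreal k * (ennreal a * ennreal b) + ennreal k * (ennreal d * ennreal b)"
      if "0 \<le> k" "0 \<le> a" "0 \<le> b" "0 \<le> d" for k a b d :: real using that by (simp add: ennreal_mult ennreal_plus)
    have "norm (\<psi> \<xi>) * norm (\<psi> \<eta>) \<le> 1 / 2 * (norm (\<psi> \<xi>))\<^sup>2 + 1 / 2 * (norm (\<psi> \<eta>))\<^sup>2"
      using sum_squares_bound[of "norm (\<psi> \<xi>)" "norm (\<psi> \<eta>)"] by simp
    then have "norm (\<psi> \<xi>) * norm (\<psi> \<eta>) * ?g (\<xi> - \<eta>) \<le> (1 / 2 * (norm (\<psi> \<xi>))\<^sup>2 + 1 / 2 * (norm (\<psi> \<eta>))\<^sup>2) * ?g (\<xi> - \<eta>)"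
      by (rule mult_right_mono) simp
    then have "norm (\<psi> \<xi>) * (norm (\<psi> \<eta>) * ?g (\<xi> - \<eta>)) \<le> 1 / 2 * ((norm (\<psi> \<xi>))\<^sup>2 * ?g (\<xi> - \<eta>)) + 1 / 2 * ((norm (\<psi> \<eta>))\<^sup>2 * ?g (\<xi> - \<eta>))"
      by (simp add: algebra_simps)
    then have "ennreal (norm (\<psi> \<xi>) * (norm (\<psi> \<eta>) * ?g (\<xi> - \<eta>))) \<le> ennreal (1 / 2 * ((norm (\<psi> \<xi>))\<^sup>2 * ?g (\<xi> - \<eta>)) + 1 / 2 * ((norm (\<psi> \<eta>))\<^sup>2 * ?g (\<xi> - \<eta>)))"
      by (rule ennreal_leI)
    also have "\<dots> = ennreal (1 / 2) * (ennreal ((norm (\<psi> \<xi>))\<^sup>2) * ennreal (?g (\<xi> - \<eta>))) + ennreal (1 / 2) * (ennreal ((norm (\<psi> \<eta>))\<^sup>2) * ennreal (?g (\<xi> - \<eta>)))"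
      by (rule e) auto
    finally show "ennreal (norm (\<psi> \<xi>) * (norm (\<psi> \<eta>) * ?g (\<xi> - \<eta>))) \<le> ennreal (1 / 2) * (ennreal ((norm (\<psi> \<xi>))\<^sup>2) * ennreal (?g (\<xi> - \<eta>))) + ennreal (1 / 2) * (ennreal ((norm (\<psi> \<eta>))\<^sup>2) * ennreal (?g (\<xi> - \<eta>)))" .
  qed
  also have "\<dots> = ennreal (1 / 2) * (\<integral>\<^sup>+\<xi>. (\<integral>\<^sup>+\<eta>. ennreal ((norm (\<psi> \<xi>))\<^sup>2) * ennreal (?g (\<xi> - \<eta>)) \<partial>lborel) \<partial>lborel) +
     ennreal (1 / 2) * (\<integral>\<^sup>+\<xi>. (\<integral>\<^sup>+\<eta>. ennreal ((norm (\<psi> \<eta>))\<^sup>2) * ennreal (?g (\<xi> - \<eta>)) \<partial>lborel) \<partial>lborel)"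
    by (simp add: nn_integral_add nn_integral_cmult)
  also have "(\<integral>\<^sup>+\<xi>. (\<integral>\<^sup>+\<eta>. ennreal ((norm (\<psi> \<eta>))\<^sup>2) * ennreal (?g (\<xi> - \<eta>)) \<partial>lborel) \<partial>lborel) =
    (\<integral>\<^sup>+\<eta>. (\<integral>\<^sup>+\<xi>. ennreal ((norm (\<psi> \<eta>))\<^sup>2) * ennreal (?g (\<xi> - \<eta>)) \<partial>lborel) \<partial>lborel)"
    by (rule lborel_pair.Fubini') measurable
  also have "\<dots> = ennreal Q * ennreal ((pi / c) powr (DIM('a) / 2))"
    by (simp add: nn_integral_cmult gi nn_integral_multc Q)
  also have "(\<integral>\<^sup>+\<xi>. (\<integral>\<^sup>+\<eta>. ennreal ((norm (\<psi> \<xi>))\<^sup>2) * ennreal (?g (\<xi> - \<eta>)) \<partial>lborel) \<partial>lborel) = ennreal Q * ennreal ((pi / c) powr (DIM('a) / 2))"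
    by (simp add: nn_integral_cmult gi nn_integral_multc Q)
  also have "ennreal (1 / 2) * (ennreal Q * ennreal ((pi / c) powr (DIM('a) / 2))) + ennreal (1 / 2) * (ennreal Q * ennreal ((pi / c) powr (DIM('a) / 2)))
     = ennreal (Q * (pi / c) powr (DIM('a) / 2))"
  proof -
    have e: "ennreal k * (ennreal a * ennreal b) + ennreal k * (ennreal a * ennreal b) = ennreal (2 * k * (a * b))"
      if "0 \<le> k" "0 \<le> a" "0 \<le> b" for k a b :: real
      using that by (simp add: ennreal_mult[symmetric] ennreal_plus[symmetric] del: ennreal_plus)
    show ?thesis using e[of "1 / 2" Q "(pi / c) powr (DIM('a) / 2)"] Q0 by simp
  qed
  finally show ?thesis by (simp only: X_def Q_def)
qed

text \<open>Gaussian regularisation turns the square of the transform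
  into a convolution with an approximate identity, which is bounded by the square norm.\<close>
lemma fourier_Lp_2:
  fixes \<psi> :: "'a::euclidean_space \<Rightarrow> complex"
  assumes i: "integrable lborel \<psi>" and L: "\<psi> \<in> Lp 2"
  shows "fourier \<psi> \<in> Lp 2"
proof -
  have [measurable]: "\<psi> \<in> borel_measurable borel" using L by (rule Lp_2_measurable)
  let ?K = "(2 * pi) powr (- real DIM('a) / 2)"
  define Q where "Q = (LINT x|lborel. (norm (\<psi> x))\<^sup>2)"
  have bf: "norm (fourier \<psi> x) \<le> ?K * (LINT x|lborel. norm (\<psi> x))" for x by (rule norm_inv_fourier_le)
  \<comment> \<open>The bound does not depend on \<open>c\<close>, so the regularisation can be
    removed afterwards.\<close>
  have bound: "(\<integral>\<^sup>+x. ennreal (gauss c x * (norm (fourier \<psi> x))\<^sup>2) \<partial>lborel) \<le> ennreal Q" if c: "c > 0" for c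
  proof -
    define G where "G x = complex_of_real (gauss c x) * cnj (fourier \<psi> x)" for x
    have [measurable]: "(cnj :: complex \<Rightarrow> complex) \<in> borel_measurable borel" by (intro borel_measurable_continuous_onI continuous_intros)
    have [measurable]: "G \<in> borel_measurable borel" unfolding G_def by measurable
    have iG: "integrable lborel G"
    proof (rule integrable_dominated)
      show "integrable lborel (\<lambda>x. (?K * (LINT x|lborel. norm (\<psi> x))) * gauss c (x::'a))"
        by (intro integrable_mult_right integrable_gauss c)
      show "norm (G x) \<le> (?K * (LINT x|lborel. norm (\<psi> x))) * gauss c x" for x
        unfolding G_def norm_mult using bf[of x] by (simp add: mult.commute mult_left_mono)
    qed measurable
    have FG: "fourier G \<xi> = complex_of_real ((4 * pi * c) powr (- real DIM('a) / 2)) * (LINT \<eta>|lborel. cnj (\<psi> \<eta>) * complex_of_real (gauss (1 / (4 * c)) (\<xi> - \<eta>)))" for \<xi>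
      unfolding G_def[abs_def] by (rule fourier_gauss_cnj[OF c i])
    let ?a = "(4 * pi * c) powr (- real DIM('a) / 2)"
    let ?g = "gauss (1 / (4 * c)) :: 'a \<Rightarrow> real"
    define X where "X = (\<integral>\<^sup>+\<xi>. (\<integral>\<^sup>+\<eta>. ennreal (norm (\<psi> \<xi>) * (norm (\<psi> \<eta>) * ?g (\<xi> - \<eta>))) \<partial>lborel) \<partial>lborel)"
    have Q0: "Q \<ge> 0" by (simp add: Q_def)
    have X: "X \<le> ennreal (Q * (4 * pi * c) powr (DIM('a) / 2))"
      using nn_integral_gauss_schur[of "1 / (4 * c)", OF _ L] c by (simp add: X_def Q_def mult_ac)
    \<comment> \<open>The regularised square is \<open>G\<close> times the transform, and the
      multiplication formula moves that transform onto \<open>G\<close>.\<close>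
    have "(LINT x|lborel. complex_of_real (gauss c x * (norm (fourier \<psi> x))\<^sup>2)) = (LINT x|lborel. G x * fourier \<psi> x)"
    proof (intro Bochner_Integration.integral_cong refl)
      fix x
      have "complex_of_real ((norm (fourier \<psi> x))\<^sup>2) = cnj (fourier \<psi> x) * fourier \<psi> x"
        by (simp only: complex_norm_square mult.commute)
      then show "complex_of_real (gauss c x * (norm (fourier \<psi> x))\<^sup>2) = G x * fourier \<psi> x"
        by (simp add: G_def)
    qed
    also have "\<dots> = (LINT \<xi>|lborel. fourier G \<xi> * \<psi> \<xi>)" by (rule fourier_multiplication(1)[OF iG i])
    finally have eq: "(LINT x|lborel. complex_of_real (gauss c x * (norm (fourier \<psi> x))\<^sup>2)) = (LINT \<xi>|lborel. fourier G \<xi> * \<psi> \<xi>)" .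
    have iR: "integrable lborel (\<lambda>x. gauss c x * (norm (fourier \<psi> x))\<^sup>2)"
    proof (rule integrable_dominated)
      show "integrable lborel (\<lambda>x. (?K * (LINT x|lborel. norm (\<psi> x)))\<^sup>2 * gauss c (x::'a))"
        by (intro integrable_mult_right integrable_gauss c)
      show "norm (gauss c x * (norm (fourier \<psi> x))\<^sup>2) \<le> (?K * (LINT x|lborel. norm (\<psi> x)))\<^sup>2 * gauss c x" for x
        using power_mono[OF bf[of x], of 2] by (simp add: abs_mult mult.commute mult_left_mono)
    qed measurable
    have ip: "integrable lborel (\<lambda>\<xi>. fourier G \<xi> * \<psi> \<xi>)"
    proof (rule integrable_dominated)
      show "integrable lborel (\<lambda>\<xi>. (?K * (LINT x|lborel. norm (G x))) * norm (\<psi> \<xi>))"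
        by (intro integrable_mult_right integrable_norm i)
      show "norm (fourier G \<xi> * \<psi> \<xi>) \<le> (?K * (LINT x|lborel. norm (G x))) * norm (\<psi> \<xi>)" for \<xi>
        unfolding norm_mult by (intro mult_right_mono norm_inv_fourier_le) auto
    qed measurable
    have nn: "ennreal (norm (fourier G \<xi> * \<psi> \<xi>)) \<le> ennreal ?a * (\<integral>\<^sup>+\<eta>. ennreal (norm (\<psi> \<xi>) * (norm (\<psi> \<eta>) * ?g (\<xi> - \<eta>))) \<partial>lborel)" for \<xi>
    proof -
      let ?f = "\<lambda>\<eta>. cnj (\<psi> \<eta>) * complex_of_real (?g (\<xi> - \<eta>))"
      have iF: "integrable lborel ?f"
      proof (rule integrable_dominated[OF integrable_norm[OF i]])
        fix \<eta>
        have "?g (\<xi> - \<eta>) \<le> 1" using c by (simp add: gauss_def)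
        then show "norm (?f \<eta>) \<le> norm (\<psi> \<eta>)" by (simp add: norm_mult mult_left_le)
      qed measurable
      have "ennreal (norm (integral\<^sup>L lborel ?f)) \<le> (\<integral>\<^sup>+\<eta>. ennreal (norm (?f \<eta>)) \<partial>lborel)"
        by (rule integral_norm_bound_ennreal[OF iF])
      then have "ennreal (?a * norm (\<psi> \<xi>)) * ennreal (norm (integral\<^sup>L lborel ?f)) \<le> ennreal (?a * norm (\<psi> \<xi>)) * (\<integral>\<^sup>+\<eta>. ennreal (norm (?f \<eta>)) \<partial>lborel)"
        by (rule mult_left_mono) simp
      also have "\<dots> = ennreal ?a * (\<integral>\<^sup>+\<eta>. ennreal (norm (\<psi> \<xi>)) * ennreal (norm (?f \<eta>)) \<partial>lborel)"
        by (simp add: nn_integral_cmult ennreal_mult mult.assoc)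
      also have "(\<integral>\<^sup>+\<eta>. ennreal (norm (\<psi> \<xi>)) * ennreal (norm (?f \<eta>)) \<partial>lborel) = (\<integral>\<^sup>+\<eta>. ennreal (norm (\<psi> \<xi>) * (norm (\<psi> \<eta>) * ?g (\<xi> - \<eta>))) \<partial>lborel)"
        by (intro nn_integral_cong) (simp add: norm_mult ennreal_mult[symmetric])
      also have "ennreal (?a * norm (\<psi> \<xi>)) * ennreal (norm (integral\<^sup>L lborel ?f)) = ennreal (norm (fourier G \<xi> * \<psi> \<xi>))"
        unfolding FG by (simp add: norm_mult ennreal_mult[symmetric] mult_ac)
      finally show ?thesis .
    qed
    have "(\<integral>\<^sup>+x. ennreal (gauss c x * (norm (fourier \<psi> x))\<^sup>2) \<partial>lborel) = ennreal (LINT x|lborel. gauss c x * (norm (fourier \<psi> x))\<^sup>2)"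
      by (rule nn_integral_eq_integral[OF iR]) auto
    also have "(LINT x|lborel. gauss c x * (norm (fourier \<psi> x))\<^sup>2) = norm (LINT x|lborel. complex_of_real (gauss c x * (norm (fourier \<psi> x))\<^sup>2))"
      unfolding integral_complex_of_real norm_of_real by (rule abs_of_nonneg[symmetric], intro integral_nonneg_AE AE_I2) auto
    also have "ennreal (norm (LINT x|lborel. complex_of_real (gauss c x * (norm (fourier \<psi> x))\<^sup>2))) \<le> (\<integral>\<^sup>+\<xi>. ennreal (norm (fourier G \<xi> * \<psi> \<xi>)) \<partial>lborel)"
      unfolding eq by (rule integral_norm_bound_ennreal[OF ip])
    also have "\<dots> \<le> (\<integral>\<^sup>+\<xi>. ennreal ?a * (\<integral>\<^sup>+\<eta>. ennreal (norm (\<psi> \<xi>) * (norm (\<psi> \<eta>) * ?g (\<xi> - \<eta>))) \<partial>lborel) \<partial>lborel)"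
      by (intro nn_integral_mono nn)
    also have "\<dots> = ennreal ?a * X" unfolding X_def by (rule nn_integral_cmult) measurable
    also have "\<dots> \<le> ennreal ?a * ennreal (Q * (4 * pi * c) powr (DIM('a) / 2))" by (rule mult_left_mono[OF X]) simp
    also have "\<dots> = ennreal Q"
      using c Q0 by (simp add: ennreal_mult[symmetric] powr_minus)
    finally show ?thesis .
  qed
  have "(\<integral>\<^sup>+x. ennreal ((norm (fourier \<psi> x))\<^sup>2) \<partial>lborel) = (\<integral>\<^sup>+x. liminf (\<lambda>k. ennreal (gauss (1 / real (Suc k)) x * (norm (fourier \<psi> x))\<^sup>2)) \<partial>lborel)"
  proof (rule nn_integral_cong)
    fix x :: 'a
    have "(\<lambda>k. 1 / real (Suc k)) \<longlonglongrightarrow> 0" by (rule LIMSEQ_inverse_real_of_nat[unfolded inverse_eq_divide])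
    then have "(\<lambda>k. exp (- (1 / real (Suc k)) * (norm x)\<^sup>2)) \<longlonglongrightarrow> exp (- 0 * (norm x)\<^sup>2)" by (intro tendsto_intros)
    then have "(\<lambda>k. gauss (1 / real (Suc k)) x) \<longlonglongrightarrow> 1" by (simp add: gauss_def)
    then have "(\<lambda>k. gauss (1 / real (Suc k)) x * (norm (fourier \<psi> x))\<^sup>2) \<longlonglongrightarrow> 1 * (norm (fourier \<psi> x))\<^sup>2" by (intro tendsto_intros)
    then have "(\<lambda>k. ennreal (gauss (1 / real (Suc k)) x * (norm (fourier \<psi> x))\<^sup>2)) \<longlonglongrightarrow> ennreal (1 * (norm (fourier \<psi> x))\<^sup>2)" by (rule tendsto_ennrealI)
    then show "ennreal ((norm (fourier \<psi> x))\<^sup>2) = liminf (\<lambda>k. ennreal (gauss (1 / real (Suc k)) x * (norm (fourier \<psi> x))\<^sup>2))"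
      using lim_imp_Liminf[OF sequentially_bot] by fastforce
  qed
  \<comment> \<open>Fatou along \<open>c = 1 / (k + 1)\<close>, where the Gaussians increase to
    1.\<close>
  also have "\<dots> \<le> liminf (\<lambda>k. \<integral>\<^sup>+x. ennreal (gauss (1 / real (Suc k)) x * (norm (fourier \<psi> x))\<^sup>2) \<partial>lborel)"
    by (rule nn_integral_liminf) measurable
  also have "\<dots> \<le> ennreal Q"
    by (rule Liminf_le[OF sequentially_bot], intro always_eventually allI bound, simp)
  also have "\<dots> < \<infinity>" by simp
  finally have "integrable lborel (\<lambda>x. (norm (fourier \<psi> x))\<^sup>2)"
    by (intro integrableI_bounded) auto
  then show ?thesis by (simp add: Lp_2_iff)
qed

subsection \<open>Slowly decaying initial data\<close>

text \<open>Small \<open>s\<close> produces the slow spatial tail. Stopping at \<open>s = 1\<close>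
  keeps the superposition bounded and its transform rapidly decaying at high frequency.\<close>

definition power_weight :: "real \<Rightarrow> real \<Rightarrow> real" where
  "power_weight m s = indicator {0<..<1} s * s powr (m - 1)"

lemma power_weight_measurable [measurable]: "power_weight m \<in> borel_measurable borel"
  unfolding power_weight_def by measurable

lemma power_weight_nonneg [simp]: "power_weight m s \<ge> 0"
  by (simp add: power_weight_def)

lemma nn_integral_powr:
  fixes m b :: real
  assumes "m > 0" "b \<ge> 0"
  shows "(\<integral>\<^sup>+s. ennreal (indicator {0<..<b} s * s powr (m - 1)) \<partial>lborel) = ennreal (b powr m / m)"
proof (rule nn_integral_has_integral_lborel)
  have "((\<lambda>s. s powr (m - 1)) has_integral (b powr m / m)) {0..b}"
    using has_integral_powr_from_0[of "m - 1" b] assms by simp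
  then have "((\<lambda>s. if s \<in> {0..b} then s powr (m - 1) else 0) has_integral (b powr m / m)) UNIV"
    by (simp only: has_integral_restrict_UNIV)
  then show "((\<lambda>s. indicator {0<..<b} s * s powr (m - 1)) has_integral (b powr m / m)) UNIV"
    by (rule has_integral_spike[of "{0, b}", rotated 2]) (auto simp: indicator_def)
qed auto

lemma nn_integral_power_weight: "m > 0 \<Longrightarrow> (\<integral>\<^sup>+s. ennreal (power_weight m s) \<partial>lborel) = ennreal (1 / m)"
  using nn_integral_powr[of m 1] by (simp add: power_weight_def)

lemma has_bochner_integral_power_weight: "m > 0 \<Longrightarrow> has_bochner_integral lborel (power_weight m) (1 / m)"
  by (rule has_bochner_integral_nn_integral) (auto simp: nn_integral_power_weight)

text \<open>For a nonnegative kernel the inner integral of absolute values is the modulus of the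
  superposition times \<open>f\<close>, so its integrability is precisely what Fubini asks
  for.\<close>

lemma integral_superposition:
  fixes f :: "'a::euclidean_space \<Rightarrow> complex" and k :: "real \<Rightarrow> 'a \<Rightarrow> real"
  assumes [measurable]: "(\<lambda>z. k (snd z) (fst z)) \<in> borel_measurable (lborel \<Otimes>\<^sub>M lborel)" "f \<in> borel_measurable borel"
    and k: "\<And>s x. k s x \<ge> 0" and ks: "AE x in lborel. integrable lborel (\<lambda>s. k s x)"
    and i: "integrable lborel (\<lambda>x. complex_of_real (LINT s|lborel. k s x) * f x)"
  shows "(LINT x|lborel. complex_of_real (LINT s|lborel. k s x) * f x) = (LINT s|lborel. (LINT x|lborel. complex_of_real (k s x) * f x))"
proof -
  have eq: "(LINT s|lborel. norm (complex_of_real (k s x) * f x)) = norm (complex_of_real (LINT s|lborel. k s x) * f x)" for x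
    using k by (simp add: norm_mult abs_of_nonneg Bochner_Integration.integral_nonneg)
  have "integrable (lborel \<Otimes>\<^sub>M lborel) (\<lambda>z. complex_of_real (k (snd z) (fst z)) * f (fst z))"
  proof (rule lborel_pair.Fubini_integrable)
    show "integrable lborel (\<lambda>x. LINT s|lborel. norm (complex_of_real (k (snd (x, s)) (fst (x, s))) * f (fst (x, s))))"
      using integrable_norm[OF i] by (simp only: fst_conv snd_conv eq)
    show "AE x in lborel. integrable lborel (\<lambda>s. complex_of_real (k (snd (x, s)) (fst (x, s))) * f (fst (x, s)))"
      using ks by eventually_elim simp
  qed measurable
  then have "integrable (lborel \<Otimes>\<^sub>M lborel) (\<lambda>(x, s). complex_of_real (k s x) * f x)" by (simp only: case_prod_unfold)
  then have "(LINT s|lborel. (LINT x|lborel. complex_of_real (k s x) * f x)) = (LINT x|lborel. (LINT s|lborel. complex_of_real (k s x) * f x))"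
    by (rule lborel_pair.Fubini_integral)
  then show ?thesis by simp
qed

definition slow_data :: "real \<Rightarrow> 'a::euclidean_space \<Rightarrow> real" where
  "slow_data m x = (LINT s|lborel. power_weight m s * gauss s x)"

lemma slow_data_integrable:
  assumes "m > 0"
  shows "integrable lborel (\<lambda>s. power_weight m s * gauss s x)"
proof (rule integrable_dominated)
  show "integrable lborel (power_weight m)" using has_bochner_integral_power_weight[OF assms] by (rule integrable.intros)
  show "norm (power_weight m s * gauss s x) \<le> power_weight m s" for s
    by (auto simp: power_weight_def gauss_def indicator_def mult_left_le)
qed (simp add: gauss_def)

lemma slow_data_measurable [measurable]: "slow_data m \<in> borel_measurable borel"
  unfolding slow_data_def gauss_def by measurable

lemma slow_data_nonneg [simp]: "slow_data m x \<ge> 0"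
  unfolding slow_data_def by (rule Bochner_Integration.integral_nonneg) simp

lemma slow_data_le:
  assumes "m > 0"
  shows "slow_data m x \<le> 1 / m"
proof -
  have "slow_data m x \<le> (LINT s|lborel. power_weight m s)"
    unfolding slow_data_def
  proof (rule integral_mono)
    show "integrable lborel (\<lambda>s. power_weight m s * gauss s x)" by (rule slow_data_integrable[OF assms])
    show "integrable lborel (power_weight m)" using has_bochner_integral_power_weight[OF assms] by (rule integrable.intros)
    show "power_weight m s * gauss s x \<le> power_weight m s" for s
      by (auto simp: power_weight_def gauss_def indicator_def mult_left_le)
  qed
  then show ?thesis using has_bochner_integral_power_weight[OF assms] by (simp add: has_bochner_integral_iff)
qed

text \<open>For \<open>s < 1\<close> one has
  \<open>exp (- s |x|^2) \<le> exp 1 * exp (- s (1 + |x|^2))\<close>; the truncated integral is then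
  dominated by the full Gamma integral at \<open>1 + |x|^2\<close>.\<close>

lemma slow_data_decay:
  fixes x :: "'a::euclidean_space"
  assumes m: "m > 0"
  shows "slow_data m x \<le> exp 1 * Gamma m * (1 + (norm x)\<^sup>2) powr (- m)"
proof -
  have pos: "1 + (norm x)\<^sup>2 > 0" by (simp add: add_pos_nonneg)
  have G: "Gamma m > 0" using m by (simp add: Gamma_real_pos)
  have "ennreal (slow_data m x) = (\<integral>\<^sup>+s. ennreal (power_weight m s * gauss s x) \<partial>lborel)"
    unfolding slow_data_def by (rule nn_integral_eq_integral[symmetric, OF slow_data_integrable[OF m]]) auto
  also have "\<dots> \<le> (\<integral>\<^sup>+s. ennreal (exp 1) * ennreal (indicator {0<..} s * (s powr (m - 1) * exp (- s * (1 + (norm x)\<^sup>2)))) \<partial>lborel)"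
  proof (rule nn_integral_mono)
    fix s :: real
    have "exp (- s * (norm x)\<^sup>2) \<le> exp 1 * exp (- s * (1 + (norm x)\<^sup>2))" if "s < 1"
      using that by (simp add: exp_add[symmetric] algebra_simps)
    then have "power_weight m s * gauss s x \<le> exp 1 * (indicator {0<..} s * (s powr (m - 1) * exp (- s * (1 + (norm x)\<^sup>2))))"
      by (auto simp: power_weight_def gauss_def indicator_def mult.left_commute[of "exp 1"] intro!: mult_left_mono)
    then show "ennreal (power_weight m s * gauss s x) \<le> ennreal (exp 1) * ennreal (indicator {0<..} s * (s powr (m - 1) * exp (- s * (1 + (norm x)\<^sup>2))))"
      by (simp add: ennreal_mult[symmetric] ennreal_leI)
  qed
  also have "\<dots> = ennreal (exp 1 * (Gamma m * (1 + (norm x)\<^sup>2) powr (- m)))"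
    using G by (subst nn_integral_cmult, measurable, subst Gamma_nn_integral[OF m pos]) (simp add: ennreal_mult)
  finally show ?thesis using G by (simp add: mult.assoc)
qed

lemma slow_data_Lp:
  fixes r m :: real
  assumes m: "m > 0" and r: "r > 0" and mr: "m * r > DIM('a::euclidean_space) / 2"
  shows "integrable lborel (\<lambda>x::'a. slow_data m x powr r)"
proof (rule integrable_dominated)
  have G: "Gamma m > 0" using m by (simp add: Gamma_real_pos)
  show "integrable lborel (\<lambda>x::'a. (exp 1 * Gamma m) powr r * (1 + (norm x)\<^sup>2) powr (- (m * r)))"
    by (intro integrable_mult_right integrable_one_plus_norm_sq_powr mr)
  fix x :: 'a
  have "slow_data m x powr r \<le> (exp 1 * Gamma m * (1 + (norm x)\<^sup>2) powr (- m)) powr r"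
    using r by (intro powr_mono2 slow_data_decay m) auto
  also have "\<dots> = (exp 1 * Gamma m) powr r * (1 + (norm x)\<^sup>2) powr (- (m * r))"
    using G by (simp add: powr_mult powr_powr)
  finally show "norm (slow_data m x powr r) \<le> (exp 1 * Gamma m) powr r * (1 + (norm x)\<^sup>2) powr (- (m * r))" by simp
qed measurable

text \<open>Only scales \<open>s < 1 / R\<close> are kept. There the product of the two Gaussians
  has rate at most \<open>2 / R\<close>, hence integral at least
  \<open>(pi * R / 2) powr (DIM('a) / 2)\<close>, and the weight contributes
  \<open>R powr (- m) / m\<close>.\<close>

lemma slow_data_gauss_lower:
  assumes m: "m > 0" and R: "R \<ge> 1"
  shows "(LINT x|lborel. slow_data m x * gauss (1 / R) (x::'a::euclidean_space)) \<ge> (pi / 2) powr (DIM('a) / 2) / m * R powr (DIM('a) / 2 - m)"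
proof -
  have R0: "R > 0" using R by simp
  let ?I = "LINT x|lborel. slow_data m x * gauss (1 / R) (x::'a)"
  have i: "integrable lborel (\<lambda>x::'a. slow_data m x * gauss (1 / R) x)"
  proof (rule integrable_dominated)
    show "integrable lborel (\<lambda>x::'a. 1 / m * gauss (1 / R) x)" using R0 by (intro integrable_mult_right integrable_gauss) simp
    show "norm (slow_data m x * gauss (1 / R) x) \<le> 1 / m * gauss (1 / R) x" for x :: 'a
      using mult_right_mono[OF slow_data_le[OF m, of x], of "gauss (1 / R) x"] by (simp add: abs_mult)
  qed measurable
  let ?c = "(pi * R / 2) powr (DIM('a) / 2)"
  have "ennreal ((1 / R) powr m / m * ?c) = (\<integral>\<^sup>+s. ennreal (indicator {0<..<1/R} s * s powr (m - 1)) \<partial>lborel) * ennreal ?c"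
    using m R0 by (subst nn_integral_powr[OF m]) (simp_all add: ennreal_mult[symmetric])
  also have "\<dots> = (\<integral>\<^sup>+s. ennreal (indicator {0<..<1/R} s * s powr (m - 1)) * ennreal ?c \<partial>lborel)"
    by (rule nn_integral_multc[symmetric]) measurable
  also have "\<dots> \<le> (\<integral>\<^sup>+s. (\<integral>\<^sup>+(x::'a). ennreal (power_weight m s * gauss s x * gauss (1 / R) x) \<partial>lborel) \<partial>lborel)"
  proof (rule nn_integral_mono)
    fix s
    show "ennreal (indicator {0<..<1/R} s * s powr (m - 1)) * ennreal ?c \<le> (\<integral>\<^sup>+(x::'a). ennreal (power_weight m s * gauss s x * gauss (1 / R) x) \<partial>lborel)"
    proof (cases "s \<in> {0<..<1/R}")
      case True
      then have s: "0 < s" "s < 1 / R" by auto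
      have "1 / R \<le> 1" using R by simp
      then have pw: "power_weight m s = s powr (m - 1)" using s by (simp add: power_weight_def indicator_def)
      have "s + 1 / R \<le> 2 / R" using s by simp
      then have "pi / (2 / R) \<le> pi / (s + 1 / R)"
        using s R0 by (intro divide_left_mono mult_pos_pos add_pos_pos) auto
      then have "pi * R / 2 \<le> pi / (s + 1 / R)" by simp
      then have "?c \<le> (pi / (s + 1 / R)) powr (DIM('a) / 2)" using R0 by (intro powr_mono2) auto
      then have "ennreal (s powr (m - 1)) * ennreal ?c \<le> ennreal (s powr (m - 1)) * ennreal ((pi / (s + 1 / R)) powr (DIM('a) / 2))"
        by (intro mult_left_mono ennreal_leI) auto
      also have "\<dots> = ennreal (s powr (m - 1)) * (\<integral>\<^sup>+(x::'a). ennreal (gauss (s + 1 / R) x) \<partial>lborel)"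
        using s R0 by (subst nn_integral_gauss) (auto intro: add_pos_pos)
      also have "\<dots> = (\<integral>\<^sup>+(x::'a). ennreal (power_weight m s * gauss s x * gauss (1 / R) x) \<partial>lborel)"
        by (subst nn_integral_cmult[symmetric]) (auto simp: pw ennreal_mult[symmetric] gauss_mult mult.assoc)
      finally show ?thesis using True by simp
    qed simp
  qed
  also have "\<dots> = (\<integral>\<^sup>+(x::'a). (\<integral>\<^sup>+s. ennreal (power_weight m s * gauss s x * gauss (1 / R) x) \<partial>lborel) \<partial>lborel)"
    by (rule lborel_pair.Fubini') (simp add: gauss_def)
  also have "\<dots> = (\<integral>\<^sup>+(x::'a). ennreal (slow_data m x * gauss (1 / R) x) \<partial>lborel)"
  proof (rule nn_integral_cong)
    fix x :: 'a
    have "(\<integral>\<^sup>+s. ennreal (power_weight m s * gauss s x * gauss (1 / R) x) \<partial>lborel) = ennreal (LINT s|lborel. power_weight m s * gauss s x * gauss (1 / R) x)"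
      by (rule nn_integral_eq_integral) (auto intro: slow_data_integrable[OF m])
    then show "(\<integral>\<^sup>+s. ennreal (power_weight m s * gauss s x * gauss (1 / R) x) \<partial>lborel) = ennreal (slow_data m x * gauss (1 / R) x)"
      by (simp add: slow_data_def)
  qed
  also have "\<dots> = ennreal ?I" by (rule nn_integral_eq_integral[OF i]) simp
  finally have "(1 / R) powr m / m * ?c \<le> ?I" by (simp add: Bochner_Integration.integral_nonneg)
  also have "(1 / R) powr m / m * ?c = (pi / 2) powr (DIM('a) / 2) / m * R powr (DIM('a) / 2 - m)"
    using R0 by (simp add: powr_mult powr_divide powr_diff)
  finally show ?thesis .
qed

text \<open>For \<open>s < 1\<close> halving the Gaussian rate frees at least
  \<open>exp (- |\<xi>|^2 / 8)\<close>, which absorbs any power uniformly in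
  \<open>s\<close>.\<close>

lemma bessel_weight_gauss_le:
  fixes a :: real
  obtains C where "C > 0" "\<And>s (\<xi> :: 'a::euclidean_space). 0 < s \<Longrightarrow> s < 1 \<Longrightarrow> (1 + (norm \<xi>)\<^sup>2) powr (a / 2) * gauss (1 / (4 * s)) \<xi> \<le> C * gauss (1 / (8 * s)) \<xi>"
proof -
  \<comment> \<open>The exponent is \<open>2 * a\<close> because the fourth root is taken
    afterwards: \<open>exp (z / 2)\<close> becomes \<open>exp (z / 8)\<close>.\<close>
  obtain C where C: "C > 0" "\<And>z. z \<ge> 0 \<Longrightarrow> (1 + z) powr (2 * a) * exp (- z) \<le> C * exp (- z / 2)"
    using powr_mult_exp_le by blast
  show thesis
  proof
    show "C powr (1 / 4) > 0" using C by simp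
    fix s :: real and \<xi> :: 'a assume s: "0 < s" "s < 1"
    let ?z = "(norm \<xi>)\<^sup>2"
    have "(1 + ?z) powr (2 * a) * exp (- ?z) * exp ?z \<le> C * exp (- ?z / 2) * exp ?z"
      by (intro mult_right_mono C) auto
    then have "(1 + ?z) powr (2 * a) \<le> C * exp (?z / 2)"
      by (simp add: mult.assoc exp_add[symmetric])
    then have "((1 + ?z) powr (2 * a)) powr (1 / 4) \<le> (C * exp (?z / 2)) powr (1 / 4)"
      by (intro powr_mono2) auto
    also have "(C * exp (?z / 2)) powr (1 / 4) = C powr (1 / 4) * exp (?z / 8)"
      using C by (simp add: powr_mult exp_powr_real)
    finally have "(1 + ?z) powr (a / 2) * gauss (1 / (4 * s)) \<xi> \<le> C powr (1 / 4) * exp (?z / 8) * gauss (1 / (4 * s)) \<xi>"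
      by (intro mult_right_mono) (auto simp: powr_powr)
    also have "C powr (1 / 4) * exp (?z / 8) * gauss (1 / (4 * s)) \<xi> = C powr (1 / 4) * exp ((1 / 8 - 1 / (4 * s)) * ?z)"
      by (simp add: gauss_def exp_add[symmetric] algebra_simps)
    also have "\<dots> \<le> C powr (1 / 4) * gauss (1 / (8 * s)) \<xi>"
    proof -
      have "(1 / 8 - 1 / (4 * s)) \<le> - (1 / (8 * s))" using s by (simp add: field_simps)
      then show ?thesis
        unfolding gauss_def by (intro mult_left_mono iffD2[OF exp_le_cancel_iff] mult_right_mono) auto
    qed
    finally show "(1 + ?z) powr (a / 2) * gauss (1 / (4 * s)) \<xi> \<le> C powr (1 / 4) * gauss (1 / (8 * s)) \<xi>" .
  qed
qed

text \<open>The Fourier transform of the summand \<open>power_weight m s * gauss s\<close>,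
  multiplied by the Bessel symbol of order \<open>a\<close>.\<close>

definition slow_kernel :: "real \<Rightarrow> real \<Rightarrow> real \<Rightarrow> 'a::euclidean_space \<Rightarrow> real" where
  "slow_kernel a m s \<xi> = (1 + (norm \<xi>)\<^sup>2) powr (a / 2) * (power_weight m s * ((2 * s) powr (- real DIM('a) / 2) * gauss (1 / (4 * s)) \<xi>))"

lemma slow_kernel_nonneg [simp]: "slow_kernel a m s \<xi> \<ge> 0"
  by (simp add: slow_kernel_def)

lemma slow_kernel_measurable [measurable]:
  "(\<lambda>z. slow_kernel a m (snd z) (fst z)) \<in> borel_measurable (lborel \<Otimes>\<^sub>M lborel)"
  unfolding slow_kernel_def gauss_def by measurable

lemma slow_kernel_le:
  fixes a :: real
  obtains C where "C > 0" "\<And>m s (\<xi> :: 'a::euclidean_space). slow_kernel a m s \<xi> \<le> C * (power_weight m s * ((2 * s) powr (- real DIM('a) / 2) * gauss (1 / (8 * s)) \<xi>))"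
proof -
  obtain C where C: "C > 0" "\<And>s (\<xi> :: 'a::euclidean_space). 0 < s \<Longrightarrow> s < 1 \<Longrightarrow> (1 + (norm \<xi>)\<^sup>2) powr (a / 2) * gauss (1 / (4 * s)) \<xi> \<le> C * gauss (1 / (8 * s)) \<xi>"
    using bessel_weight_gauss_le by blast
  show thesis
  proof (rule that[OF C(1)])
    fix m s and \<xi> :: 'a
    show "slow_kernel a m s \<xi> \<le> C * (power_weight m s * ((2 * s) powr (- real DIM('a) / 2) * gauss (1 / (8 * s)) \<xi>))"
    proof (cases "0 < s \<and> s < 1")
      case True
      then have "power_weight m s * (2 * s) powr (- real DIM('a) / 2) * ((1 + (norm \<xi>)\<^sup>2) powr (a / 2) * gauss (1 / (4 * s)) \<xi>) \<le>
         power_weight m s * (2 * s) powr (- real DIM('a) / 2) * (C * gauss (1 / (8 * s)) \<xi>)"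
        by (intro mult_left_mono C) auto
      then show ?thesis by (simp add: slow_kernel_def mult_ac)
    next
      case False
      then have "power_weight m s = 0" by (auto simp: power_weight_def)
      then show ?thesis by (simp add: slow_kernel_def)
    qed
  qed
qed

text \<open>The normalisation \<open>(2 * s) powr (- DIM('a) / 2)\<close> cancels the integral of
  the Gaussian of width \<open>8 * s\<close>, so only the integrable weight remains in
  \<open>s\<close>.\<close>

lemma slow_kernel_integrable:
  assumes m: "m > 0"
  shows "integrable (lborel \<Otimes>\<^sub>M lborel) (\<lambda>z. slow_kernel a m (snd z) (fst z :: 'a::euclidean_space))"
proof (rule integrableI_bounded)
  obtain C where C: "C > 0" "\<And>m s (\<xi> :: 'a::euclidean_space). slow_kernel a m s \<xi> \<le> C * (power_weight m s * ((2 * s) powr (- real DIM('a) / 2) * gauss (1 / (8 * s)) \<xi>))"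
    using slow_kernel_le by blast
  have "(\<integral>\<^sup>+z. ennreal (norm (slow_kernel a m (snd z) (fst z :: 'a))) \<partial>(lborel \<Otimes>\<^sub>M lborel)) = (\<integral>\<^sup>+s. (\<integral>\<^sup>+\<xi>. ennreal (slow_kernel a m s (\<xi>::'a)) \<partial>lborel) \<partial>lborel)"
    by (subst lborel_pair.nn_integral_snd[symmetric]) (auto simp: case_prod_unfold)
  also have "\<dots> \<le> (\<integral>\<^sup>+s. ennreal (C * (4 * pi) powr (DIM('a) / 2)) * ennreal (power_weight m s) \<partial>lborel)"
  proof (rule nn_integral_mono)
    fix s
    show "(\<integral>\<^sup>+\<xi>. ennreal (slow_kernel a m s (\<xi>::'a)) \<partial>lborel) \<le> ennreal (C * (4 * pi) powr (DIM('a) / 2)) * ennreal (power_weight m s)"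
    proof (cases "0 < s \<and> s < 1")
      case True
      have "(\<integral>\<^sup>+\<xi>. ennreal (slow_kernel a m s (\<xi>::'a)) \<partial>lborel) \<le>
         (\<integral>\<^sup>+\<xi>. ennreal (C * (power_weight m s * (2 * s) powr (- real DIM('a) / 2))) * ennreal (gauss (1 / (8 * s)) (\<xi>::'a)) \<partial>lborel)"
        using C by (intro nn_integral_mono) (auto simp: ennreal_mult[symmetric] mult.assoc intro!: ennreal_leI)
      also have "\<dots> = ennreal (C * (power_weight m s * (2 * s) powr (- real DIM('a) / 2))) * ennreal ((pi / (1 / (8 * s))) powr (DIM('a) / 2))"
        using True by (subst nn_integral_cmult, measurable, subst nn_integral_gauss) auto
      also have "\<dots> = ennreal (C * (power_weight m s * ((2 * s) powr (- real DIM('a) / 2) * (pi / (1 / (8 * s))) powr (DIM('a) / 2))))"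
        using C by (simp add: ennreal_mult[symmetric] mult.assoc)
      also have "(2 * s) powr (- real DIM('a) / 2) * (pi / (1 / (8 * s))) powr (DIM('a) / 2) = (4 * pi) powr (DIM('a) / 2)"
      proof -
        have "(pi / (1 / (8 * s))) powr (DIM('a) / 2) = ((4 * pi) * (2 * s)) powr (DIM('a) / 2)" by (simp add: mult_ac)
        also have "\<dots> = (4 * pi) powr (DIM('a) / 2) * (2 * s) powr (DIM('a) / 2)" by (rule powr_mult)
        finally have e: "(pi / (1 / (8 * s))) powr (DIM('a) / 2) = (4 * pi) powr (DIM('a) / 2) * (2 * s) powr (DIM('a) / 2)" .
        have "(2 * s) powr (- real DIM('a) / 2) * (2 * s) powr (DIM('a) / 2) = 1"
          using True by (simp add: powr_add[symmetric])
        then show ?thesis unfolding e mult.left_commute[of "(2 * s) powr (- real DIM('a) / 2)"] by simp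
      qed
      finally show ?thesis using C by (simp add: ennreal_mult[symmetric] mult_ac)
    next
      case False
      then have "power_weight m s = 0" by (auto simp: power_weight_def)
      then show ?thesis by (simp add: slow_kernel_def)
    qed
  qed
  also have "\<dots> < \<infinity>"
    by (simp add: nn_integral_cmult nn_integral_power_weight[OF m] ennreal_mult_less_top)
  finally show "(\<integral>\<^sup>+z. ennreal (norm (slow_kernel a m (snd z) (fst z :: 'a))) \<partial>(lborel \<Otimes>\<^sub>M lborel)) < \<infinity>" .
qed measurable

text \<open>The Fourier transform of the Bessel potential of order \<open>a\<close> of
  \<open>slow_data m\<close>, as a function.\<close>

definition slow_bessel :: "real \<Rightarrow> real \<Rightarrow> 'a::euclidean_space \<Rightarrow> real" where
  "slow_bessel a m \<xi> = (LINT s|lborel. slow_kernel a m s \<xi>)"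

lemma slow_bessel_measurable [measurable]: "slow_bessel a m \<in> borel_measurable borel"
  unfolding slow_bessel_def slow_kernel_def gauss_def by measurable

lemma slow_bessel_nonneg [simp]: "slow_bessel a m \<xi> \<ge> 0"
  unfolding slow_bessel_def by (rule Bochner_Integration.integral_nonneg) simp

lemma slow_bessel_integrable: "m > 0 \<Longrightarrow> integrable lborel (slow_bessel a m)"
  using lborel_pair.integrable_fst'[OF slow_kernel_integrable[of m a]] by (simp add: slow_bessel_def[abs_def])

lemma slow_kernel_AE_integrable: "m > 0 \<Longrightarrow> AE \<xi> in lborel. integrable lborel (\<lambda>s. slow_kernel a m s \<xi>)"
  using lborel_pair.AE_integrable_fst'[OF slow_kernel_integrable[of m a]] by simp

text \<open>Cauchy--Schwarz in the scale \<open>s\<close>, the weight being split so that both factors produce the same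
  convergent integral.\<close>
lemma slow_bessel_Lp_2:
  assumes m: "m > DIM('a::euclidean_space) / 4"
  shows "(\<lambda>\<xi>::'a. complex_of_real (slow_bessel a m \<xi>)) \<in> Lp 2"
proof -
  have m0: "m > 0" using m by (rule le_less_trans[rotated]) simp
  \<comment> \<open>The margin over the critical value; both square integrals reduce to the integral
    of \<open>s powr (g - 1)\<close> over the unit interval.\<close>
  define g where "g = m - DIM('a) / 4"
  have g: "g > 0" using m by (simp add: g_def)
  obtain C where C: "C > 0" "\<And>m s (\<xi> :: 'a::euclidean_space). slow_kernel a m s \<xi> \<le> C * (power_weight m s * ((2 * s) powr (- real DIM('a) / 2) * gauss (1 / (8 * s)) \<xi>))"
    using slow_kernel_le by blast
  \<comment> \<open>Half of the exponent \<open>g - 1\<close> goes to each factor; the extra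
    \<open>- DIM('a) / 4\<close> in \<open>B\<close> is what the square integral over \<xi>
    compensates.\<close>
  define A where "A s = indicator {0<..<1::real} s * s powr ((g - 1) / 2)" for s
  define B where "B s \<xi> = indicator {0<..<1::real} s * (s powr ((g - 1) / 2 - DIM('a) / 4) * gauss (1 / (8 * s)) (\<xi>::'a))" for s \<xi>
  have [measurable]: "A \<in> borel_measurable borel" unfolding A_def by measurable
  have [measurable]: "(\<lambda>z. B (fst z) (snd z)) \<in> borel_measurable (borel \<Otimes>\<^sub>M borel)" unfolding B_def gauss_def by measurable
  have AB0: "A s \<ge> 0" "B s \<xi> \<ge> 0" for s \<xi> by (auto simp: A_def B_def)
  define D where "D = C * 2 powr (- real DIM('a) / 2)"
  have D: "D > 0" using C by (simp add: D_def)
  have kAB: "slow_kernel a m s \<xi> \<le> D * (A s * B s \<xi>)" for s \<xi>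
  proof (cases "0 < s \<and> s < 1")
    case True
    have "s powr (m - 1) * (2 * s) powr (- real DIM('a) / 2) = 2 powr (- real DIM('a) / 2) * (s powr ((g - 1) / 2) * s powr ((g - 1) / 2 - DIM('a) / 4))"
    proof -
      have "(m - 1) + (- real DIM('a) / 2) = (g - 1) / 2 + ((g - 1) / 2 - DIM('a) / 4)" by (simp add: g_def field_simps)
      then have "s powr (m - 1) * s powr (- real DIM('a) / 2) = s powr ((g - 1) / 2) * s powr ((g - 1) / 2 - DIM('a) / 4)"
        by (simp only: powr_add[symmetric])
      moreover have "(2 * s) powr (- real DIM('a) / 2) = 2 powr (- real DIM('a) / 2) * s powr (- real DIM('a) / 2)"
        by (rule powr_mult)
      ultimately show ?thesis by (metis mult.left_commute)
    qed
    then have "C * (power_weight m s * ((2 * s) powr (- real DIM('a) / 2) * gauss (1 / (8 * s)) \<xi>)) = D * (A s * B s \<xi>)"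
      using True by (simp add: power_weight_def A_def B_def D_def mult.assoc[symmetric])
    then show ?thesis using C(2)[of m s \<xi>] by simp
  next
    case False
    then have "power_weight m s = 0" by (auto simp: power_weight_def)
    then show ?thesis using D AB0 by (simp add: slow_kernel_def)
  qed
  have A2: "(\<integral>\<^sup>+s. (ennreal (A s))\<^sup>2 \<partial>lborel) = ennreal (1 / g)"
  proof -
    have "(ennreal (A s))\<^sup>2 = ennreal (power_weight g s)" for s
      by (auto simp: A_def power_weight_def indicator_def power2_eq_square ennreal_mult[symmetric] powr_add[symmetric])
    then show ?thesis by (simp add: nn_integral_power_weight[OF g])
  qed
  have B2: "(\<integral>\<^sup>+\<xi>. (ennreal (B s \<xi>))\<^sup>2 \<partial>lborel) = ennreal ((4 * pi) powr (DIM('a) / 2)) * ennreal (power_weight g s)" for s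
  proof (cases "0 < s \<and> s < 1")
    case True
    have "B s \<xi> * B s \<xi> = s powr (g - 1 - DIM('a) / 2) * gauss (1 / (4 * s)) \<xi>" for \<xi>
    proof -
      have "B s \<xi> * B s \<xi> = (s powr ((g - 1) / 2 - DIM('a) / 4) * s powr ((g - 1) / 2 - DIM('a) / 4)) * (gauss (1 / (8 * s)) \<xi> * gauss (1 / (8 * s)) \<xi>)"
        using True by (simp add: B_def mult_ac)
      also have "s powr ((g - 1) / 2 - DIM('a) / 4) * s powr ((g - 1) / 2 - DIM('a) / 4) = s powr (g - 1 - DIM('a) / 2)"
        unfolding powr_add[symmetric] by (rule arg_cong[where f = "(powr) s"]) (simp add: field_simps)
      also have "gauss (1 / (8 * s)) \<xi> * gauss (1 / (8 * s)) \<xi> = gauss (1 / (4 * s)) \<xi>"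
        unfolding gauss_mult by (simp add: field_simps)
      finally show ?thesis .
    qed
    then have "(\<integral>\<^sup>+\<xi>. (ennreal (B s \<xi>))\<^sup>2 \<partial>lborel) = (\<integral>\<^sup>+\<xi>. ennreal (s powr (g - 1 - DIM('a) / 2)) * ennreal (gauss (1 / (4 * s)) (\<xi>::'a)) \<partial>lborel)"
      by (intro nn_integral_cong) (simp add: power2_eq_square ennreal_mult[symmetric] AB0)
    also have "\<dots> = ennreal (s powr (g - 1 - DIM('a) / 2)) * ennreal ((pi / (1 / (4 * s))) powr (DIM('a) / 2))"
      using True by (subst nn_integral_cmult, measurable, subst nn_integral_gauss) auto
    also have "\<dots> = ennreal (s powr (g - 1 - DIM('a) / 2) * (pi / (1 / (4 * s))) powr (DIM('a) / 2))"
      by (simp add: ennreal_mult)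
    also have "s powr (g - 1 - DIM('a) / 2) * (pi / (1 / (4 * s))) powr (DIM('a) / 2) = (4 * pi) powr (DIM('a) / 2) * s powr (g - 1)"
    proof -
      have "pi / (1 / (4 * s)) = 4 * pi * s" by simp
      then show ?thesis using True by (simp add: powr_mult powr_diff)
    qed
    finally show ?thesis using True by (simp add: power_weight_def ennreal_mult)
  next
    case False
    then have "power_weight g s = 0" "B s \<xi> = 0" for \<xi> by (auto simp: power_weight_def B_def)
    then show ?thesis by simp
  qed
  have pt: "ennreal ((slow_bessel a m \<xi>)\<^sup>2) \<le> ennreal (D\<^sup>2 / g) * (\<integral>\<^sup>+s. (ennreal (B s \<xi>))\<^sup>2 \<partial>lborel)"
    if i: "integrable lborel (\<lambda>s. slow_kernel a m s \<xi>)" for \<xi> :: 'a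
  proof -
    have "ennreal (slow_bessel a m \<xi>) = (\<integral>\<^sup>+s. ennreal (slow_kernel a m s \<xi>) \<partial>lborel)"
      unfolding slow_bessel_def by (rule nn_integral_eq_integral[OF i, symmetric]) simp
    also have "\<dots> \<le> (\<integral>\<^sup>+s. ennreal D * (ennreal (A s) * ennreal (B s \<xi>)) \<partial>lborel)"
      using kAB[of _ \<xi>] D AB0 by (intro nn_integral_mono) (simp add: ennreal_mult[symmetric] ennreal_leI)
    also have "\<dots> = ennreal D * (\<integral>\<^sup>+s. ennreal (A s) * ennreal (B s \<xi>) \<partial>lborel)"
      by (rule nn_integral_cmult) (simp add: B_def gauss_def)
    finally have "(ennreal (slow_bessel a m \<xi>))\<^sup>2 \<le> (ennreal D * (\<integral>\<^sup>+s. ennreal (A s) * ennreal (B s \<xi>) \<partial>lborel))\<^sup>2"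
      by (rule power_mono) simp
    also have "\<dots> = (ennreal D)\<^sup>2 * (\<integral>\<^sup>+s. ennreal (A s) * ennreal (B s \<xi>) \<partial>lborel)\<^sup>2" by (rule power_mult_distrib)
    also have "\<dots> \<le> (ennreal D)\<^sup>2 * ((\<integral>\<^sup>+s. (ennreal (A s))\<^sup>2 \<partial>lborel) * (\<integral>\<^sup>+s. (ennreal (B s \<xi>))\<^sup>2 \<partial>lborel))"
      by (intro mult_left_mono Cauchy_Schwarz_nn_integral) (simp_all add: B_def gauss_def)
    also have "\<dots> = ennreal (D\<^sup>2 / g) * (\<integral>\<^sup>+s. (ennreal (B s \<xi>))\<^sup>2 \<partial>lborel)"
    proof -
      have "(ennreal D)\<^sup>2 * ennreal (1 / g) = ennreal (D\<^sup>2 / g)"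
        using D g by (simp add: ennreal_power ennreal_mult[symmetric])
      then show ?thesis unfolding A2 by (simp add: mult.assoc[symmetric])
    qed
    finally show ?thesis by (simp add: ennreal_power)
  qed
  have "(\<integral>\<^sup>+\<xi>. ennreal ((slow_bessel a m (\<xi>::'a))\<^sup>2) \<partial>lborel) \<le> (\<integral>\<^sup>+\<xi>. ennreal (D\<^sup>2 / g) * (\<integral>\<^sup>+s. (ennreal (B s \<xi>))\<^sup>2 \<partial>lborel) \<partial>lborel)"
  proof (rule nn_integral_mono_AE)
    show "AE \<xi> in lborel. ennreal ((slow_bessel a m (\<xi>::'a))\<^sup>2) \<le> ennreal (D\<^sup>2 / g) * (\<integral>\<^sup>+s. (ennreal (B s \<xi>))\<^sup>2 \<partial>lborel)"
      using slow_kernel_AE_integrable[OF m0, of a] by eventually_elim (rule pt)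
  qed
  also have "\<dots> = ennreal (D\<^sup>2 / g) * (\<integral>\<^sup>+\<xi>. (\<integral>\<^sup>+s. (ennreal (B s \<xi>))\<^sup>2 \<partial>lborel) \<partial>lborel)"
    by (rule nn_integral_cmult) (simp add: B_def gauss_def)
  also have "(\<integral>\<^sup>+\<xi>. (\<integral>\<^sup>+s. (ennreal (B s \<xi>))\<^sup>2 \<partial>lborel) \<partial>lborel) = (\<integral>\<^sup>+s. (\<integral>\<^sup>+\<xi>. (ennreal (B s \<xi>))\<^sup>2 \<partial>lborel) \<partial>lborel)"
    by (rule lborel_pair.Fubini') (simp add: B_def gauss_def)
  also have "\<dots> = ennreal ((4 * pi) powr (DIM('a) / 2)) * ennreal (1 / g)"
    unfolding B2 by (simp add: nn_integral_cmult nn_integral_power_weight[OF g])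
  also have "ennreal (D\<^sup>2 / g) * (ennreal ((4 * pi) powr (DIM('a) / 2)) * ennreal (1 / g)) < \<infinity>"
    by (simp add: ennreal_mult_less_top)
  finally have "integrable lborel (\<lambda>\<xi>::'a. (slow_bessel a m \<xi>)\<^sup>2)"
    by (intro integrableI_bounded) auto
  then show ?thesis by (simp add: Lp_2_iff)
qed

lemma slow_data_Lp_fun:
  assumes m: "m > 0" and r: "r > 0" and mr: "m * r > DIM('a::euclidean_space) / 2" and k: "\<bar>\<kappa>\<bar> = 1"
  shows "(\<lambda>x::'a. \<kappa> * slow_data m x) \<in> Lp_fun r"
proof -
  have "norm (complex_of_real (\<kappa> * slow_data m x)) powr r = slow_data m x powr r" for x :: 'a
    using k by (simp add: norm_mult)
  then have "(\<lambda>x::'a. norm (complex_of_real (\<kappa> * slow_data m x)) powr r) = (\<lambda>x. slow_data m x powr r)" by (rule ext)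
  then show ?thesis using slow_data_Lp[OF m r mr] by (simp add: Lp_fun_def Lp_def comp_def del: norm_of_real of_real_mult)
qed

text \<open>\<open>slow_data\<close> itself may fail to be integrable, so the multiplication formula
  is applied to each Gaussian of the superposition; the scales are then summed on the Fourier side,
  where the sum is integrable, and the formula is used once more to return.\<close>

lemma bessel_slow_data:
  fixes \<phi> :: "'a::euclidean_space \<Rightarrow> complex"
  assumes m: "m > DIM('a) / 4" and \<phi>: "\<phi> \<in> schwartz"
  shows "(LINT x|lborel. complex_of_real (slow_data m x) * fourier (\<lambda>\<xi>. complex_of_real ((1 + (norm \<xi>)\<^sup>2) powr (a / 2)) * inv_fourier \<phi> \<xi>) x) =
    (LINT x|lborel. inv_fourier (\<lambda>\<xi>. complex_of_real (slow_bessel a m \<xi>)) x * \<phi> x)"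
proof -
  have m0: "m > 0" using m by (rule le_less_trans[rotated]) simp
  have m2: "m * 2 > DIM('a) / 2" using m by simp
  have [measurable]: "\<phi> \<in> borel_measurable borel" by (rule schwartz_measurable[OF \<phi>])
  define \<Psi> where "\<Psi> \<xi> = complex_of_real ((1 + (norm \<xi>)\<^sup>2) powr (a / 2)) * inv_fourier \<phi> \<xi>" for \<xi>
  have [measurable]: "\<Psi> \<in> borel_measurable borel" unfolding \<Psi>_def by measurable
  \<comment> \<open>Enough decay of the transform to offset the Bessel symbol and still leave order
    \<open>DIM('a)\<close>.\<close>
  obtain k :: nat where k: "real k \<ge> a / 2 + real DIM('a)" using real_arch_simple by blast
  obtain C where C: "\<And>\<xi>. norm (inv_fourier \<phi> \<xi>) \<le> C * (1 + (norm \<xi>)\<^sup>2) powr (- real k)"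
    using inv_fourier_schwartz_decay[OF \<phi>, of k] by blast
  have C0: "C \<ge> 0" using order_trans[OF norm_ge_zero C[of 0]] by simp
  have \<Psi>: "norm (\<Psi> \<xi>) \<le> C * (1 + (norm \<xi>)\<^sup>2) powr (- real DIM('a))" for \<xi>
  proof -
    have pos: "1 \<le> 1 + (norm \<xi>)\<^sup>2" by simp
    have "norm (\<Psi> \<xi>) \<le> (1 + (norm \<xi>)\<^sup>2) powr (a / 2) * (C * (1 + (norm \<xi>)\<^sup>2) powr (- real k))"
      unfolding \<Psi>_def norm_mult norm_of_real by (intro mult_mono C) auto
    also have "\<dots> = C * (1 + (norm \<xi>)\<^sup>2) powr (a / 2 + (- real k))"
      by (simp only: powr_add mult.left_commute)
    also have "\<dots> \<le> C * (1 + (norm \<xi>)\<^sup>2) powr (- real DIM('a))"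
      using k by (intro mult_left_mono powr_mono pos C0) auto
    finally show ?thesis .
  qed
  have i\<Psi>: "integrable lborel \<Psi>"
    by (rule integrable_dominated[OF _ _ \<Psi>]) (auto intro!: integrable_one_plus_norm_sq_powr)
  have L\<Psi>: "\<Psi> \<in> Lp 2"
  proof -
    have "integrable lborel (\<lambda>\<xi>. (norm (\<Psi> \<xi>))\<^sup>2)"
    proof (rule integrable_dominated)
      show "integrable lborel (\<lambda>\<xi>::'a. C\<^sup>2 * (1 + (norm \<xi>)\<^sup>2) powr (- (2 * real DIM('a))))"
        by (intro integrable_mult_right integrable_one_plus_norm_sq_powr) (simp add: DIM_positive)
      fix \<xi> :: 'a
      have "(norm (\<Psi> \<xi>))\<^sup>2 \<le> (C * (1 + (norm \<xi>)\<^sup>2) powr (- real DIM('a)))\<^sup>2" by (intro power_mono \<Psi>) simp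
      also have "\<dots> = C\<^sup>2 * (1 + (norm \<xi>)\<^sup>2) powr (- (2 * real DIM('a)))"
        by (simp add: power_mult_distrib power2_eq_square powr_add[symmetric])
      finally show "norm ((norm (\<Psi> \<xi>))\<^sup>2) \<le> C\<^sup>2 * (1 + (norm \<xi>)\<^sup>2) powr (- (2 * real DIM('a)))" by simp
    qed measurable
    then show ?thesis by (simp add: Lp_2_iff)
  qed
  \<comment> \<open>Pairs with \<open>slow_data\<close> in L^2, which provides the absolute
    convergence for \<open>integral_superposition\<close>.\<close>
  have L\<psi>: "fourier \<Psi> \<in> Lp 2" by (rule fourier_Lp_2[OF i\<Psi> L\<Psi>])
  have Lw: "(\<lambda>x::'a. complex_of_real (slow_data m x)) \<in> Lp 2"
    using slow_data_Lp[OF m0 _ m2] by (simp add: Lp_2_iff powr_two)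
  have i\<phi>: "integrable lborel \<phi>" by (rule schwartz_integrable(1)[OF \<phi>])
  have iV: "integrable lborel (\<lambda>\<xi>::'a. complex_of_real (slow_bessel a m \<xi>))"
    by (rule integrable_of_real[OF slow_bessel_integrable[OF m0]])
  have iV\<phi>: "integrable lborel (\<lambda>\<xi>. complex_of_real (slow_bessel a m \<xi>) * inv_fourier \<phi> \<xi>)"
  proof (rule integrable_dominated)
    let ?B = "(2 * pi) powr (- real DIM('a) / 2) * (LINT x|lborel. norm (\<phi> x))"
    show "integrable lborel (\<lambda>\<xi>::'a. ?B * slow_bessel a m \<xi>)" by (intro integrable_mult_right slow_bessel_integrable m0)
    show "norm (complex_of_real (slow_bessel a m \<xi>) * inv_fourier \<phi> \<xi>) \<le> ?B * slow_bessel a m \<xi>" for \<xi>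
      using mult_left_mono[OF norm_inv_fourier_le(1)[of \<phi> \<xi>], of "slow_bessel a m \<xi>"] by (simp add: norm_mult mult_ac)
  qed measurable
  have "(LINT x|lborel. complex_of_real (slow_data m x) * fourier \<Psi> x) =
     (LINT s|lborel. (LINT x|lborel. complex_of_real (power_weight m s * gauss s x) * fourier \<Psi> x))"
    unfolding slow_data_def
  proof (rule integral_superposition)
    show "AE x in lborel. integrable lborel (\<lambda>s. power_weight m s * gauss s (x::'a))"
      by (intro AE_I2 slow_data_integrable m0)
    show "integrable lborel (\<lambda>x. complex_of_real (LINT s|lborel. power_weight m s * gauss s x) * fourier \<Psi> x)"
      using Lp_2_Cauchy_Schwarz(1)[OF Lw L\<psi>] by (simp only: slow_data_def)
  qed (simp_all add: gauss_def)
  also have "\<dots> = (LINT s|lborel. (LINT \<xi>|lborel. complex_of_real (slow_kernel a m s \<xi>) * inv_fourier \<phi> \<xi>))"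
  proof (rule Bochner_Integration.integral_cong[OF refl])
    fix s
    show "(LINT x|lborel. complex_of_real (power_weight m s * gauss s x) * fourier \<Psi> x) = (LINT \<xi>|lborel. complex_of_real (slow_kernel a m s \<xi>) * inv_fourier \<phi> \<xi>)"
    proof (cases "0 < s \<and> s < 1")
      case True
      then have s: "s > 0" by simp
      have "(LINT x|lborel. complex_of_real (power_weight m s * gauss s x) * fourier \<Psi> x) = complex_of_real (power_weight m s) * (LINT x|lborel. complex_of_real (gauss s x) * fourier \<Psi> x)"
        by (simp add: mult.assoc)
      also have "(LINT x|lborel. complex_of_real (gauss s x) * fourier \<Psi> x) = (LINT \<xi>|lborel. fourier (\<lambda>x. complex_of_real (gauss s x)) \<xi> * \<Psi> \<xi>)"
        by (rule fourier_multiplication(1)[OF _ i\<Psi>]) (simp add: integrable_gauss s)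
      also have "complex_of_real (power_weight m s) * \<dots> = (LINT \<xi>|lborel. complex_of_real (power_weight m s) * (fourier (\<lambda>x. complex_of_real (gauss s x)) \<xi> * \<Psi> \<xi>))"
        by (rule integral_mult_right_zero[symmetric])
      also have "\<dots> = (LINT \<xi>|lborel. complex_of_real (slow_kernel a m s \<xi>) * inv_fourier \<phi> \<xi>)"
        unfolding fourier_gauss[OF s] \<Psi>_def slow_kernel_def by (simp add: mult_ac)
      finally show ?thesis .
    next
      case False
      then have "power_weight m s = 0" by (auto simp: power_weight_def)
      then show ?thesis by (simp add: slow_kernel_def)
    qed
  qed
  also have "\<dots> = (LINT \<xi>|lborel. complex_of_real (slow_bessel a m \<xi>) * inv_fourier \<phi> \<xi>)"
    unfolding slow_bessel_def
  proof (rule integral_superposition[symmetric])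
    show "(\<lambda>z. slow_kernel a m (snd z) (fst z :: 'a)) \<in> borel_measurable (lborel \<Otimes>\<^sub>M lborel)" by measurable
    show "AE \<xi> in lborel. integrable lborel (\<lambda>s. slow_kernel a m s (\<xi>::'a))" by (rule slow_kernel_AE_integrable[OF m0])
    show "integrable lborel (\<lambda>\<xi>. complex_of_real (LINT s|lborel. slow_kernel a m s \<xi>) * inv_fourier \<phi> \<xi>)"
      using iV\<phi> by (simp only: slow_bessel_def)
  qed simp_all
  also have "\<dots> = (LINT x|lborel. inv_fourier (\<lambda>\<xi>. complex_of_real (slow_bessel a m \<xi>)) x * \<phi> x)"
    by (rule fourier_multiplication(2)[OF iV i\<phi>])
  finally show ?thesis unfolding \<Psi>_def .
qed

text \<open>For real \<open>f\<close> the two transforms are complex conjugates of each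
  other.\<close>

lemma inv_fourier_real_Lp_2:
  fixes f :: "'a::euclidean_space \<Rightarrow> real"
  assumes "integrable lborel f" "(\<lambda>x. complex_of_real (f x)) \<in> Lp 2"
  shows "inv_fourier (\<lambda>x. complex_of_real (f x)) \<in> Lp 2"
proof -
  let ?f = "\<lambda>x. complex_of_real (f x)"
  have [measurable]: "f \<in> borel_measurable borel" using assms(1) by simp
  have "norm (inv_fourier ?f x) = norm (fourier ?f x)" for x
  proof -
    have "cnj (LINT \<xi>|lborel. cis (x \<bullet> \<xi>) * ?f \<xi>) = (LINT \<xi>|lborel. cnj (cis (x \<bullet> \<xi>) * ?f \<xi>))"
      by (rule Bochner_Integration.integral_cnj[symmetric])
    then have "cnj (inv_fourier ?f x) = fourier ?f x"
      by (simp add: fourier_def inv_fourier_def cis_cnj inner_commute)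
    then show ?thesis by (metis complex_mod_cnj)
  qed
  moreover have "fourier ?f \<in> Lp 2" using assms by (intro fourier_Lp_2) auto
  ultimately show ?thesis by (simp add: Lp_2_iff)
qed

text \<open>Every order \<open>a\<close> is reached: high frequencies are damped like a Gaussian,
  and \<open>m > DIM('a) / 4\<close> controls the singularity of the transform at frequency
  0.\<close>

lemma slow_data_sobolev:
  assumes m: "m > DIM('a::euclidean_space) / 4"
  shows "(\<lambda>x::'a. \<kappa> * slow_data m x) \<in> sobolev_fun a 2"
proof -
  have m0: "m > 0" using m by (rule le_less_trans[rotated]) simp
  let ?w = "complex_of_real \<circ> (\<lambda>x::'a. \<kappa> * slow_data m x)"
  let ?V = "\<lambda>\<xi>::'a. complex_of_real (slow_bessel a m \<xi>)"
  define g where "g x = complex_of_real \<kappa> * inv_fourier ?V x" for x :: 'a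
  have w: "?w \<in> tempered_fun"
  proof (rule bounded_tempered_fun)
    show "norm (?w x) \<le> \<bar>\<kappa>\<bar> * (1 / m)" for x
      using mult_left_mono[OF slow_data_le[OF m0, of x], of "\<bar>\<kappa>\<bar>"] by (simp add: norm_mult)
  qed (simp add: comp_def)
  have g: "g \<in> tempered_fun"
  proof (rule bounded_tempered_fun)
    show "norm (g x) \<le> \<bar>\<kappa>\<bar> * ((2 * pi) powr (- real DIM('a) / 2) * (LINT \<xi>|lborel. norm (?V \<xi>)))" for x
      unfolding g_def norm_mult[of "complex_of_real \<kappa>"] norm_of_real[of \<kappa>] by (rule mult_left_mono[OF norm_inv_fourier_le(1)]) simp
    show "g \<in> borel_measurable borel" unfolding g_def by measurable
  qed
  have L: "g \<in> Lp 2"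
    unfolding g_def by (intro Lp_2_cmult inv_fourier_real_Lp_2 slow_bessel_integrable m0 slow_bessel_Lp_2 m)
  have "bessel a (fun_dist ?w) \<phi> = fun_dist g \<phi>" if \<phi>: "\<phi> \<in> schwartz" for \<phi>
  proof -
    have "bessel a (fun_dist ?w) \<phi> = complex_of_real \<kappa> * (LINT x|lborel. complex_of_real (slow_data m x) * fourier (\<lambda>\<xi>. complex_of_real ((1 + (norm \<xi>)\<^sup>2) powr (a / 2)) * inv_fourier \<phi> \<xi>) x)"
      by (simp add: bessel_def fourier_multiplier_def dist_inv_fourier_def dist_mult_def dist_fourier_def fun_dist_def mult.assoc)
    also have "\<dots> = complex_of_real \<kappa> * (LINT x|lborel. inv_fourier ?V x * \<phi> x)"
      unfolding bessel_slow_data[OF m \<phi>] ..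
    also have "\<dots> = fun_dist g \<phi>" by (simp add: fun_dist_def g_def mult.assoc)
    finally show ?thesis .
  qed
  then have "represents g (bessel a (fun_dist ?w))" using g by (simp add: represents_def)
  then have "fun_dist ?w \<in> sobolev a 2" using L w unfolding sobolev_def tempered_fun_def by blast
  then show ?thesis using w by (simp add: sobolev_fun_def)
qed

lemma zero_sobolev: "(\<lambda>_::'a::euclidean_space. 0) \<in> sobolev_fun a q"
proof -
  let ?z = "complex_of_real \<circ> (\<lambda>_::'a. 0)"
  have z: "?z \<in> tempered_fun" by (rule bounded_tempered_fun[of _ 0]) (auto simp: comp_def)
  have "?z \<in> Lp q" by (simp add: Lp_def comp_def)
  moreover have "represents ?z (bessel a (fun_dist ?z))"
    using z by (simp add: represents_def bessel_def fourier_multiplier_def dist_inv_fourier_def dist_mult_def dist_fourier_def fun_dist_def)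
  ultimately have "fun_dist ?z \<in> sobolev a q" using z unfolding sobolev_def tempered_fun_def by blast
  then show ?thesis using z by (simp add: sobolev_fun_def)
qed

subsection \<open>The lifespan\<close>

text \<open>The lower bound on the data and the tested equation share the power
  \<open>R powr (DIM('a) / 2 - m)\<close>; dividing by it leaves
  \<open>R powr (1 / a) \<le> E / \<epsilon>\<close> for every \<open>R\<close> below the existence
  time.\<close>

lemma lifespan_le:
  fixes w :: "'a::euclidean_space \<Rightarrow> real" and \<kappa> p m c a W :: real
  assumes k: "\<bar>\<kappa>\<bar> = 1" and p: "p > 1"
    and w: "w \<in> borel_measurable borel" "\<And>x. w x \<ge> 0" "\<And>x. w x \<le> W"
    and c: "c > 0" and low: "\<And>R. R \<ge> 1 \<Longrightarrow> c * R powr (DIM('a) / 2 - m) \<le> (LINT x|lborel. w x * gauss (1 / R) x)"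
    and a: "a > 0" "1 / a = 1 / (p - 1) - m"
  obtains C where "C > 0" "\<And>s \<epsilon>. 0 < \<epsilon> \<Longrightarrow> \<epsilon> \<le> 1 \<Longrightarrow>
     lifespan (\<lambda>v. \<kappa> * \<bar>v\<bar> powr p) s (\<lambda>_. 0) (\<lambda>x. \<kappa> * w x) \<epsilon> \<le> ereal (C * \<epsilon> powr (- a))"
proof -
  obtain l C where lC: "l \<ge> 3" "C > 0" and young: "\<And>R t V (x::'a). \<lbrakk>R \<ge> 1; 0 < t; t < R; V \<ge> 0\<rbrakk> \<Longrightarrow>
      V * \<bar>(cutoff2 l R t - cutoff1 l R t) * gauss (1 / R) x - cutoff l R t * gauss_lap R x\<bar> \<le>
      cutoff l R t * (V powr p * gauss (1 / R) x) + C * R powr (- (p / (p - 1))) * gauss (1 / (2 * R)) x"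
    using test_function_young[OF p] by metis
  define E where "E = C * (2 * pi) powr (DIM('a) / 2) / c"
  have E: "E > 0" using lC c by (simp add: E_def)
  have R_le: "R \<le> E powr a * \<epsilon> powr (- a)"
    if mild: "mild_solution (\<lambda>v. \<kappa> * \<bar>v\<bar> powr p) (\<lambda>_. 0) (\<lambda>x. \<kappa> * w x) \<epsilon> T u"
      and \<epsilon>: "0 < \<epsilon>" and R: "R \<ge> 2" "ereal R < T" for T u \<epsilon> R
  proof -
    have R0: "R > 0" using R by simp
    have "\<epsilon> * (c * R powr (DIM('a) / 2 - m)) \<le> \<epsilon> * (LINT x|lborel. w x * gauss (1 / R) x)"
      using \<epsilon> R by (intro mult_left_mono low) auto
    also have "\<dots> \<le> R * (C * R powr (- (p / (p - 1))) * (2 * pi * R) powr (DIM('a) / 2))"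
      by (rule mild_solution_test[OF mild k p w \<epsilon> R lC]) (use R in \<open>auto intro: young\<close>)
    also have "\<dots> = C * (2 * pi) powr (DIM('a) / 2) * (R powr 1 * R powr (- (p / (p - 1))) * R powr (DIM('a) / 2))"
      using R0 by (simp add: powr_mult mult_ac)
    also have "\<dots> = C * (2 * pi) powr (DIM('a) / 2) * R powr (1 + - (p / (p - 1)) + DIM('a) / 2)"
      by (simp only: powr_add)
    \<comment> \<open>\<open>1 - p / (p - 1) = - 1 / (p - 1)\<close>, and this equals
      \<open>- m - 1 / a\<close> by the relation between \<open>a\<close> and
      \<open>m\<close>.\<close>
    also have "1 + - (p / (p - 1)) + DIM('a) / 2 = (DIM('a) / 2 - m) + - (1 / a)"
      using p unfolding a by (simp add: field_simps)
    also have "R powr ((DIM('a) / 2 - m) + - (1 / a)) = R powr (DIM('a) / 2 - m) * R powr (- (1 / a))" by (rule powr_add)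
    finally have "(\<epsilon> * c) * R powr (DIM('a) / 2 - m) \<le> (C * (2 * pi) powr (DIM('a) / 2) * R powr (- (1 / a))) * R powr (DIM('a) / 2 - m)"
      by (simp only: mult_ac)
    then have "\<epsilon> * c \<le> C * (2 * pi) powr (DIM('a) / 2) * R powr (- (1 / a))"
      using R0 by (simp only: mult_le_cancel_right) auto
    then have "\<epsilon> * R powr (1 / a) \<le> E"
      using R0 c by (simp add: E_def powr_minus field_simps)
    then have "R powr (1 / a) \<le> E / \<epsilon>" using \<epsilon> by (simp add: field_simps)
    then have "(R powr (1 / a)) powr a \<le> (E / \<epsilon>) powr a" using a by (intro powr_mono2) auto
    moreover have "(R powr (1 / a)) powr a = R" unfolding powr_powr using R0 a(1) by simp
    moreover have "(E / \<epsilon>) powr a = E powr a * \<epsilon> powr (- a)" by (simp add: powr_divide powr_minus_divide)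
    ultimately show ?thesis by (simp only:)
  qed
  show thesis
  proof (rule that)
    \<comment> \<open>The entry 2 covers existence times up to 2, which the test with
      \<open>R \<ge> 2\<close> does not reach; it suffices because
      \<open>\<epsilon> powr (- a) \<ge> 1\<close> for \<open>\<epsilon> \<le> 1\<close>.\<close>
    show "max 2 (E powr a) > 0" by simp
    fix s \<epsilon> :: real assume \<epsilon>: "0 < \<epsilon>" "\<epsilon> \<le> 1"
    show "lifespan (\<lambda>v. \<kappa> * \<bar>v\<bar> powr p) s (\<lambda>_. 0) (\<lambda>x. \<kappa> * w x) \<epsilon> \<le> ereal (max 2 (E powr a) * \<epsilon> powr (- a))"
      unfolding lifespan_def
    proof (rule Sup_least, clarify)
      fix T :: ereal and u
      assume "C1_Hs_mild_solution (\<lambda>v. \<kappa> * \<bar>v\<bar> powr p) s (\<lambda>_. 0) (\<lambda>x. \<kappa> * w x) \<epsilon> T u"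
      then have mild: "mild_solution (\<lambda>v. \<kappa> * \<bar>v\<bar> powr p) (\<lambda>_. 0) (\<lambda>x. \<kappa> * w x) \<epsilon> T u"
        unfolding C1_Hs_mild_solution_def Hs_mild_solution_def by blast
      \<comment> \<open>\<open>T\<close> may be infinite, so the estimate is made at the real values
        below it.\<close>
      show "T \<le> ereal (max 2 (E powr a) * \<epsilon> powr (- a))"
      proof (rule dense_le)
        fix y :: ereal assume y: "y < T"
        have "1 \<le> \<epsilon> powr (- a)" using \<epsilon> a by (simp add: powr_minus one_le_inverse powr_le_one_le powr_le1)
        then have two: "2 \<le> max 2 (E powr a) * \<epsilon> powr (- a)"
          using mult_mono[of 2 "max 2 (E powr a)" 1 "\<epsilon> powr (- a)"] by simp
        show "y \<le> ereal (max 2 (E powr a) * \<epsilon> powr (- a))"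
        proof (cases "y \<le> ereal 2")
          case True
          then show ?thesis using two by (meson ereal_less_eq(3) order_trans)
        next
          case False
          then obtain R where R: "y = ereal R" using y by (cases y) auto
          then have "R \<le> E powr a * \<epsilon> powr (- a)"
            using False y by (intro R_le[OF mild \<epsilon>(1)]) auto
          also have "\<dots> \<le> max 2 (E powr a) * \<epsilon> powr (- a)" by (intro mult_right_mono) auto
          finally show ?thesis by (simp add: R)
        qed
      qed
    qed
  qed
qed

theorem theorem1p8:
  fixes n p0 :: nat and p s r \<beta> \<omega> :: real and N :: "real \<Rightarrow> real"
  assumes "n = CARD('n::finite)" and "n \<ge> 1"
    and "p > 1"
    and "N = (\<lambda>u. \<bar>u\<bar> powr p) \<or> N = (\<lambda>u. - (\<bar>u\<bar> powr p))"
    and "condition_N N p p0"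
    and "s \<ge> 0" and "1 < r" and "r \<le> 2"
    and "\<lfloor>s\<rfloor> \<le> int p0"
    and "r \<ge> 2 * (real n - 1) / (real n + 1)"
    and "2 * s < real n \<longrightarrow> p \<le> 1 + min (real n) 2 / (real n - 2 * s)"
    and "p < 1 + 2 * r / real n"
    and "\<beta> = (real n - 1) * (1 / r - 1 / 2)"
    and "\<omega> = 1 / (p - 1) - real n / (2 * r)"
  shows "\<forall>\<delta>>0. \<exists>(u0 :: real ^ 'n \<Rightarrow> real) (u1 :: real ^ 'n \<Rightarrow> real).
      u0 \<in> sobolev_fun s 2 \<inter> sobolev_fun \<beta> r \<and>
      u1 \<in> sobolev_fun (s - 1) 2 \<inter> Lp_fun r \<and>
      (\<exists>\<epsilon>2>0. \<exists>C>0. \<forall>\<epsilon>. 0 < \<epsilon> \<and> \<epsilon> \<le> \<epsilon>2 \<longrightarrow>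
         lifespan N s u0 u1 \<epsilon> \<le> ereal (C * \<epsilon> powr (- 1 / \<omega> - \<delta>)))"
proof (intro allI impI)
  fix \<delta> :: real assume \<delta>: "\<delta> > 0"
  have p: "p > 1" by fact
  have n: "real n > 0" using \<open>n \<ge> 1\<close> by simp
  have dim: "DIM(real ^ 'n) = n" using \<open>n = CARD('n)\<close> by simp
  have r: "1 < r" "r \<le> 2" by fact+
  have "(p - 1) * real n < 2 * r" using \<open>p < 1 + 2 * r / real n\<close> n by (simp add: field_simps)
  then have \<omega>: "\<omega> > 0" using p n r unfolding \<open>\<omega> = _\<close> by (simp add: field_simps)
  \<comment> \<open>The target exponent. Its reciprocal lies strictly below \<omega>, which pushes
    the decay parameter \<open>m\<close> strictly above \<open>n / (2 r)\<close>.\<close>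
  define a where "a = 1 / \<omega> + \<delta>"
  define m where "m = 1 / (p - 1) - 1 / a"
  have a: "a > 0" using \<omega> \<delta> by (simp add: a_def add_pos_pos)
  have "1 / a < \<omega>" using \<omega> \<delta> a by (simp add: a_def field_simps)
  then have mr: "m > real n / (2 * r)" unfolding m_def \<open>\<omega> = _\<close> by simp
  \<comment> \<open>Through \<open>r \<le> 2\<close> the L^r threshold for \<open>m\<close> implies
    the one for the Sobolev membership.\<close>
  have "real n / (2 * r) \<ge> real n / 4" using r n by (intro divide_left_mono) auto
  then have m4: "m > real n / 4" using mr by simp
  then have m0: "m > 0" using n by simp
  have mr': "m * r > real n / 2" using mr r by (simp add: field_simps)
  \<comment> \<open>One sign covers both nonlinearities and is also the sign of the initial
    velocity.\<close>
  obtain \<kappa> :: real where k: "\<bar>\<kappa>\<bar> = 1" and N: "N = (\<lambda>v. \<kappa> * \<bar>v\<bar> powr p)"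
  proof (rule disjE[OF \<open>N = _ \<or> N = _\<close>])
    assume "N = (\<lambda>u. \<bar>u\<bar> powr p)"
    then show thesis using that[of 1] by simp
  next
    assume "N = (\<lambda>u. - (\<bar>u\<bar> powr p))"
    then show thesis using that[of "- 1"] by simp
  qed
  let ?u0 = "\<lambda>_ :: real ^ 'n. 0 :: real"
  let ?u1 = "\<lambda>x :: real ^ 'n. \<kappa> * slow_data m x"
  define c where "c = (pi / 2) powr (real n / 2) / m"
  have c: "c > 0" using m0 by (simp add: c_def)
  have low: "c * R powr (DIM(real ^ 'n) / 2 - m) \<le> (LINT x|lborel. slow_data m x * gauss (1 / R) (x :: real ^ 'n))" if "R \<ge> 1" for R
    using slow_data_gauss_lower[OF m0 that, where ?'a = "real ^ 'n"] by (simp only: c_def dim)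
  have am: "1 / a = 1 / (p - 1) - m" by (simp add: m_def)
  obtain C where C: "C > 0" "\<And>s \<epsilon>. 0 < \<epsilon> \<Longrightarrow> \<epsilon> \<le> 1 \<Longrightarrow> lifespan (\<lambda>v. \<kappa> * \<bar>v\<bar> powr p) s ?u0 ?u1 \<epsilon> \<le> ereal (C * \<epsilon> powr (- a))"
    using lifespan_le[OF k p slow_data_measurable slow_data_nonneg slow_data_le[OF m0] c low a am] by blast
  have u1: "?u1 \<in> sobolev_fun (s - 1) 2 \<inter> Lp_fun r"
    using m4 mr' r k by (auto intro!: slow_data_sobolev slow_data_Lp_fun m0 simp: dim simp del: DIM_cart)
  have exponent: "- 1 / \<omega> - \<delta> = - a" by (simp add: a_def)
  have "\<exists>\<epsilon>2>0. \<exists>C>0. \<forall>\<epsilon>. 0 < \<epsilon> \<and> \<epsilon> \<le> \<epsilon>2 \<longrightarrow> lifespan N s ?u0 ?u1 \<epsilon> \<le> ereal (C * \<epsilon> powr (- 1 / \<omega> - \<delta>))"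
    unfolding N exponent using C by (intro exI[of _ "1::real"] conjI exI[of _ C]) auto
  with u1 zero_sobolev show "\<exists>(u0 :: real ^ 'n \<Rightarrow> real) (u1 :: real ^ 'n \<Rightarrow> real).
      u0 \<in> sobolev_fun s 2 \<inter> sobolev_fun \<beta> r \<and>
      u1 \<in> sobolev_fun (s - 1) 2 \<inter> Lp_fun r \<and>
      (\<exists>\<epsilon>2>0. \<exists>C>0. \<forall>\<epsilon>. 0 < \<epsilon> \<and> \<epsilon> \<le> \<epsilon>2 \<longrightarrow>
         lifespan N s u0 u1 \<epsilon> \<le> ereal (C * \<epsilon> powr (- 1 / \<omega> - \<delta>)))"
    by blast
qed

end
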